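(* Let $\theta_0,\ldots,\theta_{m-1}$ ($m\ge3$) be a unimodular partition of the unit circle, with associated billiard table $D$, set $\mathcal{S}_B$, measure $\tilde\mu$, and set of matrices $\Sigma=\{A_0,\ldots,A_{m-1}\}$. For $\tilde\mu$-almost every $(\sigma,\tau)\in\mathcal{S}_B$, the mean free path of the billiard trajectory $\bar\gamma$ determined by $(\sigma,\tau)$ equals $0$. The supremum of the family of mean free paths of periodic trajectories equals $2\log(\rho(\Sigma))$, and this supremum is a maximum if and only if the finiteness conjecture holds for $\Sigma$ (i.e., there exist $k\ge1$ and $A\in\Sigma^k$ with $\rho(\Sigma)=\rho(A)^{1/k}$).
   Context: $S^1=\{z\in\mathbb{C}:|z|=1\}$ is the boundary of the Poincar\'e disk $\mathcal{D}=\{|z|<1\}$ (with its hyperbolic metric of curvature $-1$). A pythagorean triple is $\mathbf{t}=(t_1,t_2,t_3)\in\mathbb{Z}^3$ with $t_3>0$, $\gcd(t_1,t_2,t_3)=1$, $t_1^2+t_2^2=t_3^2$; it is identified with the point $\theta=(t_1+t_2i)/t_3\in S^1\cap\mathbb{Q}(i)$. Let $L=\mathrm{diag}(1,1,-1)$ and $\langle \mathbf{x},\mathbf{y}\rangle=\mathbf{x}^\top L\mathbf{y}$. For distinct pythagorean triples $\mathbf{t},\mathbf{t}'$, the closed arc $[\mathbf{t},\mathbf{t}']$ going counterclockwise from $\mathbf{t}$ to $\mathbf{t}'$ is unimodular if $\mathbf{w}=(L\mathbf{t}'\times L\mathbf{t})/\langle\mathbf{t}',\mathbf{t}\rangle\in\mathbb{Z}^3$.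 A unimodular partition of $S^1$ is a counterclockwise cyclically ordered $m$-tuple $\mathbf{t}_0,\ldots,\mathbf{t}_{m-1}$ of pythagorean triples, $m\ge3$, such that each arc $[\mathbf{t}_a,\mathbf{t}_{a+1}]$ is unimodular (indices modulo $m$); $\theta_a\in S^1$ is the point identified with $\mathbf{t}_a$. Let $I_a=[\theta_a,\theta_{a+1})$ be the half-open counterclockwise arc, let $l_a$ be the geodesic in $\mathcal{D}$ with ideal endpoints $\theta_a,\theta_{a+1}$, and let $D$ be the ideal polygon in $\mathcal{D}$ with sides $l_0,\ldots,l_{m-1}$. Let $\mathscr{A}_a$ be the hyperbolic reflection in $l_a$; it acts on $S^1$ by $\mathscr{A}_a*z=\frac{(\theta_a+\theta_{a+1})z-2\theta_a\theta_{a+1}}{2z-(\theta_a+\theta_{a+1})}$. The map $B:S^1\to S^1$ is $B(\sigma)=\mathscr{A}_a*\sigma$ for $\sigma\in I_a$. The group $\varGamma_B^\pm$ is generated by $\mathscr{A}_0,\ldots,\mathscr{A}_{m-1}$ and $D$ is a fundamental domain for it. A point $\sigma\in S^1$ is $B$-terminating if $B^h(\sigma)=\theta_a$ for some $h\ge0$ and some $a$. $\mathcal{S}_B$ is the set of pairs $(\sigma,\tau)\in S^1\times S^1$ such that $\sigma,\tau$ are both not $B$-terminating and belong to different intervals among $I_0,\ldots,I_{m-1}$. The measure $\tilde\mu$ is the restriction to $\mathcal{S}_B$ of the image of the measure $(\omega-\alpha)^{-2}\,d\omega\,d\alpha$ on $(\mathbb{P}^1\mathbb{R}\times\mathbb{P}^1\mathbb{R})\setminus(\text{diagonal})$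 under $(\omega,\alpha)\mapsto(C*\omega,C*\alpha)$, where $C*z=(z-i)/(-iz+1)$. Mean free path: given $(\sigma,\tau)\in\mathcal{S}_B$, let $\gamma:\mathbb{R}\to\mathcal{D}$ be the geodesic path with ideal endpoints $\gamma(-\infty)=\tau$ and $\gamma(+\infty)=\sigma$, parametrized by arclength and entering $D$ at $t=0$. Then $\gamma$ descends to a billiard trajectory $\bar\gamma:\mathbb{R}\to D=\varGamma_B^\pm\backslash\mathcal{D}$, and the mean free path of $\bar\gamma$ is $\lim_{t\to\infty} t/(\text{number of bounces of }\bar\gamma\text{ on the sides of }D\text{ between time }0\text{ and time }t)$, provided that the limit exists (it does if $\bar\gamma$ is periodic). Matrices: as an element of $\mathrm{GL}_2\mathbb{C}/\{\pm I\}$, $\mathscr{A}_a$ is represented by $(\theta_a-\theta_{a+1})^{-1}\begin{pmatrix}-\theta_a-\theta_{a+1} & 2\theta_a\theta_{a+1}\\ -2 & \theta_a+\theta_{a+1}\end{pmatrix}$. With $C=2^{-1/2}\begin{pmatrix}1&-i\\-i&1\end{pmatrix}$, the matrix $A_a=C^{-1}\mathscr{A}_aC$ has (up to sign, which is irrelevant) integer entries and determinant $-1$; $\Sigma=\{A_0,\ldots,A_{m-1}\}$, after any choice of signs. $\Sigma^k$ is the set of all products of $k$ elements of $\Sigma$, repetitions allowed; $\rho(A)$ is the spectral radius of a matrix $A$, and the joint spectral radius is $\rho(\Sigma)=\lim_{k\to\infty}\max\{\|A\|^{1/k}:A\in\Sigma^k\}$ for any operator norm. *)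

theory Defs
  imports "HOL-Analysis.Analysis"
begin

section \<open>Unimodular partitions\<close>

definition pythagorean_triple :: "int^3 \<Rightarrow> bool" where
  "pythagorean_triple t \<longleftrightarrow>
     t$3 > 0 \<and> gcd (t$1) (gcd (t$2) (t$3)) = 1 \<and> (t$1)\<^sup>2 + (t$2)\<^sup>2 = (t$3)\<^sup>2"

definition triple_point :: "int^3 \<Rightarrow> complex" where
  "triple_point t = Complex (of_int (t$1) / of_int (t$3)) (of_int (t$2) / of_int (t$3))"

definition real_triple :: "int^3 \<Rightarrow> real^3" where
  "real_triple t = (\<chi> i. of_int (t$i))"

definition lorentz_matrix :: "real^3^3" where
  "lorentz_matrix = vector [vector [1, 0, 0], vector [0, 1, 0], vector [0, 0, -1]]"

definition lorentz_form :: "real^3 \<Rightarrow> real^3 \<Rightarrow> real" where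
  "lorentz_form x y = x \<bullet> (lorentz_matrix *v y)"

definition unimodular_arc :: "int^3 \<Rightarrow> int^3 \<Rightarrow> bool" where
  "unimodular_arc t t' \<longleftrightarrow>
     (let x = real_triple t; x' = real_triple t';
          w = (1 / lorentz_form x' x) *\<^sub>R cross3 (lorentz_matrix *v x') (lorentz_matrix *v x)
      in t \<noteq> t' \<and> (\<forall>i. w$i \<in> \<int>))"

text \<open>
  The triples are listed counterclockwise, going around the circle once: seen from the first
  point, the angles in \<open>[0,2\<pi>)\<close> are strictly increasing.
\<close>

definition unimodular_partition :: "nat \<Rightarrow> (nat \<Rightarrow> int^3) \<Rightarrow> bool" where
  "unimodular_partition m t \<longleftrightarrow>
     m \<ge> 3 \<and>
     (\<forall>a<m. pythagorean_triple (t a)) \<and>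
     strict_mono_on {..<m} (\<lambda>a. Arg2pi (triple_point (t a) / triple_point (t 0))) \<and>
     (\<forall>a<m. unimodular_arc (t a) (t (Suc a mod m)))"


section \<open>The map \<open>B\<close> on the circle\<close>

text \<open>In what follows \<open>\<theta> 0, \<dots>, \<theta> (m - 1)\<close> are the points of a partition.\<close>

definition arc_co :: "complex \<Rightarrow> complex \<Rightarrow> complex set" where
  "arc_co x y = {z. norm z = 1 \<and> Arg2pi (z / x) < Arg2pi (y / x)}"

definition part_arc :: "nat \<Rightarrow> (nat \<Rightarrow> complex) \<Rightarrow> nat \<Rightarrow> complex set" where
  "part_arc m \<theta> a = arc_co (\<theta> a) (\<theta> (Suc a mod m))"

definition circle_reflection :: "complex \<Rightarrow> complex \<Rightarrow> complex \<Rightarrow> complex" where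
  "circle_reflection x y z = ((x + y) * z - 2 * x * y) / (2 * z - (x + y))"

definition B_map :: "nat \<Rightarrow> (nat \<Rightarrow> complex) \<Rightarrow> complex \<Rightarrow> complex" where
  "B_map m \<theta> \<sigma> =
     (let a = (THE a. a < m \<and> \<sigma> \<in> part_arc m \<theta> a)
      in circle_reflection (\<theta> a) (\<theta> (Suc a mod m)) \<sigma>)"

definition B_terminating :: "nat \<Rightarrow> (nat \<Rightarrow> complex) \<Rightarrow> complex \<Rightarrow> bool" where
  "B_terminating m \<theta> \<sigma> \<longleftrightarrow> (\<exists>h. \<exists>a<m. (B_map m \<theta> ^^ h) \<sigma> = \<theta> a)"

definition S_B :: "nat \<Rightarrow> (nat \<Rightarrow> complex) \<Rightarrow> (complex \<times> complex) set" where
  "S_B m \<theta> = {(\<sigma>, \<tau>).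
     norm \<sigma> = 1 \<and> norm \<tau> = 1 \<and>
     \<not> B_terminating m \<theta> \<sigma> \<and> \<not> B_terminating m \<theta> \<tau> \<and>
     (\<exists>a<m. \<exists>b<m. a \<noteq> b \<and> \<sigma> \<in> part_arc m \<theta> a \<and> \<tau> \<in> part_arc m \<theta> b)}"


section \<open>The invariant measure\<close>

definition cayley :: "complex \<Rightarrow> complex" where
  "cayley z = (z - \<i>) / (- \<i> * z + 1)"

text \<open>
  The measure \<open>(\<omega> - \<alpha>)\<^sup>-\<^sup>2 d\<omega> d\<alpha>\<close> on pairs of distinct points of the real projective line is given
  in the affine chart: the pairs with a coordinate at infinity are a null set, and so is the
  diagonal of the chart.
\<close>

definition geodesic_measure :: "(real \<times> real) measure" where
  "geodesic_measure = density lborel (\<lambda>(\<omega>, \<alpha>). ennreal (1 / (\<omega> - \<alpha>)\<^sup>2))"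

definition mu_tilde :: "nat \<Rightarrow> (nat \<Rightarrow> complex) \<Rightarrow> (complex \<times> complex) measure" where
  "mu_tilde m \<theta> =
     restrict_space
       (distr geodesic_measure borel
          (\<lambda>(\<omega>, \<alpha>). (cayley (complex_of_real \<omega>), cayley (complex_of_real \<alpha>))))
       (S_B m \<theta>)"


section \<open>The Poincare disk and the billiard table\<close>

abbreviation pdisk :: "complex set" where
  "pdisk \<equiv> ball 0 1"

definition hyp_dist :: "complex \<Rightarrow> complex \<Rightarrow> real" where
  "hyp_dist z w = arcosh (1 + 2 * (norm (z - w))\<^sup>2 / ((1 - (norm z)\<^sup>2) * (1 - (norm w)\<^sup>2)))"

text \<open>
  In the hyperbolic plane the bi-infinite geodesics parametrized by arclength are exactly the
  isometric embeddings of the real line.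
\<close>

definition geodesic_path :: "(real \<Rightarrow> complex) \<Rightarrow> bool" where
  "geodesic_path \<gamma> \<longleftrightarrow> range \<gamma> \<subseteq> pdisk \<and> (\<forall>s t. hyp_dist (\<gamma> s) (\<gamma> t) = \<bar>s - t\<bar>)"

definition geodesic_from_to :: "complex \<Rightarrow> complex \<Rightarrow> (real \<Rightarrow> complex) \<Rightarrow> bool" where
  "geodesic_from_to \<tau> \<sigma> \<gamma> \<longleftrightarrow>
     geodesic_path \<gamma> \<and> (\<gamma> \<longlongrightarrow> \<tau>) at_bot \<and> (\<gamma> \<longlongrightarrow> \<sigma>) at_top"

definition geodesic_line :: "complex \<Rightarrow> complex \<Rightarrow> complex set" where
  "geodesic_line x y = {z. \<exists>\<gamma>. geodesic_from_to x y \<gamma> \<and> z \<in> range \<gamma>}"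

definition hyp_segment :: "complex \<Rightarrow> complex \<Rightarrow> complex set" where
  "hyp_segment z w = {p \<in> pdisk. hyp_dist z p + hyp_dist p w = hyp_dist z w}"

definition hyp_convex :: "complex set \<Rightarrow> bool" where
  "hyp_convex K \<longleftrightarrow> K \<subseteq> pdisk \<and> (\<forall>z\<in>K. \<forall>w\<in>K. hyp_segment z w \<subseteq> K)"

definition side :: "nat \<Rightarrow> (nat \<Rightarrow> complex) \<Rightarrow> nat \<Rightarrow> complex set" where
  "side m \<theta> a = geodesic_line (\<theta> a) (\<theta> (Suc a mod m))"

text \<open>
  The ideal polygon contains its sides, but of course not its ideal vertices: it is the
  hyperbolic convex hull of the sides.
\<close>

definition billiard_table :: "nat \<Rightarrow> (nat \<Rightarrow> complex) \<Rightarrow> complex set" where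
  "billiard_table m \<theta> = hyp_convex hull (\<Union>a<m. side m \<theta> a)"

text \<open>
  The hyperbolic reflection in the geodesic with ideal endpoints \<open>x\<close> and \<open>y\<close>, as an
  antiholomorphic map of the disk. It is the composition of \<^const>\<open>circle_reflection\<close> with the
  inversion \<open>z \<mapsto> 1 / cnj z\<close>, which is the identity on the unit circle.
\<close>

definition disk_reflection :: "complex \<Rightarrow> complex \<Rightarrow> complex \<Rightarrow> complex" where
  "disk_reflection x y z = ((x + y) - 2 * x * y * cnj z) / (2 - (x + y) * cnj z)"

text \<open>
  No inverses are needed in generating the group, since on the disk the reflections are
  involutions. The elements are only ever applied to points of the disk.
\<close>

inductive_set Gamma_B :: "nat \<Rightarrow> (nat \<Rightarrow> complex) \<Rightarrow> (complex \<Rightarrow> complex) set"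
  for m :: nat and \<theta> :: "nat \<Rightarrow> complex" where
  Gamma_B_id: "id \<in> Gamma_B m \<theta>"
| Gamma_B_comp: "a < m \<Longrightarrow> g \<in> Gamma_B m \<theta> \<Longrightarrow>
    disk_reflection (\<theta> a) (\<theta> (Suc a mod m)) \<circ> g \<in> Gamma_B m \<theta>"


section \<open>Billiard trajectories and mean free paths\<close>

definition entering_geodesic ::
    "nat \<Rightarrow> (nat \<Rightarrow> complex) \<Rightarrow> complex \<Rightarrow> complex \<Rightarrow> (real \<Rightarrow> complex) \<Rightarrow> bool" where
  "entering_geodesic m \<theta> \<sigma> \<tau> \<gamma> \<longleftrightarrow>
     geodesic_from_to \<tau> \<sigma> \<gamma> \<and>
     \<gamma> 0 \<in> billiard_table m \<theta> \<and> (\<forall>t<0. \<gamma> t \<notin> billiard_table m \<theta>)"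

text \<open>
  The closed polygon contains exactly one point of each orbit; this identifies the quotient of
  the disk by the group with the polygon.
\<close>

definition table_proj :: "nat \<Rightarrow> (nat \<Rightarrow> complex) \<Rightarrow> complex \<Rightarrow> complex" where
  "table_proj m \<theta> z = (THE w. w \<in> billiard_table m \<theta> \<and> (\<exists>g\<in>Gamma_B m \<theta>. w = g z))"

definition billiard_trajectory ::
    "nat \<Rightarrow> (nat \<Rightarrow> complex) \<Rightarrow> complex \<Rightarrow> complex \<Rightarrow> real \<Rightarrow> complex" where
  "billiard_trajectory m \<theta> \<sigma> \<tau> =
     table_proj m \<theta> \<circ> (THE \<gamma>. entering_geodesic m \<theta> \<sigma> \<tau> \<gamma>)"

definition bounces :: "nat \<Rightarrow> (nat \<Rightarrow> complex) \<Rightarrow> (real \<Rightarrow> complex) \<Rightarrow> real \<Rightarrow> nat" where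
  "bounces m \<theta> \<beta> t = card {s \<in> {0<..t}. \<beta> s \<in> (\<Union>a<m. side m \<theta> a)}"

definition has_mean_free_path ::
    "nat \<Rightarrow> (nat \<Rightarrow> complex) \<Rightarrow> (real \<Rightarrow> complex) \<Rightarrow> real \<Rightarrow> bool" where
  "has_mean_free_path m \<theta> \<beta> l \<longleftrightarrow> ((\<lambda>t. t / real (bounces m \<theta> \<beta> t)) \<longlongrightarrow> l) at_top"

definition periodic :: "(real \<Rightarrow> complex) \<Rightarrow> bool" where
  "periodic \<beta> \<longleftrightarrow> (\<exists>p>0. \<forall>t. \<beta> (t + p) = \<beta> t)"

definition periodic_mean_free_paths :: "nat \<Rightarrow> (nat \<Rightarrow> complex) \<Rightarrow> real set" where
  "periodic_mean_free_paths m \<theta> =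
     {l. \<exists>(\<sigma>, \<tau>)\<in>S_B m \<theta>.
           periodic (billiard_trajectory m \<theta> \<sigma> \<tau>) \<and>
           has_mean_free_path m \<theta> (billiard_trajectory m \<theta> \<sigma> \<tau>) l}"


section \<open>Matrices and the joint spectral radius\<close>

definition reflection_matrix :: "complex \<Rightarrow> complex \<Rightarrow> complex^2^2" where
  "reflection_matrix x y =
     mat (inverse (x - y)) ** vector [vector [- x - y, 2 * x * y], vector [- 2, x + y]]"

definition cayley_matrix :: "complex^2^2" where
  "cayley_matrix = mat (1 / complex_of_real (sqrt 2)) ** vector [vector [1, - \<i>], vector [- \<i>, 1]]"

definition billiard_matrix :: "nat \<Rightarrow> (nat \<Rightarrow> complex) \<Rightarrow> nat \<Rightarrow> complex^2^2" where
  "billiard_matrix m \<theta> a =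
     matrix_inv cayley_matrix ** reflection_matrix (\<theta> a) (\<theta> (Suc a mod m)) ** cayley_matrix"

fun set_products :: "(complex^2^2) set \<Rightarrow> nat \<Rightarrow> (complex^2^2) set" where
  "set_products S 0 = {mat 1}"
| "set_products S (Suc k) = {M ** N | M N. M \<in> S \<and> N \<in> set_products S k}"

definition spectral_radius :: "complex^2^2 \<Rightarrow> real" where
  "spectral_radius M = Max {norm c | c. \<exists>v. v \<noteq> 0 \<and> M *v v = c *s v}"

text \<open>
  The norm used is the operator norm for the Euclidean norm; as all norms on the matrices are
  equivalent, the limit does not depend on this choice.
\<close>

definition joint_spectral_radius :: "(complex^2^2) set \<Rightarrow> real" where
  "joint_spectral_radius S =
     lim (\<lambda>k. Max {root k (onorm ((*v) M)) | M. M \<in> set_products S k})"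

definition finiteness_property :: "(complex^2^2) set \<Rightarrow> bool" where
  "finiteness_property S \<longleftrightarrow>
     (\<exists>k\<ge>1. \<exists>M\<in>set_products S k. joint_spectral_radius S = root k (spectral_radius M))"

end

theory Submission
  imports Defs
begin

text \<open>In the hyperboloid model a geodesic is the curve \<open>exp u *\<^sub>R s + exp (- u) *\<^sub>R t\<close> for light vectors
  \<open>s\<close>, \<open>t\<close> over its ends, and a side of \<open>D\<close> is the zero set of a linear form. Bounce times are therefore
  logarithms of ratios of chords, and unfolding turns a bounce into a reflection of both ends.

  The \<open>n\<close>-th bounce time exceeds \<open>\<epsilon> n\<close> only if \<open>\<sigma>\<close> is within about \<open>exp (- \<epsilon> n)\<close> of an end of its
  cylinder of order \<open>n\<close>. Seen from a base point \<open>e\<close>, the relative lengths of the arcs not containing \<open>e\<close>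
  form a probability vector, and a bounce at a cusp is the translation \<open>D \<mapsto> D + 1\<close> of a cross ratio
  coordinate. A bounded drift function exploiting this slow escape shows that the sum of the
  powers \<open>1 - \<delta>\<close> of the lengths of the cylinders of order \<open>n\<close> is at most \<open>B * (1 + 2 * \<delta> * \<eta>) ^ n\<close> for
  arbitrarily small \<open>\<eta>\<close>, and Borel--Cantelli makes the bounce times \<open>o(n)\<close> almost everywhere.

  A periodic trajectory corresponds to a cyclically reduced word in the reflections; its length is
  twice the logarithm of the spectral radius of the word. Since \<open>1\<close>, \<open>A 0\<close>, \<open>A 1\<close>, \<open>A 2\<close> span the two by two
  matrices, traces of words control norms, so the joint spectral radius is the supremum of the
  normalised spectral radii of words.\<close>

section \<open>Reflections of the circle and of light vectors\<close>

text \<open>The obstacle is the cusps. At a vertex the boundary map is neutral, arcs of repeated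
  bounces into one vertex shrink only harmonically, and there is no uniform contraction factor; so
  cylinder sums are estimated at exponents \<open>1 - \<delta>\<close> instead of through a spectral
  gap. The base point \<open>e\<close> is reflected along with the word, which makes the length of a
  cylinder, seen from \<open>e\<close>, a product of conditional probabilities. To first order in
  \<open>\<delta>\<close>, lowering the exponent costs \<open>\<delta>\<close> times the entropy of
  the current probability vector. At depth \<open>D\<close> in a cusp this entropy is at most of
  order \<open>1 / sqrt (1 + D)\<close>, and the drift function returns as much while losing only an
  arbitrarily small \<open>\<eta>\<close> per step. Interpolating the minimum of cylinder length and
  \<open>exp (- \<epsilon> * n)\<close> then turns slow growth of the sums into summability.

  A periodic trajectory needs a hyperbolic word: spectral radius above one gives two fixed points on
  the circle, and uniqueness of codings decides which of them is the future end.\<close>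

definition kappa :: "complex \<Rightarrow> complex \<Rightarrow> complex \<Rightarrow> real" where
  "kappa x y z = norm (2 * z - (x + y)) / norm (x - y)"

lemma norm1_cnj: "norm (z::complex) = 1 \<Longrightarrow> z * cnj z = 1"
  by (simp add: complex_norm_square[symmetric])

lemma norm1_cnj': "norm (z::complex) = 1 \<Longrightarrow> cnj z = 1 / z"
  using norm1_cnj[of z] by (metis mult_zero_left nonzero_eq_divide_eq mult.commute zero_neq_one)

lemma norm1_nonzero: "norm (z::complex) = 1 \<Longrightarrow> z \<noteq> 0"
  by auto

lemma norm1_ReIm: "norm (z::complex) = 1 \<Longrightarrow> (Re z)\<^sup>2 + (Im z)\<^sup>2 = 1"
  by (metis cmod_power2 one_power2)

lemma midpoint_norm_lt:
  assumes "norm x = 1" "norm (y::complex) = 1" "x \<noteq> y"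
  shows "norm (x + y) < 2"
proof -
  have "norm (x + y)^2 + norm (x - y)^2 = 4"
    unfolding cmod_power2 using norm1_ReIm[OF assms(1)] norm1_ReIm[OF assms(2)]
    by (simp add: power2_eq_square algebra_simps)
  moreover have "norm (x - y)^2 > 0" using assms by simp
  ultimately have "norm (x + y)^2 < 4" by linarith
  hence "norm (x + y)^2 < 2^2" by simp
  thus ?thesis by (rule power_less_imp_less_base) simp
qed

lemma refl_den_nonzero:
  assumes "norm x = 1" "norm (y::complex) = 1" "x \<noteq> y" "norm z = 1"
  shows "2 * z - (x + y) \<noteq> 0"
  using midpoint_norm_lt[OF assms(1-3)] assms(4) by (metis eq_iff_diff_eq_0 norm_mult norm_numeral mult.right_neutral less_irrefl)

lemma kappa_pos:
  assumes "norm x = 1" "norm (y::complex) = 1" "x \<noteq> y" "norm z = 1"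
  shows "kappa x y z > 0"
  using refl_den_nonzero[OF assms] assms by (simp add: kappa_def)

lemma kappa_left: "x \<noteq> y \<Longrightarrow> kappa x y x = 1"
  and kappa_right: "x \<noteq> y \<Longrightarrow> kappa x y y = 1"
  by (simp_all add: kappa_def norm_minus_commute)

lemma circle_reflection_left: "x \<noteq> y \<Longrightarrow> circle_reflection x y x = x"
  and circle_reflection_right: "x \<noteq> y \<Longrightarrow> circle_reflection x y y = y"
  by (simp_all add: circle_reflection_def field_simps)

lemma norm_circle_reflection:
  assumes "norm x = 1" "norm (y::complex) = 1" "x \<noteq> y" "norm z = 1"
  shows "norm (circle_reflection x y z) = 1"
proof -
  have "(x + y) * z - 2 * x * y = - x * y * z * cnj (2 * z - (x + y))"
    using norm1_cnj[OF assms(1)] norm1_cnj[OF assms(2)] norm1_cnj[OF assms(4)] 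
    unfolding complex_cnj_diff complex_cnj_mult complex_cnj_add complex_cnj_numeral by algebra
  hence "norm ((x + y) * z - 2 * x * y) = norm (2 * z - (x + y))"
    by (metis assms(1,2,4) complex_mod_cnj mult.right_neutral norm_minus_cancel norm_mult mult_1)
  thus ?thesis using refl_den_nonzero[OF assms] by (simp add: circle_reflection_def norm_divide)
qed

lemma circle_reflection_den:
  assumes "2 * z - (x + y) \<noteq> 0"
  shows "2 * circle_reflection x y z - (x + y) = (x - y)\<^sup>2 / (2 * z - (x + y))"
  using assms by (simp add: circle_reflection_def field_simps power2_eq_square)

lemma circle_reflection_invol:
  assumes "norm x = 1" "norm (y::complex) = 1" "x \<noteq> y" "norm z = 1"
  shows "circle_reflection x y (circle_reflection x y z) = z"
proof -
  let ?d = "2 * z - (x + y)" let ?w = "circle_reflection x y z"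
  have d: "?d \<noteq> 0" by (rule refl_den_nonzero[OF assms])
  have "(x + y) * ?w - 2 * x * y = z * (x - y)\<^sup>2 / ?d"
    using d by (simp add: circle_reflection_def field_simps power2_eq_square)
  thus ?thesis using d assms(3) circle_reflection_den[OF d]
    by (subst circle_reflection_def) simp
qed

lemma kappa_circle_reflection:
  assumes "norm x = 1" "norm (y::complex) = 1" "x \<noteq> y" "norm z = 1"
  shows "kappa x y (circle_reflection x y z) = 1 / kappa x y z"
  using circle_reflection_den[OF refl_den_nonzero[OF assms]] assms(3)
  by (simp add: kappa_def norm_divide norm_power power2_eq_square norm_mult)

text \<open>The Moebius distortion formula. It shows what \<open>kappa\<close> is: the derivative of
  the reflection at \<open>z\<close> has modulus \<open>1 / (kappa x y z)^2\<close>, and the factor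
  splits over the two points, so it cancels in cross ratios.\<close>

lemma dist_circle_reflection:
  assumes "norm x = 1" "norm (y::complex) = 1" "x \<noteq> y" "norm z = 1" "norm w = 1"
  shows "norm (circle_reflection x y z - circle_reflection x y w) = norm (z - w) / (kappa x y z * kappa x y w)"
proof -
  have d: "2 * z - (x + y) \<noteq> 0" "2 * w - (x + y) \<noteq> 0" using refl_den_nonzero assms by blast+
  have "circle_reflection x y z - circle_reflection x y w
     = - (z - w) * (x - y)\<^sup>2 / ((2 * z - (x + y)) * (2 * w - (x + y)))"
    using d by (simp add: circle_reflection_def divide_simps) (simp add: algebra_simps power2_eq_square)
  thus ?thesis by (simp add: kappa_def norm_divide norm_mult norm_power norm_minus_commute power2_eq_square)
qed

definition light :: "complex \<Rightarrow> complex \<times> real" where "light z = (z, 1)"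

text \<open>Normalised so that on light vectors the form is positive exactly over the open counterclockwise arc
  from \<open>x\<close> to \<open>y\<close>.\<close>

definition side_form :: "complex \<Rightarrow> complex \<Rightarrow> complex \<times> real \<Rightarrow> real" where
  "side_form x y u = Re (cnj (\<i> * (x - y)) * fst u) - Im (y * cnj x) * snd u"

lemma linear_side_form: "linear (side_form x y)"
  by (rule linearI) (simp_all add: side_form_def algebra_simps)

text \<open>On the unit circle conjugation is inversion, so the real form becomes a rational
  function of \<open>z\<close>; its two zeros are the ends of the side.\<close>

lemma side_form_light_complex:
  assumes "norm x = 1" "norm (y::complex) = 1" "norm z = 1"
  shows "of_real (2 * side_form x y (light z)) = \<i> * (x - y) * (z - x) * (z - y) / (x * y * z)"
proof -
  have "of_real (2 * side_form x y (light z)) = cnj (\<i> * (x - y)) * z + \<i> * (x - y) * cnj z + \<i> * (y * cnj x - x * cnj y)"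
    by (simp add: complex_eq_iff side_form_def light_def algebra_simps)
  also have "\<dots> = \<i> * (x - y) * (z - x) * (z - y) / (x * y * z)"
    using norm1_nonzero[OF assms(1)] norm1_nonzero[OF assms(2)] norm1_nonzero[OF assms(3)]
    unfolding complex_cnj_mult complex_cnj_diff complex_cnj_i norm1_cnj'[OF assms(1)] norm1_cnj'[OF assms(2)] norm1_cnj'[OF assms(3)]
    by (simp add: divide_simps) (simp add: algebra_simps)
  finally show ?thesis .
qed

lemma abs_side_form_light:
  assumes "norm x = 1" "norm (y::complex) = 1" "norm z = 1"
  shows "\<bar>side_form x y (light z)\<bar> = norm (x - y) * norm (z - x) * norm (z - y) / 2"
proof -
  have "norm (complex_of_real (2 * side_form x y (light z))) = norm (x - y) * norm (z - x) * norm (z - y)"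
    unfolding side_form_light_complex[OF assms] using assms by (simp add: norm_mult norm_divide)
  thus ?thesis unfolding norm_of_real by simp
qed

lemma side_form_eq_0_iff:
  assumes "norm x = 1" "norm (y::complex) = 1" "x \<noteq> y" "norm z = 1"
  shows "side_form x y (light z) = 0 \<longleftrightarrow> z = x \<or> z = y"
  using abs_side_form_light[OF assms(1,2,4)] assms(3) by auto

lemma cis_diff: "cis a - cis b = 2 * \<i> * of_real (sin ((a - b) / 2)) * cis ((a + b) / 2)"
proof -
  have "a = (a - b) / 2 + (a + b) / 2" "b = (a + b) / 2 - (a - b) / 2" by argo+
  hence "cis a - cis b = cis ((a - b) / 2 + (a + b) / 2) - cis ((a + b) / 2 - (a - b) / 2)" by simp
  also have "\<dots> = 2 * \<i> * of_real (sin ((a - b) / 2)) * cis ((a + b) / 2)"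
    by (simp add: complex_eq_iff cos_add sin_add cos_diff sin_diff)
  finally show ?thesis .
qed

lemma norm_cis_diff: "norm (cis a - cis b) = 2 * \<bar>sin ((a - b) / 2)\<bar>"
  by (subst cis_diff) (simp add: norm_mult)

text \<open>Half angles turn the factored form into a real product of sines, so that its sign can be
  read off from the order of the three angles.\<close>

lemma side_form_cis:
  "side_form (cis a) (cis b) (light (cis t)) = 4 * sin ((b - a) / 2) * sin ((t - a) / 2) * sin ((b - t) / 2)"
proof -
  have ph: "cis ((a + b) / 2) * cis ((t + a) / 2) * cis ((t + b) / 2) = cis a * cis b * cis t"
  proof -
    have "(a + b) / 2 + (t + a) / 2 + (t + b) / 2 = a + b + t" by argo
    thus ?thesis by (simp only: cis_mult)
  qed
  have "of_real (2 * side_form (cis a) (cis b) (light (cis t)))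
      = \<i> * (cis a - cis b) * (cis t - cis a) * (cis t - cis b) / (cis a * cis b * cis t)"
    by (rule side_form_light_complex) simp_all
  also have "\<dots> = 8 * of_real (sin ((a - b) / 2)) * of_real (sin ((t - a) / 2)) * of_real (sin ((t - b) / 2))
      * (cis ((a + b) / 2) * cis ((t + a) / 2) * cis ((t + b) / 2)) / (cis a * cis b * cis t)"
    unfolding cis_diff by (simp add: algebra_simps)
  also have "\<dots> = of_real (8 * sin ((a - b) / 2) * sin ((t - a) / 2) * sin ((t - b) / 2))"
    unfolding ph by simp
  finally have "2 * side_form (cis a) (cis b) (light (cis t)) = 8 * sin ((a - b) / 2) * sin ((t - a) / 2) * sin ((t - b) / 2)"
    using of_real_eq_iff by blast
  moreover have "sin ((b - a) / 2) = - sin ((a - b) / 2)" "sin ((b - t) / 2) = - sin ((t - b) / 2)"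
    by (metis minus_diff_eq minus_divide_left sin_minus)+
  ultimately show ?thesis by simp
qed

text \<open>The reflection of the circle as a linear map of Minkowski space. The formula arises by
  multiplying the numerator and denominator of \<open>circle_reflection\<close> by the conjugate of
  the denominator and homogenising in the second component.\<close>

definition lorentz_refl :: "complex \<Rightarrow> complex \<Rightarrow> complex \<times> real \<Rightarrow> complex \<times> real" where
  "lorentz_refl x y u = (1 / (norm (x - y))\<^sup>2) *\<^sub>R
     (of_real (4 * snd u) * (x + y) - of_real ((norm (x + y))\<^sup>2) * fst u - 4 * x * y * cnj (fst u),
      ((norm (x + y))\<^sup>2 + 4) * snd u - 4 * Re (cnj (x + y) * fst u))"

lemma linear_lorentz_refl: "linear (lorentz_refl x y)"
  by (rule linearI) (simp_all add: lorentz_refl_def algebra_simps scaleR_conv_of_real)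

lemma side_form_lorentz_refl:
  assumes "norm x = 1" "norm (y::complex) = 1" "x \<noteq> y"
  shows "side_form x y (lorentz_refl x y u) = - side_form x y u"
proof -
  obtain v h where u: "u = (v, h)" by (cases u)
  define N where "N = (norm (x - y))\<^sup>2"
  have N: "N \<noteq> 0" using assms by (simp add: N_def)
  have N': "N = (Re x - Re y)\<^sup>2 + (Im x - Im y)\<^sup>2" by (simp add: N_def cmod_power2)
  have P: "(norm (x + y))\<^sup>2 = (Re x + Re y)\<^sup>2 + (Im x + Im y)\<^sup>2" by (simp add: cmod_power2)
  have "N * side_form x y (lorentz_refl x y u) = side_form x y (N *\<^sub>R lorentz_refl x y u)"
    by (simp add: linear_scale[OF linear_side_form])
  also have "N *\<^sub>R lorentz_refl x y u = (of_real (4 * h) * (x + y) - of_real ((norm (x + y))\<^sup>2) * v - 4 * x * y * cnj v,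
      ((norm (x + y))\<^sup>2 + 4) * h - 4 * Re (cnj (x + y) * v))"
    using N by (simp add: lorentz_refl_def u N_def)
  also have "side_form x y \<dots> = - (N * side_form x y u)"
    unfolding u P N' side_form_def fst_conv snd_conv
    using norm1_ReIm[OF assms(1)] norm1_ReIm[OF assms(2)] by simp algebra
  finally have "N * side_form x y (lorentz_refl x y u) = N * (- side_form x y u)" by simp
  thus ?thesis using N by (simp only: mult_cancel_left simp_thms)
qed

lemma lorentz_refl_light:
  assumes "norm x = 1" "norm (y::complex) = 1" "x \<noteq> y" "norm z = 1"
  shows "lorentz_refl x y (light z) = (kappa x y z)\<^sup>2 *\<^sub>R light (circle_reflection x y z)"
proof -
  let ?d = "2 * z - (x + y)"
  have d: "?d \<noteq> 0" by (rule refl_den_nonzero[OF assms])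
  have k: "(kappa x y z)\<^sup>2 = (norm ?d)\<^sup>2 / (norm (x - y))\<^sup>2" by (simp add: kappa_def power_divide)
  have "of_real ((norm ?d)\<^sup>2) * circle_reflection x y z = cnj ?d * ((x + y) * z - 2 * x * y)"
    unfolding complex_norm_square circle_reflection_def using d by (simp add: field_simps)
  also have "\<dots> = 4 * (x + y) - of_real ((norm (x + y))\<^sup>2) * z - 4 * x * y * cnj z"
    unfolding complex_norm_square complex_cnj_diff complex_cnj_add complex_cnj_mult complex_cnj_numeral
    using norm1_cnj[OF assms(1)] norm1_cnj[OF assms(2)] norm1_cnj[OF assms(4)] by algebra
  finally have 1: "of_real ((norm ?d)\<^sup>2) * circle_reflection x y z = 4 * (x + y) - of_real ((norm (x + y))\<^sup>2) * z - 4 * x * y * cnj z" .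
  have 2: "(norm ?d)\<^sup>2 = (norm (x + y))\<^sup>2 + 4 - 4 * Re (cnj (x + y) * z)"
    using norm1_ReIm[OF assms(4)] unfolding cmod_power2 by (simp add: power2_eq_square algebra_simps)
  have "lorentz_refl x y (light z) = (1 / (norm (x - y))\<^sup>2) *\<^sub>R
     (of_real ((norm ?d)\<^sup>2) * circle_reflection x y z, (norm ?d)\<^sup>2)"
    by (subst 1, subst 2) (simp add: lorentz_refl_def light_def)
  thus ?thesis unfolding k
    by (simp add: light_def scaleR_conv_of_real)
qed

lemma side_form_circle_reflection:
  assumes "norm x = 1" "norm (y::complex) = 1" "x \<noteq> y" "norm z = 1"
  shows "(kappa x y z)\<^sup>2 * side_form x y (light (circle_reflection x y z)) = - side_form x y (light z)"
  using side_form_lorentz_refl[OF assms(1-3), of "light z"]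
  unfolding lorentz_refl_light[OF assms] by (simp add: linear_scale[OF linear_side_form])

section \<open>Geodesics in the disk\<close>

text \<open>Signed so that time-like vectors are positive: \<open>lift\<close> is then the usual map
  of the disk onto the sheet \<open>mink u u = 1\<close>, \<open>snd u > 0\<close> of the
  hyperboloid, and \<open>mink\<close> of two lifts is the \<open>cosh\<close> of the hyperbolic
  distance.\<close>

definition mink :: "complex \<times> real \<Rightarrow> complex \<times> real \<Rightarrow> real" where
  "mink u v = snd u * snd v - Re (fst u * cnj (fst v))"

definition lift :: "complex \<Rightarrow> complex \<times> real" where
  "lift z = (1 / (1 - (norm z)\<^sup>2)) *\<^sub>R (2 * z, 1 + (norm z)\<^sup>2)"

lemma mink_add_left: "mink (u + v) w = mink u w + mink v w"
  and mink_add_right: "mink w (u + v) = mink w u + mink w v"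
  and mink_diff_left: "mink (u - v) w = mink u w - mink v w"
  and mink_diff_right: "mink w (u - v) = mink w u - mink w v"
  and mink_scale_left: "mink (c *\<^sub>R u) w = c * mink u w"
  and mink_scale_right: "mink w (c *\<^sub>R u) = c * mink w u"
  and mink_commute: "mink u v = mink v u"
  by (simp_all add: mink_def algebra_simps)

lemmas mink_simps = mink_add_left mink_add_right mink_diff_left mink_diff_right mink_scale_left mink_scale_right

lemma mink_self: "mink u u = (snd u)\<^sup>2 - (norm (fst u))\<^sup>2"
  by (simp add: mink_def power2_eq_square[of "snd u"] cmod_power2) (simp add: power2_eq_square)

lemma mink_light: 
  assumes "norm s = 1" "norm t = 1"
  shows "2 * mink (light s) (light t) = (norm (s - t))\<^sup>2"
  unfolding cmod_power2 using norm1_ReIm[OF assms(1)] norm1_ReIm[OF assms(2)]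
  by (simp add: mink_def light_def power2_eq_square algebra_simps)

lemma norm_less_one_sq: "z \<in> pdisk \<Longrightarrow> (norm z)\<^sup>2 < 1"
  by (simp add: power_less_one_iff abs_square_less_1)

lemma mink_lift_self: "z \<in> pdisk \<Longrightarrow> mink (lift z) (lift z) = 1"
proof -
  assume "z \<in> pdisk"
  hence "1 - (norm z)\<^sup>2 \<noteq> 0" using norm_less_one_sq[of z] by simp
  thus ?thesis unfolding mink_self lift_def
    by (simp add: norm_mult power_mult_distrib power_divide divide_simps) (simp add: power2_eq_square algebra_simps)
qed

lemma snd_lift_pos: "z \<in> pdisk \<Longrightarrow> snd (lift z) > 0"
  using norm_less_one_sq[of z] by (simp add: lift_def add_pos_nonneg)

definition unlift :: "complex \<times> real \<Rightarrow> complex" where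
  "unlift u = fst u / of_real (1 + snd u)"

lemma unlift_lift: 
  assumes "z \<in> pdisk" shows "unlift (lift z) = z"
proof -
  have n: "1 - (norm z)\<^sup>2 \<noteq> 0" using norm_less_one_sq[OF assms] by simp
  have "1 + snd (lift z) = 2 / (1 - (norm z)\<^sup>2)" using n by (simp add: lift_def field_simps)
  moreover have "fst (lift z) = of_real (2 / (1 - (norm z)\<^sup>2)) * z" by (simp add: lift_def scaleR_conv_of_real)
  ultimately show ?thesis unfolding unlift_def
    using n by (metis divide_eq_0_iff nonzero_mult_div_cancel_left of_real_eq_0_iff zero_neq_numeral)
qed

lemma lift_inj: "z \<in> pdisk \<Longrightarrow> w \<in> pdisk \<Longrightarrow> lift z = lift w \<Longrightarrow> z = w"
  by (metis unlift_lift)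

lemma unlift_props:
  assumes "mink u u = 1" "snd u > 0"
  shows "unlift u \<in> pdisk" "lift (unlift u) = u"
proof -
  obtain v h where u: "u = (v, h)" by (cases u)
  have h: "h > 0" "(norm v)\<^sup>2 = h\<^sup>2 - 1" using assms by (auto simp: u mink_self)
  have n: "(norm (unlift u))\<^sup>2 = (h - 1) / (h + 1)"
  proof -
    have "(norm (unlift u))\<^sup>2 = (norm v)\<^sup>2 / (1 + h)\<^sup>2"
      unfolding unlift_def u fst_conv snd_conv norm_divide power_divide norm_of_real by simp
    also have "\<dots> = (h - 1) / (h + 1)" unfolding h(2) using h(1) 
      by (simp add: divide_simps power2_eq_square) (simp add: algebra_simps)
    finally show ?thesis .
  qed
  have "(norm (unlift u))\<^sup>2 < 1" unfolding n using h(1) by simp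
  thus "unlift u \<in> pdisk" by (simp add: power_less_one_iff abs_square_less_1)
  have n1: "1 - (norm (unlift u))\<^sup>2 = 2 / (h + 1)" "1 + (norm (unlift u))\<^sup>2 = 2 * h / (h + 1)"
    unfolding n using h(1) by (auto simp: field_simps)
  have "complex_of_real (1 + h) \<noteq> 0" using h(1) by (metis add_pos_pos less_numeral_extra(1,3) of_real_eq_0_iff)
  hence 2: "2 * unlift u = of_real (2 / (h + 1)) * v"
    by (simp add: unlift_def u add.commute)
  have "lift (unlift u) = (1 / (2 / (h + 1))) *\<^sub>R ((2 / (h + 1)) *\<^sub>R v, 2 * h / (h + 1))"
    unfolding lift_def n1 2 scaleR_conv_of_real[symmetric] ..
  moreover have "1 / (2 / (h + 1)) * (2 / (h + 1)) = 1" "1 / (2 / (h + 1)) * (2 * h / (h + 1)) = h"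
    using h(1) by (auto simp: divide_simps)
  ultimately show "lift (unlift u) = u" by (simp only: u scaleR_Pair scaleR_scaleR scaleR_one real_scaleR_def)
qed

lemma cosh_hyp_dist:
  assumes "z \<in> pdisk" "w \<in> pdisk"
  shows "cosh (hyp_dist z w) = mink (lift z) (lift w)"
proof -
  have n: "1 - (norm z)\<^sup>2 > 0" "1 - (norm w)\<^sup>2 > 0" using norm_less_one_sq assms by auto
  hence "cosh (hyp_dist z w) = 1 + 2 * (norm (z - w))\<^sup>2 / ((1 - (norm z)\<^sup>2) * (1 - (norm w)\<^sup>2))"
    unfolding hyp_dist_def by (intro cosh_arcosh_real) simp
  also have "\<dots> = ((1 + (norm z)\<^sup>2) * (1 + (norm w)\<^sup>2) - 4 * Re (z * cnj w)) / ((1 - (norm z)\<^sup>2) * (1 - (norm w)\<^sup>2))"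
  proof -
    have "(1 - (norm z)\<^sup>2) * (1 - (norm w)\<^sup>2) + 2 * (norm (z - w))\<^sup>2 = (1 + (norm z)\<^sup>2) * (1 + (norm w)\<^sup>2) - 4 * Re (z * cnj w)"
      unfolding cmod_power2 by (simp add: power2_eq_square algebra_simps)
    moreover have "(1 - (norm z)\<^sup>2) * (1 - (norm w)\<^sup>2) \<noteq> 0" using n by simp
    ultimately show ?thesis by (metis (no_types, lifting) add_divide_distrib divide_self)
  qed
  also have "\<dots> = mink (lift z) (lift w)"
    using n by (simp add: lift_def mink_def divide_simps)
  finally show ?thesis .
qed

lemma hyp_dist_nonneg: "z \<in> pdisk \<Longrightarrow> w \<in> pdisk \<Longrightarrow> hyp_dist z w \<ge> 0"
  unfolding hyp_dist_def using norm_less_one_sq[of z] norm_less_one_sq[of w]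
  by (intro arcosh_nonneg_real) simp

lemma hyp_dist_eqI:
  assumes "z \<in> pdisk" "w \<in> pdisk" "mink (lift z) (lift w) = cosh d"
  shows "hyp_dist z w = \<bar>d\<bar>"
  by (metis (no_types) arcosh_cosh_real assms cosh_hyp_dist cosh_real_abs hyp_dist_nonneg abs_ge_zero)

text \<open>The difference of the two vectors is null and orthogonal to the time-like
  \<open>v\<close>; by Cauchy-Schwarz only zero has both properties.\<close>

lemma mink_eq_one:
  assumes "mink u u = 1" "mink v v = 1" "mink u v = 1"
  shows "u = v"
proof -
  define d where "d = u - v"
  have "mink d d = 0" "mink d v = 0"
    using assms mink_commute[of v u] by (auto simp: d_def mink_simps)
  hence d: "(norm (fst d))\<^sup>2 = (snd d)\<^sup>2" "snd d * snd v = Re (fst d * cnj (fst v))" by (simp_all add: mink_self mink_def)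
  have v: "(snd v)\<^sup>2 = 1 + (norm (fst v))\<^sup>2" using assms(2) by (simp add: mink_self)
  have "(snd d * snd v)\<^sup>2 \<le> (norm (fst d) * norm (fst v))\<^sup>2"
    unfolding d(2) by (metis abs_Re_le_cmod abs_ge_zero complex_mod_cnj norm_mult power2_abs power_mono)
  hence "(snd d)\<^sup>2 * (1 + (norm (fst v))\<^sup>2) \<le> (snd d)\<^sup>2 * (norm (fst v))\<^sup>2"
    unfolding power_mult_distrib v d(1) .
  hence "(snd d)\<^sup>2 \<le> 0" by (simp add: algebra_simps)
  hence "snd d = 0" by simp
  moreover from this have "fst d = 0" using d(1) by simp
  ultimately show ?thesis by (metis d_def eq_iff_diff_eq_0 prod.collapse zero_prod_def)
qed

text \<open>Equality in the triangle inequality is exploited without calculus: the interpolated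
  vector on the right has \<open>mink\<close> one with itself and with \<open>lift p\<close>, so
  \<open>mink_eq_one\<close> identifies the two.\<close>

lemma lift_between:
  assumes z: "z \<in> pdisk" and p: "p \<in> pdisk" and w: "w \<in> pdisk"
    and d: "hyp_dist z p = r" "hyp_dist p w = q" "hyp_dist z w = r + q" and pos: "r + q > 0"
  shows "lift p = (1 / sinh (r + q)) *\<^sub>R (sinh q *\<^sub>R lift z + sinh r *\<^sub>R lift w)"
proof -
  let ?y = "(1 / sinh (r + q)) *\<^sub>R (sinh q *\<^sub>R lift z + sinh r *\<^sub>R lift w)"
  have s: "sinh (r + q) \<noteq> 0" using pos by simp
  have c: "mink (lift z) (lift p) = cosh r" "mink (lift w) (lift p) = cosh q" "mink (lift z) (lift w) = cosh (r + q)"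
    "mink (lift w) (lift z) = cosh (r + q)"
    using cosh_hyp_dist[OF z p] cosh_hyp_dist[OF p w] cosh_hyp_dist[OF z w] mink_commute d by auto
  have cr: "(cosh r)\<^sup>2 = 1 + (sinh r)\<^sup>2" "(cosh q)\<^sup>2 = 1 + (sinh q)\<^sup>2" by (simp_all add: cosh_square_eq)
  have "mink ?y ?y = ((sinh q)\<^sup>2 + (sinh r)\<^sup>2 + 2 * sinh q * sinh r * cosh (r + q)) / (sinh (r + q))\<^sup>2"
    by (simp add: mink_simps c mink_lift_self[OF z] mink_lift_self[OF w] power2_eq_square add_divide_distrib algebra_simps)
  also have "(sinh q)\<^sup>2 + (sinh r)\<^sup>2 + 2 * sinh q * sinh r * cosh (r + q) = (sinh (r + q))\<^sup>2"
    unfolding sinh_add cosh_add using cr by algebra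
  finally have 1: "mink ?y ?y = 1" using s by simp
  have "mink ?y (lift p) = (sinh q * cosh r + sinh r * cosh q) / sinh (r + q)"
    by (simp add: mink_simps c add_divide_distrib)
  also have "\<dots> = 1" using s by (simp add: sinh_add algebra_simps)
  finally have 2: "mink (lift p) ?y = 1" by (simp add: mink_commute)
  show ?thesis by (rule mink_eq_one[OF mink_lift_self[OF p] 1 2])
qed

text \<open>The factor \<open>1 / norm (s - t)\<close> makes \<open>u\<close> an arclength
  parameter, because twice the product of two light vectors is the squared chord. The end
  \<open>s\<close> is reached at plus infinity, \<open>t\<close> at minus infinity.\<close>

definition geo :: "complex \<Rightarrow> complex \<Rightarrow> real \<Rightarrow> complex" where
  "geo s t u = unlift ((1 / norm (s - t)) *\<^sub>R (exp u *\<^sub>R light s + exp (- u) *\<^sub>R light t))"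

lemma geo_vec:
  assumes "norm s = 1" "norm t = 1" "s \<noteq> t"
  shows "mink ((1 / norm (s - t)) *\<^sub>R (exp u *\<^sub>R light s + exp (- u) *\<^sub>R light t))
     ((1 / norm (s - t)) *\<^sub>R (exp v *\<^sub>R light s + exp (- v) *\<^sub>R light t)) = cosh (u - v)"
proof -
  have l: "mink (light s) (light t) = (norm (s - t))\<^sup>2 / 2" "mink (light t) (light s) = (norm (s - t))\<^sup>2 / 2"
     "mink (light s) (light s) = 0" "mink (light t) (light t) = 0"
    using mink_light[OF assms(1,2)] mink_light[OF assms(1,1)] mink_light[OF assms(2,2)] mink_commute[of "light s" "light t"] by auto
  have n: "norm (s - t) \<noteq> 0" using assms by simp
  have e: "exp u * exp (- v) + exp (- u) * exp v = 2 * cosh (u - v)"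
    by (simp add: cosh_def exp_diff exp_minus field_simps)
  have "mink ((1 / norm (s - t)) *\<^sub>R (exp u *\<^sub>R light s + exp (- u) *\<^sub>R light t))
     ((1 / norm (s - t)) *\<^sub>R (exp v *\<^sub>R light s + exp (- v) *\<^sub>R light t))
     = (exp u * exp (- v) + exp (- u) * exp v) / 2"
    using n by (simp add: mink_simps l power2_eq_square field_simps)
  thus ?thesis unfolding e by simp
qed

lemma
  assumes "norm s = 1" "norm t = 1" "s \<noteq> t"
  shows geo_in_disk: "geo s t u \<in> pdisk"
    and lift_geo: "lift (geo s t u) = (1 / norm (s - t)) *\<^sub>R (exp u *\<^sub>R light s + exp (- u) *\<^sub>R light t)"
  using unlift_props[OF geo_vec[OF assms, of u u, simplified]] assms
  by (auto simp: geo_def light_def add_pos_pos)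

lemma hyp_dist_geo:
  assumes "norm s = 1" "norm t = 1" "s \<noteq> t"
  shows "hyp_dist (geo s t u) (geo s t v) = \<bar>u - v\<bar>"
  using geo_vec[OF assms, of u v] geo_in_disk[OF assms] lift_geo[OF assms] hyp_dist_eqI by metis

lemma geo_swap:
  "norm s = 1 \<Longrightarrow> norm t = 1 \<Longrightarrow> s \<noteq> t \<Longrightarrow> geo t s (- u) = geo s t u"
  by (simp add: geo_def norm_minus_commute add.commute)

lemma null_vector_light:
  assumes "mink v v = 0" "snd v > 0"
  shows "norm (fst v / of_real (snd v)) = 1" "v = snd v *\<^sub>R light (fst v / of_real (snd v))"
proof -
  have "(norm (fst v))\<^sup>2 = (snd v)\<^sup>2" using assms(1) by (simp add: mink_self)
  hence "norm (fst v) = snd v" using assms(2) by (simp add: power2_eq_iff_nonneg)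
  thus "norm (fst v / of_real (snd v)) = 1" using assms(2) by (simp add: norm_divide)
  show "v = snd v *\<^sub>R light (fst v / of_real (snd v))"
    using assms(2) by (cases v) (simp add: light_def scaleR_conv_of_real)
qed

lemma geo_of_combination:
  assumes "norm s = 1" "norm t = 1" "a > 0" "b > 0" and m: "mink (a *\<^sub>R light s + b *\<^sub>R light t) (a *\<^sub>R light s + b *\<^sub>R light t) = 1"
  shows "s \<noteq> t" "a *\<^sub>R light s + b *\<^sub>R light t = lift (geo s t (ln (a * norm (s - t))))"
proof -
  have l: "mink (light s) (light t) = (norm (s - t))\<^sup>2 / 2" "mink (light t) (light s) = (norm (s - t))\<^sup>2 / 2"
     "mink (light s) (light s) = 0" "mink (light t) (light t) = 0"
    using mink_light[OF assms(1,2)] mink_light[OF assms(1,1)] mink_light[OF assms(2,2)] mink_commute[of "light s" "light t"] by auto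
  have ab: "a * b * (norm (s - t))\<^sup>2 = 1" using m by (simp add: mink_simps l)
  thus st: "s \<noteq> t" by auto
  hence n: "norm (s - t) > 0" by simp
  have "b = 1 / (a * (norm (s - t))\<^sup>2)" using ab assms(3) n by (simp add: field_simps)
  hence "(1 / norm (s - t)) * exp (ln (a * norm (s - t))) = a" "(1 / norm (s - t)) * exp (- ln (a * norm (s - t))) = b"
    using assms(3) n by (simp_all add: exp_minus power2_eq_square field_simps)
  thus "a *\<^sub>R light s + b *\<^sub>R light t = lift (geo s t (ln (a * norm (s - t))))"
    unfolding lift_geo[OF assms(1,2) st] scaleR_add_right scaleR_scaleR by simp
qed

text \<open>Subtracting a suitable multiple \<open>q\<close> of \<open>light t\<close> from
  \<open>lift z\<close> leaves a null vector, whose direction is the other end. Together with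
  \<open>sform_geo\<close> this reduces questions about disk points to signs at two ideal
  points.\<close>

lemma disk_point_on_geo:
  assumes z: "z \<in> pdisk" and t: "norm t = 1"
  shows "\<exists>s u. norm s = 1 \<and> s \<noteq> t \<and> z = geo s t u"
proof -
  define x where "x = lift z"
  define q where "q = 1 / (2 * mink x (light t))"
  define v where "v = x - q *\<^sub>R light t"
  have x: "mink x x = 1" "snd x > 0" using mink_lift_self[OF z] snd_lift_pos[OF z] by (auto simp: x_def)
  have "(norm (fst x))\<^sup>2 < (snd x)\<^sup>2" using x by (simp add: mink_self)
  hence "norm (fst x) < snd x" using x(2) by (rule power_less_imp_less_base[OF _ less_imp_le])
  moreover have "Re (fst x * cnj t) \<le> norm (fst x)" using complex_Re_le_cmod[of "fst x * cnj t"] t by (simp add: norm_mult)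
  ultimately have m: "mink x (light t) > 0" by (simp add: mink_def light_def)
  have t0: "mink (light t) (light t) = 0" using mink_light[OF t t] by simp
  have v0: "mink v v = 0" using m mink_commute[of x "light t"] by (simp add: v_def q_def mink_simps x(1) t0)
  have vt: "mink v (light t) > 0" using m by (simp add: v_def mink_simps t0)
  have sv: "snd v > 0"
  proof (rule ccontr)
    assume "\<not> snd v > 0"
    moreover have "(norm (fst v))\<^sup>2 = (- snd v)\<^sup>2" using v0 by (simp add: mink_self)
    ultimately have "norm (fst v) = - snd v" using power2_eq_imp_eq[of "norm (fst v)" "- snd v"] by simp
    moreover have "- Re (fst v * cnj t) \<le> norm (fst v)" using abs_Re_le_cmod[of "fst v * cnj t"] t by (simp add: norm_mult)
    ultimately show False using vt by (simp add: mink_def light_def)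
  qed
  define s where "s = fst v / of_real (snd v)"
  have s: "norm s = 1" "v = snd v *\<^sub>R light s" using null_vector_light[OF v0 sv] by (simp_all add: s_def)
  have "x = v + q *\<^sub>R light t" by (simp add: v_def)
  hence xe: "x = snd v *\<^sub>R light s + q *\<^sub>R light t" using s(2) by metis
  have q: "q > 0" using m by (simp add: q_def)
  note g = geo_of_combination[OF s(1) t sv q x(1)[unfolded xe]]
  have "lift z = lift (geo s t (ln (snd v * norm (s - t))))" using g(2) xe by (simp add: x_def)
  hence "z = geo s t (ln (snd v * norm (s - t)))" using lift_inj[OF z geo_in_disk[OF s(1) t g(1)]] by blast
  thus ?thesis using s(1) g(1) by blast
qed

lemma tendsto_unlift_combination:
  assumes "snd a > 0"
  shows "((\<lambda>u. unlift (exp u *\<^sub>R a + exp (- u) *\<^sub>R b)) \<longlongrightarrow> fst a / of_real (snd a)) at_top"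
proof -
  have e1: "((\<lambda>u::real. exp (- u)) \<longlongrightarrow> 0) at_top"
    by (rule filterlim_compose[OF exp_at_bot filterlim_uminus_at_bot_at_top])
  have e2: "((\<lambda>u::real. exp (- u) * exp (- u)) \<longlongrightarrow> 0) at_top" using tendsto_mult[OF e1 e1] by simp
  have "unlift (exp u *\<^sub>R a + exp (- u) *\<^sub>R b)
     = (fst a + (exp (- u) * exp (- u)) *\<^sub>R fst b) / of_real (exp (- u) + snd a + exp (- u) * exp (- u) * snd b)" for u
  proof -
    have e: "exp (- u) * exp u = 1" by (simp add: exp_minus)
    have "(fst a + (exp (- u) * exp (- u)) *\<^sub>R fst b) = of_real (exp (- u)) * fst (exp u *\<^sub>R a + exp (- u) *\<^sub>R b)"
      using e unfolding fst_add fst_scaleR scaleR_conv_of_real distrib_left mult.assoc[symmetric] of_real_mult[symmetric] by simp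
    moreover have "exp (- u) + snd a + exp (- u) * exp (- u) * snd b = exp (- u) * (1 + snd (exp u *\<^sub>R a + exp (- u) *\<^sub>R b))"
      using e by (simp add: distrib_left)
    ultimately show ?thesis unfolding unlift_def by (simp del: of_real_add of_real_1)
  qed
  moreover have "((\<lambda>u. (fst a + (exp (- u) * exp (- u)) *\<^sub>R fst b) / of_real (exp (- u) + snd a + exp (- u) * exp (- u) * snd b))
     \<longlongrightarrow> (fst a + 0 *\<^sub>R fst b) / of_real (0 + snd a + 0 * snd b)) at_top"
    using assms by (intro tendsto_intros e1 e2) auto
  ultimately show ?thesis by simp
qed

lemma geo_at_top:
  assumes "norm s = 1" "norm t = 1" "s \<noteq> t"
  shows "(geo s t \<longlongrightarrow> s) at_top"
proof -
  have n: "norm (s - t) > 0" using assms by simp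
  have "((\<lambda>u. unlift (exp u *\<^sub>R ((1 / norm (s - t)) *\<^sub>R light s) + exp (- u) *\<^sub>R ((1 / norm (s - t)) *\<^sub>R light t)))
     \<longlongrightarrow> fst ((1 / norm (s - t)) *\<^sub>R light s) / of_real (snd ((1 / norm (s - t)) *\<^sub>R light s))) at_top"
    by (rule tendsto_unlift_combination) (use n in \<open>simp add: light_def\<close>)
  moreover have "fst ((1 / norm (s - t)) *\<^sub>R light s) / of_real (snd ((1 / norm (s - t)) *\<^sub>R light s)) = s"
    using n by (simp add: light_def scaleR_conv_of_real)
  ultimately show ?thesis unfolding geo_def by (simp add: scaleR_add_right mult.commute)
qed

lemma geo_at_bot:
  assumes "norm s = 1" "norm t = 1" "s \<noteq> t"
  shows "(geo s t \<longlongrightarrow> t) at_bot"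
  unfolding filterlim_at_bot_mirror
  using geo_at_top[OF assms(2,1) assms(3)[symmetric]] geo_swap[OF assms(2,1) assms(3)[symmetric]] by simp

lemma geodesic_from_to_geo:
  assumes "norm s = 1" "norm t = 1" "s \<noteq> t"
  shows "geodesic_from_to t s (\<lambda>u. geo s t (u + c))"
  unfolding geodesic_from_to_def geodesic_path_def
proof (intro conjI allI)
  show "range (\<lambda>u. geo s t (u + c)) \<subseteq> pdisk" using geo_in_disk[OF assms] by blast
  show "hyp_dist (geo s t (u + c)) (geo s t (v + c)) = \<bar>u - v\<bar>" for u v using hyp_dist_geo[OF assms] by simp
  have "filterlim (\<lambda>u. u + c) at_bot at_bot" "filterlim (\<lambda>u. u + c) at_top at_top"
    unfolding filterlim_at_bot filterlim_at_top eventually_at_bot_linorder eventually_at_top_linorder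
    by (simp_all only: le_diff_eq[symmetric] diff_le_eq[symmetric]) blast+
  thus "((\<lambda>u. geo s t (u + c)) \<longlongrightarrow> t) at_bot" "((\<lambda>u. geo s t (u + c)) \<longlongrightarrow> s) at_top"
    using filterlim_compose[OF geo_at_bot[OF assms]] filterlim_compose[OF geo_at_top[OF assms]] by blast+
qed

text \<open>An isometric embedding of the line is given only by its distances.
  \<open>lift_between\<close>, solved for an outer point when necessary, expresses every point
  through those at times 0 and 1; \<open>a\<close> and \<open>b\<close> are the resulting
  coefficients of the exponentials. Positivity of the heights passes to the limit, and a null vector
  of height zero would vanish, against \<open>mink a b = 1 / 2\<close>.\<close>

lemma geodesic_path_combination:
  assumes "geodesic_path g"
  shows "\<exists>a b. mink a a = 0 \<and> mink b b = 0 \<and> snd a > 0 \<and> snd b > 0 \<and> (\<forall>u. lift (g u) = exp u *\<^sub>R a + exp (- u) *\<^sub>R b)"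
proof -
  have in_disk: "g u \<in> pdisk" and d: "hyp_dist (g u) (g v) = \<bar>u - v\<bar>" for u v
    using assms unfolding geodesic_path_def by blast+
  define x where "x = (\<lambda>u. lift (g u))"
  have btw: "sinh (w - u) *\<^sub>R x v = sinh (w - v) *\<^sub>R x u + sinh (v - u) *\<^sub>R x w" if "u \<le> v" "v \<le> w" "u < w" for u v w
  proof -
    have "x v = (1 / sinh (w - u)) *\<^sub>R (sinh (w - v) *\<^sub>R x u + sinh (v - u) *\<^sub>R x w)"
      using lift_between[OF in_disk[of u] in_disk[of v] in_disk[of w], of "v - u" "w - v"] that by (simp add: d x_def)
    thus ?thesis using that by simp
  qed
  have x: "sinh 1 *\<^sub>R x u = sinh (1 - u) *\<^sub>R x 0 + sinh u *\<^sub>R x 1" for u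
  proof -
    consider "0 \<le> u" "u \<le> 1" | "1 \<le> u" | "u \<le> 0" by linarith
    thus ?thesis
    proof cases
      case 1 thus ?thesis using btw[of 0 u 1] by simp
    next
      case 2
      have "sinh (u - 1) = - sinh (1 - u)" by (metis minus_diff_eq sinh_minus)
      thus ?thesis using btw[of 0 1 u] 2 by simp
    next
      case 3 thus ?thesis using btw[of u 0 1] by (simp add: algebra_simps)
    qed
  qed
  define S where "S = (sinh 1 :: real)"
  have S: "S > 0" by (simp add: S_def)
  have SE: "2 * S = exp 1 - exp (- 1)" by (simp add: S_def sinh_def)
  define a where "a = (1 / (2 * S)) *\<^sub>R (x 1 - exp (- 1) *\<^sub>R x 0)"
  define b where "b = (1 / (2 * S)) *\<^sub>R (exp 1 *\<^sub>R x 0 - x 1)"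
  have xab: "x u = exp u *\<^sub>R a + exp (- u) *\<^sub>R b" for u
  proof -
    have "S *\<^sub>R x u = S *\<^sub>R (exp u *\<^sub>R a + exp (- u) *\<^sub>R b)"
    proof -
      have "S *\<^sub>R x u = ((exp (1 - u) - exp (u - 1)) / 2) *\<^sub>R x 0 + ((exp u - exp (- u)) / 2) *\<^sub>R x 1"
        using x[of u] by (simp add: S_def sinh_def)
      also have "\<dots> = exp u *\<^sub>R (S *\<^sub>R a) + exp (- u) *\<^sub>R (S *\<^sub>R b)"
      proof -
        have "S *\<^sub>R a = (1 / 2) *\<^sub>R (x 1 - exp (- 1) *\<^sub>R x 0)" "S *\<^sub>R b = (1 / 2) *\<^sub>R (exp 1 *\<^sub>R x 0 - x 1)"
          using S by (simp_all add: a_def b_def)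
        moreover have "exp (1 - u) = exp 1 * exp (- u)" "exp (u - 1) = exp u * exp (- 1)" by (simp_all flip: exp_add)
        ultimately show ?thesis
          by (simp add: scaleR_diff_right scaleR_diff_left diff_divide_distrib)
      qed
      also have "\<dots> = S *\<^sub>R (exp u *\<^sub>R a + exp (- u) *\<^sub>R b)"
        by (simp add: scaleR_add_right mult.commute)
      finally show ?thesis .
    qed
    thus ?thesis using S by (simp only: scaleR_cancel_left) simp
  qed
  have "mink (x u) (x v) = cosh (u - v)" for u v
    using cosh_hyp_dist[OF in_disk[of u] in_disk[of v]] unfolding d x_def by simp
  from this[of 0 0] this[of 1 1] this[of 0 1] this[of 1 0]
  have m: "mink (x 0) (x 0) = 1" "mink (x 1) (x 1) = 1" "mink (x 0) (x 1) = cosh 1" "mink (x 1) (x 0) = cosh 1"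
    by simp_all
  have ee: "exp 1 * exp (- 1) = (1::real)" "2 * cosh 1 = exp 1 + exp (- (1::real))" by (simp_all add: exp_minus cosh_def)
  have C: "(cosh 1)\<^sup>2 = 1 + S\<^sup>2" unfolding S_def by (simp add: cosh_square_eq)
  have na: "mink a a = 0" and nb: "mink b b = 0"
    unfolding a_def b_def mink_simps m using ee by (algebra, algebra)
  have "mink a b = (1 / (2 * S))\<^sup>2 * (2 * ((cosh 1)\<^sup>2 - 1))"
    unfolding a_def b_def mink_simps m using ee by algebra
  hence nab: "mink a b = 1 / 2" using S unfolding C by (simp add: power2_eq_square)
  have pos: "exp u * snd a + exp (- u) * snd b > 0" for u
    using snd_lift_pos[OF in_disk[of u]] xab[of u] by (simp add: x_def)
  have pos': "exp (2 * u) * snd a + snd b > 0" "snd a + exp (- 2 * u) * snd b > 0" for u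
  proof -
    have e: "exp u * exp (- u) = 1" "exp (2 * u) = exp u * exp u" "exp (- 2 * u) = exp (- u) * exp (- u)"
      by (simp add: exp_minus, simp_all flip: exp_add)
    have "exp u * (exp u * snd a + exp (- u) * snd b) = exp (2 * u) * snd a + snd b"
      "exp (- u) * (exp u * snd a + exp (- u) * snd b) = snd a + exp (- 2 * u) * snd b"
      unfolding e distrib_left mult.assoc[symmetric] e(1) mult.commute[of "exp (- u)" "exp u"] by simp_all
    thus "exp (2 * u) * snd a + snd b > 0" "snd a + exp (- 2 * u) * snd b > 0"
      using mult_pos_pos[OF exp_gt_zero[of u] pos[of u]] mult_pos_pos[OF exp_gt_zero[of "- u"] pos[of u]] by linarith+
  qed
  have key: "p \<ge> 0" if "\<And>u::real. exp (2 * u) * p + r > 0" for p r :: real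
  proof (rule ccontr)
    assume "\<not> p \<ge> 0"
    hence "exp (2 * (ln ((\<bar>r\<bar> + 1) / (- p)) / 2)) * p = - (\<bar>r\<bar> + 1)" by (simp add: divide_pos_neg)
    thus False using that[of "ln ((\<bar>r\<bar> + 1) / (- p)) / 2"] by linarith
  qed
  have a0: "snd a \<ge> 0" by (rule key[OF pos'(1)])
  have "exp (2 * u) * snd b + snd a > 0" for u using pos'(2)[of "- u"] by simp
  hence b0: "snd b \<ge> 0" by (rule key)
  have nz: "snd v \<noteq> 0" if "mink v v = 0" "mink v w \<noteq> 0" for v w
  proof
    assume "snd v = 0" 
    hence "fst v = 0" using that(1) by (simp add: mink_self)
    thus False using that(2) \<open>snd v = 0\<close> by (simp add: mink_def)
  qed
  have "snd a \<noteq> 0" "snd b \<noteq> 0" using nz[OF na, of b] nz[OF nb, of a] nab mink_commute[of b a] by simp_all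
  hence "snd a > 0" "snd b > 0" using a0 b0 by simp_all
  thus ?thesis using na nb xab unfolding x_def by blast
qed

lemma geodesic_from_to_iff:
  assumes st: "norm s = 1" "norm t = 1" "s \<noteq> t"
  shows "geodesic_from_to t s g \<longleftrightarrow> (\<exists>c. g = (\<lambda>u. geo s t (u + c)))"
proof
  assume g: "geodesic_from_to t s g"
  hence gp: "geodesic_path g" and lim: "(g \<longlongrightarrow> t) at_bot" "(g \<longlongrightarrow> s) at_top" by (auto simp: geodesic_from_to_def)
  obtain a b where ab: "mink a a = 0" "mink b b = 0" "snd a > 0" "snd b > 0" and x: "\<And>u. lift (g u) = exp u *\<^sub>R a + exp (- u) *\<^sub>R b"
    using geodesic_path_combination[OF gp] by blast
  have gd: "g u \<in> pdisk" for u using gp unfolding geodesic_path_def by blast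
  have gu: "g u = unlift (exp u *\<^sub>R a + exp (- u) *\<^sub>R b)" for u using unlift_lift[OF gd] x by metis
  have "(g \<longlongrightarrow> fst a / of_real (snd a)) at_top"
    using tendsto_unlift_combination[OF ab(3), of b] by (simp add: gu[abs_def])
  hence s: "fst a / of_real (snd a) = s" using lim(2) tendsto_unique trivial_limit_at_top_linorder by blast
  have "((\<lambda>u. g (- u)) \<longlongrightarrow> fst b / of_real (snd b)) at_top"
    using tendsto_unlift_combination[OF ab(4), of a] by (simp add: gu[abs_def] add.commute)
  moreover have "((\<lambda>u. g (- u)) \<longlongrightarrow> t) at_top" using lim(1) unfolding filterlim_at_bot_mirror .
  ultimately have t: "fst b / of_real (snd b) = t" using tendsto_unique trivial_limit_at_top_linorder by blast
  have a: "a = snd a *\<^sub>R light s" and b: "b = snd b *\<^sub>R light t" using null_vector_light(2) ab s t by metis+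
  have x': "lift (g u) = (exp u * snd a) *\<^sub>R light s + (exp (- u) * snd b) *\<^sub>R light t" for u
    using x[of u] a b by (metis scaleR_scaleR)
  have "g u = geo s t (u + ln (snd a * norm (s - t)))" for u
  proof -
    have "lift (g u) = lift (geo s t (ln (exp u * snd a * norm (s - t))))"
      unfolding x' using mink_lift_self[OF gd[of u]] ab(3,4) unfolding x'
      by (intro geo_of_combination(2)[OF st(1,2)]) auto
    moreover have "ln (exp u * snd a * norm (s - t)) = u + ln (snd a * norm (s - t))"
      using ab(3) st(3) by (simp add: ln_mult)
    ultimately show ?thesis using lift_inj[OF gd geo_in_disk[OF st]] by metis
  qed
  thus "\<exists>c. g = (\<lambda>u. geo s t (u + c))" by blast
qed (use geodesic_from_to_geo[OF st] in blast)

lemma geodesic_line_eq: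
  assumes "norm x = 1" "norm y = 1" "x \<noteq> y"
  shows "geodesic_line x y = range (geo y x)"
proof -
  have "z \<in> range (\<lambda>u. geo y x (u + c)) \<Longrightarrow> z \<in> range (geo y x)" for z c by blast
  moreover have "range (geo y x) = range (\<lambda>u. geo y x (u + 0))" by simp
  ultimately show ?thesis
    unfolding geodesic_line_def geodesic_from_to_iff[OF assms(2,1) assms(3)[symmetric]] by blast
qed

text \<open>The antiholomorphic reflection of the disk and the reflection of the circle are the same
  linear map, seen on the hyperboloid and on the light cone. The computation rests on
  \<open>dn\<close>, which also keeps the image inside the disk.\<close>

lemma lift_disk_reflection:
  assumes xy: "norm x = 1" "norm y = 1" "x \<noteq> y" and z: "z \<in> pdisk"
  shows "disk_reflection x y z \<in> pdisk" "lift (disk_reflection x y z) = lorentz_refl x y (lift z)"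
proof -
  let ?n = "(x + y) - 2 * x * y * cnj z" let ?d = "2 - (x + y) * cnj z"
  define n where "n = 1 - (norm z)\<^sup>2"
  define N where "N = (norm (x - y))\<^sup>2"
  have n: "n > 0" using norm_less_one_sq[OF z] by (simp add: n_def)
  have N: "N > 0" using xy by (simp add: N_def)
  have c: "x * cnj x = 1" "y * cnj y = 1" using norm1_cnj xy by auto
  have "complex_of_real ((norm ?d)\<^sup>2 - (norm ?n)\<^sup>2) = of_real (N * n)"
    unfolding N_def n_def of_real_diff of_real_mult of_real_1 complex_norm_square complex_cnj_diff complex_cnj_add complex_cnj_mult complex_cnj_cnj complex_cnj_numeral
    using c by algebra
  hence dn: "(norm ?d)\<^sup>2 - (norm ?n)\<^sup>2 = N * n" using of_real_eq_iff by blast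
  moreover have "N * n > 0" using N n by simp
  ultimately have "(norm ?d)\<^sup>2 > 0" using zero_le_power2[of "norm ?n"] by linarith
  hence d: "?d \<noteq> 0" by auto
  define w where "w = disk_reflection x y z"
  have w2: "(norm w)\<^sup>2 = (norm ?n)\<^sup>2 / (norm ?d)\<^sup>2" by (simp add: w_def disk_reflection_def norm_divide power_divide)
  have w1: "1 - (norm w)\<^sup>2 = N * n / (norm ?d)\<^sup>2" and w3: "1 + (norm w)\<^sup>2 = ((norm ?d)\<^sup>2 + (norm ?n)\<^sup>2) / (norm ?d)\<^sup>2"
    unfolding w2 dn[symmetric] using d by (simp_all add: diff_divide_distrib add_divide_distrib)
  have "1 - (norm w)\<^sup>2 > 0" unfolding w1 using N n d by simp
  thus "disk_reflection x y z \<in> pdisk" unfolding w_def by (simp add: power_less_one_iff abs_square_less_1)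
  have "2 * (a / b) = (1 / (norm b)\<^sup>2) *\<^sub>R (2 * (a * cnj b))" if "b \<noteq> 0" for a b :: complex
    unfolding scaleR_conv_of_real of_real_divide of_real_1 complex_norm_square using that by (simp add: field_simps)
  hence ww: "2 * w = (1 / (norm ?d)\<^sup>2) *\<^sub>R (2 * (?n * cnj ?d))"
    unfolding w_def disk_reflection_def using d by blast
  have "lift w = (1 / (N * n)) *\<^sub>R (2 * (?n * cnj ?d), (norm ?d)\<^sup>2 + (norm ?n)\<^sup>2)"
    unfolding lift_def w1 w3 ww using d N n by simp
  also have "2 * (?n * cnj ?d) = of_real (4 * (1 + (norm z)\<^sup>2)) * (x + y) - of_real ((norm (x + y))\<^sup>2) * (2 * z) - 4 * x * y * cnj (2 * z)"
    unfolding of_real_add of_real_mult of_real_1 of_real_numeral complex_norm_square complex_cnj_diff complex_cnj_add complex_cnj_mult complex_cnj_cnj complex_cnj_numeral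
    using c by algebra
  also have "(norm ?d)\<^sup>2 + (norm ?n)\<^sup>2 = ((norm (x + y))\<^sup>2 + 4) * (1 + (norm z)\<^sup>2) - 4 * Re (cnj (x + y) * (2 * z))"
    unfolding cmod_power2 using norm1_ReIm[OF xy(1)] norm1_ReIm[OF xy(2)] by simp algebra
  finally have "lift w = (1 / n) *\<^sub>R lorentz_refl x y (2 * z, 1 + (norm z)\<^sup>2)"
    by (simp add: lorentz_refl_def N_def[symmetric] mult.commute)
  also have "\<dots> = lorentz_refl x y (lift z)"
    unfolding lift_def n_def[symmetric] by (simp only: linear_scale[OF linear_lorentz_refl])
  finally show "lift (disk_reflection x y z) = lorentz_refl x y (lift z)" unfolding w_def .
qed

text \<open>The linear reflection scales the two light vectors by the squares of their
  \<open>kappa\<close>; after renormalisation to unit speed only the quotient is left, as a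
  translation of the parameter.\<close>

lemma disk_reflection_geo:
  assumes xy: "norm x = 1" "norm y = 1" "x \<noteq> y" and st: "norm s = 1" "norm t = 1" "s \<noteq> t"
  shows "disk_reflection x y (geo s t u)
     = geo (circle_reflection x y s) (circle_reflection x y t) (u + ln (kappa x y s) - ln (kappa x y t))"
proof -
  let ?s = "circle_reflection x y s" let ?t = "circle_reflection x y t"
  have st': "norm ?s = 1" "norm ?t = 1" "?s \<noteq> ?t"
    using norm_circle_reflection[OF xy] circle_reflection_invol[OF xy] st by metis+
  define k l where kl: "k = kappa x y s" "l = kappa x y t"
  have p: "k > 0" "l > 0" using kappa_pos[OF xy] st by (auto simp: kl)
  have D: "norm (s - t) = norm (?s - ?t) * (k * l)"
    unfolding dist_circle_reflection[OF xy st(1,2)] using p by (simp add: kl)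
  have np: "norm (?s - ?t) \<noteq> 0" using st' by simp
  have "lift (disk_reflection x y (geo s t u)) = lorentz_refl x y (lift (geo s t u))"
    by (rule lift_disk_reflection(2)[OF xy geo_in_disk[OF st]])
  also have "\<dots> = (1 / norm (s - t)) *\<^sub>R (exp u *\<^sub>R k\<^sup>2 *\<^sub>R light ?s + exp (- u) *\<^sub>R l\<^sup>2 *\<^sub>R light ?t)"
    unfolding lift_geo[OF st] kl
    by (simp add: linear_scale[OF linear_lorentz_refl] linear_add[OF linear_lorentz_refl] lorentz_refl_light[OF xy] st)
  also have "\<dots> = lift (geo ?s ?t (u + ln k - ln l))"
  proof -
    have "1 / norm (s - t) * (exp u * k\<^sup>2) = 1 / norm (?s - ?t) * exp (u + ln k - ln l)"
         "1 / norm (s - t) * (exp (- u) * l\<^sup>2) = 1 / norm (?s - ?t) * exp (- (u + ln k - ln l))"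
    proof -
      have e: "exp (u + ln k - ln l) = exp u * k / l" "exp (- (u + ln k - ln l)) = exp (- u) * l / k"
        using p by (simp_all add: exp_add exp_diff exp_minus field_simps)
      have "1 / (n * (k * l)) * (c * k\<^sup>2) = 1 / n * (c * k / l)" "1 / (n * (k * l)) * (c * l\<^sup>2) = 1 / n * (c * l / k)"
        if "n \<noteq> 0" for n c using p that by (simp_all add: power2_eq_square)
      from this[OF np] show "1 / norm (s - t) * (exp u * k\<^sup>2) = 1 / norm (?s - ?t) * exp (u + ln k - ln l)"
         "1 / norm (s - t) * (exp (- u) * l\<^sup>2) = 1 / norm (?s - ?t) * exp (- (u + ln k - ln l))"
        unfolding D e by blast+
    qed
    thus ?thesis unfolding lift_geo[OF st'] by (simp only: scaleR_add_right scaleR_scaleR)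
  qed
  finally show ?thesis unfolding kl
    using lift_inj[OF lift_disk_reflection(1)[OF xy geo_in_disk[OF st]] geo_in_disk[OF st']] by blast
qed

lemma Arg2pi_cis_eq: "0 \<le> t \<Longrightarrow> t < 2 * pi \<Longrightarrow> Arg2pi (cis t) = t"
  using Arg2pi_unique[of 1 t "cis t"] by (simp add: cis_conv_exp)

lemma infinite_unit_circle: "infinite {z::complex. norm z = 1}"
proof
  assume "finite {z::complex. norm z = 1}"
  hence "finite (cis ` {0..1})" by (rule finite_subset[rotated]) auto
  moreover have "inj_on cis {0..1}"
  proof (rule inj_onI)
    fix x y :: real assume "x \<in> {0..1}" "y \<in> {0..1}" "cis x = cis y"
    thus "x = y" using cos_inj_pi[of x y] pi_gt3 by (auto simp: complex_eq_iff)
  qed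
  ultimately have "finite {0..1::real}" by (rule finite_imageD)
  thus False using infinite_Icc[of 0 "1::real"] by simp
qed

lemma geo_endpoint_unique:
  assumes "norm s = 1" "norm s' = 1" "norm t = 1" "s \<noteq> t" "s' \<noteq> t" "geo s t u = geo s' t v"
  shows "s = s'"
proof -
  define p q where "p = exp u / norm (s - t)" and "q = exp (- u) / norm (s - t)"
  define p' q' where "p' = exp v / norm (s' - t)" and "q' = exp (- v) / norm (s' - t)"
  have pos: "p > 0" "p' > 0" using assms by (auto simp: p_def p'_def)
  have "p *\<^sub>R light s + q *\<^sub>R light t = p' *\<^sub>R light s' + q' *\<^sub>R light t"
    using lift_geo[OF assms(1,3,4), of u] lift_geo[OF assms(2,3,5), of v] assms(6)
    by (simp add: p_def q_def p'_def q'_def scaleR_add_right)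
  hence e: "p *\<^sub>R light s = p' *\<^sub>R light s' + (q' - q) *\<^sub>R light t" by (simp add: scaleR_diff_left algebra_simps)
  have l: "mink (light s) (light s) = 0" "mink (light s') (light s') = 0" "mink (light t) (light t) = 0"
    "mink (light s') (light t) > 0" "mink (light t) (light s') = mink (light s') (light t)"
    using mink_light[OF assms(1,1)] mink_light[OF assms(2,2)] mink_light[OF assms(3,3)] mink_light[OF assms(2,3)] assms(5) mink_commute[of "light t" "light s'"]
    by (auto simp: zero_less_mult_iff) (metis mult_pos_pos zero_less_mult_pos zero_less_numeral zero_less_norm_iff zero_less_power right_minus_eq)
  have "mink (p *\<^sub>R light s) (p *\<^sub>R light s) = 2 * p' * (q' - q) * mink (light s') (light t)"
    unfolding e by (simp add: mink_simps l algebra_simps)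
  hence "q' = q" using l pos by (simp add: mink_simps)
  hence "p *\<^sub>R light s = p' *\<^sub>R light s'" using e by simp
  hence "p = p'" "p *\<^sub>R s = p' *\<^sub>R s'" by (auto simp: light_def)
  thus ?thesis using pos by simp
qed

section \<open>The ideal polygon and its reflection group\<close>

text \<open>The angles are indexed by all natural numbers and gain a full turn after
  \<open>m\<close> steps, so that the arc closing the cycle is an interval of angles like every
  other.\<close>

locale ideal_polygon =
  fixes m :: nat and \<theta> :: "nat \<Rightarrow> complex" and \<alpha> :: "nat \<Rightarrow> real"
  assumes m3: "m \<ge> 3"
    and angle_step: "\<alpha> j < \<alpha> (Suc j)"
    and angle_period: "\<alpha> (j + m) = \<alpha> j + 2 * pi"
    and vertex_eq: "j < m \<Longrightarrow> \<theta> j = cis (\<alpha> j)"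
begin

abbreviation nxt :: "nat \<Rightarrow> nat" where "nxt a \<equiv> Suc a mod m"
abbreviation verts :: "complex set" where "verts \<equiv> \<theta> ` {..<m}"

definition sform :: "nat \<Rightarrow> complex \<times> real \<Rightarrow> real" where "sform a = side_form (\<theta> a) (\<theta> (nxt a))"
definition sgn_arc :: "nat \<Rightarrow> complex \<Rightarrow> real" where "sgn_arc a z = sform a (light z)"
definition crefl :: "nat \<Rightarrow> complex \<Rightarrow> complex" where "crefl a = circle_reflection (\<theta> a) (\<theta> (nxt a))"
definition kap :: "nat \<Rightarrow> complex \<Rightarrow> real" where "kap a = kappa (\<theta> a) (\<theta> (nxt a))"
definition drefl :: "nat \<Rightarrow> complex \<Rightarrow> complex" where "drefl a = disk_reflection (\<theta> a) (\<theta> (nxt a))"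
definition arc_index :: "complex \<Rightarrow> nat" where "arc_index z = (THE a. a < m \<and> z \<in> part_arc m \<theta> a)"

lemma m_pos: "m > 0" using m3 by simp

lemma nxt_less: "nxt a < m" using m_pos by simp

lemma angle_mono: "strict_mono \<alpha>"
  by (rule strict_monoI_Suc) (rule angle_step)

lemma angle_less: "i < j \<Longrightarrow> \<alpha> i < \<alpha> j" using angle_mono by (simp add: strict_mono_less)
lemma angle_le: "i \<le> j \<Longrightarrow> \<alpha> i \<le> \<alpha> j" using angle_mono by (simp add: strict_mono_less_eq)

lemma cis_angle_mod: "cis (\<alpha> (j + m)) = cis (\<alpha> j)"
  by (simp add: angle_period flip: cis_mult)

lemma vertex_nxt: "a < m \<Longrightarrow> \<theta> (nxt a) = cis (\<alpha> (Suc a))"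
proof (cases "Suc a = m")
  case True
  thus ?thesis using cis_angle_mod[of 0] vertex_eq[of 0] m_pos by simp
next
  case False
  assume "a < m"
  hence "Suc a < m" using False by simp
  thus ?thesis using vertex_eq[of "Suc a"] by simp
qed

lemma norm_vertex: "a < m \<Longrightarrow> norm (\<theta> a) = 1" by (simp add: vertex_eq)
lemma norm_vertex_nxt: "norm (\<theta> (nxt a)) = 1" by (rule norm_vertex[OF nxt_less])

lemma cis_inj_window:
  assumes "cis x = cis y" "\<bar>x - y\<bar> < 2 * pi"
  shows "x = y"
proof -
  have "2 * \<bar>sin ((x - y) / 2)\<bar> = 0" using norm_cis_diff[of x y] assms(1) by simp
  hence s: "sin ((x - y) / 2) = 0" by simp
  show ?thesis
  proof (rule ccontr)
    assume "x \<noteq> y"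
    then consider "y < x" | "x < y" by linarith
    thus False
    proof cases
      case 1 thus ?thesis using s sin_gt_zero[of "(x - y) / 2"] assms(2) by simp
    next
      case 2
      have "sin ((y - x) / 2) = - sin ((x - y) / 2)" by (metis minus_diff_eq minus_divide_left sin_minus)
      thus ?thesis using s sin_gt_zero[of "(y - x) / 2"] 2 assms(2) by simp
    qed
  qed
qed

lemma vertex_inj:
  assumes "a < m" "b < m" "\<theta> a = \<theta> b"
  shows "a = b"
proof -
  have "\<alpha> a < \<alpha> 0 + 2 * pi" "\<alpha> b < \<alpha> 0 + 2 * pi" "\<alpha> 0 \<le> \<alpha> a" "\<alpha> 0 \<le> \<alpha> b"
    using angle_less[of a m] angle_less[of b m] angle_period[of 0] assms angle_le[of 0] by auto
  hence "\<bar>\<alpha> a - \<alpha> b\<bar> < 2 * pi" by linarith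
  hence "\<alpha> a = \<alpha> b" using cis_inj_window assms vertex_eq by metis
  thus ?thesis using angle_mono by (simp add: strict_mono_eq)
qed

lemma nxt_neq: "a < m \<Longrightarrow> nxt a \<noteq> a"
  using m3 by (metis One_nat_def Suc_1 Suc_leI le_less_trans lessI less_Suc_eq_le mod_Suc_le_divisor mod_less mod_self n_not_Suc_n not_less numeral_3_eq_3 zero_less_Suc Suc_lessI)

lemma vertex_neq: "a < m \<Longrightarrow> \<theta> a \<noteq> \<theta> (nxt a)"
  using vertex_inj nxt_less nxt_neq by metis

lemmas side_ends = norm_vertex norm_vertex_nxt vertex_neq

lemma arc_length: "\<alpha> (Suc a) - \<alpha> a < 2 * pi"
  using angle_less[of "Suc a" "a + m"] angle_period[of a] m3 by simp

lemma sgn_arc_cis: "a < m \<Longrightarrow> sgn_arc a (cis t) = 4 * sin ((\<alpha> (Suc a) - \<alpha> a) / 2) * sin ((t - \<alpha> a) / 2) * sin ((\<alpha> (Suc a) - t) / 2)"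
  unfolding sgn_arc_def sform_def by (simp only: vertex_nxt vertex_eq[of a] side_form_cis)

lemma sin_half_arc: "sin ((\<alpha> (Suc a) - \<alpha> a) / 2) > 0"
  using arc_length[of a] angle_step[of a] by (intro sin_gt_zero) auto

lemma sin_half_nonneg: "0 \<le> x \<Longrightarrow> x \<le> 2 * pi \<Longrightarrow> sin (x / 2) \<ge> 0"
  by (intro sin_ge_zero) auto
lemma sin_half_nonpos: "x \<le> 0 \<Longrightarrow> - 2 * pi \<le> x \<Longrightarrow> sin (x / 2) \<le> 0"
  using sin_half_nonneg[of "- x"] by simp

lemma circle_angle:
  assumes "norm z = 1"
  obtains j t where "j < m" "z = cis t" "\<alpha> j \<le> t" "t < \<alpha> (Suc j)"
proof -
  define t where "t = \<alpha> 0 + Arg2pi (z / cis (\<alpha> 0))"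
  have nz: "norm (z / cis (\<alpha> 0)) = 1" using assms by (simp add: norm_divide)
  have "z / cis (\<alpha> 0) = cis (Arg2pi (z / cis (\<alpha> 0)))"
    using Arg2pi_eq[of "z / cis (\<alpha> 0)"] nz by (simp add: cis_conv_exp)
  hence z: "z = cis t" unfolding t_def cis_mult[symmetric] by (metis cis_neq_zero nonzero_divide_eq_eq mult.commute)
  have t: "\<alpha> 0 \<le> t" "t < \<alpha> m" using Arg2pi_ge_0 Arg2pi_lt_2pi angle_period[of 0] by (auto simp: t_def)
  define k where "k = (LEAST j. t < \<alpha> j)"
  have k: "t < \<alpha> k" "k \<le> m" unfolding k_def using t(2) by (auto intro: LeastI Least_le)
  have "k \<noteq> 0" using k t(1) by (metis not_less)
  then obtain j where j: "k = Suc j" using not0_implies_Suc by blast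
  have "\<not> t < \<alpha> j" using not_less_Least[of j "\<lambda>j. t < \<alpha> j"] j k_def by simp
  thus ?thesis using that[of j t] j k z by simp
qed

lemma sgn_arc_pos:
  assumes "a < m" "\<alpha> a < t" "t < \<alpha> (Suc a)"
  shows "sgn_arc a (cis t) > 0"
  unfolding sgn_arc_cis[OF assms(1)]
  using sin_half_arc[of a] arc_length[of a] assms
  by (intro mult_pos_pos sin_gt_zero) auto

lemma sgn_arc_other:
  assumes "j < m" "b < m" "b \<noteq> j" "\<alpha> j \<le> t" "t \<le> \<alpha> (Suc j)"
  shows "sgn_arc b (cis t) \<le> 0"
proof -
  have le: "\<alpha> 0 \<le> \<alpha> j" "\<alpha> (Suc j) \<le> \<alpha> 0 + 2 * pi" "\<alpha> 0 \<le> \<alpha> b" "\<alpha> (Suc b) \<le> \<alpha> 0 + 2 * pi" 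
    using angle_le[of "Suc j" m] angle_le[of "Suc b" m] angle_period[of 0] assms angle_le[of 0] by auto
  have "sin ((t - \<alpha> b) / 2) * sin ((\<alpha> (Suc b) - t) / 2) \<le> 0"
  proof (cases "j < b")
    case True
    hence "\<alpha> (Suc j) \<le> \<alpha> b" by (intro angle_le) simp
    thus ?thesis using le assms angle_step[of b] by (intro mult_nonpos_nonneg sin_half_nonpos sin_half_nonneg) linarith+
  next
    case False
    hence "\<alpha> (Suc b) \<le> \<alpha> j" using assms(3) by (intro angle_le) simp
    thus ?thesis using le assms angle_step[of b] by (intro mult_nonneg_nonpos sin_half_nonpos sin_half_nonneg) linarith+
  qed
  thus ?thesis unfolding sgn_arc_cis[OF assms(2)] using sin_half_arc[of b]
    by (simp add: mult.assoc mult_nonneg_nonpos)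
qed

lemma sgn_arc_eq_0_iff:
  assumes "a < m" "norm z = 1"
  shows "sgn_arc a z = 0 \<longleftrightarrow> z = \<theta> a \<or> z = \<theta> (nxt a)"
  unfolding sgn_arc_def sform_def by (rule side_form_eq_0_iff) (use assms side_ends in auto)

lemma sgn_arc_vertex: 
  assumes "a < m" "b < m" shows "sgn_arc b (\<theta> a) \<le> 0"
proof (cases "b = a")
  case True thus ?thesis using sgn_arc_eq_0_iff[OF assms(2) norm_vertex[OF assms(1)]] by simp
next
  case False thus ?thesis using sgn_arc_other[OF assms False order_refl] angle_step[of a] vertex_eq assms by simp
qed

lemma sgn_arc_disjoint_weak:
  assumes "a < m" "b < m" "a \<noteq> b" "norm z = 1" "sgn_arc a z \<ge> 0"
  shows "sgn_arc b z \<le> 0"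
proof -
  obtain j t where j: "j < m" "z = cis t" "\<alpha> j \<le> t" "t < \<alpha> (Suc j)" using circle_angle[OF assms(4)] by blast
  show ?thesis
  proof (cases "b = j")
    case False thus ?thesis using sgn_arc_other[OF j(1) assms(2)] j by simp
  next
    case True
    hence "sgn_arc a z \<le> 0" using sgn_arc_other[OF j(1) assms(1)] assms(3) j by simp
    hence "sgn_arc a z = 0" using assms(5) by simp
    hence "z = \<theta> a \<or> z = \<theta> (nxt a)" using sgn_arc_eq_0_iff assms by blast
    thus ?thesis using sgn_arc_vertex assms nxt_less by metis
  qed
qed

lemma sgn_arc_pos_not_vertex:
  assumes "a < m" "sgn_arc a z > 0" shows "z \<notin> verts"
  using sgn_arc_vertex assms by (auto simp: not_le[symmetric])

lemma sgn_arc_nonzero: 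
  assumes "a < m" "norm z = 1" "z \<notin> verts" shows "sgn_arc a z \<noteq> 0"
  using sgn_arc_eq_0_iff[OF assms(1,2)] assms nxt_less by blast

lemma sgn_arc_disjoint:
  assumes "a < m" "b < m" "a \<noteq> b" "norm z = 1" "sgn_arc a z > 0"
  shows "sgn_arc b z < 0"
  using sgn_arc_disjoint_weak[OF assms(1-4)] sgn_arc_nonzero[OF assms(2,4)] sgn_arc_pos_not_vertex[OF assms(1,5)] assms(5) by linarith

lemma part_arc_iff:
  assumes "a < m"
  shows "z \<in> part_arc m \<theta> a \<longleftrightarrow> (\<exists>t. z = cis t \<and> \<alpha> a \<le> t \<and> t < \<alpha> (Suc a))"
proof -
  have len: "Arg2pi (\<theta> (nxt a) / \<theta> a) = \<alpha> (Suc a) - \<alpha> a"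
    unfolding vertex_eq[OF assms] vertex_nxt[OF assms] cis_divide using arc_length[of a] angle_step[of a] by (intro Arg2pi_cis_eq) auto
  show ?thesis
  proof
    assume "z \<in> part_arc m \<theta> a"
    hence z: "norm z = 1" "Arg2pi (z / \<theta> a) < \<alpha> (Suc a) - \<alpha> a" by (auto simp: part_arc_def arc_co_def len)
    have "norm (z / cis (\<alpha> a)) = 1" using z by (simp add: norm_divide)
    hence "z / cis (\<alpha> a) = cis (Arg2pi (z / cis (\<alpha> a)))" using Arg2pi_eq[of "z / cis (\<alpha> a)"] by (simp add: cis_conv_exp)
    hence "z = cis (\<alpha> a + Arg2pi (z / cis (\<alpha> a)))" unfolding cis_mult[symmetric] by (metis cis_neq_zero nonzero_divide_eq_eq mult.commute)
    thus "\<exists>t. z = cis t \<and> \<alpha> a \<le> t \<and> t < \<alpha> (Suc a)"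
      using z(2) Arg2pi_ge_0[of "z / cis (\<alpha> a)"] vertex_eq[OF assms] by (intro exI[of _ "\<alpha> a + Arg2pi (z / cis (\<alpha> a))"]) auto
  next
    assume "\<exists>t. z = cis t \<and> \<alpha> a \<le> t \<and> t < \<alpha> (Suc a)"
    then obtain t where t: "z = cis t" "\<alpha> a \<le> t" "t < \<alpha> (Suc a)" by blast
    hence "Arg2pi (z / \<theta> a) = t - \<alpha> a" unfolding vertex_eq[OF assms] t(1) cis_divide using arc_length[of a] by (intro Arg2pi_cis_eq) auto
    thus "z \<in> part_arc m \<theta> a" using t by (simp add: part_arc_def arc_co_def len)
  qed
qed

lemma sgn_arc_part_arc:
  assumes "a < m" "z \<in> part_arc m \<theta> a"
  shows "norm z = 1" "sgn_arc a z \<ge> 0" "z \<notin> verts \<Longrightarrow> sgn_arc a z > 0"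
proof -
  obtain t where t: "z = cis t" "\<alpha> a \<le> t" "t < \<alpha> (Suc a)" using assms part_arc_iff by blast
  show n: "norm z = 1" using t by simp
  show "sgn_arc a z \<ge> 0"
  proof (cases "t = \<alpha> a")
    case True thus ?thesis using t sgn_arc_eq_0_iff[OF assms(1) n] vertex_eq[OF assms(1)] by simp
  next
    case False thus ?thesis using sgn_arc_pos[OF assms(1)] t by (simp add: less_imp_le)
  qed
  thus "z \<notin> verts \<Longrightarrow> sgn_arc a z > 0" using sgn_arc_nonzero[OF assms(1) n] by simp
qed

lemma part_arc_disjoint:
  assumes "a < m" "b < m" "z \<in> part_arc m \<theta> a" "z \<in> part_arc m \<theta> b"
  shows "a = b"
proof (rule ccontr)
  assume ab: "a \<noteq> b"
  obtain t where t: "z = cis t" "\<alpha> a \<le> t" "t < \<alpha> (Suc a)" using assms part_arc_iff by blast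
  obtain u where u: "z = cis u" "\<alpha> b \<le> u" "u < \<alpha> (Suc b)" using assms part_arc_iff by blast
  have le: "\<alpha> 0 \<le> \<alpha> a" "\<alpha> (Suc a) \<le> \<alpha> 0 + 2 * pi" "\<alpha> 0 \<le> \<alpha> b" "\<alpha> (Suc b) \<le> \<alpha> 0 + 2 * pi" 
    using angle_le[of "Suc a" m] angle_le[of "Suc b" m] angle_period[of 0] assms angle_le[of 0] by auto
  hence "t = u" using cis_inj_window[of t u] t u by simp
  moreover have "\<alpha> (Suc a) \<le> \<alpha> b \<or> \<alpha> (Suc b) \<le> \<alpha> a" using ab angle_le[of "Suc a" b] angle_le[of "Suc b" a] by linarith
  ultimately show False using t u by linarith
qed

lemma arc_index_eqI: "a < m \<Longrightarrow> z \<in> part_arc m \<theta> a \<Longrightarrow> arc_index z = a"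
  unfolding arc_index_def using part_arc_disjoint by (intro the_equality) auto

lemma arc_index_props:
  assumes "norm z = 1"
  shows "arc_index z < m" "z \<in> part_arc m \<theta> (arc_index z)"
proof -
  obtain j t where "j < m" "z = cis t" "\<alpha> j \<le> t" "t < \<alpha> (Suc j)" using circle_angle[OF assms] by blast
  hence "j < m" "z \<in> part_arc m \<theta> j" using part_arc_iff by auto
  thus "arc_index z < m" "z \<in> part_arc m \<theta> (arc_index z)" using arc_index_eqI by auto
qed

lemma sgn_arc_index: "norm z = 1 \<Longrightarrow> z \<notin> verts \<Longrightarrow> sgn_arc (arc_index z) z > 0"
  using arc_index_props sgn_arc_part_arc by blast

lemma arc_index_unique:
  assumes "a < m" "norm z = 1" "sgn_arc a z > 0" shows "arc_index z = a"
  using sgn_arc_disjoint[OF assms(1) _ _ assms(2,3)] arc_index_props[OF assms(2)] sgn_arc_part_arc(2) by (metis not_le)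

lemma B_map_eq: "B_map m \<theta> z = crefl (arc_index z) z"
  by (simp add: B_map_def arc_index_def crefl_def Let_def)

lemma sform_geo:
  assumes "norm s = 1" "norm t = 1" "s \<noteq> t"
  shows "sform a (lift (geo s t u)) = (exp u * sgn_arc a s + exp (- u) * sgn_arc a t) / norm (s - t)"
  unfolding lift_geo[OF assms] sform_def sgn_arc_def
  by (simp add: linear_scale[OF linear_side_form] linear_add[OF linear_side_form])

lemma side_eq:
  assumes "a < m"
  shows "side m \<theta> a = {z \<in> pdisk. sform a (lift z) = 0}"
proof -
  let ?x = "\<theta> a" let ?y = "\<theta> (nxt a)"
  note e = norm_vertex[OF assms] norm_vertex_nxt vertex_neq[OF assms]
  have x0: "sgn_arc a ?x = 0" "sgn_arc a ?y = 0" using sgn_arc_eq_0_iff[OF assms] e by auto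
  have "range (geo ?y ?x) = {z \<in> pdisk. sform a (lift z) = 0}"
  proof (intro equalityI subsetI)
    fix z assume "z \<in> range (geo ?y ?x)"
    then obtain u where z: "z = geo ?y ?x u" by blast
    show "z \<in> {z \<in> pdisk. sform a (lift z) = 0}"
      using geo_in_disk[OF e(2,1) e(3)[symmetric]] sform_geo[OF e(2,1) e(3)[symmetric], of a u] x0 z by simp
  next
    fix z assume z: "z \<in> {z \<in> pdisk. sform a (lift z) = 0}"
    obtain s u where s: "norm s = 1" "s \<noteq> ?x" "z = geo s ?x u" using disk_point_on_geo[of z ?x] z e by blast
    have "sgn_arc a s = 0" using z sform_geo[OF s(1) e(1) s(2), of a u] s x0 by simp
    hence "s = ?y" using sgn_arc_eq_0_iff[OF assms s(1)] s(2) by simp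
    thus "z \<in> range (geo ?y ?x)" using s by blast
  qed
  thus ?thesis unfolding side_def geodesic_line_eq[OF e] .
qed

text \<open>With \<open>z\<close> on the geodesic from \<open>\<theta> a\<close> to
  \<open>s\<close>, the form of side \<open>a\<close> sees only \<open>s\<close>, and disjointness
  of the arcs at infinity carries over. Strictness could fail only if both ends of this geodesic
  were ends of side \<open>b\<close>, which would make \<open>a\<close> and \<open>b\<close>
  successors of each other, impossible for three or more sides.\<close>

lemma outer_disjoint:
  assumes z: "z \<in> pdisk" and ab: "a < m" "b < m" "a \<noteq> b" and sa: "sform a (lift z) \<ge> 0"
  shows "sform b (lift z) < 0"
proof -
  let ?x = "\<theta> a"
  have nx: "norm ?x = 1" by (rule norm_vertex[OF ab(1)])
  obtain s u where s: "norm s = 1" "s \<noteq> ?x" "z = geo s ?x u" using disk_point_on_geo[OF z nx] by blast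
  note f = sform_geo[OF s(1) nx s(2)]
  have pos: "norm (s - ?x) > 0" using s(2) by simp
  have "sgn_arc a ?x = 0" using sgn_arc_eq_0_iff[OF ab(1) nx] by simp
  hence sa0: "sgn_arc a s \<ge> 0" using sa pos unfolding s(3) f by (simp add: zero_le_mult_iff zero_le_divide_iff)
  have bs: "sgn_arc b s \<le> 0" by (rule sgn_arc_disjoint_weak[OF ab s(1) sa0])
  have bx: "sgn_arc b ?x \<le> 0" by (rule sgn_arc_vertex[OF ab(1,2)])
  have nz: "sgn_arc b s \<noteq> 0 \<or> sgn_arc b ?x \<noteq> 0"
  proof (rule ccontr)
    assume "\<not> ?thesis"
    hence 0: "s = \<theta> b \<or> s = \<theta> (nxt b)" "?x = \<theta> b \<or> ?x = \<theta> (nxt b)"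
      using sgn_arc_eq_0_iff[OF ab(2) s(1)] sgn_arc_eq_0_iff[OF ab(2) nx] by auto
    have "?x \<noteq> \<theta> b" using vertex_inj ab by blast
    hence xb: "?x = \<theta> (nxt b)" "s = \<theta> b" using 0 s(2) by auto
    hence "sgn_arc a (\<theta> b) = 0" using sa0 sgn_arc_vertex[OF ab(2,1)] by simp
    hence "\<theta> b = ?x \<or> \<theta> b = \<theta> (nxt a)" using sgn_arc_eq_0_iff[OF ab(1) norm_vertex[OF ab(2)]] by blast
    hence "b = nxt a" "a = nxt b" using xb vertex_inj ab nxt_less by metis+
    hence "Suc (Suc a) mod m = a" by (metis mod_Suc_eq)
    thus False using ab m3 by (cases "Suc (Suc a) < m") (auto simp: mod_if split: if_splits)
  qed
  have "exp u * sgn_arc b s + exp (- u) * sgn_arc b ?x < 0"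
  proof (cases "sgn_arc b s = 0")
    case True
    hence "sgn_arc b ?x < 0" using nz bx by simp
    thus ?thesis using True by (simp add: mult_pos_neg)
  next
    case False
    hence "exp u * sgn_arc b s < 0" using bs by (simp add: mult_pos_neg)
    moreover have "exp (- u) * sgn_arc b ?x \<le> 0" using bx by (simp add: mult_nonneg_nonpos)
    ultimately show ?thesis by linarith
  qed
  thus ?thesis unfolding s(3) f using pos by (simp add: divide_neg_pos)
qed

definition table :: "complex set" where "table = {z \<in> pdisk. \<forall>a<m. sform a (lift z) \<le> 0}"

lemma hyp_convex_table: "hyp_convex table"
  unfolding hyp_convex_def
proof (intro conjI ballI subsetI)
  fix z w p assume z: "z \<in> table" and w: "w \<in> table" and p: "p \<in> hyp_segment z w"
  have d: "z \<in> pdisk" "w \<in> pdisk" "p \<in> pdisk" "hyp_dist z p + hyp_dist p w = hyp_dist z w"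
    using z w p by (auto simp: table_def hyp_segment_def)
  define r q where "r = hyp_dist z p" "q = hyp_dist p w"
  have rq: "r \<ge> 0" "q \<ge> 0" using hyp_dist_nonneg d by (auto simp: r_q_def)
  show "p \<in> table"
  proof (cases "r + q > 0")
    case True
    have lp: "lift p = (1 / sinh (r + q)) *\<^sub>R (sinh q *\<^sub>R lift z + sinh r *\<^sub>R lift w)"
      by (rule lift_between[OF d(1,3,2)]) (use True d in \<open>auto simp: r_q_def\<close>)
    have "sform a (lift p) \<le> 0" if "a < m" for a
    proof -
      have "sform a (lift p) = (1 / sinh (r + q)) * (sinh q * sform a (lift z) + sinh r * sform a (lift w))"
        unfolding lp sform_def by (simp add: linear_scale[OF linear_side_form] linear_add[OF linear_side_form])
      moreover have "sinh q * sform a (lift z) \<le> 0" "sinh r * sform a (lift w) \<le> 0"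
        using rq z w that by (auto simp: table_def intro!: mult_nonneg_nonpos)
      ultimately show ?thesis using True by (simp add: divide_nonpos_pos)
    qed
    thus ?thesis using d by (simp add: table_def)
  next
    case False
    hence "r = 0" using rq by linarith
    hence "mink (lift z) (lift p) = 1" using cosh_hyp_dist[OF d(1,3)] by (simp add: r_q_def)
    hence "lift z = lift p" using mink_eq_one mink_lift_self d by blast
    hence "z = p" using lift_inj d by blast
    thus ?thesis using z by simp
  qed
qed (auto simp: table_def)

lemma side_subset_table: "a < m \<Longrightarrow> side m \<theta> a \<subseteq> table"
  unfolding table_def using side_eq outer_disjoint by (smt (verit) mem_Collect_eq subsetI)

lemma crossing_param:
  assumes "p > 0" "q < (0::real)"
  obtains v where "exp v * p + exp (- v) * q = 0" "\<And>u. exp u * p + exp (- u) * q \<le> 0 \<longleftrightarrow> u \<le> v" 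
    "\<And>u. exp u * p + exp (- u) * q = 0 \<longleftrightarrow> u = v"
proof -
  define v where "v = ln (- q / p) / 2"
  have "- q / p > 0" using assms by (intro divide_pos_pos) auto
  hence e: "exp (2 * v) = - q / p" by (simp add: v_def)
  have *: "exp u * p + exp (- u) * q = exp (- u) * p * (exp (2 * u) - exp (2 * v))" for u
  proof -
    have "exp (- u) * exp (2 * u) = exp u" by (simp flip: exp_add)
    thus ?thesis unfolding e using assms by (simp add: field_simps)
  qed
  show ?thesis using that[of v] assms unfolding * by (simp add: mult_le_0_iff)
qed

text \<open>Converts the convex hull into an intersection of half-planes. For the harder inclusion,
  a chord through \<open>z\<close> without vertices as ends leaves the table through two sides, and
  \<open>z\<close> lies between the two exit points.\<close>

lemma billiard_table_eq: "billiard_table m \<theta> = table"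
proof
  show "billiard_table m \<theta> \<subseteq> table"
    unfolding billiard_table_def using side_subset_table by (intro hull_minimal hyp_convex_table) auto
  show "table \<subseteq> billiard_table m \<theta>"
    unfolding billiard_table_def hull_def
  proof (intro subsetI InterI)
    fix z K assume z: "z \<in> table" and "K \<in> {t. hyp_convex t \<and> (\<Union>a<m. side m \<theta> a) \<subseteq> t}"
    hence K: "hyp_convex K" "\<And>a. a < m \<Longrightarrow> side m \<theta> a \<subseteq> K" by auto
    have zd: "z \<in> pdisk" using z by (simp add: table_def)
    have "\<exists>s. norm s = 1 \<and> s \<noteq> v \<and> (\<exists>u. z = geo s v u)" if "v \<in> verts" for v
      using disk_point_on_geo[OF zd] that norm_vertex by blast
    then obtain opp where opp: "\<And>v. v \<in> verts \<Longrightarrow> norm (opp v) = 1 \<and> opp v \<noteq> v \<and> (\<exists>u. z = geo (opp v) v u)" by metis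
    \<comment> \<open>Besides the vertices, \<open>t\<close> has to avoid the finitely many points
      opposite to a vertex as seen through \<open>z\<close>; then the other end \<open>s\<close> is
      not a vertex either.\<close>
    have "\<not> {z::complex. norm z = 1} \<subseteq> verts \<union> opp ` verts"
      using infinite_unit_circle finite_subset[of "{z::complex. norm z = 1}" "verts \<union> opp ` verts"] by auto
    then obtain t where t: "norm t = 1" "t \<notin> verts" "t \<notin> opp ` verts" by auto
    obtain s u where s: "norm s = 1" "s \<noteq> t" "z = geo s t u" using disk_point_on_geo[OF zd t(1)] by blast
    have sV: "s \<notin> verts"
    proof
      assume sV: "s \<in> verts"
      obtain v where v: "z = geo (opp s) s v" "norm (opp s) = 1" "opp s \<noteq> s" using opp[OF sV] by blast
      have "geo t s (- u) = geo (opp s) s v" using s v geo_swap[OF s(1) t(1) s(2)] by simp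
      hence "t = opp s" using geo_endpoint_unique[OF t(1) v(2) s(1)] s(2) v(3) by metis
      thus False using t(3) sV by blast
    qed
    define a b where "a = arc_index s" "b = arc_index t"
    have ab: "a < m" "b < m" "sgn_arc a s > 0" "sgn_arc b t > 0"
      using arc_index_props s(1) t(1) sgn_arc_index sV t(2) by (auto simp: a_b_def)
    have n: "norm (s - t) > 0" using s(2) by simp
    have zt: "exp u * sgn_arc c s + exp (- u) * sgn_arc c t \<le> 0" if "c < m" for c
    proof -
      have "(exp u * sgn_arc c s + exp (- u) * sgn_arc c t) / norm (s - t) \<le> 0"
        using z that unfolding table_def s(3) mem_Collect_eq sform_geo[OF s(1) t(1) s(2)] by blast
      thus ?thesis using n by (simp add: divide_le_0_iff)
    qed
    have "a \<noteq> b" using zt[OF ab(1)] ab(3,4) by (smt (verit) exp_gt_zero mult_pos_pos)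
    hence neg: "sgn_arc a t < 0" "sgn_arc b s < 0" using sgn_arc_disjoint ab s t by metis+
    obtain v where v: "exp v * sgn_arc a s + exp (- v) * sgn_arc a t = 0" "u \<le> v"
      using crossing_param[OF ab(3) neg(1)] zt[OF ab(1)] by metis
    obtain w where w: "exp w * sgn_arc b t + exp (- w) * sgn_arc b s = 0" "- u \<le> w"
      using crossing_param[OF ab(4) neg(2)] zt[OF ab(2)] by (metis add.commute minus_minus)
    have inS: "geo s t p \<in> K" if "c < m" "exp p * sgn_arc c s + exp (- p) * sgn_arc c t = 0" for c p
      using K(2)[OF that(1)] unfolding side_eq[OF that(1)]
      using geo_in_disk[OF s(1) t(1) s(2), of p] sform_geo[OF s(1) t(1) s(2), of c p] that(2) by auto
    have "geo s t v \<in> K" "geo s t (- w) \<in> K" using inS[OF ab(1) v(1)] inS[OF ab(2), of "- w"] w(1) by (auto simp: add.commute)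
    moreover have "z \<in> hyp_segment (geo s t (- w)) (geo s t v)"
      unfolding hyp_segment_def s(3) using geo_in_disk[OF s(1) t(1) s(2)] hyp_dist_geo[OF s(1) t(1) s(2)] v(2) w(2) by simp
    ultimately show "z \<in> K" using K(1) unfolding hyp_convex_def by blast
  qed
qed

section \<open>Words in the reflections and the fundamental domain\<close>

definition refl_word :: "nat list \<Rightarrow> complex \<Rightarrow> complex" where "refl_word w z = foldr drefl w z"

lemma refl_word_Nil [simp]: "refl_word [] z = z" and refl_word_Cons [simp]: "refl_word (a # w) z = drefl a (refl_word w z)"
  and refl_word_append: "refl_word (v @ w) z = refl_word v (refl_word w z)"
  by (simp_all add: refl_word_def)

lemma Gamma_B_iff: "g \<in> Gamma_B m \<theta> \<longleftrightarrow> (\<exists>w. set w \<subseteq> {..<m} \<and> g = refl_word w)"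
proof
  assume "g \<in> Gamma_B m \<theta>"
  thus "\<exists>w. set w \<subseteq> {..<m} \<and> g = refl_word w"
  proof induction
    case Gamma_B_id
    show ?case by (intro exI[of _ "[]"]) (auto simp: fun_eq_iff)
  next
    case (Gamma_B_comp a g)
    then obtain w where "set w \<subseteq> {..<m}" "g = refl_word w" by blast
    thus ?case using Gamma_B_comp(1) by (intro exI[of _ "a # w"]) (auto simp: fun_eq_iff drefl_def)
  qed
next
  have "set w \<subseteq> {..<m} \<Longrightarrow> refl_word w \<in> Gamma_B m \<theta>" for w
  proof (induction w)
    case Nil
    have "refl_word [] = id" by auto
    thus ?case using Gamma_B.Gamma_B_id by metis
  next
    case (Cons a w)
    have "drefl a \<circ> refl_word w \<in> Gamma_B m \<theta>" unfolding drefl_def by (rule Gamma_B.Gamma_B_comp) (use Cons in auto)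
    moreover have "refl_word (a # w) = drefl a \<circ> refl_word w" by auto
    ultimately show ?case by metis
  qed
  thus "\<exists>w. set w \<subseteq> {..<m} \<and> g = refl_word w \<Longrightarrow> g \<in> Gamma_B m \<theta>" by blast
qed

lemma orbit_iff: "(\<exists>g\<in>Gamma_B m \<theta>. x = g z) \<longleftrightarrow> (\<exists>w. set w \<subseteq> {..<m} \<and> x = refl_word w z)"
  unfolding Bex_def Gamma_B_iff by blast

lemma drefl_in_disk: "a < m \<Longrightarrow> z \<in> pdisk \<Longrightarrow> drefl a z \<in> pdisk"
  unfolding drefl_def by (rule lift_disk_reflection(1)[OF side_ends(1,2,3)])

lemma sform_drefl: "a < m \<Longrightarrow> z \<in> pdisk \<Longrightarrow> sform a (lift (drefl a z)) = - sform a (lift z)"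
  unfolding drefl_def sform_def
  by (subst lift_disk_reflection(2)[OF side_ends(1,2,3)]) (simp_all add: side_form_lorentz_refl side_ends)

lemma norm_crefl: "a < m \<Longrightarrow> norm z = 1 \<Longrightarrow> norm (crefl a z) = 1"
  unfolding crefl_def by (rule norm_circle_reflection[OF side_ends(1,2,3)])
lemma crefl_invol: "a < m \<Longrightarrow> norm z = 1 \<Longrightarrow> crefl a (crefl a z) = z"
  unfolding crefl_def by (rule circle_reflection_invol[OF side_ends(1,2,3)])
lemma crefl_inj: "a < m \<Longrightarrow> norm z = 1 \<Longrightarrow> norm w = 1 \<Longrightarrow> crefl a z = crefl a w \<Longrightarrow> z = w"
  using crefl_invol by metis
lemma kap_pos: "a < m \<Longrightarrow> norm z = 1 \<Longrightarrow> kap a z > 0"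
  unfolding kap_def by (rule kappa_pos[OF side_ends(1,2,3)])
lemma kap_crefl: "a < m \<Longrightarrow> norm z = 1 \<Longrightarrow> kap a (crefl a z) = 1 / kap a z"
  unfolding kap_def crefl_def by (rule kappa_circle_reflection[OF side_ends(1,2,3)])
lemma dist_crefl: "a < m \<Longrightarrow> norm z = 1 \<Longrightarrow> norm w = 1 \<Longrightarrow> norm (crefl a z - crefl a w) = norm (z - w) / (kap a z * kap a w)"
  unfolding kap_def crefl_def by (rule dist_circle_reflection[OF side_ends(1,2,3)])
lemma crefl_vertex: "a < m \<Longrightarrow> crefl a (\<theta> a) = \<theta> a" "a < m \<Longrightarrow> crefl a (\<theta> (nxt a)) = \<theta> (nxt a)"
  unfolding crefl_def by (simp_all add: vertex_neq circle_reflection_left circle_reflection_right)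
lemma kap_vertex: "a < m \<Longrightarrow> kap a (\<theta> a) = 1" "a < m \<Longrightarrow> kap a (\<theta> (nxt a)) = 1"
  unfolding kap_def by (simp_all add: vertex_neq kappa_left kappa_right)

lemma sgn_arc_crefl:
  assumes "a < m" "norm z = 1"
  shows "sgn_arc a (crefl a z) > 0 \<longleftrightarrow> sgn_arc a z < 0" "sgn_arc a (crefl a z) < 0 \<longleftrightarrow> sgn_arc a z > 0"
proof -
  have "(kap a z)\<^sup>2 * sgn_arc a (crefl a z) = - sgn_arc a z"
    unfolding kap_def crefl_def sgn_arc_def sform_def by (rule side_form_circle_reflection) (use assms side_ends in auto)
  moreover have "(kap a z)\<^sup>2 > 0" using kap_pos[OF assms] by simp
  ultimately show "sgn_arc a (crefl a z) > 0 \<longleftrightarrow> sgn_arc a z < 0" "sgn_arc a (crefl a z) < 0 \<longleftrightarrow> sgn_arc a z > 0"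
    by (smt (verit) zero_less_mult_iff mult_less_0_iff)+
qed

lemma drefl_geo:
  assumes "a < m" "norm s = 1" "norm t = 1" "s \<noteq> t"
  shows "drefl a (geo s t u) = geo (crefl a s) (crefl a t) (u + ln (kap a s) - ln (kap a t))"
  unfolding drefl_def crefl_def kap_def by (rule disk_reflection_geo) (use assms side_ends in auto)

lemma drefl_invol:
  assumes "a < m" "z \<in> pdisk" shows "drefl a (drefl a z) = z"
proof -
  obtain s u where s: "norm s = 1" "s \<noteq> 1" "z = geo s 1 u" using disk_point_on_geo[OF assms(2), of 1] by auto
  have ne: "crefl a s \<noteq> crefl a 1" using crefl_inj[OF assms(1) s(1), of 1] s(2) by auto
  have p: "kap a s > 0" "kap a 1 > 0" using kap_pos[OF assms(1)] s by auto
  show ?thesis unfolding s(3)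
    using p by (simp add: drefl_geo assms s ne norm_crefl crefl_invol kap_crefl ln_div)
qed

lemma drefl_fixes_side:
  assumes "a < m" "z \<in> pdisk" "sform a (lift z) = 0" shows "drefl a z = z"
proof -
  have "z \<in> side m \<theta> a" using side_eq assms by blast
  then obtain u where z: "z = geo (\<theta> (nxt a)) (\<theta> a) u"
    unfolding side_def using geodesic_line_eq[OF side_ends(1,2,3)] assms(1) by blast
  show ?thesis unfolding z using assms(1) vertex_neq[OF assms(1), symmetric]
    by (simp add: drefl_geo crefl_vertex kap_vertex side_ends)
qed

lemma refl_word_in_disk: "set w \<subseteq> {..<m} \<Longrightarrow> z \<in> pdisk \<Longrightarrow> refl_word w z \<in> pdisk"
  by (induction w) (simp_all del: mem_ball mem_ball_0 add: drefl_in_disk)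

lemma refl_word_rev: "set w \<subseteq> {..<m} \<Longrightarrow> z \<in> pdisk \<Longrightarrow> refl_word (rev w) (refl_word w z) = z"
proof (induction w)
  case (Cons a w)
  thus ?case using drefl_invol[of a "refl_word w z"] refl_word_in_disk[of w z] by (simp add: refl_word_append del: mem_ball)
qed simp

lemma reduce_word:
  "set w \<subseteq> {..<m} \<Longrightarrow> \<exists>v. set v \<subseteq> {..<m} \<and> distinct_adj v \<and> (\<forall>z\<in>pdisk. refl_word v z = refl_word w z)"
proof (induction w)
  case Nil thus ?case by (intro exI[of _ "[]"]) simp
next
  case (Cons a w)
  then obtain v where v: "set v \<subseteq> {..<m}" "distinct_adj v" "\<And>z. z \<in> pdisk \<Longrightarrow> refl_word v z = refl_word w z" by auto
  have a: "a < m" using Cons.prems by simp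
  show ?case
  proof (cases "v \<noteq> [] \<and> hd v = a")
    case True
    then obtain u where u: "v = a # u" by (cases v) auto
    have "refl_word u z = drefl a (refl_word w z)" if "z \<in> pdisk" for z
    proof -
      have "refl_word u z \<in> pdisk" using refl_word_in_disk[of u z] v(1) u that by simp
      thus ?thesis using v(3)[OF that, symmetric] drefl_invol[OF a] by (simp add: u del: mem_ball)
    qed
    thus ?thesis using v u by (intro exI[of _ u]) (auto simp: distinct_adj_Cons split: list.splits)
  next
    case False
    thus ?thesis using v a by (intro exI[of _ "a # v"]) (auto simp: distinct_adj_Cons split: list.splits)
  qed
qed

text \<open>Ping-pong: a point beyond one side is strictly inside every other side, so the next
  letter throws it strictly beyond its own side. The value zero can occur only for one-letter words,
  which fix the points of their side.\<close>

lemma reduced_word_outside: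
  assumes "z \<in> table"
  shows "set (a # w) \<subseteq> {..<m} \<Longrightarrow> distinct_adj (a # w) \<Longrightarrow>
    sform a (lift (refl_word (a # w) z)) \<ge> 0 \<and> (sform a (lift (refl_word (a # w) z)) = 0 \<longrightarrow> refl_word (a # w) z = z)"
proof (induction w arbitrary: a)
  case Nil
  hence "a < m" "z \<in> pdisk" "sform a (lift z) \<le> 0" using assms by (auto simp: table_def)
  thus ?case using sform_drefl drefl_fixes_side by simp
next
  case (Cons b w)
  hence ab: "a < m" "b < m" "b \<noteq> a" by auto
  have v: "refl_word (b # w) z \<in> pdisk" using assms Cons.prems by (intro refl_word_in_disk) (auto simp: table_def)
  have "sform b (lift (refl_word (b # w) z)) \<ge> 0" using Cons by auto
  hence "sform a (lift (refl_word (b # w) z)) < 0" by (rule outer_disjoint[OF v ab(2,1,3)])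
  hence "sform a (lift (drefl a (refl_word (b # w) z))) > 0" using sform_drefl[OF ab(1) v] by simp
  thus ?case by simp
qed

text \<open>The closed table is a strict fundamental domain, boundary included; this is what gives
  the definite description in \<open>table_proj\<close> its meaning.\<close>

lemma refl_word_table:
  assumes "z \<in> table" "set w \<subseteq> {..<m}" "refl_word w z \<in> table"
  shows "refl_word w z = z"
proof -
  have zd: "z \<in> pdisk" using assms by (simp add: table_def)
  obtain v where v: "set v \<subseteq> {..<m}" "distinct_adj v" "refl_word v z = refl_word w z"
    using reduce_word[OF assms(2)] zd by blast
  show ?thesis
  proof (cases v)
    case Nil thus ?thesis using v by simp
  next
    case (Cons a u)
    thus ?thesis using reduced_word_outside[OF assms(1), of a u] v assms(3) by (auto simp: table_def)
  qed
qed

lemma table_proj_eqI: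
  assumes "z \<in> pdisk" "set w \<subseteq> {..<m}" "refl_word w z \<in> table"
  shows "table_proj m \<theta> z = refl_word w z"
  unfolding table_proj_def billiard_table_eq
proof (rule the_equality)
  show "refl_word w z \<in> table \<and> (\<exists>g\<in>Gamma_B m \<theta>. refl_word w z = g z)" using assms unfolding orbit_iff by blast
next
  fix x assume "x \<in> table \<and> (\<exists>g\<in>Gamma_B m \<theta>. x = g z)"
  then obtain v where v: "x \<in> table" "set v \<subseteq> {..<m}" "x = refl_word v z" unfolding orbit_iff by blast
  have "refl_word (v @ rev w) (refl_word w z) = x" using refl_word_rev[OF assms(2,1)] v by (simp add: refl_word_append)
  thus "x = refl_word w z" using refl_word_table[OF assms(3), of "v @ rev w"] v assms(2) by simp
qed

lemma table_proj_drefl: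
  assumes "a < m" "z \<in> pdisk"
  shows "table_proj m \<theta> (drefl a z) = table_proj m \<theta> z"
proof -
  have "(\<exists>g\<in>Gamma_B m \<theta>. x = g (drefl a z)) \<longleftrightarrow> (\<exists>g\<in>Gamma_B m \<theta>. x = g z)" for x
  proof
    assume "\<exists>g\<in>Gamma_B m \<theta>. x = g (drefl a z)"
    then obtain w where "set w \<subseteq> {..<m}" "x = refl_word w (drefl a z)" unfolding orbit_iff by blast
    hence "set (w @ [a]) \<subseteq> {..<m}" "x = refl_word (w @ [a]) z" using assms by (auto simp: refl_word_append)
    thus "\<exists>g\<in>Gamma_B m \<theta>. x = g z" unfolding orbit_iff by blast
  next
    assume "\<exists>g\<in>Gamma_B m \<theta>. x = g z"
    then obtain w where "set w \<subseteq> {..<m}" "x = refl_word w z" unfolding orbit_iff by blast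
    hence "set (w @ [a]) \<subseteq> {..<m}" "x = refl_word (w @ [a]) (drefl a z)" using assms drefl_invol[OF assms] by (auto simp: refl_word_append)
    thus "\<exists>g\<in>Gamma_B m \<theta>. x = g (drefl a z)" unfolding orbit_iff by blast
  qed
  thus ?thesis unfolding table_proj_def by simp
qed

lemma table_proj_refl_word:
  "set w \<subseteq> {..<m} \<Longrightarrow> z \<in> pdisk \<Longrightarrow> table_proj m \<theta> (refl_word w z) = table_proj m \<theta> z"
proof (induction w)
  case (Cons a w)
  thus ?case using table_proj_drefl[of a "refl_word w z"] refl_word_in_disk[of w z] by (simp del: mem_ball)
qed simp

end

section \<open>Bounces and the boundary map\<close>

text \<open>The parameter at which \<open>geo s t\<close> meets the geodesic with ends \<open>x\<close>, \<open>y\<close>.\<close>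

definition cross_time :: "complex \<Rightarrow> complex \<Rightarrow> complex \<Rightarrow> complex \<Rightarrow> real" where
  "cross_time x y s t = ln (norm (t - x) * norm (t - y) / (norm (s - x) * norm (s - y))) / 2"

lemma strict_mono_real_seq_bracket:
  fixes T :: "nat \<Rightarrow> real"
  assumes "filterlim T at_top sequentially" "T 0 \<le> u"
  obtains n where "T n \<le> u" "u < T (Suc n)"
proof -
  obtain k where k: "u < T k" using assms(1) unfolding filterlim_at_top_dense by (metis eventually_sequentially order_refl)
  define j where "j = (LEAST j. u < T j)"
  have j: "u < T j" unfolding j_def by (rule LeastI[of _ k]) (rule k)
  then obtain n where n: "j = Suc n" using assms(2) by (cases j) auto
  have "\<not> u < T n" using not_less_Least[of n "\<lambda>j. u < T j"] n j_def by simp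
  thus ?thesis using that[of n] j n by (simp add: not_less)
qed

lemma card_event_times:
  fixes T :: "nat \<Rightarrow> real"
  assumes T: "strict_mono T" "T 0 = 0" and ev: "{s \<in> {0<..u}. P s} = {s. \<exists>k\<ge>1. s = T k \<and> T k \<le> u}"
    and n: "T n \<le> u" "u < T (Suc n)"
  shows "card {s \<in> {0<..u}. P s} = n"
proof -
  have "{s. \<exists>k\<ge>1. s = T k \<and> T k \<le> u} = T ` {1..n}"
  proof (intro equalityI subsetI)
    fix s assume "s \<in> {s. \<exists>k\<ge>1. s = T k \<and> T k \<le> u}"
    then obtain k where k: "k \<ge> 1" "s = T k" "T k \<le> u" by blast
    hence "T k < T (Suc n)" using n by linarith
    hence "k < Suc n" using T(1) by (simp add: strict_mono_less)
    thus "s \<in> T ` {1..n}" using k by auto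
  next
    fix s assume "s \<in> T ` {1..n}"
    then obtain k where k: "k \<ge> 1" "k \<le> n" "s = T k" by auto
    hence "T k \<le> T n" using T(1) by (simp add: strict_mono_less_eq)
    thus "s \<in> {s. \<exists>k\<ge>1. s = T k \<and> T k \<le> u}" using k n by auto
  qed
  thus ?thesis unfolding ev using T(1) by (simp add: card_image strict_mono_imp_inj_on)
qed

text \<open>While \<open>N\<close> is constant, \<open>u / N\<close> lies between
  \<open>T N / N\<close> and \<open>T (Suc N) / N\<close>, and these have the same limit because
  \<open>(N + 1) / N\<close> tends to one.\<close>

lemma mean_free_path_limit:
  fixes T :: "nat \<Rightarrow> real" and N :: "real \<Rightarrow> nat"
  assumes T: "strict_mono T" "T 0 = 0" "filterlim T at_top sequentially"
    and N: "\<And>n u. T n \<le> u \<Longrightarrow> u < T (Suc n) \<Longrightarrow> N u = n"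
    and L: "(\<lambda>n. T n / real n) \<longlonglongrightarrow> L"
  shows "((\<lambda>u. u / real (N u)) \<longlongrightarrow> L) at_top"
proof -
  have br: "T (N u) \<le> u \<and> u < T (Suc (N u))" if "u \<ge> 0" for u
    using strict_mono_real_seq_bracket[OF T(3), of u] T(2) that N by metis
  have Ntop: "filterlim N at_top at_top"
    unfolding filterlim_at_top
  proof
    fix k
    have "eventually (\<lambda>u. u \<ge> T k \<and> u \<ge> 0) at_top" by (intro eventually_conj eventually_ge_at_top)
    thus "eventually (\<lambda>u. k \<le> N u) at_top"
    proof eventually_elim
      case (elim u)
      hence "T k < T (Suc (N u))" using br[of u] by linarith
      hence "k < Suc (N u)" using T(1) by (simp add: strict_mono_less)
      thus ?case by simp
    qed
  qed
  have L1: "((\<lambda>u. T (N u) / real (N u)) \<longlongrightarrow> L) at_top" by (rule filterlim_compose[OF L Ntop])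
  have "(\<lambda>n. T (Suc n) / real (Suc n) * (1 + 1 / real n)) \<longlonglongrightarrow> L * (1 + 0)"
    by (intro tendsto_mult LIMSEQ_Suc[OF L] tendsto_add tendsto_const lim_1_over_n)
  hence "(\<lambda>n. T (Suc n) / real (Suc n) * (1 + 1 / real n)) \<longlonglongrightarrow> L" by simp
  hence "(\<lambda>n. T (Suc n) / real n) \<longlonglongrightarrow> L"
  proof (rule Lim_transform_eventually)
    show "\<forall>\<^sub>F n in sequentially. T (Suc n) / real (Suc n) * (1 + 1 / real n) = T (Suc n) / real n"
      using eventually_gt_at_top[of 0]
    proof eventually_elim
      case (elim n)
      hence "1 + 1 / real n = real (Suc n) / real n" by (simp add: field_simps)
      thus ?case by simp
    qed
  qed
  hence L2: "((\<lambda>u. T (Suc (N u)) / real (N u)) \<longlongrightarrow> L) at_top" by (rule filterlim_compose[OF _ Ntop])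
  show ?thesis
  proof (rule tendsto_sandwich[OF _ _ L1 L2])
    have "T (N u) / real (N u) \<le> u / real (N u)" "u / real (N u) \<le> T (Suc (N u)) / real (N u)" if "u \<ge> 0" for u
      using br[OF that] by (simp_all add: divide_right_mono)
    thus "eventually (\<lambda>u. T (N u) / real (N u) \<le> u / real (N u)) at_top" "eventually (\<lambda>u. u / real (N u) \<le> T (Suc (N u)) / real (N u)) at_top"
      using eventually_at_top_linorder by blast+
  qed
qed

context ideal_polygon
begin

section \<open>Non-terminating points and the crossing of sides by a geodesic\<close>

definition nonterm :: "complex \<Rightarrow> bool" where "nonterm z \<longleftrightarrow> norm z = 1 \<and> \<not> B_terminating m \<theta> z"

lemma nontermD:
  assumes "nonterm z"
  shows "norm z = 1" "z \<notin> verts" "sgn_arc (arc_index z) z > 0" "arc_index z < m"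
proof -
  show n: "norm z = 1" using assms by (simp add: nonterm_def)
  show v: "z \<notin> verts"
  proof
    assume "z \<in> verts"
    hence "\<exists>a<m. (B_map m \<theta> ^^ 0) z = \<theta> a" by auto
    thus False using assms unfolding nonterm_def B_terminating_def by blast
  qed
  show "sgn_arc (arc_index z) z > 0" "arc_index z < m" using sgn_arc_index arc_index_props n v by auto
qed

lemma nontermI:
  assumes "norm z = 1" "\<And>h. (B_map m \<theta> ^^ h) z \<notin> verts" shows "nonterm z"
  using assms unfolding nonterm_def B_terminating_def by force

lemma nonterm_orbit: "nonterm z \<Longrightarrow> (B_map m \<theta> ^^ h) z \<notin> verts"
  unfolding nonterm_def B_terminating_def by auto

lemma nonterm_B: 
  assumes "nonterm z" shows "nonterm (crefl (arc_index z) z)"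
proof (rule nontermI)
  show "norm (crefl (arc_index z) z) = 1" using norm_crefl nontermD[OF assms] by blast
  show "(B_map m \<theta> ^^ h) (crefl (arc_index z) z) \<notin> verts" for h
    using nonterm_orbit[OF assms, of "Suc h"] unfolding funpow_Suc_right comp_def B_map_eq .
qed

text \<open>A point outside arc \<open>a\<close> is thrown into arc \<open>a\<close>, where the
  boundary map undoes the reflection; its new orbit is therefore the old one preceded by one
  non-vertex.\<close>

lemma nonterm_crefl:
  assumes "nonterm z" "a < m" "arc_index z \<noteq> a"
  shows "nonterm (crefl a z)" "arc_index (crefl a z) = a"
proof -
  note z = nontermD[OF assms(1)]
  have "sgn_arc a z < 0" using sgn_arc_disjoint[OF z(4) assms(2) assms(3) z(1) z(3)] .
  hence p: "sgn_arc a (crefl a z) > 0" using sgn_arc_crefl assms z by blast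
  have n: "norm (crefl a z) = 1" using norm_crefl assms z by blast
  show i: "arc_index (crefl a z) = a" by (rule arc_index_unique[OF assms(2) n p])
  show "nonterm (crefl a z)"
  proof (rule nontermI[OF n])
    fix h
    show "(B_map m \<theta> ^^ h) (crefl a z) \<notin> verts"
    proof (cases h)
      case 0 thus ?thesis using sgn_arc_pos_not_vertex[OF assms(2) p] by simp
    next
      case (Suc k)
      have "B_map m \<theta> (crefl a z) = z" using crefl_invol[OF assms(2) z(1)] by (simp add: B_map_eq i)
      thus ?thesis using nonterm_orbit[OF assms(1), of k] unfolding Suc funpow_Suc_right comp_def by simp
    qed
  qed
qed

lemma S_B_iff: "(s, t) \<in> S_B m \<theta> \<longleftrightarrow> nonterm s \<and> nonterm t \<and> arc_index s \<noteq> arc_index t"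
proof
  assume "(s, t) \<in> S_B m \<theta>"
  thus "nonterm s \<and> nonterm t \<and> arc_index s \<noteq> arc_index t"
    unfolding S_B_def nonterm_def using arc_index_eqI by auto
next
  assume "nonterm s \<and> nonterm t \<and> arc_index s \<noteq> arc_index t"
  thus "(s, t) \<in> S_B m \<theta>" unfolding S_B_def nonterm_def using arc_index_props by auto
qed

lemma S_B_D:
  assumes "(s, t) \<in> S_B m \<theta>"
  shows "norm s = 1" "norm t = 1" "s \<noteq> t" "arc_index s < m" "arc_index t < m" "arc_index s \<noteq> arc_index t"
    "sgn_arc (arc_index s) s > 0" "sgn_arc (arc_index t) t > 0" "sgn_arc (arc_index s) t < 0" "sgn_arc (arc_index t) s < 0"
  using assms nontermD sgn_arc_disjoint unfolding S_B_iff by metis+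

definition cross :: "nat \<Rightarrow> complex \<Rightarrow> complex \<Rightarrow> real" where "cross a = cross_time (\<theta> a) (\<theta> (nxt a))"

lemma cross_sign:
  assumes "a < m" "norm s = 1" "norm t = 1" "sgn_arc a s > 0" "sgn_arc a t < 0"
  shows "exp u * sgn_arc a s + exp (- u) * sgn_arc a t \<le> 0 \<longleftrightarrow> u \<le> cross a s t"
    "exp u * sgn_arc a s + exp (- u) * sgn_arc a t = 0 \<longleftrightarrow> u = cross a s t"
proof -
  let ?x = "\<theta> a" let ?y = "\<theta> (nxt a)"
  have ab: "\<bar>sgn_arc a z\<bar> = norm (?x - ?y) * norm (z - ?x) * norm (z - ?y) / 2" if "norm z = 1" for z
    unfolding sgn_arc_def sform_def by (rule abs_side_form_light) (use assms(1) side_ends that in auto)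
  have d: "norm (?x - ?y) > 0" using vertex_neq assms by simp
  have s: "sgn_arc a s = norm (?x - ?y) / 2 * (norm (s - ?x) * norm (s - ?y))" and t: "- sgn_arc a t = norm (?x - ?y) / 2 * (norm (t - ?x) * norm (t - ?y))"
    using ab[OF assms(2)] ab[OF assms(3)] assms(4,5) by auto
  have ps: "norm (s - ?x) * norm (s - ?y) > 0" "norm (t - ?x) * norm (t - ?y) > 0" using s t assms(4,5) d by (auto simp: zero_less_mult_iff) 
  hence "exp (2 * cross a s t) = (norm (t - ?x) * norm (t - ?y)) / (norm (s - ?x) * norm (s - ?y))"
    unfolding cross_def cross_time_def by simp
  also have "\<dots> = - sgn_arc a t / sgn_arc a s" unfolding s t using d by simp
  finally have e: "exp (2 * cross a s t) * sgn_arc a s = - sgn_arc a t" using assms(4) by simp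
  have "exp u * sgn_arc a s + exp (- u) * sgn_arc a t = exp (- u) * sgn_arc a s * (exp (2 * u) - exp (2 * cross a s t))"
  proof -
    have "exp (- u) * exp (2 * u) = exp u" by (simp flip: exp_add)
    thus ?thesis using e by (simp add: algebra_simps)
  qed
  thus "exp u * sgn_arc a s + exp (- u) * sgn_arc a t \<le> 0 \<longleftrightarrow> u \<le> cross a s t"
    "exp u * sgn_arc a s + exp (- u) * sgn_arc a t = 0 \<longleftrightarrow> u = cross a s t"
    using assms(4) by (simp_all add: mult_le_0_iff)
qed

lemma cross_swap: "cross a t s = - cross a s t"
proof -
  have "ln (p / q) = - ln (q / p :: real)" for p q by (metis inverse_divide ln_inverse)
  thus ?thesis unfolding cross_def cross_time_def by (metis minus_divide_left)
qed

lemma cross_sign_swap: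
  assumes "a < m" "norm s = 1" "norm t = 1" "sgn_arc a s < 0" "sgn_arc a t > 0"
  shows "exp u * sgn_arc a s + exp (- u) * sgn_arc a t \<le> 0 \<longleftrightarrow> cross a s t \<le> u"
    "exp u * sgn_arc a s + exp (- u) * sgn_arc a t = 0 \<longleftrightarrow> u = cross a s t"
  using cross_sign[OF assms(1,3,2,5,4), of "- u"] unfolding cross_swap[of a t s] by (auto simp: add.commute)

lemma sform_geo_le_0:
  assumes "norm s = 1" "norm t = 1" "s \<noteq> t"
  shows "sform a (lift (geo s t u)) \<le> 0 \<longleftrightarrow> exp u * sgn_arc a s + exp (- u) * sgn_arc a t \<le> 0"
    "sform a (lift (geo s t u)) = 0 \<longleftrightarrow> exp u * sgn_arc a s + exp (- u) * sgn_arc a t = 0"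
  unfolding sform_geo[OF assms] using assms(3) by (simp_all add: divide_le_0_iff)

context
  fixes s t assumes st: "(s, t) \<in> S_B m \<theta>"
begin

lemma sgn_arc_third: 
  assumes "c < m" "c \<noteq> arc_index s" "c \<noteq> arc_index t"
  shows "exp u * sgn_arc c s + exp (- u) * sgn_arc c t < 0"
proof -
  note S = S_B_D[OF st]
  have "sgn_arc c s < 0" "sgn_arc c t < 0" using sgn_arc_disjoint S assms by metis+
  thus ?thesis by (simp add: add_neg_neg mult_pos_neg)
qed

lemma geo_in_table_iff:
  "geo s t u \<in> table \<longleftrightarrow> cross (arc_index t) s t \<le> u \<and> u \<le> cross (arc_index s) s t"
proof -
  note S = S_B_D[OF st]
  have "geo s t u \<in> table \<longleftrightarrow> (\<forall>c<m. exp u * sgn_arc c s + exp (- u) * sgn_arc c t \<le> 0)"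
    unfolding table_def using geo_in_disk[OF S(1,2,3)] sform_geo_le_0[OF S(1,2,3)] by auto
  also have "\<dots> \<longleftrightarrow> exp u * sgn_arc (arc_index s) s + exp (- u) * sgn_arc (arc_index s) t \<le> 0
      \<and> exp u * sgn_arc (arc_index t) s + exp (- u) * sgn_arc (arc_index t) t \<le> 0"
    using S(4,5) sgn_arc_third[of _ u] by (metis less_imp_le)
  finally show ?thesis using cross_sign(1)[OF S(4,1,2,7,9)] cross_sign_swap(1)[OF S(5,1,2,10,8)] by blast
qed

lemma geo_on_side_iff:
  "geo s t u \<in> (\<Union>a<m. side m \<theta> a) \<longleftrightarrow> u = cross (arc_index t) s t \<or> u = cross (arc_index s) s t"
proof -
  note S = S_B_D[OF st]
  have "geo s t u \<in> (\<Union>a<m. side m \<theta> a) \<longleftrightarrow> (\<exists>c<m. exp u * sgn_arc c s + exp (- u) * sgn_arc c t = 0)"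
    using side_eq geo_in_disk[OF S(1,2,3)] sform_geo_le_0(2)[OF S(1,2,3)] by auto
  also have "\<dots> \<longleftrightarrow> exp u * sgn_arc (arc_index s) s + exp (- u) * sgn_arc (arc_index s) t = 0
      \<or> exp u * sgn_arc (arc_index t) s + exp (- u) * sgn_arc (arc_index t) t = 0"
    using S(4,5) sgn_arc_third[of _ u] by (metis less_irrefl)
  finally show ?thesis using cross_sign(2)[OF S(4,1,2,7,9)] cross_sign_swap(2)[OF S(5,1,2,10,8)] by blast
qed

lemma enter_before_exit: "cross (arc_index t) s t < cross (arc_index s) s t"
proof -
  note S = S_B_D[OF st]
  let ?u = "cross (arc_index t) s t"
  have z: "geo s t ?u \<in> pdisk" by (rule geo_in_disk[OF S(1,2,3)])
  have "sform (arc_index t) (lift (geo s t ?u)) = 0"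
    using sform_geo_le_0(2)[OF S(1,2,3)] cross_sign_swap(2)[OF S(5,1,2,10,8)] by blast
  hence "sform (arc_index s) (lift (geo s t ?u)) < 0" using outer_disjoint[OF z S(5,4)] S(6) by simp
  thus ?thesis using sform_geo_le_0[OF S(1,2,3)] cross_sign[OF S(4,1,2,7,9)] by (metis less_le)
qed

lemma entering_geodesic_iff: "entering_geodesic m \<theta> s t g \<longleftrightarrow> g = (\<lambda>u. geo s t (u + cross (arc_index t) s t))"
proof -
  note S = S_B_D[OF st]
  have key: "(geo s t (0 + c) \<in> table \<and> (\<forall>u<0. geo s t (u + c) \<notin> table)) \<longleftrightarrow> c = cross (arc_index t) s t" for c
  proof
    assume c: "geo s t (0 + c) \<in> table \<and> (\<forall>u<0. geo s t (u + c) \<notin> table)"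
    show "c = cross (arc_index t) s t"
    proof (rule ccontr)
      assume "c \<noteq> cross (arc_index t) s t"
      hence "cross (arc_index t) s t - c < 0" using c geo_in_table_iff by auto
      thus False using c[THEN conjunct2, rule_format, of "cross (arc_index t) s t - c"] geo_in_table_iff enter_before_exit by simp
    qed
  qed (use geo_in_table_iff enter_before_exit in auto)
  show ?thesis unfolding entering_geodesic_def billiard_table_eq geodesic_from_to_iff[OF S(1,2,3)]
  proof
    assume g: "(\<exists>c. g = (\<lambda>u. geo s t (u + c))) \<and> g 0 \<in> table \<and> (\<forall>t<0. g t \<notin> table)"
    then obtain c where "g = (\<lambda>u. geo s t (u + c))" by blast
    moreover from this have "c = cross (arc_index t) s t" using g key by blast
    ultimately show "g = (\<lambda>u. geo s t (u + cross (arc_index t) s t))" by simp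
  qed (use key[THEN iffD2, OF refl] in blast)
qed

lemma billiard_trajectory_eq: "billiard_trajectory m \<theta> s t u = table_proj m \<theta> (geo s t (u + cross (arc_index t) s t))"
  unfolding billiard_trajectory_def entering_geodesic_iff by simp

end

text \<open>The natural extension of the boundary map: the future end chooses the side, and the past
  end is carried along by the same reflection. Afterwards the past end lies in the arc just left, so
  consecutive letters differ.\<close>

primrec orbit :: "complex \<times> complex \<Rightarrow> nat \<Rightarrow> complex \<times> complex" where
  "orbit p 0 = p"
| "orbit p (Suc n) = (let a = arc_index (fst (orbit p n)) in (crefl a (fst (orbit p n)), crefl a (snd (orbit p n))))"

abbreviation letter :: "complex \<times> complex \<Rightarrow> nat \<Rightarrow> nat" where "letter p n \<equiv> arc_index (fst (orbit p n))"

lemma orbit_fst: "fst (orbit p (Suc n)) = crefl (letter p n) (fst (orbit p n))"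
  and orbit_snd: "snd (orbit p (Suc n)) = crefl (letter p n) (snd (orbit p n))"
  by (simp_all add: Let_def)

declare orbit.simps(2) [simp del]

lemma orbit_in_S_B:
  assumes "p \<in> S_B m \<theta>" shows "orbit p n \<in> S_B m \<theta>"
proof (induction n)
  case (Suc n)
  obtain s t where o: "orbit p n = (s, t)" by (cases "orbit p n")
  have st: "nonterm s" "nonterm t" "arc_index s \<noteq> arc_index t" using Suc o S_B_iff by auto
  note S = S_B_D[OF Suc[unfolded o]]
  have "nonterm (crefl (arc_index s) s)" "nonterm (crefl (arc_index s) t)" "arc_index (crefl (arc_index s) t) = arc_index s"
    using nonterm_B nonterm_crefl st S by auto
  moreover have "arc_index (crefl (arc_index s) s) \<noteq> arc_index s"
    using sgn_arc_crefl(2)[OF S(4,1)] S(7) calculation(1) nontermD(3) by (metis less_asym)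
  ultimately show ?case unfolding orbit.simps o Let_def fst_conv snd_conv S_B_iff by metis
qed (simp add: assms)

lemma orbit_snd_index:
  assumes "p \<in> S_B m \<theta>" shows "arc_index (snd (orbit p (Suc n))) = letter p n"
proof -
  obtain s t where o: "orbit p n = (s, t)" by (cases "orbit p n")
  have "(s, t) \<in> S_B m \<theta>" using orbit_in_S_B[OF assms, of n] o by simp
  thus ?thesis using nonterm_crefl[of t "arc_index s"] S_B_iff[of s t] S_B_D(4)[of s t] unfolding orbit_snd o by simp
qed

lemma letter_less: "p \<in> S_B m \<theta> \<Longrightarrow> letter p n < m"
  using orbit_in_S_B[of p n] S_B_D(4)[of "fst (orbit p n)" "snd (orbit p n)"] by simp

lemma letter_neq: "p \<in> S_B m \<theta> \<Longrightarrow> letter p (Suc n) \<noteq> letter p n"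
  using orbit_in_S_B[of p "Suc n"] S_B_D(6)[of "fst (orbit p (Suc n))" "snd (orbit p (Suc n))"] orbit_snd_index[of p n] by simp

lemma norm_orbit: assumes "p \<in> S_B m \<theta>" shows "norm (fst (orbit p n)) = 1" "norm (snd (orbit p n)) = 1"
  using orbit_in_S_B[OF assms, of n] S_B_D(1,2)[of "fst (orbit p n)" "snd (orbit p n)"] by simp_all

text \<open>After \<open>n\<close> bounces the trajectory follows the geodesic with ends \<open>orbit p n\<close>, its parameter being
  translated by \<open>shift p n\<close>.\<close>

primrec shift :: "complex \<times> complex \<Rightarrow> nat \<Rightarrow> real" where
  "shift p 0 = cross (arc_index (snd p)) (fst p) (snd p)"
| "shift p (Suc n) = shift p n + ln (kap (letter p n) (fst (orbit p n))) - ln (kap (letter p n) (snd (orbit p n)))"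

definition bounce_time :: "complex \<times> complex \<Rightarrow> nat \<Rightarrow> real" where
  "bounce_time p n = cross (arc_index (snd (orbit p n))) (fst (orbit p n)) (snd (orbit p n)) - shift p n"

text \<open>The conformal factors of \<open>x\<close> and \<open>y\<close> occur in both numerator
  and denominator and cancel; those of \<open>s\<close> and \<open>t\<close> produce exactly the
  increment of \<open>shift\<close>.\<close>

lemma cross_time_crefl:
  assumes "a < m" "norm x = 1" "norm y = 1" "norm s = 1" "norm t = 1" "s \<noteq> x" "s \<noteq> y" "t \<noteq> x" "t \<noteq> y"
  shows "cross_time (crefl a x) (crefl a y) (crefl a s) (crefl a t) = cross_time x y s t + ln (kap a s) - ln (kap a t)"
proof -
  define A B C D where "A = norm (t - x)" and "B = norm (t - y)" and "C = norm (s - x)" and "D = norm (s - y)"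
  define k l p q where "k = kap a s" and "l = kap a t" and "p = kap a x" and "q = kap a y"
  have pos: "A > 0" "B > 0" "C > 0" "D > 0" using assms by (simp_all add: A_def B_def C_def D_def)
  have kp: "k > 0" "l > 0" "p > 0" "q > 0" using kap_pos[OF assms(1)] assms by (simp_all add: k_def l_def p_def q_def)
  have d: "norm (crefl a t - crefl a x) = A / (l * p)" "norm (crefl a t - crefl a y) = B / (l * q)"
    "norm (crefl a s - crefl a x) = C / (k * p)" "norm (crefl a s - crefl a y) = D / (k * q)"
    using assms by (simp_all add: dist_crefl A_def B_def C_def D_def k_def l_def p_def q_def)
  have e1: "(A / (l * p)) * (B / (l * q)) / ((C / (k * p)) * (D / (k * q))) = (A * B / (C * D)) * (k / l)\<^sup>2"
    using pos kp by (simp add: divide_simps power2_eq_square)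
  have e2: "ln ((A * B / (C * D)) * (k / l)\<^sup>2) = ln (A * B / (C * D)) + 2 * (ln k - ln l)"
    using pos kp by (subst ln_mult) (auto simp: ln_realpow ln_div)
  show ?thesis
    unfolding cross_time_def d e1 e2 A_def[symmetric] B_def[symmetric] C_def[symmetric] D_def[symmetric] k_def[symmetric] l_def[symmetric]
    by (simp add: add_divide_distrib)
qed

lemma cross_crefl:
  assumes "a < m" "norm s = 1" "norm t = 1" "sgn_arc a s \<noteq> 0" "sgn_arc a t \<noteq> 0"
  shows "cross a (crefl a s) (crefl a t) = cross a s t + ln (kap a s) - ln (kap a t)"
proof -
  have "s \<noteq> \<theta> a" "s \<noteq> \<theta> (nxt a)" "t \<noteq> \<theta> a" "t \<noteq> \<theta> (nxt a)" using sgn_arc_eq_0_iff assms by blast+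
  thus ?thesis using cross_time_crefl[OF assms(1) norm_vertex[OF assms(1)] norm_vertex_nxt[of a] assms(2,3)] 
    by (simp add: cross_def crefl_vertex assms(1))
qed

context
  fixes p assumes p: "p \<in> S_B m \<theta>"
begin

lemma orbit_S_B: "(fst (orbit p n), snd (orbit p n)) \<in> S_B m \<theta>" using orbit_in_S_B[OF p] by simp

lemma bounce_time_Suc: "bounce_time p (Suc n) = cross (letter p n) (fst (orbit p n)) (snd (orbit p n)) - shift p n"
proof -
  note S = S_B_D[OF orbit_S_B]
  show ?thesis unfolding bounce_time_def orbit_snd_index[OF p]
    unfolding shift.simps orbit_fst orbit_snd
    using cross_crefl[OF S(4)[of n] S(1)[of n] S(2)[of n]] S(7)[of n] S(9)[of n] by simp
qed

lemma bounce_time_0: "bounce_time p 0 = 0" by (simp add: bounce_time_def)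

lemma bounce_time_mono: "strict_mono (bounce_time p)"
proof (rule strict_monoI_Suc)
  show "bounce_time p n < bounce_time p (Suc n)" for n
    unfolding bounce_time_Suc using enter_before_exit[OF orbit_S_B[of n]] by (simp add: bounce_time_def)
qed

primrec itinerary :: "nat \<Rightarrow> nat list" where
  "itinerary 0 = []"
| "itinerary (Suc n) = itinerary n @ [letter p n]"

lemma itinerary_letters: "set (itinerary n) \<subseteq> {..<m}"
  by (induction n) (auto simp: letter_less[OF p])

lemma refl_word_geo:
  "refl_word (rev (itinerary n)) (geo (fst p) (snd p) (u + shift p 0)) = geo (fst (orbit p n)) (snd (orbit p n)) (u + shift p n)"
proof (induction n)
  case (Suc n)
  note S = S_B_D[OF orbit_S_B[of n]]
  show ?case unfolding itinerary.simps rev_append by (simp add: Suc.IH[simplified] drefl_geo[OF S(4,1,2,3)] orbit_fst orbit_snd algebra_simps)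
qed simp

text \<open>Between two bounces the reflected geodesic runs inside the table, so it is the
  representative of the orbit picked by \<open>table_proj\<close>.\<close>

lemma trajectory_eq:
  assumes "bounce_time p n \<le> u" "u \<le> bounce_time p (Suc n)"
  shows "billiard_trajectory m \<theta> (fst p) (snd p) u = geo (fst (orbit p n)) (snd (orbit p n)) (u + shift p n)"
proof -
  have p': "(fst p, snd p) \<in> S_B m \<theta>" using p by simp
  note S = S_B_D[OF p']
  have "geo (fst (orbit p n)) (snd (orbit p n)) (u + shift p n) \<in> table"
    using assms unfolding geo_in_table_iff[OF orbit_S_B] bounce_time_Suc by (simp add: bounce_time_def)
  thus ?thesis unfolding billiard_trajectory_eq[OF p'] refl_word_geo[symmetric] shift.simps
    using itinerary_letters by (intro table_proj_eqI geo_in_disk S) (auto simp: refl_word_geo[symmetric])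
qed

lemma trajectory_on_side_iff:
  assumes "bounce_time p n \<le> u" "u \<le> bounce_time p (Suc n)"
  shows "billiard_trajectory m \<theta> (fst p) (snd p) u \<in> (\<Union>a<m. side m \<theta> a) \<longleftrightarrow> u = bounce_time p n \<or> u = bounce_time p (Suc n)"
  unfolding trajectory_eq[OF assms] geo_on_side_iff[OF orbit_S_B] bounce_time_Suc by (auto simp: bounce_time_def)

lemma bounce_set:
  assumes "filterlim (bounce_time p) at_top sequentially"
  shows "{v \<in> {0<..u}. billiard_trajectory m \<theta> (fst p) (snd p) v \<in> (\<Union>a<m. side m \<theta> a)} = {v. \<exists>k\<ge>1. v = bounce_time p k \<and> bounce_time p k \<le> u}"
proof (intro equalityI subsetI)
  fix v assume v: "v \<in> {v \<in> {0<..u}. billiard_trajectory m \<theta> (fst p) (snd p) v \<in> (\<Union>a<m. side m \<theta> a)}"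
  obtain n where n: "bounce_time p n \<le> v" "v < bounce_time p (Suc n)"
    using strict_mono_real_seq_bracket[OF assms, of v] bounce_time_0 v by auto
  hence "v = bounce_time p n" using trajectory_on_side_iff[of n v] v by auto
  moreover have "n \<noteq> 0"
  proof
    assume "n = 0"
    hence "v = 0" using \<open>v = bounce_time p n\<close> bounce_time_0 by simp
    thus False using v by simp
  qed
  ultimately show "v \<in> {v. \<exists>k\<ge>1. v = bounce_time p k \<and> bounce_time p k \<le> u}" using v by (auto intro!: exI[of _ n])
next
  fix v assume "v \<in> {v. \<exists>k\<ge>1. v = bounce_time p k \<and> bounce_time p k \<le> u}"
  then obtain k where k: "k \<ge> 1" "v = bounce_time p k" "bounce_time p k \<le> u" by blast
  have "0 < v" using bounce_time_0 k bounce_time_mono by (metis strict_mono_less zero_less_one less_le_trans)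
  moreover have "bounce_time p k \<le> bounce_time p (Suc k)" using bounce_time_mono by (simp add: strict_mono_less_eq)
  ultimately show "v \<in> {v \<in> {0<..u}. billiard_trajectory m \<theta> (fst p) (snd p) v \<in> (\<Union>a<m. side m \<theta> a)}"
    using k trajectory_on_side_iff[of k v] by auto
qed

lemma has_mean_free_pathI:
  assumes "filterlim (bounce_time p) at_top sequentially" "(\<lambda>n. bounce_time p n / real n) \<longlonglongrightarrow> L"
  shows "has_mean_free_path m \<theta> (billiard_trajectory m \<theta> (fst p) (snd p)) L"
  unfolding has_mean_free_path_def
proof (rule mean_free_path_limit[OF bounce_time_mono bounce_time_0 assms(1) _ assms(2)])
  fix n u assume "bounce_time p n \<le> u" "u < bounce_time p (Suc n)"
  thus "bounces m \<theta> (billiard_trajectory m \<theta> (fst p) (snd p)) u = n"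
    unfolding bounces_def by (rule card_event_times[OF bounce_time_mono bounce_time_0 bounce_set[OF assms(1)]])
qed

end

section \<open>Bounces as crossings of image sides by one fixed geodesic\<close>

definition crefl_word :: "nat list \<Rightarrow> complex \<Rightarrow> complex" where "crefl_word w z = foldr crefl w z"

lemma crefl_word_Nil [simp]: "crefl_word [] z = z" and crefl_word_Cons [simp]: "crefl_word (a # w) z = crefl a (crefl_word w z)"
  and crefl_word_append: "crefl_word (v @ w) z = crefl_word v (crefl_word w z)"
  by (simp_all add: crefl_word_def)

text \<open>Instead of reflecting the geodesic into the table, the side hit at bounce
  \<open>Suc n\<close> is carried back to the original geodesic. The ends of the image side bound a
  cylinder, which ties bounce times to cylinder lengths.\<close>

lemma bounce_time_cross:
  assumes p: "p \<in> S_B m \<theta>"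
  shows "bounce_time p (Suc n) + shift p 0
    = cross_time (crefl_word (itinerary p n) (\<theta> (letter p n))) (crefl_word (itinerary p n) (\<theta> (nxt (letter p n)))) (fst p) (snd p)"
proof -
  note S = S_B_D[OF orbit_S_B[OF p]]
  \<comment> \<open>Stated for arbitrary points \<open>x\<close>, \<open>y\<close>, since the
    induction moves the last letter from the word onto them.\<close>
  have gen: "cross_time (crefl_word (itinerary p n) x) (crefl_word (itinerary p n) y) (fst p) (snd p)
     = cross_time x y (fst (orbit p n)) (snd (orbit p n)) + shift p 0 - shift p n"
    if "norm x = 1" "norm y = 1" "fst (orbit p n) \<notin> {x, y}" "snd (orbit p n) \<notin> {x, y}" for x y n
    using that
  proof (induction n arbitrary: x y)
    case (Suc n)
    define a s t where ast: "a = letter p n" "s = fst (orbit p n)" "t = snd (orbit p n)"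
    have a: "a < m" "norm s = 1" "norm t = 1" using S by (auto simp: ast)
    define x' y' where "x' = crefl a x" and "y' = crefl a y"
    have xy: "x = crefl a x'" "y = crefl a y'" "norm x' = 1" "norm y' = 1"
      using crefl_invol[OF a(1)] Suc.prems norm_crefl[OF a(1)] by (auto simp: x'_def y'_def)
    have o: "fst (orbit p (Suc n)) = crefl a s" "snd (orbit p (Suc n)) = crefl a t" by (simp_all add: ast orbit_fst orbit_snd)
    have ne: "s \<noteq> x'" "s \<noteq> y'" "t \<noteq> x'" "t \<noteq> y'" using Suc.prems(3,4) unfolding o xy(1,2) by auto
    have "cross_time (crefl_word (itinerary p (Suc n)) x) (crefl_word (itinerary p (Suc n)) y) (fst p) (snd p)
       = cross_time (crefl_word (itinerary p n) x') (crefl_word (itinerary p n) y') (fst p) (snd p)"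
      by (simp add: itinerary.simps[OF p] crefl_word_append ast(1)[symmetric] x'_def y'_def)
    also have "\<dots> = cross_time x' y' s t + shift p 0 - shift p n"
      using Suc.IH[OF xy(3,4)] ne by (simp add: ast)
    also have "cross_time x' y' s t = cross_time x y (crefl a s) (crefl a t) - ln (kap a s) + ln (kap a t)"
      unfolding xy(1,2) using cross_time_crefl[OF a(1) xy(3,4) a(2,3) ne] by simp
    finally show ?case unfolding o by (simp add: ast)
  qed (simp add: itinerary.simps[OF p])
  have a: "letter p n < m" using letter_less[OF p] .
  have "fst (orbit p n) \<notin> {\<theta> (letter p n), \<theta> (nxt (letter p n))}" "snd (orbit p n) \<notin> {\<theta> (letter p n), \<theta> (nxt (letter p n))}"
    using sgn_arc_eq_0_iff[OF a S(1)[of n]] sgn_arc_eq_0_iff[OF a S(2)[of n]] S(7)[of n] S(9)[of n] by auto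
  from gen[OF norm_vertex[OF a] norm_vertex_nxt this] show ?thesis
    unfolding bounce_time_Suc[OF p] cross_def by simp
qed

end

section \<open>Arcs seen from a base point\<close>

text \<open>Up to a factor, the length of an interval in the projective chart with \<open>e\<close> at infinity; hence additive
  over arcs that avoid \<open>e\<close>.\<close>

definition ell :: "complex \<Rightarrow> complex \<Rightarrow> complex \<Rightarrow> real" where
  "ell e x y = norm (x - y) / (norm (x - e) * norm (y - e))"

lemma ell_commute: "ell e x y = ell e y x" by (simp add: ell_def norm_minus_commute mult.commute)
lemma ell_nonneg: "ell e x y \<ge> 0" by (simp add: ell_def)
lemma ell_pos: "x \<noteq> y \<Longrightarrow> x \<noteq> e \<Longrightarrow> y \<noteq> e \<Longrightarrow> ell e x y > 0" by (simp add: ell_def)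

lemma dist_le_ell:
  assumes "norm e = 1" "norm x = 1" "norm y = 1" "x \<noteq> e" "y \<noteq> e"
  shows "norm (x - y) \<le> 4 * ell e x y"
proof -
  have "norm (x - y) = ell e x y * (norm (x - e) * norm (y - e))" using assms by (simp add: ell_def)
  also have "\<dots> \<le> ell e x y * (2 * 2)"
    using norm_triangle_ineq4[of x e] norm_triangle_ineq4[of y e] assms by (intro mult_left_mono mult_mono ell_nonneg) auto
  finally show ?thesis by simp
qed

lemma sin_diff_cot:
  assumes "sin A \<noteq> 0" "sin B \<noteq> 0" shows "sin (B - A) / (sin A * sin B) = cot A - cot (B::real)"
  using assms by (simp add: cot_def sin_diff field_simps)

text \<open>Half the cotangent of the half angle is an affine coordinate on the circle with the base
  point at infinity; \<open>ell\<close> is the length of an interval in it, so sums over adjacent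
  arcs telescope.\<close>

lemma ell_cis:
  assumes "b < u" "u \<le> v" "v < b + 2 * pi"
  shows "ell (cis b) (cis u) (cis v) = (cot ((u - b) / 2) - cot ((v - b) / 2)) / 2"
proof -
  have s: "sin ((u - b) / 2) > 0" "sin ((v - b) / 2) > 0" "sin ((v - u) / 2) \<ge> 0"
    using assms by (auto intro!: sin_gt_zero sin_ge_zero)
  have "sin ((u - v) / 2) = - sin ((v - u) / 2)" by (metis minus_diff_eq minus_divide_left sin_minus)
  hence "ell (cis b) (cis u) (cis v) = sin ((v - u) / 2) / (sin ((u - b) / 2) * sin ((v - b) / 2)) / 2"
    unfolding ell_def norm_cis_diff using s by simp
  also have "(v - u) / 2 = (v - b) / 2 - (u - b) / 2" by argo
  also have "sin ((v - b) / 2 - (u - b) / 2) / (sin ((u - b) / 2) * sin ((v - b) / 2)) = cot ((u - b) / 2) - cot ((v - b) / 2)"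
    using s by (intro sin_diff_cot) auto
  finally show ?thesis .
qed

lemma cot_antimono:
  assumes "0 < A" "A \<le> B" "B < pi" shows "cot B \<le> cot (A::real)"
proof -
  have "sin A > 0" "sin B > 0" "sin (B - A) \<ge> 0" using assms by (auto intro!: sin_gt_zero sin_ge_zero)
  thus ?thesis using sin_diff_cot[of A B] by (metis divide_nonneg_pos mult_pos_pos diff_ge_0_iff_ge less_irrefl)
qed

lemma cis_cross_ratio:
  "(cis a - cis b) * (cis c - cis d) / ((cis a - cis c) * (cis b - cis d))
   = of_real (sin ((a - b) / 2) * sin ((c - d) / 2) / (sin ((a - c) / 2) * sin ((b - d) / 2)))"
proof -
  have "cis ((a + b) / 2) * cis ((c + d) / 2) = cis ((a + c) / 2) * cis ((b + d) / 2)"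
  proof -
    have "(a + b) / 2 + (c + d) / 2 = (a + c) / 2 + (b + d) / 2" by argo
    thus ?thesis by (simp only: cis_mult)
  qed
  moreover have g: "(2 * \<i> * p * X) * (2 * \<i> * q * Y) = p * q * (- 4 * (X * Y))" for p q X Y by (simp add: algebra_simps)
  ultimately have 1: "(2 * \<i> * p * cis ((a + b) / 2)) * (2 * \<i> * q * cis ((c + d) / 2)) = p * q * (- 4 * (cis ((a + c) / 2) * cis ((b + d) / 2)))"
    and 2: "(2 * \<i> * p * cis ((a + c) / 2)) * (2 * \<i> * q * cis ((b + d) / 2)) = p * q * (- 4 * (cis ((a + c) / 2) * cis ((b + d) / 2)))" for p q
    by (simp_all only:)
  have n: "- 4 * (cis ((a + c) / 2) * cis ((b + d) / 2)) \<noteq> 0" by simp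
  show ?thesis unfolding cis_diff 1 2 of_real_mult of_real_divide by (rule mult_divide_mult_cancel_right[OF n])
qed

text \<open>For \<open>p\<close> a cross ratio, reflecting the fourth point in the geodesic through the first two turns
  \<open>p\<close> into \<open>1 / (2 - p)\<close>, which is \<open>D \<mapsto> D + 1\<close> in the coordinate \<open>D = p / (1 - p)\<close>.\<close>

lemma cross_ratio_reflection:
  assumes n: "norm v = 1" "norm w = 1" "norm z = 1" "norm e = 1" and d: "v \<noteq> w" "v \<noteq> z" "w \<noteq> e" "z \<noteq> e" "v \<noteq> e"
    and r: "(v - z) * (w - e) / ((v - w) * (z - e)) = of_real r" "0 < r" "r < 2"
  shows "ell e v z / ell e v w = r"
    "ell (circle_reflection v z e) v w / ell (circle_reflection v z e) v z = 1 / (2 - r)"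
proof -
  define q where "q = 2 * e - (v + z)"
  define f where "f = circle_reflection v z e"
  have q: "q \<noteq> 0" unfolding q_def by (rule refl_den_nonzero) (use n d in auto)
  have "ell e v z / ell e v w = norm (v - z) * norm (w - e) / (norm (v - w) * norm (z - e))"
    using d by (simp add: ell_def divide_simps)
  also have "\<dots> = norm (of_real r :: complex)" unfolding r(1)[symmetric] by (simp add: norm_mult norm_divide)
  finally show "ell e v z / ell e v w = r" using r(2) by simp
  have zf: "(z - f) * q = (z - v) * (e - z)" and wf0: "(w - f) * q = 2 * w * e - (w + e) * (v + z) + 2 * v * z"
  proof -
    have fq: "f * q = (v + z) * e - 2 * v * z" using q by (simp add: f_def circle_reflection_def q_def)
    show "(z - f) * q = (z - v) * (e - z)" "(w - f) * q = 2 * w * e - (w + e) * (v + z) + 2 * v * z"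
      unfolding left_diff_distrib fq unfolding q_def by (simp_all add: algebra_simps)
  qed
  have "(of_real (2 - r) :: complex) * ((v - w) * (z - e)) = 2 * ((v - w) * (z - e)) - (v - z) * (w - e)"
  proof -
    have "of_real r * ((v - w) * (z - e)) = (v - z) * (w - e)" unfolding r(1)[symmetric] using d by simp
    thus ?thesis unfolding of_real_diff left_diff_distrib by simp
  qed
  hence wf: "(w - f) * q = of_real (2 - r) * ((v - w) * (z - e))" unfolding wf0 by (simp add: algebra_simps)
  have nz: "norm (z - f) * norm q = norm (v - z) * norm (z - e)" "norm (w - f) * norm q = (2 - r) * (norm (v - w) * norm (z - e))"
    using arg_cong[OF zf, of norm] arg_cong[OF wf, of norm] r(3) unfolding norm_mult norm_of_real by (simp_all add: norm_minus_commute)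
  have fv: "f \<noteq> v" 
  proof
    assume "f = v"
    hence "circle_reflection v z f = v" using d by (simp add: circle_reflection_left)
    thus False using circle_reflection_invol[of v z e] n d by (simp add: f_def)
  qed
  have z0: "norm (z - f) \<noteq> 0" "norm (w - f) \<noteq> 0" using nz d r(3) q by auto
  have "ell f v w / ell f v z = norm (v - w) * norm (z - f) / (norm (v - z) * norm (w - f))"
    using fv d by (simp add: ell_def divide_simps)
  also have "\<dots> = norm (v - w) * (norm (z - f) * norm q) / (norm (v - z) * (norm (w - f) * norm q))" using q by simp
  also have "\<dots> = 1 / (2 - r)" unfolding nz using d by (simp add: divide_simps)
  finally show "ell (circle_reflection v z e) v w / ell (circle_reflection v z e) v z = 1 / (2 - r)" unfolding f_def .
qed

lemma circle_reflection_commute: "circle_reflection x y = circle_reflection y x"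
  by (auto simp: circle_reflection_def fun_eq_iff algebra_simps)

context ideal_polygon
begin

definition prv :: "nat \<Rightarrow> nat" where "prv c = (c + (m - 1)) mod m"

lemma prv_less: "prv c < m" using m_pos by (simp add: prv_def)
lemma nxt_prv: "c < m \<Longrightarrow> nxt (prv c) = c"
  using m_pos by (simp add: prv_def mod_Suc_eq)
lemma prv_nxt: "c < m \<Longrightarrow> prv (nxt c) = c"
proof -
  assume "c < m"
  have "prv (nxt c) = (Suc c + (m - 1)) mod m" by (simp add: prv_def mod_add_left_eq)
  also have "\<dots> = (c + m) mod m" using m_pos by simp
  finally show ?thesis using \<open>c < m\<close> by simp
qed
lemma prv_neq_nxt: assumes "c < m" shows "prv c \<noteq> nxt c"
proof
  assume e: "prv c = nxt c"
  hence "nxt (nxt c) = c" using nxt_prv[OF assms] by simp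
  hence "Suc (Suc c) mod m = c" by (simp add: mod_Suc_eq)
  thus False using assms m3 by (cases "Suc (Suc c) < m") (auto simp: mod_if split: if_splits)
qed
lemma prv_neq: "c < m \<Longrightarrow> prv c \<noteq> c" using nxt_prv nxt_neq prv_less by metis

lemma cis_angle: "cis (\<alpha> j) = \<theta> (j mod m)"
proof (induction j rule: less_induct)
  case (less j)
  show ?case
  proof (cases "j < m")
    case True thus ?thesis using vertex_eq by simp
  next
    case False
    hence "j = (j - m) + m" by simp
    thus ?thesis using less[of "j - m"] cis_angle_mod[of "j - m"] False m_pos by (metis diff_less less_le_trans mod_add_self2 not_less)
  qed
qed

abbreviation arc_ell :: "complex \<Rightarrow> nat \<Rightarrow> real" where "arc_ell e a \<equiv> ell e (\<theta> a) (\<theta> (nxt a))"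

definition regular :: "complex \<Rightarrow> bool" where "regular e \<longleftrightarrow> norm e = 1 \<and> e \<notin> verts"

lemma regularD:
  assumes "regular e"
  shows "norm e = 1" "e \<notin> verts" "arc_index e < m" "sgn_arc (arc_index e) e > 0" 
    "a < m \<Longrightarrow> \<theta> a \<noteq> e" "\<theta> (nxt a) \<noteq> e" "a < m \<Longrightarrow> arc_ell e a > 0"
proof -
  show n: "norm e = 1" "e \<notin> verts" using assms by (auto simp: regular_def)
  thus "arc_index e < m" "sgn_arc (arc_index e) e > 0" using arc_index_props sgn_arc_index by auto
  show v: "a < m \<Longrightarrow> \<theta> a \<noteq> e" "\<theta> (nxt a) \<noteq> e" using n nxt_less by blast+
  thus "a < m \<Longrightarrow> arc_ell e a > 0" using vertex_neq by (intro ell_pos) auto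
qed

lemma regular_angle:
  assumes "regular e"
  obtains b where "e = cis b" "\<alpha> (arc_index e) < b" "b < \<alpha> (Suc (arc_index e))"
proof -
  note R = regularD[OF assms]
  obtain b where b: "e = cis b" "\<alpha> (arc_index e) \<le> b" "b < \<alpha> (Suc (arc_index e))"
    using arc_index_props(2)[OF R(1)] part_arc_iff[OF R(3)] by blast
  moreover have "\<alpha> (arc_index e) \<noteq> b" using R(5)[OF R(3)] vertex_eq[OF R(3)] b by auto
  ultimately show ?thesis using that by fastforce
qed

lemma sum_period:
  fixes f :: "nat \<Rightarrow> real"
  assumes "\<And>j. f (j + m) = f j" shows "sum f {c..<c + m} = sum f {..<m}"
proof (induction c)
  case (Suc c)
  have "sum f {Suc c..<Suc c + m} = sum f {c..<c + m} - f c + f (c + m)"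
    using m_pos by (simp add: sum.atLeast_Suc_lessThan[of c "c + m"])
  thus ?case using Suc assms by simp
qed (simp add: atLeast0LessThan)

text \<open>The arcs not containing \<open>e\<close> tile the complement of the one that does, and
  that complement has the same two ends. Hence the normaliser in \<open>prob\<close> is simply the
  \<open>ell\<close> of the own arc.\<close>

lemma sum_arc_ell:
  assumes "regular e" shows "(\<Sum>a\<in>{..<m} - {arc_index e}. arc_ell e a) = arc_ell e (arc_index e)"
proof -
  note R = regularD[OF assms]
  define c where "c = arc_index e"
  obtain b where b: "e = cis b" "\<alpha> c < b" "b < \<alpha> (Suc c)" using regular_angle[OF assms] unfolding c_def by blast
  define f where "f = (\<lambda>j. ell e (cis (\<alpha> j)) (cis (\<alpha> (Suc j))))"
  have f: "f j = arc_ell e (j mod m)" for j unfolding f_def cis_angle by (simp add: mod_Suc_eq)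
  have fp: "f (j + m) = f j" for j unfolding f by simp
  define g where "g = (\<lambda>j. - cot ((\<alpha> j - b) / 2) / 2)"
  have fg: "f j = g (Suc j) - g j" if "c < j" "j < c + m" for j
    unfolding f_def g_def b(1)
    using angle_le[of "Suc c" j] angle_le[of "Suc j" "c + m"] angle_period[of c] angle_step[of j] that b
    by (subst ell_cis) (auto simp: field_simps)
  have "(\<Sum>a\<in>{..<m} - {c}. arc_ell e a) = (\<Sum>a\<in>{..<m} - {c}. f a)" by (intro sum.cong) (auto simp: f)
  also have "\<dots> = sum f {..<m} - f c" using R(3) by (simp add: sum_diff1 c_def)
  also have "\<dots> = sum f {Suc c..<c + m}"
    unfolding sum_period[of f c, OF fp, symmetric] using m_pos by (simp add: sum.atLeast_Suc_lessThan[of c "c + m"])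
  also have "\<dots> = (\<Sum>j = Suc c..<c + m. g (Suc j) - g j)" by (intro sum.cong) (auto simp: fg)
  also have "\<dots> = g (c + m) - g (Suc c)" using m_pos by (intro sum_Suc_diff') simp
  also have "\<dots> = ell e (cis (\<alpha> (Suc c))) (cis (\<alpha> (c + m)))"
    unfolding b(1) g_def using angle_le[of "Suc c" "c + m"] m_pos b angle_period[of c] by (subst ell_cis) (auto simp: field_simps)
  also have "\<dots> = arc_ell e c" unfolding cis_angle using R(3) by (simp add: c_def ell_commute)
  finally show ?thesis unfolding c_def .
qed

definition prob :: "complex \<Rightarrow> nat \<Rightarrow> real" where "prob e a = arc_ell e a / arc_ell e (arc_index e)"

lemma prob_pos: "regular e \<Longrightarrow> a < m \<Longrightarrow> prob e a > 0"
  using regularD(3,7) by (simp add: prob_def)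

lemma sum_prob: "regular e \<Longrightarrow> (\<Sum>a\<in>{..<m} - {arc_index e}. prob e a) = 1"
  unfolding prob_def sum_divide_distrib[symmetric] sum_arc_ell using regularD(3,7) by (metis divide_self less_irrefl)

lemma sum_prob_subset:
  assumes "regular e" "A \<subseteq> {..<m} - {arc_index e}" shows "sum (prob e) A \<le> 1"
  unfolding sum_prob[OF assms(1), symmetric] using assms prob_pos by (intro sum_mono2) (auto simp: less_imp_le)

lemma prob_le: "regular e \<Longrightarrow> a < m \<Longrightarrow> a \<noteq> arc_index e \<Longrightarrow> prob e a \<le> 1"
  using sum_prob_subset[of e "{a}"] by simp

lemma prob_le_compl: "regular e \<Longrightarrow> a < m \<Longrightarrow> b < m \<Longrightarrow> a \<noteq> arc_index e \<Longrightarrow> b \<noteq> arc_index e \<Longrightarrow> a \<noteq> b \<Longrightarrow> prob e a \<le> 1 - prob e b"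
  using sum_prob_subset[of e "{a, b}"] by auto

lemma prob_less: 
  assumes "regular e" "a < m" "a \<noteq> arc_index e" shows "prob e a < 1"
proof -
  note R = regularD[OF assms(1)]
  obtain b where "b \<in> {..<m} - {a, arc_index e}"
  proof -
    have "card {a, arc_index e} \<le> 2" by (simp add: card_insert_if)
    hence "card ({..<m} - {a, arc_index e}) > 0" using m3 assms(2) R(3) by (subst card_Diff_subset) auto
    thus ?thesis using that by (metis card_gt_0_iff ex_in_conv)
  qed
  thus ?thesis using prob_le_compl[OF assms(1), of a b] prob_pos[OF assms(1), of b] assms by auto
qed

lemma regular_crefl:
  assumes "regular e" "a < m" "a \<noteq> arc_index e"
  shows "regular (crefl a e)" "arc_index (crefl a e) = a" "sgn_arc a (crefl a e) > 0" "sgn_arc a e < 0"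
proof -
  note R = regularD[OF assms(1)]
  show s: "sgn_arc a e < 0" using sgn_arc_disjoint[OF R(3) assms(2) _ R(1,4)] assms(3) by simp
  show p: "sgn_arc a (crefl a e) > 0" using sgn_arc_crefl(1)[OF assms(2) R(1)] s by simp
  show "regular (crefl a e)" using norm_crefl[OF assms(2) R(1)] sgn_arc_pos_not_vertex[OF assms(2) p] by (simp add: regular_def)
  show "arc_index (crefl a e) = a" by (rule arc_index_unique[OF assms(2) norm_crefl[OF assms(2) R(1)] p])
qed

text \<open>The factors of \<open>x\<close> and \<open>y\<close> cancel, leaving one that depends on
  the base point only; ratios of lengths survive when base point and arcs are reflected
  together.\<close>

lemma ell_crefl:
  assumes "a < m" "norm e = 1" "norm x = 1" "norm y = 1"
  shows "ell (crefl a e) (crefl a x) (crefl a y) = ell e x y * (kap a e)\<^sup>2"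
  using kap_pos[OF assms(1,2)] kap_pos[OF assms(1,3)] kap_pos[OF assms(1,4)] assms
  by (auto simp: ell_def dist_crefl divide_simps power2_eq_square)

text \<open>Here \<open>v\<close> is the vertex common to the arcs \<open>b\<close> and
  \<open>c\<close>, while \<open>w\<close> and \<open>z\<close> are their far ends. The cross ratio
  of four points of the circle is real, and its sign follows from their cyclic order.\<close>

lemma neighbour_ratio:
  assumes e: "regular e" and c: "c = arc_index e" and b: "b = nxt c \<or> c = nxt b" "b < m"
    and v: "v = (if b = nxt c then \<theta> b else \<theta> c)" "w = (if b = nxt c then \<theta> c else \<theta> (nxt c))" "z = (if b = nxt c then \<theta> (nxt b) else \<theta> b)"
  shows "\<exists>r>0. (v - z) * (w - e) / ((v - w) * (z - e)) = of_real r"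
proof -
  note R = regularD[OF e]
  have cm: "c < m" using R(3) c by simp
  obtain t where t: "e = cis t" "\<alpha> c < t" "t < \<alpha> (Suc c)" using regular_angle[OF e] unfolding c by blast
  have sneg: "sin (x / 2) < 0" if "- 2 * pi < x" "x < 0" for x using sin_gt_zero[of "- x / 2"] that by simp
  have spos: "sin (x / 2) > 0" if "0 < x" "x < 2 * pi" for x using that by (intro sin_gt_zero) auto
  show ?thesis
  proof (cases "b = nxt c")
    case True
    have vv: "v = cis (\<alpha> (Suc c))" "w = cis (\<alpha> c)" "z = cis (\<alpha> (Suc (Suc c)))"
      unfolding v cis_angle using True cm by (simp_all add: mod_Suc_eq)
    have o: "\<alpha> (Suc (Suc c)) < \<alpha> c + 2 * pi" using angle_less[of "Suc (Suc c)" "c + m"] angle_period[of c] m3 by simp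
    have "sin ((\<alpha> (Suc c) - \<alpha> (Suc (Suc c))) / 2) * sin ((\<alpha> c - t) / 2) / (sin ((\<alpha> (Suc c) - \<alpha> c) / 2) * sin ((\<alpha> (Suc (Suc c)) - t) / 2)) > 0"
      using o t angle_step[of c] angle_step[of "Suc c"] pi_gt_zero
      by (intro divide_pos_pos mult_pos_pos mult_neg_neg sneg spos) linarith+
    thus ?thesis unfolding vv t(1) cis_cross_ratio by blast
  next
    case False
    hence cb: "c = nxt b" using b by blast
    have vv: "v = cis (\<alpha> (Suc b))" "w = cis (\<alpha> (Suc (Suc b)))" "z = cis (\<alpha> b)"
      unfolding v cis_angle using False cb b(2) by (simp_all add: mod_Suc_eq)
    \<comment> \<open>When \<open>b\<close> is the last arc, \<open>c\<close> is arc 0 and the angle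
      of \<open>e\<close> has to be advanced by a full turn to follow
      \<open>\<alpha> (Suc b)\<close>.\<close>
    obtain t' where t': "e = cis t'" "\<alpha> (Suc b) < t'" "t' < \<alpha> (Suc (Suc b))"
    proof (cases "Suc b = m")
      case True
      hence "c = 0" using cb by simp
      have "\<alpha> (Suc b) = \<alpha> c + 2 * pi" "\<alpha> (Suc (Suc b)) = \<alpha> (Suc c) + 2 * pi" using angle_period[of 0] angle_period[of 1] True \<open>c = 0\<close> by simp_all
      moreover have "e = cis (t + 2 * pi)" by (simp add: t(1) flip: cis_mult)
      ultimately show ?thesis using that[of "t + 2 * pi"] t by simp
    next
      case False
      hence "c = Suc b" using cb b(2) by simp
      thus ?thesis using that t by simp
    qed
    have o: "\<alpha> (Suc (Suc b)) < \<alpha> b + 2 * pi" using angle_less[of "Suc (Suc b)" "b + m"] angle_period[of b] m3 by simp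
    have "sin ((\<alpha> (Suc b) - \<alpha> b) / 2) * sin ((\<alpha> (Suc (Suc b)) - t') / 2) > 0"
      "sin ((\<alpha> (Suc b) - \<alpha> (Suc (Suc b))) / 2) * sin ((\<alpha> b - t') / 2) > 0"
      using o t' angle_step[of b] angle_step[of "Suc b"] pi_gt_zero
      by (intro mult_pos_pos mult_neg_neg sneg spos; linarith)+
    hence "sin ((\<alpha> (Suc b) - \<alpha> b) / 2) * sin ((\<alpha> (Suc (Suc b)) - t') / 2) / (sin ((\<alpha> (Suc b) - \<alpha> (Suc (Suc b))) / 2) * sin ((\<alpha> b - t') / 2)) > 0"
      by (rule divide_pos_pos)
    thus ?thesis unfolding vv t'(1) cis_cross_ratio by blast
  qed
qed

text \<open>\<open>prob e b\<close> is the cross ratio of the common vertex, the two far ends and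
  \<open>e\<close>, so \<open>cross_ratio_reflection\<close> gives the probability of bouncing
  straight back. The lower bound estimates the two chords in the denominator by 2 each.\<close>

lemma prob_neighbour:
  assumes e: "regular e" and c: "c = arc_index e" and b: "b = nxt c \<or> c = nxt b" "b < m"
  shows "prob (crefl b e) c = 1 / (2 - prob e b)"
    "prob e b \<ge> norm (\<theta> b - \<theta> (nxt b)) * norm ((if b = nxt c then \<theta> c else \<theta> (nxt c)) - e) / 4"
proof -
  note R = regularD[OF e]
  have cm: "c < m" using R(3) c by simp
  have bc: "b \<noteq> c" using b nxt_neq cm by metis
  define v where "v = (if b = nxt c then \<theta> b else \<theta> c)" 
  define w where "w = (if b = nxt c then \<theta> c else \<theta> (nxt c))"
  define z where "z = (if b = nxt c then \<theta> (nxt b) else \<theta> b)"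
  obtain r where r: "r > 0" "(v - z) * (w - e) / ((v - w) * (z - e)) = of_real r"
    using neighbour_ratio[OF e c b v_def w_def z_def] by blast
  have n: "norm v = 1" "norm w = 1" "norm z = 1" "norm e = 1" using norm_vertex norm_vertex_nxt b cm R by (auto simp: v_def w_def z_def)
  have d: "v \<noteq> w" "v \<noteq> z" "w \<noteq> e" "z \<noteq> e" "v \<noteq> e"
    using vertex_neq[OF cm] vertex_neq[OF b(2)] R(5)[OF cm] R(5)[OF b(2)] R(6)[of c] R(6)[of b] b(1) by (auto simp: v_def w_def z_def)
  have eb: "arc_ell f b = ell f v z" "arc_ell f c = ell f v w" for f
    using b by (auto simp: v_def w_def z_def ell_commute)
  have "ell e v z / ell e v w = norm (v - z) * norm (w - e) / (norm (v - w) * norm (z - e))"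
    using d by (simp add: ell_def divide_simps)
  also have "\<dots> = norm (of_real r :: complex)" unfolding r(2)[symmetric] by (simp add: norm_mult norm_divide)
  finally have pr: "prob e b = r" "prob e b = norm (v - z) * norm (w - e) / (norm (v - w) * norm (z - e))"
    unfolding prob_def c[symmetric] eb using r(1) d by (simp_all add: ell_def divide_simps)
  hence "r < 1" using prob_less[OF e b(2)] bc c by simp
  hence cr: "ell (circle_reflection v z e) v w / ell (circle_reflection v z e) v z = 1 / (2 - r)"
    using cross_ratio_reflection(2)[OF n d r(2) r(1)] by simp
  have "crefl b e = circle_reflection v z e"
    using b by (auto simp: crefl_def v_def z_def circle_reflection_commute)
  moreover have "prob (crefl b e) c = arc_ell (crefl b e) c / arc_ell (crefl b e) b"
    unfolding prob_def using regular_crefl(2)[OF e b(2)] bc c by simp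
  ultimately show "prob (crefl b e) c = 1 / (2 - prob e b)" using cr unfolding eb pr(1) by metis
  have "norm (v - w) * norm (z - e) \<le> 2 * 2" using norm_triangle_ineq4[of v w] norm_triangle_ineq4[of z e] n by (intro mult_mono) auto
  moreover have "norm (v - w) * norm (z - e) > 0" using d by simp
  ultimately have "norm (v - z) * norm (w - e) / 4 \<le> norm (v - z) * norm (w - e) / (norm (v - w) * norm (z - e))"
    by (intro divide_left_mono) auto
  moreover have "norm (v - z) = norm (\<theta> b - \<theta> (nxt b))" using b by (auto simp: v_def z_def norm_minus_commute)
  ultimately show "prob e b \<ge> norm (\<theta> b - \<theta> (nxt b)) * norm ((if b = nxt c then \<theta> c else \<theta> (nxt c)) - e) / 4"
    unfolding pr(2) w_def by simp
qed

text \<open>A base point cannot be near both ends of its arc. With \<open>s\<close> the shortest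
  side chord, one end is at distance at least \<open>s / 2\<close>, and the bound of
  \<open>prob_neighbour\<close> yields \<open>s * (s / 2) / 4\<close>.\<close>

lemma prob_neighbour_bound: "\<exists>p0>0. p0 \<le> 1 / 2 \<and> (\<forall>e. regular e \<longrightarrow> prob e (nxt (arc_index e)) \<ge> p0 \<or> prob e (prv (arc_index e)) \<ge> p0)"
proof -
  define s where "s = Min ((\<lambda>a. norm (\<theta> a - \<theta> (nxt a))) ` {..<m})"
  have s: "s \<le> norm (\<theta> a - \<theta> (nxt a))" if "a < m" for a unfolding s_def using that by (intro Min_le) auto
  have "s \<in> (\<lambda>a. norm (\<theta> a - \<theta> (nxt a))) ` {..<m}" unfolding s_def using m_pos by (intro Min_in) auto
  hence s0: "s > 0" using vertex_neq by auto
  have s2: "s \<le> 2" using s[OF m_pos] norm_triangle_ineq4[of "\<theta> 0" "\<theta> (nxt 0)"] norm_vertex[OF m_pos] norm_vertex_nxt[of 0] by linarith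
  show ?thesis
  proof (intro exI[of _ "s\<^sup>2 / 8"] conjI allI impI)
    show "s\<^sup>2 / 8 > 0" using s0 by simp
    show "s\<^sup>2 / 8 \<le> 1 / 2" using s2 s0 power_mono[of s 2 2] by simp
    fix e assume e: "regular e"
    define c where "c = arc_index e"
    have cm: "c < m" using regularD(3)[OF e] c_def by simp
    have b1: "prob e (nxt c) \<ge> norm (\<theta> (nxt c) - \<theta> (nxt (nxt c))) * norm (\<theta> c - e) / 4"
      using prob_neighbour(2)[OF e c_def, of "nxt c"] nxt_less by simp
    have b2: "prob e (prv c) \<ge> norm (\<theta> (prv c) - \<theta> (nxt (prv c))) * norm (\<theta> (nxt c) - e) / 4"
      using prob_neighbour(2)[OF e c_def, of "prv c"] prv_less nxt_prv[OF cm] prv_neq_nxt[OF cm] by simp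
    have "s \<le> norm (\<theta> c - e) + norm (\<theta> (nxt c) - e)" using s[OF cm] norm_triangle_ineq4[of "\<theta> c - e" "\<theta> (nxt c) - e"] by simp
    hence "norm (\<theta> c - e) \<ge> s / 2 \<or> norm (\<theta> (nxt c) - e) \<ge> s / 2" by linarith
    moreover have "s\<^sup>2 / 8 \<le> norm (\<theta> a - \<theta> (nxt a)) * x / 4" if "a < m" "x \<ge> s / 2" for a x
    proof -
      have "s * (s / 2) \<le> norm (\<theta> a - \<theta> (nxt a)) * x" using s[OF that(1)] that(2) s0 by (intro mult_mono) auto
      thus ?thesis by (simp add: power2_eq_square)
    qed
    ultimately show "s\<^sup>2 / 8 \<le> prob e (nxt (arc_index e)) \<or> s\<^sup>2 / 8 \<le> prob e (prv (arc_index e))"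
      using b1 b2 nxt_less[of c] prv_less[of c] unfolding c_def[symmetric] by (meson order_trans)
  qed
qed


section \<open>Cylinders\<close>

lemma circle_window:
  assumes "norm z = 1" obtains t where "z = cis t" "b \<le> t" "t < b + 2 * pi"
proof -
  have "norm (z / cis b) = 1" using assms by (simp add: norm_divide)
  hence "z / cis b = cis (Arg2pi (z / cis b))" using Arg2pi_eq[of "z / cis b"] by (simp add: cis_conv_exp)
  hence "z = cis (b + Arg2pi (z / cis b))" unfolding cis_mult[symmetric] by (metis cis_neq_zero nonzero_divide_eq_eq mult.commute)
  thus ?thesis using that[of "b + Arg2pi (z / cis b)"] Arg2pi_ge_0 Arg2pi_lt_2pi by simp
qed

lemma sgn_arc_angle:
  assumes "a < m" "\<alpha> a \<le> t" "t < \<alpha> a + 2 * pi" "sgn_arc a (cis t) \<ge> 0"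
  shows "t \<le> \<alpha> (Suc a)"
proof (rule ccontr)
  assume "\<not> t \<le> \<alpha> (Suc a)"
  hence t: "\<alpha> (Suc a) < t" by simp
  have "sin ((t - \<alpha> a) / 2) > 0" using t assms angle_step[of a] by (intro sin_gt_zero) auto
  moreover have "sin ((t - \<alpha> (Suc a)) / 2) > 0" using t assms angle_step[of a] by (intro sin_gt_zero) auto
  moreover have "sin ((\<alpha> (Suc a) - t) / 2) = - sin ((t - \<alpha> (Suc a)) / 2)" by (metis minus_diff_eq minus_divide_left sin_minus)
  ultimately have "sgn_arc a (cis t) < 0" unfolding sgn_arc_cis[OF assms(1)] using sin_half_arc[of a] by (simp add: mult_pos_pos)
  thus False using assms(4) by simp
qed

text \<open>In the cotangent coordinate with \<open>e\<close> at infinity the closed arc is a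
  bounded interval, and two of its points are no farther apart than its ends.\<close>

lemma ell_le_arc_ell:
  assumes a: "a < m" and e: "norm e = 1" "sgn_arc a e < 0" and x: "norm x = 1" "sgn_arc a x \<ge> 0" and y: "norm y = 1" "sgn_arc a y \<ge> 0"
  shows "ell e x y \<le> arc_ell e a"
proof -
  obtain u where u: "x = cis u" "\<alpha> a \<le> u" "u < \<alpha> a + 2 * pi" using circle_window[OF x(1)] by blast
  obtain v where v: "y = cis v" "\<alpha> a \<le> v" "v < \<alpha> a + 2 * pi" using circle_window[OF y(1)] by blast
  obtain b where b: "e = cis b" "\<alpha> (Suc a) - 2 * pi \<le> b" "b < \<alpha> (Suc a) - 2 * pi + 2 * pi" using circle_window[OF e(1)] by blast
  have uv: "u \<le> \<alpha> (Suc a)" "v \<le> \<alpha> (Suc a)" using sgn_arc_angle[OF a] u v x y by auto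
  have "\<not> \<alpha> a < b" using sgn_arc_pos[OF a, of b] b e(2) by auto
  moreover have "b \<noteq> \<alpha> a" "b \<noteq> \<alpha> (Suc a) - 2 * pi"
  proof -
    have 0: "sgn_arc a (\<theta> a) = 0" "sgn_arc a (\<theta> (nxt a)) = 0" using sgn_arc_eq_0_iff[OF a] norm_vertex[OF a] norm_vertex_nxt[of a] by auto
    show "b \<noteq> \<alpha> a" using 0(1) e(2) b(1) vertex_eq[OF a] by auto
    have "cis (\<alpha> (Suc a) - 2 * pi) = \<theta> (nxt a)" using vertex_nxt[OF a] by (simp flip: cis_divide)
    thus "b \<noteq> \<alpha> (Suc a) - 2 * pi" using 0(2) e(2) b(1) by auto
  qed
  ultimately have bb: "b < \<alpha> a" "\<alpha> (Suc a) < b + 2 * pi" using b by auto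
  have main: "ell e (cis u) (cis v) \<le> arc_ell e a" if "\<alpha> a \<le> u" "u \<le> v" "v \<le> \<alpha> (Suc a)" for u v
  proof -
    have E: "ell e (cis u) (cis v) = (cot ((u - b) / 2) - cot ((v - b) / 2)) / 2"
      unfolding b(1) using that bb by (intro ell_cis) auto
    have E2: "arc_ell e a = (cot ((\<alpha> a - b) / 2) - cot ((\<alpha> (Suc a) - b) / 2)) / 2"
      unfolding b(1) vertex_nxt[OF a] vertex_eq[OF a] using angle_step[of a] bb by (intro ell_cis) auto
    have "cot ((u - b) / 2) \<le> cot ((\<alpha> a - b) / 2)" "cot ((\<alpha> (Suc a) - b) / 2) \<le> cot ((v - b) / 2)"
      using that bb by (auto intro!: cot_antimono)
    thus ?thesis unfolding E E2 by simp
  qed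
  show ?thesis
  proof (cases "u \<le> v")
    case True thus ?thesis using main[of u v] u v uv by simp
  next
    case False thus ?thesis using main[of v u] u v uv ell_commute[of e x y] by simp
  qed
qed

text \<open>A chain rule: reflecting the base point with each letter makes every factor the relative
  length of an arc of order one.\<close>

primrec wprob :: "complex \<Rightarrow> nat list \<Rightarrow> real" where
  "wprob e [] = 1"
| "wprob e (a # w) = prob e a * wprob (crefl a e) w"

primrec admissible :: "complex \<Rightarrow> nat list \<Rightarrow> bool" where
  "admissible e [] \<longleftrightarrow> True"
| "admissible e (a # w) \<longleftrightarrow> a < m \<and> a \<noteq> arc_index e \<and> admissible (crefl a e) w"

text \<open>The non-strict sign conditions make cylinders closed, so that they contain their end
  points, which are images of vertices.\<close>

primrec in_cylinder :: "nat list \<Rightarrow> complex \<Rightarrow> bool" where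
  "in_cylinder [] x \<longleftrightarrow> True"
| "in_cylinder (a # w) x \<longleftrightarrow> sgn_arc a x \<ge> 0 \<and> in_cylinder w (crefl a x)"

lemma wprob_snoc: "wprob e (w @ [a]) = wprob e w * prob (crefl_word (rev w) e) a"
  by (induction w arbitrary: e) (auto simp: crefl_word_append)

lemma admissible_append: "admissible e (w @ v) \<longleftrightarrow> admissible e w \<and> admissible (crefl_word (rev w) e) v"
  by (induction w arbitrary: e) (auto simp: crefl_word_append)

lemma in_cylinder_append: "in_cylinder (w @ v) x \<longleftrightarrow> in_cylinder w x \<and> in_cylinder v (crefl_word (rev w) x)"
  by (induction w arbitrary: x) (auto simp: crefl_word_append)

lemma norm_crefl_word: "set w \<subseteq> {..<m} \<Longrightarrow> norm x = 1 \<Longrightarrow> norm (crefl_word w x) = 1"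
  by (induction w) (auto simp: norm_crefl)

lemma regular_crefl_word: "regular e \<Longrightarrow> admissible e w \<Longrightarrow> regular (crefl_word (rev w) e)"
  by (induction w arbitrary: e) (auto simp: crefl_word_append regular_crefl)

lemma wprob_pos: "regular e \<Longrightarrow> admissible e w \<Longrightarrow> wprob e w > 0"
  by (induction w arbitrary: e) (auto simp: prob_pos regular_crefl)

text \<open>Induction along the word: reflecting everything multiplies both sides by the same
  \<open>(kap a e)^2\<close>, which cancels, and \<open>prob e a\<close> is the fraction by which
  the first letter shrinks the scale.\<close>

lemma cylinder_ell_bound:
  assumes "regular e" "admissible e w" "w \<noteq> []" "norm x = 1" "norm y = 1" "in_cylinder w x" "in_cylinder w y"
  shows "ell e x y \<le> wprob e w * arc_ell e (arc_index e)"
  using assms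
proof (induction w arbitrary: e x y)
  case (Cons a w)
  have a: "a < m" "a \<noteq> arc_index e" "admissible (crefl a e) w" using Cons.prems by auto
  note R = regularD[OF Cons.prems(1)]
  note C = regular_crefl[OF Cons.prems(1) a(1,2)]
  have pe: "prob e a * arc_ell e (arc_index e) = arc_ell e a"
    unfolding prob_def using R(7)[OF R(3)] by simp
  have arc: "ell e x y \<le> arc_ell e a" using Cons.prems a C(4) R by (intro ell_le_arc_ell) auto
  show ?case
  proof (cases "w = []")
    case True thus ?thesis using arc pe by simp
  next
    case False
    have k: "(kap a e)\<^sup>2 > 0" using kap_pos[OF a(1) R(1)] by simp
    have "ell e x y * (kap a e)\<^sup>2 = ell (crefl a e) (crefl a x) (crefl a y)" using ell_crefl a R Cons.prems by simp
    also have "\<dots> \<le> wprob (crefl a e) w * arc_ell (crefl a e) (arc_index (crefl a e))"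
      by (rule Cons.IH) (use C a False Cons.prems norm_crefl in auto)
    also have "arc_ell (crefl a e) (arc_index (crefl a e)) = arc_ell e a * (kap a e)\<^sup>2"
      unfolding C(2) using ell_crefl[OF a(1) R(1) norm_vertex[OF a(1)] norm_vertex_nxt[of a]] crefl_vertex[OF a(1)] by simp
    finally have "ell e x y * (kap a e)\<^sup>2 \<le> (wprob (crefl a e) w * arc_ell e a) * (kap a e)\<^sup>2" by (simp add: mult.assoc)
    hence "ell e x y \<le> wprob (crefl a e) w * arc_ell e a" using k by (rule mult_right_le_imp_le)
    thus ?thesis unfolding pe[symmetric] by (simp add: mult_ac)
  qed
qed simp

text \<open>Built up from the last letter backwards: a point of the closed arc \<open>c\<close> is
  not inside arc \<open>b\<close> for \<open>b \<noteq> c\<close>, so reflecting it in side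
  \<open>b\<close> puts it into the closed arc \<open>b\<close>.\<close>

lemma in_cylinder_endpoint:
  assumes "regular e" "admissible e (w @ [a])" "v = \<theta> a \<or> v = \<theta> (nxt a)"
  shows "in_cylinder (w @ [a]) (crefl_word w v) \<and> norm (crefl_word w v) = 1"
  using assms(1,2)
proof (induction w arbitrary: e)
  case Nil
  hence a: "a < m" by simp
  hence "norm v = 1" using assms(3) norm_vertex norm_vertex_nxt by blast
  moreover from this have "sgn_arc a v = 0" using sgn_arc_eq_0_iff[OF a] assms(3) by blast
  ultimately show ?case by simp
next
  case (Cons b w)
  have b: "b < m" "b \<noteq> arc_index e" "admissible (crefl b e) (w @ [a])" using Cons.prems by auto
  note C = regular_crefl[OF Cons.prems(1) b(1,2)]
  define u where "u = crefl_word w v"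
  have u: "in_cylinder (w @ [a]) u" "norm u = 1" using Cons.IH[OF C(1) b(3)] by (auto simp: u_def)
  obtain c l where c: "w @ [a] = c # l" by (cases "w @ [a]") auto
  have "c < m" "c \<noteq> b" "sgn_arc c u \<ge> 0" using b(3) u(1) unfolding c by (auto simp: C(2))
  hence "sgn_arc b u \<le> 0" using sgn_arc_disjoint_weak b(1) u(2) by blast
  hence "sgn_arc b (crefl b u) \<ge> 0" using sgn_arc_crefl(2)[OF b(1) u(2)] by linarith
  thus ?case using u norm_crefl[OF b(1) u(2)] crefl_invol[OF b(1) u(2)] by (simp add: u_def)
qed

text \<open>The products decrease. A positive limit would force the factors towards one, which
  happens only when the word bounces for ever between two adjacent sides; but then the factors form
  a telescoping product of harmonic type that does tend to zero.\<close>

lemma wprob_tendsto_0: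
  assumes e: "regular e" and adm: "\<And>n. admissible e (map a [0..<n])"
  shows "(\<lambda>n. wprob e (map a [0..<n])) \<longlonglongrightarrow> 0"
proof -
  define P where "P = (\<lambda>n. wprob e (map a [0..<n]))"
  define f where "f = (\<lambda>n. crefl_word (rev (map a [0..<n])) e)"
  define q where "q = (\<lambda>n. prob (f n) (a n))"
  have reg: "regular (f n)" for n unfolding f_def by (rule regular_crefl_word[OF e adm])
  have am: "a n < m" "a n \<noteq> arc_index (f n)" for n using adm[of "Suc n"] by (auto simp: admissible_append f_def)
  have fS: "f (Suc n) = crefl (a n) (f n)" for n by (simp add: f_def)
  have idx: "arc_index (f (Suc n)) = a n" for n unfolding fS using regular_crefl(2)[OF reg am] .
  have PS: "P (Suc n) = P n * q n" for n by (simp add: P_def wprob_snoc q_def f_def)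
  have Pp: "P n > 0" for n unfolding P_def by (rule wprob_pos[OF e adm])
  have q1: "q n < 1" "q n > 0" for n unfolding q_def using prob_less[OF reg am] prob_pos[OF reg am(1)] by auto
  have "decseq P" unfolding decseq_Suc_iff PS using Pp q1 by (simp add: mult_le_cancel_left1 less_imp_le not_less)
  then obtain L where L: "P \<longlonglongrightarrow> L" "\<And>n. L \<le> P n" using decseq_convergent[of P 0] Pp less_imp_le by metis
  have "L \<ge> 0" using LIMSEQ_le_const[OF L(1), of 0] Pp less_imp_le by blast
  moreover have "\<not> L > 0"
  proof
    assume L0: "L > 0"
    have "(\<lambda>n. P (Suc n) / P n) \<longlonglongrightarrow> L / L" by (intro tendsto_divide LIMSEQ_Suc L(1)) (use L0 in auto)
    moreover have "P (Suc n) / P n = q n" for n unfolding PS using Pp[of n] by simp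
    ultimately have "q \<longlonglongrightarrow> 1" using L0 by simp
    obtain p0 where p0: "p0 > 0" "p0 \<le> 1 / 2" "\<And>e. regular e \<Longrightarrow> prob e (nxt (arc_index e)) \<ge> p0 \<or> prob e (prv (arc_index e)) \<ge> p0"
      using prob_neighbour_bound by blast
    have "1 - p0 < 1" using p0 by simp
    then obtain N where N: "\<And>n. n \<ge> N \<Longrightarrow> q n > 1 - p0"
      using order_tendstoD(1)[OF \<open>q \<longlonglongrightarrow> 1\<close>] unfolding eventually_sequentially by blast
    \<comment> \<open>A letter that is not adjacent competes with both neighbours, one of which has
      probability at least \<open>p0\<close>.\<close>
    have nb: "a n = nxt (arc_index (f n)) \<or> arc_index (f n) = nxt (a n)" if "n \<ge> N" for n
    proof (rule ccontr)
      let ?c = "arc_index (f n)"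
      assume nn: "\<not> ?thesis"
      have c: "?c < m" using regularD(3)[OF reg] .
      have ne: "a n \<noteq> nxt ?c" "a n \<noteq> prv ?c" using nn nxt_prv[OF c] by auto
      have "q n \<le> 1 - prob (f n) (nxt ?c)" "q n \<le> 1 - prob (f n) (prv ?c)" unfolding q_def
        using prob_le_compl[OF reg am(1) nxt_less am(2)] prob_le_compl[OF reg am(1) prv_less am(2)] ne nxt_neq[OF c] prv_neq[OF c] by auto
      thus False using p0(3)[OF reg[of n]] N[OF that] by linarith
    qed
    have step: "q (Suc n) = 1 / (2 - q n)" if "n \<ge> N" for n
    proof -
      let ?c = "arc_index (f n)"
      have c: "?c < m" using regularD(3)[OF reg] .
      have pc: "prob (f (Suc n)) ?c = 1 / (2 - q n)"
        unfolding fS q_def by (rule prob_neighbour(1)[OF reg refl nb[OF that] am(1)])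
      \<comment> \<open>The way back has probability above one half, so any other letter would have
        probability below \<open>1 / 2\<close>, hence below \<open>1 - p0\<close>.\<close>
      have "a (Suc n) = ?c"
      proof (rule ccontr)
        assume "a (Suc n) \<noteq> ?c"
        hence "q (Suc n) \<le> 1 - prob (f (Suc n)) ?c" unfolding q_def
          using prob_le_compl[OF reg am(1) c am(2), of "Suc n"] idx[of n] am(2)[of n] by auto
        hence "q (Suc n) \<le> 1 - 1 / (2 - q n)" unfolding pc .
        moreover have "1 / (2 - q n) > 1 / 2" using q1[of n] by (simp add: field_simps)
        ultimately show False using N[of "Suc n"] that p0 by simp
      qed
      thus ?thesis using pc by (simp add: q_def)
    qed
    \<comment> \<open>One plus the cusp depth at stage \<open>N\<close>; in this coordinate the
      recursion of \<open>step\<close> is addition of one.\<close>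
    define d where "d = 1 / (1 - q N)"
    have d1: "d > 1" unfolding d_def using q1[of N] by (simp add: field_simps)
    have qk: "q (N + k) = (d + k - 1) / (d + k)" for k
    proof (induction k)
      case 0 thus ?case unfolding d_def using q1[of N] by (simp add: field_simps)
    next
      case (Suc k)
      have "q (N + Suc k) = 1 / (2 - (d + k - 1) / (d + k))" using step[of "N + k"] Suc by simp
      also have "2 - (d + k - 1) / (d + k) = (d + k + 1) / (d + k)" using d1 by (simp add: field_simps)
      finally show ?case by (simp add: add_ac)
    qed
    have Pk: "P (N + k) = P N * (d - 1) / (d + k - 1)" for k
    proof (induction k)
      case 0 thus ?case using d1 by simp
    next
      case (Suc k)
      have "P (N + Suc k) = P N * (d - 1) / (d + k - 1) * ((d + k - 1) / (d + k))" using PS[of "N + k"] Suc qk[of k] by simp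
      moreover have "d + real k - 1 > 0" using d1 by linarith
      ultimately have "P (N + Suc k) = P N * (d - 1) / (d + real k)" by (simp only: times_divide_times_eq) simp
      moreover have "d + real (Suc k) - 1 = d + real k" by simp
      ultimately show ?case by simp
    qed
    have "(\<lambda>k. P N * (d - 1) / (d + real k - 1)) \<longlonglongrightarrow> 0"
      by (rule tendsto_divide_0[OF tendsto_const])
        (rule filterlim_at_top_imp_at_infinity, rule filterlim_at_top_mono[OF filterlim_real_sequentially], use d1 in auto)
    moreover have "(\<lambda>k. P (N + k)) \<longlonglongrightarrow> L" using LIMSEQ_ignore_initial_segment[OF L(1), of N] by (simp add: add.commute)
    ultimately show False using L0 LIMSEQ_unique unfolding Pk by fastforce
  qed
  ultimately show ?thesis using L(1) unfolding P_def by simp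
qed

lemma nonterm_regular: "nonterm z \<Longrightarrow> regular z"
  using nontermD by (simp add: regular_def)

context
  fixes p assumes p: "p \<in> S_B m \<theta>"
begin

lemma p_pair: "(fst p, snd p) \<in> S_B m \<theta>" using p by simp

lemma itinerary_map: "itinerary p n = map (letter p) [0..<n]"
  by (induction n) (auto simp: itinerary.simps[OF p])

lemma orbit_crefl_word: "fst (orbit p n) = crefl_word (rev (itinerary p n)) (fst p)" "snd (orbit p n) = crefl_word (rev (itinerary p n)) (snd p)"
  by (induction n) (auto simp: itinerary.simps[OF p] orbit_fst orbit_snd crefl_word_append)

lemma admissible_itinerary: "admissible (snd p) (itinerary p n)"
proof (induction n)
  case (Suc n)
  thus ?case using letter_less[OF p, of n] S_B_D(6)[OF orbit_S_B[OF p, of n]]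
    by (simp add: itinerary.simps[OF p] admissible_append orbit_crefl_word[symmetric])
qed (simp add: itinerary.simps[OF p])

lemma in_cylinder_itinerary: "in_cylinder (itinerary p n) (fst p)"
proof (induction n)
  case (Suc n)
  thus ?case using S_B_D(7)[OF orbit_S_B[OF p, of n]]
    by (simp add: itinerary.simps[OF p] in_cylinder_append orbit_crefl_word[symmetric])
qed (simp add: itinerary.simps[OF p])

lemma regular_snd: "regular (snd p)" using p_pair S_B_iff nonterm_regular by blast

definition end_pts :: "nat \<Rightarrow> complex \<times> complex" where
  "end_pts n = (crefl_word (itinerary p n) (\<theta> (letter p n)), crefl_word (itinerary p n) (\<theta> (nxt (letter p n))))"

lemma end_pts:
  assumes "x = fst (end_pts n) \<or> x = snd (end_pts n)"
  shows "norm x = 1" "in_cylinder (itinerary p (Suc n)) x" "fst p \<noteq> x" "snd p \<noteq> x"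
proof -
  obtain v where v: "v = \<theta> (letter p n) \<or> v = \<theta> (nxt (letter p n))" "x = crefl_word (itinerary p n) v"
    using assms by (auto simp: end_pts_def)
  have adm: "admissible (snd p) (itinerary p n @ [letter p n])" using admissible_itinerary[of "Suc n"] by (simp add: itinerary.simps[OF p])
  show nx: "norm x = 1" and "in_cylinder (itinerary p (Suc n)) x"
    using in_cylinder_endpoint[OF regular_snd adm v(1)] v(2) by (auto simp: itinerary.simps[OF p])
  have l: "letter p n < m" by (rule letter_less[OF p])
  have nv: "norm v = 1" using v(1) norm_vertex[OF l] norm_vertex_nxt by auto
  have inv: "crefl_word (rev w) (crefl_word w v) = v" if "set w \<subseteq> {..<m}" for w using that
    by (induction w) (auto simp: crefl_word_append crefl_invol norm_crefl_word nv)
  have xv: "crefl_word (rev (itinerary p n)) x = v" unfolding v(2) by (rule inv[OF itinerary_letters[OF p]])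
  note S = S_B_D[OF orbit_S_B[OF p, of n]]
  have "fst (orbit p n) \<noteq> v" "snd (orbit p n) \<noteq> v"
    using sgn_arc_eq_0_iff[OF l nv] v(1) S(7,9) by auto
  thus "fst p \<noteq> x" "snd p \<noteq> x" using xv orbit_crefl_word by auto
qed

lemma bounce_time_end_pts: "bounce_time p (Suc n) + shift p 0 = cross_time (fst (end_pts n)) (snd (end_pts n)) (fst p) (snd p)"
  unfolding bounce_time_cross[OF p] end_pts_def by simp

text \<open>Seen from the past end \<open>t\<close>, the cylinders around \<open>s\<close> shrink to
  a point, so both ends of the crossed side approach \<open>s\<close> and the logarithm in
  \<open>cross_time\<close> diverges. This holds for every pair, not only almost everywhere.\<close>

lemma bounce_time_at_top: "filterlim (bounce_time p) at_top sequentially"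
proof -
  define s t where "s = fst p" "t = snd p"
  note S = S_B_D[OF p_pair, folded s_t_def]
  note R = regularD[OF regular_snd, folded s_t_def]
  define E where "E = (\<lambda>n. wprob t (itinerary p (Suc n)) * arc_ell t (arc_index t))"
  have Ep: "E n > 0" for n unfolding E_def s_t_def
    using wprob_pos[OF regular_snd admissible_itinerary] regularD(7)[OF regular_snd regularD(3)[OF regular_snd]] by simp
  have En0: "E n \<noteq> 0" for n using Ep[of n] by simp
  have d: "norm (s - t) > 0" using S(3) by simp
  have bound: "bounce_time p (Suc n) + shift p 0 \<ge> - ln (E n * norm (s - t))" for n
  proof -
    define x y where "x = fst (end_pts n)" "y = snd (end_pts n)"
    have ne: "norm x = 1" "norm y = 1" "s \<noteq> x" "s \<noteq> y" "t \<noteq> x" "t \<noteq> y" using end_pts[of _ n] by (auto simp: x_y_def s_t_def)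
    have cyl: "in_cylinder (itinerary p (Suc n)) z" "norm z = 1" if "z \<in> {s, x, y}" for z
      using end_pts(1,2)[of _ n] in_cylinder_itinerary S(1) that by (auto simp: x_y_def s_t_def)
    have l: "ell t s z \<le> E n" if "z = x \<or> z = y" for z unfolding E_def s_t_def(2)
      using cyl[of z] cyl[of s] that by (intro cylinder_ell_bound regular_snd admissible_itinerary) (auto simp: itinerary.simps[OF p])
    have lp: "ell t s x > 0" "ell t s y > 0" using ne S(3) by (auto intro!: ell_pos)
    have "ell t s x * norm (s - t) = norm (s - x) / norm (t - x)" "ell t s y * norm (s - t) = norm (s - y) / norm (t - y)"
      using S(3) by (simp_all add: ell_def norm_minus_commute)
    hence "norm (t - x) * norm (t - y) / (norm (s - x) * norm (s - y)) = 1 / ((ell t s x * norm (s - t)) * (ell t s y * norm (s - t)))" by simp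
    also have "\<dots> \<ge> 1 / ((E n * norm (s - t)) * (E n * norm (s - t)))"
      using l lp d Ep[of n] by (intro divide_left_mono mult_mono mult_right_mono mult_pos_pos) auto
    finally have "ln (1 / ((E n * norm (s - t)) * (E n * norm (s - t)))) \<le> ln (norm (t - x) * norm (t - y) / (norm (s - x) * norm (s - y)))"
      using d Ep[of n] ne by (intro ln_mono) auto
    moreover have "ln (1 / ((E n * norm (s - t)) * (E n * norm (s - t)))) = - 2 * ln (E n * norm (s - t))"
      using d Ep[of n] by (simp add: ln_div ln_mult)
    ultimately show ?thesis unfolding bounce_time_end_pts cross_time_def x_y_def[symmetric] s_t_def[symmetric] by simp
  qed
  have "(\<lambda>n. wprob t (itinerary p n)) \<longlonglongrightarrow> 0"
    unfolding itinerary_map s_t_def by (rule wprob_tendsto_0[OF regular_snd]) (use admissible_itinerary itinerary_map in metis)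
  from tendsto_mult[OF tendsto_mult[OF LIMSEQ_Suc[OF this] tendsto_const] tendsto_const]
  have "(\<lambda>n. E n * norm (s - t)) \<longlonglongrightarrow> 0" by (simp add: E_def)
  hence "filterlim (\<lambda>n. E n * norm (s - t)) (at_right 0) sequentially"
    unfolding filterlim_at using Ep En0 d by (auto intro!: always_eventually)
  hence "filterlim (\<lambda>n. - ln (E n * norm (s - t))) at_top sequentially"
    unfolding filterlim_uminus_at_top by (simp add: filterlim_compose[OF ln_at_0])
  hence "filterlim (\<lambda>n. bounce_time p (Suc n) + shift p 0) at_top sequentially"
    by (rule filterlim_at_top_mono) (use bound in \<open>auto intro!: always_eventually\<close>)
  hence "filterlim (\<lambda>n. - shift p 0 + (bounce_time p (Suc n) + shift p 0)) at_top sequentially"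
    by (rule filterlim_tendsto_add_at_top[OF tendsto_const])
  thus ?thesis by (simp add: filterlim_sequentially_Suc)
qed

end

end

section \<open>The drift function\<close>

text \<open>The profile is \<open>\<eta> / 2 * ln (1 + r) - K + K / sqrt (1 + r)\<close> cut off at zero: the square root gains the
  required \<open>C / sqrt (1 + r)\<close> per step, and the logarithm, at cost \<open>\<eta> / 2\<close>, makes the support bounded.\<close>

lemma drift_profile:
  assumes C: "C > 0" and d: "d > 0" and \<eta>: "\<eta> > (0::real)"
  shows "\<exists>g M. M \<ge> 0 \<and> (\<forall>r. g r \<le> 0) \<and> (\<forall>r>0. r * g r \<ge> - M) \<and> (\<forall>r>0. r * (g r - g (r + 1)) \<ge> - \<eta> / 2)
     \<and> (\<forall>r\<ge>d. r * (g r - g (r + 1)) \<ge> C / sqrt (1 + r) - \<eta> / 2)"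
proof -
  \<comment> \<open>The value that makes \<open>K * r / (2 * (2 + r))\<close> at least
    \<open>C\<close> for all \<open>r \<ge> d\<close>, which is the gain demanded there; the
    consequence \<open>K \<ge> 2 * C\<close> serves the region where the profile is cut off.\<close>
  define K where "K = 2 * C * (2 + d) / d"
  have "K = 2 * C + 4 * C / d" using d by (simp add: K_def field_simps)
  hence K: "K \<ge> 2 * C" "K > 0" using C d by (simp_all add: add_pos_pos)
  define h where "h = (\<lambda>r. \<eta> / 2 * ln (1 + r) - K + K / sqrt (1 + r))"
  define g where "g = (\<lambda>r. min 0 (h r))"
  define M where "M = K * exp (2 * K / \<eta>)"
  have step: "r * (h r - h (r + 1)) \<ge> K * r / (2 * (2 + r) * sqrt (1 + r)) - \<eta> / 2" if r: "r > 0" for r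
  proof -
    define u v where "u = sqrt (1 + r)" and "v = sqrt (2 + r)"
    have uv: "u > 0" "v > 0" "v\<^sup>2 = u\<^sup>2 + 1" "u\<^sup>2 = 1 + r" "u \<le> v" using r by (auto simp: u_def v_def)
    have "1 / (2 * (2 + r) * u) = 1 / (u * v * (2 * v))" using uv by (simp add: power2_eq_square mult_ac)
    also have "\<dots> \<le> 1 / (u * v * (u + v))" using uv by (intro divide_left_mono mult_left_mono) auto
    also have "\<dots> = 1 / u - 1 / v" using uv by (simp add: divide_simps) (use uv(3) in \<open>simp add: power2_eq_square algebra_simps\<close>)
    finally have 1: "1 / (2 * (2 + r) * u) \<le> 1 / u - 1 / v" .
    have "ln ((2 + r) / (1 + r)) \<le> (2 + r) / (1 + r) - 1" using r by (intro ln_le_minus_one) simp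
    also have "\<dots> = 1 / (1 + r)" using r by (simp add: field_simps)
    finally have l: "ln (2 + r) - ln (1 + r) \<le> 1 / (1 + r)" using r by (simp add: ln_div)
    have "r * (ln (2 + r) - ln (1 + r)) \<le> r * (1 / (1 + r))" using r l by (intro mult_left_mono) auto
    also have "\<dots> \<le> 1" using r by simp
    finally have 2: "\<eta> / 2 * (r * (ln (2 + r) - ln (1 + r))) \<le> \<eta> / 2 * 1" using \<eta> by (intro mult_left_mono) auto
    have "K * r * (1 / (2 * (2 + r) * u)) \<le> K * r * (1 / u - 1 / v)" using K r 1 by (intro mult_left_mono) auto
    moreover have "r * (h r - h (r + 1)) = K * r * (1 / u - 1 / v) - \<eta> / 2 * (r * (ln (2 + r) - ln (1 + r)))"
      by (simp add: h_def u_def v_def algebra_simps)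
    ultimately show ?thesis using 2 by (simp add: u_def)
  qed
  have le: "r * (h r - h (r + 1)) \<le> r * (g r - g (r + 1))" if "r > 0" "h r \<le> 0" for r
    using that by (intro mult_left_mono) (auto simp: g_def)
  have pos: "r * (g r - g (r + 1)) \<ge> 0" if "r > 0" "h r > 0" for r
    using that by (auto simp: g_def intro!: mult_nonneg_nonpos)
  show ?thesis
  proof (intro exI[of _ g] exI[of _ M] conjI allI impI)
    show "M \<ge> 0" using K by (simp add: M_def)
    show "g r \<le> 0" for r by (simp add: g_def)
    show "r * g r \<ge> - M" if r: "r > 0" for r
    proof (cases "h r < 0")
      case True
      have "K / sqrt (1 + r) \<ge> 0" using K r by simp
      hence "\<eta> / 2 * ln (1 + r) < K" using True unfolding h_def by linarith
      hence "ln (1 + r) < 2 * K / \<eta>" using \<eta> by (simp add: field_simps)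
      hence "1 + r < exp (2 * K / \<eta>)" using r by (metis exp_less_mono exp_ln add_pos_pos zero_less_one)
      hence "K * r \<le> M" unfolding M_def using K by (intro mult_left_mono) auto
      moreover have "h r \<ge> - K" using \<eta> r \<open>K / sqrt (1 + r) \<ge> 0\<close> by (simp add: h_def)
      hence "r * h r \<ge> r * (- K)" using r by (intro mult_left_mono) auto
      ultimately show ?thesis using True by (simp add: g_def min_def mult.commute)
    next
      case False thus ?thesis using K by (simp add: g_def M_def)
    qed
    show "r * (g r - g (r + 1)) \<ge> - \<eta> / 2" if r: "r > 0" for r
    proof (cases "h r > 0")
      case True thus ?thesis using pos[OF r True] \<eta> by linarith
    next
      case False
      have "K * r / (2 * (2 + r) * sqrt (1 + r)) \<ge> 0" using K r by simp
      thus ?thesis using le[OF r] step[OF r] False by linarith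
    qed
    show "r * (g r - g (r + 1)) \<ge> C / sqrt (1 + r) - \<eta> / 2" if rd: "r \<ge> d" for r
    proof (cases "h r > 0")
      case True
      have r: "r > 0" using rd d by simp
      define y where "y = sqrt (1 + r)"
      have y: "y > 1" "1 + r = y\<^sup>2" using r by (auto simp: y_def)
      \<comment> \<open>Where the cut-off is active, \<open>ln y \<le> y - 1\<close> forces
        \<open>K / y < \<eta>\<close>, so the demanded gain \<open>C / y - \<eta> / 2\<close> is not
        positive and nothing is left to prove.\<close>
      have "\<eta> / 2 * ln (1 + r) - K + K / y > 0" using True by (simp add: h_def y_def)
      hence "\<eta> * ln y > K * (y - 1) / y" using y by (simp add: ln_realpow field_simps)
      moreover have "\<eta> * ln y \<le> \<eta> * (y - 1)" using \<eta> y by (intro mult_left_mono ln_le_minus_one) auto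
      ultimately have "(K / y) * (y - 1) < \<eta> * (y - 1)" by (simp add: field_simps)
      hence "K / y < \<eta>" by (rule mult_right_less_imp_less) (use y in auto)
      moreover have "2 * C / y \<le> K / y" using K y by (intro divide_right_mono) auto
      moreover have "2 * C / y = 2 * (C / y)" by simp
      ultimately have "C / y \<le> \<eta> / 2" by linarith
      thus ?thesis using pos[OF r True] unfolding y_def by linarith
    next
      case False
      have r: "r > 0" using rd d by simp
      have "d / (2 + d) \<le> r / (2 + r)" using d r rd by (simp add: field_simps)
      hence "C * (2 + d) / d * (d / (2 + d)) \<le> C * (2 + d) / d * (r / (2 + r))" using C d by (intro mult_left_mono) auto
      moreover have "C * (2 + d) / d * (d / (2 + d)) = C" using d by simp
      moreover have "C * (2 + d) / d * (r / (2 + r)) = K * r / (2 * (2 + r))"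
      proof -
        have "K * r / (2 * (2 + r)) = (2 * (C * (2 + d) / d * r)) / (2 * (2 + r))" by (simp add: K_def)
        also have "\<dots> = (C * (2 + d) / d * r) / (2 + r)" by (rule mult_divide_mult_cancel_left) simp
        finally show ?thesis by simp
      qed
      ultimately have "C \<le> K * r / (2 * (2 + r))" by linarith
      hence "C / sqrt (1 + r) \<le> K * r / (2 * (2 + r)) / sqrt (1 + r)" using r by (intro divide_right_mono) auto
      hence "C / sqrt (1 + r) \<le> K * r / (2 * (2 + r) * sqrt (1 + r))" by simp
      thus ?thesis using le[OF r] step[OF r] False by linarith
    qed
  qed
qed

text \<open>This is \<open>exp x - 1 \<le> x * exp x\<close> at
  \<open>x = \<delta> * ln (1 / p)\<close>: the price of lowering the exponent is
  \<open>\<delta>\<close> times an entropy term.\<close>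

lemma powr_diff_le:
  assumes p: "0 < p" "p \<le> 1" and \<delta>: "0 < \<delta>" "\<delta> \<le> (1::real)"
  shows "p powr (1 - \<delta>) - p \<le> \<delta> * ln (1 / p) * p powr (1 - \<delta>)"
proof -
  define x where "x = \<delta> * ln (1 / p)"
  have "p * exp x = exp (ln p + x)" using p by (simp add: exp_add)
  also have "ln p + x = (1 - \<delta>) * ln p" using p by (simp add: x_def ln_div algebra_simps)
  finally have "p powr (1 - \<delta>) = p * exp x" using p by (simp add: powr_def)
  moreover have "exp x - 1 \<le> x * exp x" 
  proof -
    have "1 + (- x) \<le> exp (- x)" by (rule exp_ge_add_one_self)
    hence "(1 - x) * exp x \<le> exp (- x) * exp x" by (intro mult_right_mono) auto
    thus ?thesis by (simp add: exp_minus algebra_simps)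
  qed
  ultimately have "p * (exp x - 1) \<le> p * (x * exp x)" using p by (intro mult_left_mono) auto
  thus ?thesis using \<open>p powr (1 - \<delta>) = p * exp x\<close> by (simp add: x_def algebra_simps)
qed

text \<open>The logarithm is absorbed by \<open>p powr (- 1 / 4)\<close>, which leaves the exponent
  \<open>3 / 4 - \<delta> \<ge> 1 / 2\<close>; hence the restriction on
  \<open>\<delta>\<close>.\<close>

lemma powr_diff_le_sqrt:
  assumes p: "0 < p" "p \<le> 1" and \<delta>: "0 < \<delta>" "\<delta> \<le> (1/4::real)"
  shows "p powr (1 - \<delta>) - p \<le> \<delta> * (4 * sqrt p)"
proof -
  have l0: "ln (1 / p) \<ge> 0" using p by simp
  have "ln (1 / p) = 4 * ln (p powr (- 1/4))" using p by (simp add: ln_powr ln_div)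
  also have "ln (p powr (- 1/4)) \<le> p powr (- 1/4)" using p by (intro order_trans[OF ln_le_minus_one]) auto
  finally have "ln (1 / p) \<le> 4 * p powr (- 1/4)" by simp
  hence "ln (1 / p) * p powr (1 - \<delta>) \<le> 4 * p powr (- 1/4) * p powr (1 - \<delta>)" by (intro mult_right_mono) auto
  also have "\<dots> = 4 * p powr (3/4 - \<delta>)" by (simp flip: powr_add)
  also have "p powr (3/4 - \<delta>) \<le> p powr (1/2)" using p \<delta> by (intro powr_mono') auto
  also have "p powr (1/2) = sqrt p" using p by (simp add: powr_half_sqrt)
  finally have "\<delta> * (ln (1 / p) * p powr (1 - \<delta>)) \<le> \<delta> * (4 * sqrt p)" using \<delta> by (intro mult_left_mono) auto
  moreover have "\<delta> \<le> 1" using \<delta> by simp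
  ultimately show ?thesis using powr_diff_le[OF p \<delta>(1)] unfolding mult.assoc by linarith
qed

text \<open>For a probability close to one, where the square root bound does not become small, the
  price is linear in \<open>1 - p\<close>.\<close>

lemma powr_diff_le_compl:
  assumes p: "q \<le> p" "0 < q" "p \<le> 1" and \<delta>: "0 < \<delta>" "\<delta> \<le> (1::real)"
  shows "p powr (1 - \<delta>) - p \<le> \<delta> * ((1 - p) / q)"
proof -
  have p0: "p > 0" using p by simp
  have "ln (1 / p) \<le> 1 / p - 1" using p0 by (intro ln_le_minus_one) simp
  also have "\<dots> = (1 - p) / p" using p0 by (simp add: field_simps)
  also have "\<dots> \<le> (1 - p) / q" using p by (intro divide_left_mono) auto
  finally have l: "ln (1 / p) \<le> (1 - p) / q" .
  have l0: "ln (1 / p) \<ge> 0" using p0 p by simp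
  have "p powr (1 - \<delta>) \<le> 1" using p p0 \<delta> by (simp add: powr_le1)
  hence "ln (1 / p) * p powr (1 - \<delta>) \<le> ln (1 / p) * 1" using l0 by (intro mult_left_mono) auto
  hence "\<delta> * (ln (1 / p) * p powr (1 - \<delta>)) \<le> \<delta> * ((1 - p) / q)" using l \<delta> by (intro mult_left_mono) auto
  thus ?thesis using powr_diff_le[OF p0 p(3) \<delta>] by (simp add: mult.assoc)
qed

context ideal_polygon
begin

definition depth :: "complex \<Rightarrow> nat \<Rightarrow> real" where "depth e b = prob e b / (1 - prob e b)"

lemma depth_pos: "regular e \<Longrightarrow> b < m \<Longrightarrow> b \<noteq> arc_index e \<Longrightarrow> depth e b > 0"
  using prob_pos prob_less by (simp add: depth_def)

lemma depth_prob: "regular e \<Longrightarrow> b < m \<Longrightarrow> b \<noteq> arc_index e \<Longrightarrow> prob e b * (depth e b + 1) = depth e b \<and> 1 / (1 + depth e b) = 1 - prob e b"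
  using prob_less[of e b] by (simp add: depth_def field_simps)

lemma depth_crefl:
  assumes "regular e" "b = nxt (arc_index e) \<or> arc_index e = nxt b" "b < m" "b \<noteq> arc_index e"
  shows "depth (crefl b e) (arc_index e) = depth e b + 1"
  unfolding depth_def prob_neighbour(1)[OF assms(1) refl assms(2,3)] using prob_less[OF assms(1,3,4)] by (simp add: field_simps)

text \<open>All letters other than \<open>b\<close> have probability at most
  \<open>1 - prob e b = 1 / (1 + depth e b)\<close>, whence the square root. Letter \<open>b\<close>
  itself is charged through \<open>powr_diff_le_compl\<close>; divided by \<open>\<delta>\<close>,
  the left side approximates the entropy of the probability vector.\<close>

lemma entropy_bound:
  assumes e: "regular e" and b: "b < m" "b \<noteq> arc_index e" "p0 \<le> prob e b" "p0 > 0" and \<delta>: "0 < \<delta>" "\<delta> \<le> 1/4"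
  shows "(\<Sum>a\<in>{..<m} - {arc_index e}. prob e a powr (1 - \<delta>) - prob e a) \<le> \<delta> * ((4 * real m + 1 / p0) / sqrt (1 + depth e b))"
proof -
  define s where "s = sqrt (1 - prob e b)"
  have b1: "0 < prob e b" "prob e b < 1" using prob_pos prob_less e b by auto
  have s0: "0 < s" "s \<le> 1" "1 - prob e b \<le> s" using b1 
    by (auto simp: s_def) (metis b1 diff_ge_0_iff_ge le_add_same_cancel1 less_imp_le real_le_rsqrt power2_eq_square mult_left_le add_le_imp_le_diff add.commute diff_le_eq)
  have se: "s = 1 / sqrt (1 + depth e b)"
    unfolding s_def using depth_prob[OF e b(1,2)] by (metis real_sqrt_divide real_sqrt_one)
  let ?A = "{..<m} - {arc_index e}"
  have each: "prob e a powr (1 - \<delta>) - prob e a \<le> \<delta> * ((4 + (if a = b then 1 / p0 else 0)) * s)" if a: "a \<in> ?A" for a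
  proof (cases "a = b")
    case True
    have "prob e b powr (1 - \<delta>) - prob e b \<le> \<delta> * ((1 - prob e b) / p0)"
      using b b1 \<delta> by (intro powr_diff_le_compl) auto
    also have "\<dots> \<le> \<delta> * ((4 + 1 / p0) * s)"
    proof (intro mult_left_mono)
      have "(1 - prob e b) / p0 \<le> s / p0" using s0 b by (intro divide_right_mono) auto
      also have "\<dots> \<le> (4 + 1 / p0) * s" using s0 by (simp add: algebra_simps)
      finally show "(1 - prob e b) / p0 \<le> (4 + 1 / p0) * s" .
    qed (use \<delta> in auto)
    finally show ?thesis using True by simp
  next
    case False
    have "prob e a \<le> 1 - prob e b" using prob_le_compl e a b False by auto
    hence "sqrt (prob e a) \<le> s" by (simp add: s_def)
    hence "\<delta> * (4 * sqrt (prob e a)) \<le> \<delta> * (4 * s)" using \<delta> by (intro mult_left_mono) auto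
    moreover have "prob e a powr (1 - \<delta>) - prob e a \<le> \<delta> * (4 * sqrt (prob e a))"
      using prob_pos e a prob_le[of e a] \<delta> by (intro powr_diff_le_sqrt) auto
    ultimately show ?thesis using False by simp
  qed
  have "(\<Sum>a\<in>?A. prob e a powr (1 - \<delta>) - prob e a) \<le> (\<Sum>a\<in>?A. \<delta> * ((4 + (if a = b then 1 / p0 else 0)) * s))"
    by (rule sum_mono) (rule each)
  also have "\<dots> = \<delta> * s * (\<Sum>a\<in>?A. 4 + (if a = b then 1 / p0 else 0))" by (simp add: sum_distrib_left mult_ac)
  also have "(\<Sum>a\<in>?A. 4 + (if a = b then 1 / p0 else 0)) = 4 * card ?A + 1 / p0"
    using b by (simp add: sum.distrib)
  also have "\<delta> * s * (4 * card ?A + 1 / p0) \<le> \<delta> * s * (4 * m + 1 / p0)"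
    using \<delta> s0 card_mono[of "{..<m}" ?A] by (intro mult_left_mono) auto
  finally show ?thesis by (simp add: se mult_ac)
qed

text \<open>A first-order perturbation in \<open>\<delta>\<close>: under the probability vector the
  correction \<open>\<psi>\<close> drops on average by \<open>S - \<eta>\<close>, where
  \<open>\<delta> * S\<close> bounds the entropy price, and only a second-order term remains,
  absorbed by a second \<open>\<eta>\<close>. The shift by \<open>2 * M\<close> keeps
  \<open>\<Phi>\<close> at least one.\<close>

lemma drift:
  assumes \<eta>: "\<eta> > 0"
  shows "\<exists>\<delta> \<Phi> B. 0 < \<delta> \<and> \<delta> \<le> 1/4 \<and> (\<forall>e. regular e \<longrightarrow> 1 \<le> \<Phi> e \<and> \<Phi> e \<le> B) \<and>
    (\<forall>e. regular e \<longrightarrow> (\<Sum>a\<in>{..<m} - {arc_index e}. prob e a powr (1 - \<delta>) * \<Phi> (crefl a e)) \<le> (1 + 2 * \<delta> * \<eta>) * \<Phi> e)"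
proof -
  obtain p0 where p0: "p0 > 0" "p0 \<le> 1 / 2" "\<And>e. regular e \<Longrightarrow> prob e (nxt (arc_index e)) \<ge> p0 \<or> prob e (prv (arc_index e)) \<ge> p0"
    using prob_neighbour_bound by blast
  define C where "C = 4 * real m + 1 / p0"
  have C: "C > 0" using p0 by (simp add: C_def add_nonneg_pos)
  obtain g M where g: "M \<ge> 0" "\<And>r. g r \<le> 0" "\<And>r. r > 0 \<Longrightarrow> r * g r \<ge> - M" "\<And>r. r > 0 \<Longrightarrow> r * (g r - g (r + 1)) \<ge> - \<eta> / 2"
     "\<And>r. r \<ge> p0 \<Longrightarrow> r * (g r - g (r + 1)) \<ge> C / sqrt (1 + r) - \<eta> / 2"
    using drift_profile[OF C p0(1) \<eta>] by blast
  \<comment> \<open>The factor \<open>r\<close> absorbs the probability of the bounce: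
    \<open>prob * (D + 1) = D\<close>, so \<open>prob * f (D + 1) = D * g (D + 1)\<close>, to be
    compared with \<open>f D = D * g D\<close>.\<close>
  define f where "f = (\<lambda>r. r * g r)"
  have f0: "f r \<le> 0" if "r \<ge> 0" for r using g(2)[of r] that by (simp add: f_def mult_nonneg_nonpos)
  define \<psi> where "\<psi> = (\<lambda>e. f (depth e (nxt (arc_index e))) + f (depth e (prv (arc_index e))))"
  have nb: "nxt (arc_index e) < m" "nxt (arc_index e) \<noteq> arc_index e" "prv (arc_index e) < m" "prv (arc_index e) \<noteq> arc_index e"
    "nxt (arc_index e) \<noteq> prv (arc_index e)" "nxt (prv (arc_index e)) = arc_index e" if "regular e" for e
    using nxt_less nxt_neq prv_less prv_neq prv_neq_nxt nxt_prv regularD(3)[OF that] by metis+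
  have dp: "depth e (nxt (arc_index e)) > 0" "depth e (prv (arc_index e)) > 0" if "regular e" for e
    using depth_pos[OF that] nb[OF that] by auto
  have \<psi>0: "\<psi> e \<le> 0" "- 2 * M \<le> \<psi> e" if "regular e" for e
    using f0[of "depth e (nxt (arc_index e))"] f0[of "depth e (prv (arc_index e))"] g(3)[OF dp(1)[OF that]] g(3)[OF dp(2)[OF that]] dp[OF that]
    by (auto simp: \<psi>_def f_def)
  \<comment> \<open>Small enough that the second-order term \<open>\<delta> * 2 * M * C\<close>
    stays below \<open>\<eta>\<close>; the bound 1/4 is the one required by
    \<open>powr_diff_le_sqrt\<close>.\<close>
  define \<delta> where "\<delta> = min (1/4) (\<eta> / (2 * M * C + 1))"
  have den: "2 * M * C + 1 > 0" using g(1) C by (simp add: add_nonneg_pos)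
  have \<delta>: "0 < \<delta>" "\<delta> \<le> 1/4" using den \<eta> unfolding \<delta>_def by (simp, intro min.cobounded1)
  have \<delta>2: "\<delta> * (2 * M * C) \<le> \<eta>"
  proof -
    have "\<delta> \<le> \<eta> / (2 * M * C + 1)" by (simp add: \<delta>_def)
    hence "\<delta> * (2 * M * C + 1) \<le> \<eta>" using den by (simp add: pos_le_divide_eq)
    thus ?thesis using \<delta> by (simp add: algebra_simps)
  qed
  define \<Phi> where "\<Phi> = (\<lambda>e. 1 + \<delta> * (2 * M + \<psi> e))"
  have main: "(\<Sum>a\<in>{..<m} - {arc_index e}. prob e a powr (1 - \<delta>) * \<Phi> (crefl a e)) \<le> (1 + 2 * \<delta> * \<eta>) * \<Phi> e" if e: "regular e" for e
  proof -
    let ?c = "arc_index e" let ?A = "{..<m} - {?c}"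
    define b1 b2 where "b1 = nxt ?c" and "b2 = prv ?c"
    note n = nb[OF e, folded b1_def b2_def]
    define D1 D2 where "D1 = depth e b1" and "D2 = depth e b2"
    have D: "D1 > 0" "D2 > 0" using dp[OF e] by (auto simp: D1_def D2_def b1_def b2_def)
    have rg: "regular (crefl a e)" "arc_index (crefl a e) = a" if "a \<in> ?A" for a using regular_crefl[OF e, of a] that by auto
    define E where "E = (\<Sum>a\<in>?A. prob e a powr (1 - \<delta>) - prob e a)"
    obtain b where b: "b = b1 \<or> b = b2" "prob e b \<ge> p0" using p0(3)[OF e] by (auto simp: b1_def b2_def)
    define S where "S = C / sqrt (1 + depth e b)"
    have bm: "b < m" "b \<noteq> ?c" using b n by auto
    have E: "E \<le> \<delta> * S" unfolding E_def S_def C_def by (rule entropy_bound[OF e bm b(2) p0(1) \<delta>])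
    have "depth e b \<ge> prob e b" unfolding depth_def using prob_less[OF e bm] prob_pos[OF e bm(1)] by (simp add: field_simps)
    hence db: "depth e b \<ge> p0" using b(2) by simp
    have S: "0 \<le> S" "S \<le> C" using C db p0 by (auto simp: S_def field_simps)
    have gam: "D1 * (g D1 - g (D1 + 1)) + D2 * (g D2 - g (D2 + 1)) \<ge> S - \<eta>"
      using b(1) g(4)[OF D(1)] g(4)[OF D(2)] g(5)[OF db] by (auto simp: S_def D1_def D2_def)
    have nbr: "prob e a * \<psi> (crefl a e) \<le> depth e a * g (depth e a + 1)" if a: "a = b1 \<or> a = b2" for a
    proof -
      have aA: "a \<in> ?A" using a n by auto
      have adj: "a = nxt ?c \<or> ?c = nxt a" using a n by (auto simp: b1_def)
      have "\<psi> (crefl a e) \<le> f (depth (crefl a e) ?c)"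
      proof -
        have "?c = nxt a \<or> ?c = prv a" using adj prv_nxt[OF regularD(3)[OF e]] by auto
        thus ?thesis unfolding \<psi>_def using f0 dp[OF rg(1)[OF aA]] rg(2)[OF aA] by (auto simp: less_imp_le)
      qed
      also have "depth (crefl a e) ?c = depth e a + 1" using depth_crefl[OF e adj] aA by auto
      finally have "prob e a * \<psi> (crefl a e) \<le> prob e a * f (depth e a + 1)" using prob_pos[OF e, of a] aA by (intro mult_left_mono) auto
      also have "\<dots> = (prob e a * (depth e a + 1)) * g (depth e a + 1)" by (simp add: f_def)
      also have "prob e a * (depth e a + 1) = depth e a" using depth_prob[OF e, of a] aA by auto
      finally show ?thesis .
    qed
    \<comment> \<open>Letters that are not adjacent contribute non-positive terms, as
      \<open>\<psi>\<close> is never positive, and are discarded.\<close>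
    have "(\<Sum>a\<in>?A. prob e a * \<psi> (crefl a e)) \<le> (\<Sum>a\<in>{b1, b2}. prob e a * \<psi> (crefl a e))"
    proof -
      have "(\<Sum>a\<in>?A - {b1, b2}. prob e a * \<psi> (crefl a e)) \<le> 0"
        using prob_pos[OF e] \<psi>0 rg by (intro sum_nonpos mult_nonneg_nonpos) (auto intro: less_imp_le)
      moreover have "(\<Sum>a\<in>?A. prob e a * \<psi> (crefl a e)) = (\<Sum>a\<in>?A - {b1, b2}. prob e a * \<psi> (crefl a e)) + (\<Sum>a\<in>{b1, b2}. prob e a * \<psi> (crefl a e))"
        using n by (intro sum.subset_diff) auto
      ultimately show ?thesis by linarith
    qed
    also have "\<dots> \<le> D1 * g (D1 + 1) + D2 * g (D2 + 1)" using n(5) nbr[of b1] nbr[of b2] by (simp add: D1_def D2_def)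
    also have "\<dots> \<le> \<psi> e + \<eta> - S" using gam by (simp add: \<psi>_def f_def D1_def D2_def b1_def b2_def algebra_simps)
    finally have drf: "(\<Sum>a\<in>?A. prob e a * \<psi> (crefl a e)) \<le> \<psi> e + \<eta> - S" .
    have "(\<Sum>a\<in>?A. prob e a powr (1 - \<delta>) * \<Phi> (crefl a e))
      = (\<Sum>a\<in>?A. prob e a) * (1 + \<delta> * (2 * M)) + \<delta> * (\<Sum>a\<in>?A. prob e a * \<psi> (crefl a e)) + (\<Sum>a\<in>?A. (prob e a powr (1 - \<delta>) - prob e a) * \<Phi> (crefl a e))"
      by (simp add: \<Phi>_def sum_distrib_left sum_distrib_right sum.distrib[symmetric] algebra_simps)
    also have "(\<Sum>a\<in>?A. prob e a) = 1" by (rule sum_prob[OF e])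
    also have "(\<Sum>a\<in>?A. (prob e a powr (1 - \<delta>) - prob e a) * \<Phi> (crefl a e)) \<le> (\<Sum>a\<in>?A. (prob e a powr (1 - \<delta>) - prob e a) * (1 + \<delta> * (2 * M)))"
    proof (intro sum_mono mult_left_mono)
      fix a assume a: "a \<in> ?A"
      show "\<Phi> (crefl a e) \<le> 1 + \<delta> * (2 * M)" unfolding \<Phi>_def using \<psi>0(1)[OF rg(1)[OF a]] \<delta> by simp
      have "prob e a powr 1 \<le> prob e a powr (1 - \<delta>)" using prob_pos[OF e] prob_le[OF e] a \<delta> by (intro powr_mono') (auto simp: less_imp_le)
      thus "0 \<le> prob e a powr (1 - \<delta>) - prob e a" using prob_pos[OF e, of a] a by simp
    qed
    also have "\<dots> = E * (1 + \<delta> * (2 * M))" by (simp add: E_def sum_distrib_right)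
    also have "\<dots> \<le> \<delta> * S * (1 + \<delta> * (2 * M))" using E \<delta> g(1) by (intro mult_right_mono) auto
    also have "\<dots> = \<delta> * S + \<delta> * (\<delta> * (2 * M) * S)" by (simp add: algebra_simps)
    also have "\<delta> * (2 * M) * S \<le> \<delta> * (2 * M) * C" using S \<delta> g(1) by (intro mult_left_mono) auto
    also have "\<delta> * (2 * M) * C \<le> \<eta>" using \<delta>2 by (simp add: mult_ac)
    also have "1 * (1 + \<delta> * (2 * M)) + \<delta> * (\<Sum>a\<in>?A. prob e a * \<psi> (crefl a e)) + (\<delta> * S + \<delta> * \<eta>)
       \<le> 1 + \<delta> * (2 * M) + \<delta> * (\<psi> e + \<eta> - S) + (\<delta> * S + \<delta> * \<eta>)"
      using mult_left_mono[OF drf less_imp_le[OF \<delta>(1)]] by simp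
    also have "\<dots> = \<Phi> e + 2 * \<delta> * \<eta>" by (simp add: \<Phi>_def algebra_simps)
    also have "\<dots> \<le> (1 + 2 * \<delta> * \<eta>) * \<Phi> e"
    proof -
      have "\<Phi> e \<ge> 1" using \<psi>0(2)[OF e] \<delta> by (simp add: \<Phi>_def)
      hence "2 * \<delta> * \<eta> * 1 \<le> 2 * \<delta> * \<eta> * \<Phi> e" using \<delta> \<eta> by (intro mult_left_mono) auto
      thus ?thesis by (simp add: algebra_simps)
    qed
    finally show ?thesis using \<delta> by simp
  qed
  have "1 \<le> \<Phi> e \<and> \<Phi> e \<le> 1 + \<delta> * (2 * M)" if "regular e" for e
    using \<psi>0[OF that] \<delta> by (simp add: \<Phi>_def)
  thus ?thesis using main \<delta> by blast
qed

section \<open>Weighted sums over the cylinders of a given order\<close>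

definition words :: "complex \<Rightarrow> nat \<Rightarrow> nat list set" where "words e n = {w. length w = n \<and> admissible e w}"

lemma words_0: "words e 0 = {[]}" by (auto simp: words_def)

lemma words_Suc: "words e (Suc n) = (\<Union>a\<in>{..<m} - {arc_index e}. (#) a ` words (crefl a e) n)"
  by (auto simp: words_def length_Suc_conv)

lemma finite_words: "finite (words e n)"
  by (induction n arbitrary: e) (auto simp: words_0 words_Suc)

lemma sum_words_Suc: "(\<Sum>w\<in>words e (Suc n). F w) = (\<Sum>a\<in>{..<m} - {arc_index e}. \<Sum>w\<in>words (crefl a e) n. F (a # w))"
proof -
  have "(\<Sum>w\<in>words e (Suc n). F w) = (\<Sum>a\<in>{..<m} - {arc_index e}. \<Sum>w\<in>(#) a ` words (crefl a e) n. F w)"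
    unfolding words_Suc by (intro sum.UNION_disjoint) (auto simp: finite_words)
  also have "\<dots> = (\<Sum>a\<in>{..<m} - {arc_index e}. \<Sum>w\<in>words (crefl a e) n. F (a # w))"
    by (rule sum.cong[OF refl], subst sum.reindex) auto
  finally show ?thesis .
qed

text \<open>At exponent one the topological pressure of the geometric potential vanishes together with its left
  derivative: the cusps make the invariant measure infinite.\<close>

lemma sum_wprob_powr:
  assumes \<eta>: "\<eta> > 0"
  shows "\<exists>\<delta> B. 0 < \<delta> \<and> \<delta> < 1 \<and> (\<forall>e n. regular e \<longrightarrow> (\<Sum>w\<in>words e n. wprob e w powr (1 - \<delta>)) \<le> B * (1 + 2 * \<delta> * \<eta>) ^ n)"
proof -
  obtain \<delta> \<Phi> B where \<delta>: "0 < \<delta>" "\<delta> \<le> 1/4" and \<Phi>: "\<And>e. regular e \<Longrightarrow> 1 \<le> \<Phi> e \<and> \<Phi> e \<le> B"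
    and dr: "\<And>e. regular e \<Longrightarrow> (\<Sum>a\<in>{..<m} - {arc_index e}. prob e a powr (1 - \<delta>) * \<Phi> (crefl a e)) \<le> (1 + 2 * \<delta> * \<eta>) * \<Phi> e"
    using drift[OF \<eta>] by blast
  define L where "L = 1 + 2 * \<delta> * \<eta>"
  have L: "L > 0" using \<delta> \<eta> by (simp add: L_def add_pos_pos)
  have "(\<Sum>w\<in>words e n. wprob e w powr (1 - \<delta>)) \<le> \<Phi> e * L ^ n" if "regular e" for e n
    using that
  proof (induction n arbitrary: e)
    case 0 thus ?case using \<Phi> by (simp add: words_0)
  next
    case (Suc n)
    have "(\<Sum>w\<in>words e (Suc n). wprob e w powr (1 - \<delta>))
       = (\<Sum>a\<in>{..<m} - {arc_index e}. \<Sum>w\<in>words (crefl a e) n. prob e a powr (1 - \<delta>) * wprob (crefl a e) w powr (1 - \<delta>))"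
      unfolding sum_words_Suc using prob_pos[OF Suc.prems] wprob_pos regular_crefl[OF Suc.prems]
      by (intro sum.cong refl) (auto simp: powr_mult words_def less_imp_le)
    also have "\<dots> \<le> (\<Sum>a\<in>{..<m} - {arc_index e}. prob e a powr (1 - \<delta>) * (\<Phi> (crefl a e) * L ^ n))"
      unfolding sum_distrib_left[symmetric] using Suc.IH regular_crefl[OF Suc.prems] by (intro sum_mono mult_left_mono) auto
    also have "\<dots> = (\<Sum>a\<in>{..<m} - {arc_index e}. prob e a powr (1 - \<delta>) * \<Phi> (crefl a e)) * L ^ n" by (simp add: sum_distrib_right mult.assoc)
    also have "\<dots> \<le> (L * \<Phi> e) * L ^ n" unfolding L_def using dr[OF Suc.prems] L by (intro mult_right_mono) (auto simp: L_def)
    finally show ?case by (simp add: mult_ac)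
  qed
  hence "(\<Sum>w\<in>words e n. wprob e w powr (1 - \<delta>)) \<le> B * L ^ n" if "regular e" for e n
    using that \<Phi>[OF that] L by (meson order_trans mult_right_mono zero_le_power less_imp_le)
  moreover have "\<delta> < 1" using \<delta> by simp
  ultimately show ?thesis using \<delta>(1) unfolding L_def by blast
qed

end

section \<open>Almost every trajectory\<close>

lemma norm_one_minus_i: "(norm (1 - \<i> * complex_of_real w))\<^sup>2 = 1 + w\<^sup>2"
  by (simp add: cmod_power2)

text \<open>On a bounded piece of the line the chart contracts distances by at most a constant
  factor, so a disk of radius \<open>\<rho>\<close> pulls back to a set of length of order
  \<open>\<rho>\<close>.\<close>

lemma cayley_dist:
  assumes "\<bar>w\<bar> \<le> R" "\<bar>v\<bar> \<le> R"
  shows "2 * \<bar>w - v\<bar> \<le> (1 + R\<^sup>2) * norm (cayley (of_real w) - cayley (of_real v))"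
proof -
  define a b where "a = 1 - \<i> * complex_of_real w" and "b = 1 - \<i> * complex_of_real v"
  have nz: "a \<noteq> 0" "b \<noteq> 0" by (auto simp: a_def b_def complex_eq_iff)
  have "cayley (of_real w) - cayley (of_real v) = (of_real w - \<i>) / a - (of_real v - \<i>) / b" by (simp add: cayley_def a_def b_def)
  also have "\<dots> = ((of_real w - \<i>) * b - (of_real v - \<i>) * a) / (a * b)" using nz by (simp add: diff_frac_eq)
  also have "(of_real w - \<i>) * b - (of_real v - \<i>) * a = of_real (2 * (w - v))" by (simp add: a_def b_def algebra_simps)
  finally have "norm (cayley (of_real w) - cayley (of_real v)) = \<bar>2 * (w - v)\<bar> / (norm a * norm b)"
    by (simp only: norm_divide norm_mult norm_of_real)
  hence e: "norm (cayley (of_real w) - cayley (of_real v)) * (norm a * norm b) = 2 * \<bar>w - v\<bar>"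
    using nz abs_mult[of 2 "w - v"] by simp
  have "(norm a * norm b)\<^sup>2 = (1 + w\<^sup>2) * (1 + v\<^sup>2)" unfolding power_mult_distrib a_def b_def norm_one_minus_i ..
  also have "\<dots> \<le> (1 + R\<^sup>2) * (1 + R\<^sup>2)"
    using power_mono[OF assms(1), of 2] power_mono[OF assms(2), of 2] by (intro mult_mono add_left_mono) auto
  finally have "norm a * norm b \<le> 1 + R\<^sup>2" by (intro power2_le_imp_le[of "norm a * norm b"]) (simp_all add: power2_eq_square)
  hence "norm (cayley (of_real w) - cayley (of_real v)) * (norm a * norm b) \<le> norm (cayley (of_real w) - cayley (of_real v)) * (1 + R\<^sup>2)"
    by (intro mult_left_mono) auto
  thus ?thesis unfolding e by (simp add: mult.commute)
qed

lemma continuous_cayley: "continuous_on UNIV (\<lambda>w::real. cayley (of_real w))"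
  unfolding cayley_def by (intro continuous_intros) (auto simp: complex_eq_iff)

lemma measurable_cayley [measurable]: "(\<lambda>w::real. cayley (of_real w)) \<in> borel_measurable borel"
  by (rule borel_measurable_continuous_onI[OF continuous_cayley])

definition cayley_slice :: "real \<Rightarrow> complex set \<Rightarrow> real set" where
  "cayley_slice R X = {w \<in> {-R..R}. cayley (of_real w) \<in> X}"

lemma cayley_slice_sets: "X \<in> sets borel \<Longrightarrow> cayley_slice R X \<in> sets lborel"
proof -
  assume X: "X \<in> sets borel"
  have "cayley_slice R X = (\<lambda>w::real. cayley (of_real w)) -` X \<inter> space borel \<inter> {-R..R}" by (auto simp: cayley_slice_def)
  thus ?thesis using measurable_sets[OF measurable_cayley X] by simp
qed

lemma measure_cayley_slice_cball:
  assumes "\<rho> \<ge> 0" shows "measure lborel (cayley_slice R (cball x \<rho>)) \<le> 2 * (1 + R\<^sup>2) * \<rho>"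
proof (cases "cayley_slice R (cball x \<rho>) = {}")
  case True thus ?thesis using assms by simp
next
  case False
  then obtain v where v: "v \<in> cayley_slice R (cball x \<rho>)" by blast
  define r where "r = (1 + R\<^sup>2) * \<rho>"
  have r: "r \<ge> 0" using assms by (simp add: r_def)
  have "cayley_slice R (cball x \<rho>) \<subseteq> {v - r..v + r}"
  proof
    fix w assume w: "w \<in> cayley_slice R (cball x \<rho>)"
    have "norm (cayley (of_real w) - cayley (of_real v)) \<le> 2 * \<rho>"
      using w v dist_triangle2[of "cayley (of_real w)" "cayley (of_real v)" x] by (auto simp: cayley_slice_def dist_norm norm_minus_commute)
    hence "(1 + R\<^sup>2) * norm (cayley (of_real w) - cayley (of_real v)) \<le> (1 + R\<^sup>2) * (2 * \<rho>)" by (intro mult_left_mono) auto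
    moreover have "\<bar>w\<bar> \<le> R" "\<bar>v\<bar> \<le> R" using w v by (auto simp: cayley_slice_def)
    ultimately have "\<bar>w - v\<bar> \<le> r" using cayley_dist[of w R v] by (simp add: r_def)
    thus "w \<in> {v - r..v + r}" by auto
  qed
  moreover have "{v - r..v + r} \<in> fmeasurable lborel" by (simp add: fmeasurable_def emeasure_lborel_Icc_eq)
  ultimately have "measure lborel (cayley_slice R (cball x \<rho>)) \<le> measure lborel {v - r..v + r}"
    by (intro measure_mono_fmeasurable cayley_slice_sets) auto
  moreover have "measure lborel {v - r..v + r} = 2 * (1 + R\<^sup>2) * \<rho>" using r by (simp add: r_def mult.assoc)
  ultimately show ?thesis by linarith
qed

lemma min_le_powr:
  assumes "a > 0" "b > 0" "0 \<le> \<delta>" "\<delta> \<le> (1::real)"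
  shows "min a b \<le> a powr (1 - \<delta>) * b powr \<delta>"
proof -
  have "min a b = min a b powr (1 - \<delta>) * min a b powr \<delta>" using assms by (simp flip: powr_add)
  also have "\<dots> \<le> a powr (1 - \<delta>) * b powr \<delta>" using assms by (intro mult_mono powr_mono2) auto
  finally show ?thesis .
qed

context ideal_polygon
begin

definition end1 :: "nat list \<Rightarrow> complex" where "end1 w = crefl_word (butlast w) (\<theta> (last w))"
definition end2 :: "nat list \<Rightarrow> complex" where "end2 w = crefl_word (butlast w) (\<theta> (nxt (last w)))"

text \<open>A point within \<open>exp (- \<epsilon> * n)\<close> of an end of its own cylinder is
  also within the cylinder length of it, where the factor 4 comes from \<open>dist_le_ell\<close>.
  The minimum uses both facts, since neither bound alone gives a convergent sum over all
  cylinders.\<close>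

definition rad :: "complex \<Rightarrow> real \<Rightarrow> nat list \<Rightarrow> real" where
  "rad e \<epsilon> w = min (4 * (wprob e w * arc_ell e (arc_index e))) (exp (- \<epsilon> * length w))"

text \<open>Unless \<open>s\<close> lies in \<open>bad e \<epsilon> n\<close>, the \<open>n\<close>-th bounce time is at most about \<open>\<epsilon> n\<close>.\<close>

definition bad :: "complex \<Rightarrow> real \<Rightarrow> nat \<Rightarrow> complex set" where
  "bad e \<epsilon> n = (\<Union>w\<in>words e n. cball (end1 w) (rad e \<epsilon> w) \<union> cball (end2 w) (rad e \<epsilon> w))"

lemma bad_borel [measurable]: "bad e \<epsilon> n \<in> sets borel"
  unfolding bad_def by (intro borel_closed closed_UN closed_Un closed_cball finite_words ballI)

lemma rad_nonneg: "regular e \<Longrightarrow> w \<in> words e n \<Longrightarrow> rad e \<epsilon> w \<ge> 0"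
  using wprob_pos[of e w] ell_nonneg by (auto simp: rad_def words_def less_imp_le)

lemma measure_bad:
  assumes e: "regular e"
  shows "measure lborel (cayley_slice R (bad e \<epsilon> n)) \<le> 4 * (1 + R\<^sup>2) * (\<Sum>w\<in>words e n. rad e \<epsilon> w)"
proof -
  let ?C = "\<lambda>x w. cayley_slice R (cball x (rad e \<epsilon> w))"
  have m1: "measure lborel (?C x w) \<le> 2 * (1 + R\<^sup>2) * rad e \<epsilon> w" if "w \<in> words e n" for w x
    by (rule measure_cayley_slice_cball) (rule rad_nonneg[OF e that])
  have s: "?C x w \<in> sets lborel" for x w by (rule cayley_slice_sets) auto
  have "cayley_slice R (bad e \<epsilon> n) = (\<Union>w\<in>words e n. ?C (end1 w) w \<union> ?C (end2 w) w)"
    by (auto simp: bad_def cayley_slice_def)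
  hence "measure lborel (cayley_slice R (bad e \<epsilon> n)) \<le> (\<Sum>w\<in>words e n. measure lborel (?C (end1 w) w \<union> ?C (end2 w) w))"
    using s by (simp only:) (intro measure_UNION_le finite_words sets.Un)
  also have "\<dots> \<le> (\<Sum>w\<in>words e n. 4 * (1 + R\<^sup>2) * rad e \<epsilon> w)"
  proof (rule sum_mono)
    fix w assume w: "w \<in> words e n"
    have "measure lborel (?C (end1 w) w \<union> ?C (end2 w) w) \<le> measure lborel (?C (end1 w) w) + measure lborel (?C (end2 w) w)"
      using s by (intro measure_Un_le) auto
    thus "measure lborel (?C (end1 w) w \<union> ?C (end2 w) w) \<le> 4 * (1 + R\<^sup>2) * rad e \<epsilon> w"
      using m1[OF w, of "end1 w"] m1[OF w, of "end2 w"] by (simp only: mult.assoc)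
  qed
  finally show ?thesis by (simp add: sum_distrib_left)
qed

text \<open>\<open>min_le_powr\<close> splits the minimum into a cylinder weight with exponent
  \<open>1 - \<delta>\<close> and the factor \<open>exp (- \<epsilon> * \<delta>)\<close> per
  letter. With \<open>\<eta> = \<epsilon> / 4\<close> the weighted sums grow by at most
  \<open>exp (\<epsilon> * \<delta> / 2)\<close> per letter, which leaves the ratio
  \<open>q\<close>.\<close>

lemma summable_rad:
  assumes e: "regular e" and \<epsilon>: "\<epsilon> > 0"
  shows "summable (\<lambda>n. \<Sum>w\<in>words e n. rad e \<epsilon> w)"
proof -
  have "\<epsilon> / 4 > 0" using \<epsilon> by simp
  then obtain \<delta> B where \<delta>: "0 < \<delta>" "\<delta> < 1" and B: "\<And>n. (\<Sum>w\<in>words e n. wprob e w powr (1 - \<delta>)) \<le> B * (1 + 2 * \<delta> * (\<epsilon> / 4)) ^ n"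
    using sum_wprob_powr e by blast
  define L where "L = 4 * arc_ell e (arc_index e)"
  have L: "L > 0" using regularD(7)[OF e regularD(3)[OF e]] by (simp add: L_def)
  define q where "q = exp (- \<epsilon> * \<delta> / 2)"
  have q: "0 < q" "q < 1" using \<epsilon> \<delta> by (auto simp: q_def)
  have bound: "(\<Sum>w\<in>words e n. rad e \<epsilon> w) \<le> L powr (1 - \<delta>) * B * q ^ n" for n
  proof -
    have "rad e \<epsilon> w \<le> L powr (1 - \<delta>) * wprob e w powr (1 - \<delta>) * exp (- \<epsilon> * \<delta>) ^ n" if w: "w \<in> words e n" for w
    proof -
      have p: "wprob e w > 0" "length w = n" using w wprob_pos[OF e] by (auto simp: words_def)
      have "rad e \<epsilon> w = min (L * wprob e w) (exp (- \<epsilon> * n))" by (simp add: rad_def L_def p mult_ac)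
      also have "\<dots> \<le> (L * wprob e w) powr (1 - \<delta>) * exp (- \<epsilon> * n) powr \<delta>" using L p \<delta> by (intro min_le_powr) auto
      also have "exp (- \<epsilon> * n) powr \<delta> = exp (- \<epsilon> * \<delta>) ^ n" by (simp add: powr_def exp_of_nat_mult[symmetric] mult_ac)
      also have "(L * wprob e w) powr (1 - \<delta>) = L powr (1 - \<delta>) * wprob e w powr (1 - \<delta>)" using L p by (simp add: powr_mult)
      finally show ?thesis .
    qed
    hence "(\<Sum>w\<in>words e n. rad e \<epsilon> w) \<le> (\<Sum>w\<in>words e n. L powr (1 - \<delta>) * wprob e w powr (1 - \<delta>) * exp (- \<epsilon> * \<delta>) ^ n)" by (rule sum_mono)
    also have "\<dots> = L powr (1 - \<delta>) * exp (- \<epsilon> * \<delta>) ^ n * (\<Sum>w\<in>words e n. wprob e w powr (1 - \<delta>))" by (simp add: sum_distrib_left mult_ac)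
    also have "\<dots> \<le> L powr (1 - \<delta>) * exp (- \<epsilon> * \<delta>) ^ n * (B * (1 + 2 * \<delta> * (\<epsilon> / 4)) ^ n)" using B by (intro mult_left_mono) auto
    also have "\<dots> = L powr (1 - \<delta>) * B * (exp (- \<epsilon> * \<delta>) * (1 + 2 * \<delta> * (\<epsilon> / 4))) ^ n" by (simp add: power_mult_distrib mult_ac)
    also have "\<dots> \<le> L powr (1 - \<delta>) * B * q ^ n"
    proof (intro mult_left_mono power_mono)
      have "1 + \<delta> * \<epsilon> / 2 \<le> exp (\<delta> * \<epsilon> / 2)" by (rule exp_ge_add_one_self)
      hence "exp (- \<epsilon> * \<delta>) * (1 + \<delta> * \<epsilon> / 2) \<le> exp (- \<epsilon> * \<delta>) * exp (\<delta> * \<epsilon> / 2)" by (intro mult_left_mono) auto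
      also have "\<dots> = q" unfolding q_def by (simp flip: exp_add add: algebra_simps)
      finally show "exp (- \<epsilon> * \<delta>) * (1 + 2 * \<delta> * (\<epsilon> / 4)) \<le> q" by simp
      show "0 \<le> exp (- \<epsilon> * \<delta>) * (1 + 2 * \<delta> * (\<epsilon> / 4))" using \<delta> \<epsilon> by simp
      have "0 \<le> B" using B[of 0] by (simp add: words_0)
      thus "0 \<le> L powr (1 - \<delta>) * B" by simp
    qed
    finally show ?thesis .
  qed
  have "summable (\<lambda>n. L powr (1 - \<delta>) * B * q ^ n)" using q by (intro summable_mult summable_geometric) auto
  thus ?thesis
  proof (rule summable_comparison_test')
    fix n :: nat
    have "(\<Sum>w\<in>words e n. rad e \<epsilon> w) \<ge> 0" using rad_nonneg[OF e] by (intro sum_nonneg) auto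
    thus "norm (\<Sum>w\<in>words e n. rad e \<epsilon> w) \<le> L powr (1 - \<delta>) * B * q ^ n" using bound[of n] by simp
  qed
qed

lemma AE_not_bad:
  assumes e: "regular e" and \<epsilon>: "\<epsilon> > 0"
  shows "AE w in lborel. eventually (\<lambda>n. cayley (complex_of_real w) \<notin> bad e \<epsilon> n) sequentially"
proof -
  \<comment> \<open>Neighbourhoods of the image of infinity have infinite length in the chart, so
    Borel-Cantelli is applied on each interval from \<open>- k\<close> to \<open>k\<close>.\<close>
  have "AE w in lborel. eventually (\<lambda>n. w \<in> space lborel - cayley_slice (real k) (bad e \<epsilon> n)) sequentially" for k
  proof (rule borel_cantelli_AE1)
    show "cayley_slice (real k) (bad e \<epsilon> n) \<in> sets lborel" for n by (intro cayley_slice_sets bad_borel)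
    have "cayley_slice (real k) (bad e \<epsilon> n) \<subseteq> {- real k..real k}" for n by (auto simp: cayley_slice_def)
    hence "emeasure lborel (cayley_slice (real k) (bad e \<epsilon> n)) \<le> emeasure lborel {- real k..real k}" for n by (intro emeasure_mono) auto
    thus "emeasure lborel (cayley_slice (real k) (bad e \<epsilon> n)) < \<infinity>" for n
      by (rule order_le_less_trans) simp
    show "summable (\<lambda>n. measure lborel (cayley_slice (real k) (bad e \<epsilon> n)))"
      by (rule summable_comparison_test'[OF summable_mult[OF summable_rad[OF e \<epsilon>], of "4 * (1 + (real k)\<^sup>2)"]])
        (use measure_bad[OF e] in auto)
  qed
  hence "AE w in lborel. \<forall>k. eventually (\<lambda>n. w \<in> space lborel - cayley_slice (real k) (bad e \<epsilon> n)) sequentially"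
    by (simp add: AE_all_countable)
  thus ?thesis
  proof eventually_elim
    case (elim w)
    obtain k where k: "\<bar>w\<bar> \<le> real k" using real_arch_simple by blast
    have "eventually (\<lambda>n. w \<in> space lborel - cayley_slice (real k) (bad e \<epsilon> n)) sequentially" using elim by blast
    thus ?case by eventually_elim (use k in \<open>auto simp: cayley_slice_def\<close>)
  qed
qed

text \<open>Finitely many fixed base points, one per arc, replace the past end as point of view; the
  exceptional null set then depends on the future end alone.\<close>

definition mid :: "nat \<Rightarrow> complex" where "mid c = cis ((\<alpha> c + \<alpha> (Suc c)) / 2)"

lemma mid: assumes "c < m" shows "regular (mid c)" "arc_index (mid c) = c"
proof -
  have p: "sgn_arc c (mid c) > 0" unfolding mid_def using angle_step[of c] by (intro sgn_arc_pos assms) auto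
  show "regular (mid c)" using sgn_arc_pos_not_vertex[OF assms p] by (simp add: regular_def mid_def)
  show "arc_index (mid c) = c" using arc_index_unique[OF assms _ p] by (simp add: mid_def)
qed

definition generic :: "complex \<Rightarrow> bool" where
  "generic s \<longleftrightarrow> (\<forall>c\<in>{..<m}. \<forall>j. \<exists>N. \<forall>n. N \<le> n \<longrightarrow> s \<notin> bad (mid c) (1 / real (Suc j)) n)"

lemma generic_borel: "{s. generic s} \<in> sets borel"
proof -
  have "{s \<in> space borel. generic s} \<in> sets borel" unfolding generic_def by measurable
  thus ?thesis by simp
qed

lemma AE_generic: "AE w in lborel. generic (cayley (complex_of_real w))"
proof -
  have "AE w in lborel. \<forall>j. \<exists>N. \<forall>n. N \<le> n \<longrightarrow> cayley (complex_of_real w) \<notin> bad (mid c) (1 / real (Suc j)) n" if "c \<in> {..<m}" for c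
    unfolding AE_all_countable using AE_not_bad[OF mid(1)] that by (auto simp: eventually_sequentially)
  hence "AE w in lborel. \<forall>c\<in>{..<m}. \<forall>j. \<exists>N. \<forall>n. N \<le> n \<longrightarrow> cayley (complex_of_real w) \<notin> bad (mid c) (1 / real (Suc j)) n"
    by (intro AE_finite_allI) auto
  thus ?thesis unfolding generic_def .
qed

lemma index_crefl_word_snoc: "regular e \<Longrightarrow> admissible e (w @ [a]) \<Longrightarrow> arc_index (crefl_word (rev (w @ [a])) e) = a"
  using regular_crefl(2)[OF regular_crefl_word] by (simp add: admissible_append)

text \<open>Both ends of the crossed side are farther than \<open>exp (- \<epsilon> * n)\<close>
  from \<open>s\<close> for large \<open>n\<close>, and all chords are at most 2, so the crossing
  time is at most \<open>\<epsilon> * n\<close> up to a constant.\<close>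

lemma bounce_time_sublinear:
  assumes p: "p \<in> S_B m \<theta>" and g: "generic (fst p)"
  shows "(\<lambda>n. bounce_time p n / real n) \<longlonglongrightarrow> 0"
proof -
  define s t where "s = fst p" "t = snd p"
  note S = S_B_D[OF p_pair[OF p], folded s_t_def]
  \<comment> \<open>The base point must lie outside the arc of the first letter, otherwise the
    itinerary would not be admissible from it.\<close>
  obtain c where c: "c < m" "c \<noteq> letter p 0" by (metis S(4,5,6))
  define e where "e = mid c"
  have e: "regular e" "arc_index e = c" using mid c by (auto simp: e_def)
  have adm: "admissible e (itinerary p n)" for n
  proof (induction n)
    case (Suc n)
    have "letter p n \<noteq> arc_index (crefl_word (rev (itinerary p n)) e)"
    proof (cases n)
      case 0 thus ?thesis using c e by (simp add: itinerary.simps[OF p])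
    next
      case (Suc k)
      have "arc_index (crefl_word (rev (itinerary p n)) e) = letter p k"
        using index_crefl_word_snoc[OF e(1)] Suc.IH unfolding Suc itinerary.simps[OF p] by blast
      thus ?thesis using letter_neq[OF p, of k] Suc by simp
    qed
    thus ?case using Suc letter_less[OF p] by (simp add: itinerary.simps[OF p] admissible_append)
  qed (simp add: itinerary.simps[OF p])
  have len: "length (itinerary p n) = n" for n by (simp add: itinerary_map[OF p])
  have ends: "end1 (itinerary p (Suc n)) = fst (end_pts p n)" "end2 (itinerary p (Suc n)) = snd (end_pts p n)" for n
    by (simp_all add: end1_def end2_def end_pts_def[OF p] itinerary.simps[OF p])
  have sc: "sgn_arc c s < 0" using sgn_arc_disjoint[OF S(4) c(1) _ S(1,7)] c(2) by (simp add: s_t_def)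
  \<comment> \<open>The point \<open>s\<close> and the end \<open>x\<close> share a closed cylinder,
    so a violation would bring them within both terms of \<open>rad\<close> and put \<open>s\<close>
    into the bad set.\<close>
  have far: "norm (s - x) > exp (- \<epsilon> * real (Suc n))" 
    if nb: "s \<notin> bad e \<epsilon> (Suc n)" and x: "x = fst (end_pts p n) \<or> x = snd (end_pts p n)" for \<epsilon> n x
  proof (rule ccontr)
    assume close: "\<not> norm (s - x) > exp (- \<epsilon> * real (Suc n))"
    let ?w = "itinerary p (Suc n)"
    have w: "?w \<in> words e (Suc n)" using adm len by (simp add: words_def)
    note E = end_pts[OF p x]
    have "ell e s x \<le> wprob e ?w * arc_ell e (arc_index e)"
      using in_cylinder_itinerary[OF p, of "Suc n"] E(1,2) S(1)
      by (intro cylinder_ell_bound e adm) (auto simp: s_t_def itinerary.simps[OF p])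
    moreover have "s \<noteq> e" "x \<noteq> e"
    proof -
      have pos: "sgn_arc c e > 0" using regularD(4)[OF e(1)] e(2) by simp
      show "s \<noteq> e" using sc pos by auto
      have "in_cylinder ?w e \<Longrightarrow> sgn_arc (letter p 0) e \<ge> 0" unfolding itinerary_map[OF p] upt_conv_Cons[of 0 "Suc n", OF zero_less_Suc] by simp
      moreover have "sgn_arc (letter p 0) e < 0" using sgn_arc_disjoint[OF c(1) letter_less[OF p] c(2) _ pos] regularD(1)[OF e(1)] by simp
      ultimately show "x \<noteq> e" using E(2) by auto
    qed
    hence "norm (s - x) \<le> 4 * ell e s x" using regularD(1)[OF e(1)] S(1) E(1) by (intro dist_le_ell) auto
    ultimately have "norm (s - x) \<le> rad e \<epsilon> ?w" using close by (simp add: rad_def len)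
    hence "s \<in> bad e \<epsilon> (Suc n)" unfolding bad_def using x ends[of n]
      by (intro UN_I[OF w]) (auto simp: dist_norm norm_minus_commute)
    thus False using nb by blast
  qed
  have upper: "bounce_time p (Suc n) \<le> ln 2 + \<epsilon> * real (Suc n) - shift p 0" if nb: "s \<notin> bad e \<epsilon> (Suc n)" for \<epsilon> n
  proof -
    define x y where "x = fst (end_pts p n)" "y = snd (end_pts p n)"
    define q where "q = exp (- \<epsilon> * real (Suc n))"
    define E where "E = \<epsilon> * real (Suc n)"
    have f: "norm (s - x) > q" "norm (s - y) > q" using far[OF nb] by (auto simp: x_y_def q_def)
    have q: "q > 0" by (simp add: q_def)
    have nx: "norm x = 1" "norm y = 1" "t \<noteq> x" "t \<noteq> y" 
      using end_pts(1,4)[OF p, of x n] end_pts(1,4)[OF p, of y n] by (simp_all add: x_y_def s_t_def)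
    have "norm (t - x) * norm (t - y) \<le> 2 * 2" using norm_triangle_ineq4[of t x] norm_triangle_ineq4[of t y] nx S(2) by (intro mult_mono) auto
    hence "norm (t - x) * norm (t - y) / (norm (s - x) * norm (s - y)) \<le> (2 * 2) / (q * q)"
      using mult_mono[OF less_imp_le[OF f(1)] less_imp_le[OF f(2)]] q by (intro frac_le) auto
    hence "ln (norm (t - x) * norm (t - y) / (norm (s - x) * norm (s - y))) \<le> ln ((2 * 2) / (q * q))"
      using f q nx by (intro ln_mono) (auto intro!: divide_pos_pos mult_pos_pos)
    also have "(2 * 2) / (q * q) = (2 / q)\<^sup>2" by (simp add: power2_eq_square)
    also have "ln ((2 / q)\<^sup>2) = 2 * (ln 2 - ln q)" using q by (simp add: ln_realpow ln_div del: power_divide)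
    also have "ln q = - E" by (simp add: q_def E_def)
    finally have "bounce_time p (Suc n) + shift p 0 \<le> ln 2 + E"
      unfolding bounce_time_end_pts[OF p, of n] cross_time_def x_y_def[symmetric] s_t_def[symmetric] by simp
    thus ?thesis unfolding E_def[symmetric] by linarith
  qed
  have "\<exists>N. \<forall>n\<ge>N. norm (bounce_time p n / real n - 0) < r" if r: "r > 0" for r
  proof -
    obtain j where j: "inverse (real (Suc j)) < r / 2" using reals_Archimedean[of "r / 2"] r by auto
    define \<epsilon> where "\<epsilon> = 1 / real (Suc j)"
    have \<epsilon>: "\<epsilon> < r / 2" using j by (simp add: \<epsilon>_def inverse_eq_divide)
    obtain N where N: "\<And>n. N \<le> n \<Longrightarrow> s \<notin> bad e \<epsilon> n" using g c unfolding generic_def e_def \<epsilon>_def s_t_def by blast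
    obtain K where K: "2 * \<bar>ln 2 - shift p 0\<bar> / r < real K" using reals_Archimedean2 by blast
    show ?thesis
    proof (intro exI[of _ "Suc (N + K)"] allI impI)
      fix n assume n: "n \<ge> Suc (N + K)"
      then obtain k where k: "n = Suc k" by (cases n) auto
      have "s \<notin> bad e \<epsilon> (Suc k)" using N[of n] n k by simp
      hence up: "bounce_time p n \<le> ln 2 + \<epsilon> * real n - shift p 0" using upper k by blast
      have "real K \<le> real n" "real n > 0" using n by auto
      hence "2 * \<bar>ln 2 - shift p 0\<bar> / r < real n" using K by linarith
      hence lk: "2 * \<bar>ln 2 - shift p 0\<bar> < real n * r" using r by (simp add: pos_divide_less_eq)
      have "2 * \<bar>a\<bar> < b \<Longrightarrow> a < b / 2" for a b :: real by linarith
      from this[OF lk] have "ln 2 - shift p 0 < (real n * r) / 2" .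
      moreover have "(real n * r) / 2 = r / 2 * real n" by simp
      ultimately have lk: "ln 2 - shift p 0 < r / 2 * real n" by metis
      have "\<epsilon> * real n \<le> r / 2 * real n" using \<epsilon> by (intro mult_right_mono) auto
      moreover have "x \<le> a + b - c \<Longrightarrow> a - c < d \<Longrightarrow> b \<le> d \<Longrightarrow> x < d + d" for x a b c d :: real by linarith
      ultimately have "bounce_time p n < r / 2 * real n + r / 2 * real n" using up lk by blast
      hence "bounce_time p n < r * real n" by simp
      moreover have "bounce_time p n \<ge> 0"
        using bounce_time_mono[OF p] bounce_time_0[OF p] by (metis strict_mono_less_eq zero_le)
      ultimately show "norm (bounce_time p n / real n - 0) < r" using \<open>0 < real n\<close> by (simp add: pos_divide_less_eq)
    qed
  qed
  thus ?thesis unfolding LIMSEQ_def dist_norm by blast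
qed

section \<open>Measurability, and transfer to the invariant measure\<close>

lemma part_arc_borel: assumes "a < m" shows "part_arc m \<theta> a \<in> sets borel"
proof -
  have "part_arc m \<theta> a = cis ` {\<alpha> a..\<alpha> (Suc a)} - {\<theta> (nxt a)}"
  proof (intro equalityI subsetI)
    fix z assume "z \<in> part_arc m \<theta> a"
    then obtain t where t: "z = cis t" "\<alpha> a \<le> t" "t < \<alpha> (Suc a)" using part_arc_iff[OF assms] by blast
    moreover have "cis t \<noteq> cis (\<alpha> (Suc a))" using cis_inj_window[of t "\<alpha> (Suc a)"] t arc_length[of a] by auto
    ultimately show "z \<in> cis ` {\<alpha> a..\<alpha> (Suc a)} - {\<theta> (nxt a)}" unfolding vertex_nxt[OF assms] by auto
  next
    fix z assume "z \<in> cis ` {\<alpha> a..\<alpha> (Suc a)} - {\<theta> (nxt a)}"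
    then obtain t where t: "z = cis t" "\<alpha> a \<le> t" "t \<le> \<alpha> (Suc a)" "z \<noteq> cis (\<alpha> (Suc a))" unfolding vertex_nxt[OF assms] by auto
    hence "t \<noteq> \<alpha> (Suc a)" by blast
    with t show "z \<in> part_arc m \<theta> a" using part_arc_iff[OF assms] by force
  qed
  moreover have "closed (cis ` {\<alpha> a..\<alpha> (Suc a)})"
    by (intro compact_imp_closed compact_continuous_image continuous_intros compact_Icc)
  ultimately show ?thesis by (simp add: sets.Diff borel_closed)
qed

text \<open>The boundary map has finitely many branches, each of them inverted by a reflection, so
  iterated preimages of the finitely many vertices are countable.\<close>

lemma countable_terminating: "countable {z. norm z = 1 \<and> B_terminating m \<theta> z}"
proof -
  define T where "T = (\<lambda>h. {z. norm z = 1 \<and> (B_map m \<theta> ^^ h) z \<in> verts})"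
  have "countable (T h)" for h
  proof (induction h)
    case 0
    have "T 0 \<subseteq> verts" by (auto simp: T_def)
    thus ?case by (rule countable_subset) (simp add: countable_finite)
  next
    case (Suc h)
    have "T (Suc h) \<subseteq> (\<Union>a\<in>{..<m}. crefl a ` T h)"
    proof
      fix z assume z: "z \<in> T (Suc h)"
      define a where "a = arc_index z"
      have a: "a < m" "norm z = 1" using z arc_index_props by (auto simp: T_def a_def)
      have "crefl a z \<in> T h" using z norm_crefl[OF a] unfolding T_def funpow_Suc_right comp_def B_map_eq a_def by auto
      thus "z \<in> (\<Union>a\<in>{..<m}. crefl a ` T h)" using a crefl_invol[OF a] by (metis UN_I image_eqI lessThan_iff)
    qed
    thus ?case by (rule countable_subset) (use Suc in auto)
  qed
  hence "countable (\<Union>h. T h)" by auto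
  moreover have "{z. norm z = 1 \<and> B_terminating m \<theta> z} \<subseteq> (\<Union>h. T h)" by (auto simp: T_def B_terminating_def)
  ultimately show ?thesis by (rule countable_subset[rotated])
qed

lemma S_B_borel: "S_B m \<theta> \<in> sets borel"
proof -
  define X where "X = (\<lambda>a. part_arc m \<theta> a - {z. norm z = 1 \<and> B_terminating m \<theta> z})"
  have X: "X a \<in> sets borel" if "a < m" for a
    unfolding X_def using part_arc_borel[OF that] sets.countable[OF _ countable_terminating, of borel] by (intro sets.Diff) auto
  have "S_B m \<theta> = (\<Union>a\<in>{..<m}. \<Union>b\<in>{..<m} - {a}. X a \<times> X b)"
    unfolding S_B_def X_def using sgn_arc_part_arc(1) by auto
  moreover have "X a \<times> X b \<in> sets borel" if "a < m" "b < m" for a b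
    unfolding borel_prod[symmetric] using X that by (intro pair_measureI) auto
  ultimately show ?thesis by (auto intro!: sets.finite_UN)
qed

text \<open>Genericity concerns the first coordinate only, so Fubini lifts it to pairs; the density,
  the chart and the restriction to \<open>S_B\<close> then preserve almost sure statements.\<close>

lemma AE_mean_free_path:
  "AE (s, t) in mu_tilde m \<theta>. has_mean_free_path m \<theta> (billiard_trajectory m \<theta> s t) 0"
proof -
  let ?f = "\<lambda>(w, a). (cayley (complex_of_real w), cayley (complex_of_real a))"
  have f: "?f \<in> borel_measurable borel"
    by (rule borel_measurable_continuous_onI)
      (auto simp: case_prod_beta intro!: continuous_intros continuous_on_compose2[OF continuous_cayley])
  have f': "?f \<in> measurable geodesic_measure borel" using f by (simp add: geodesic_measure_def)
  have G: "{p. generic (fst p)} \<in> sets (borel :: (complex \<times> complex) measure)"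
  proof -
    have "fst \<in> borel_measurable (borel :: (complex \<times> complex) measure)"
      by (intro borel_measurable_continuous_onI continuous_intros)
    from measurable_sets[OF this generic_borel] show ?thesis by (simp add: vimage_def)
  qed
  have lb: "AE p in lborel. generic (cayley (complex_of_real (fst (p :: real \<times> real))))"
  proof -
    have "AE p in lborel \<Otimes>\<^sub>M lborel. generic (cayley (complex_of_real (fst (p :: real \<times> real))))"
    proof (rule lborel_pair.AE_pair_measure)
      have "(\<lambda>p::real \<times> real. cayley (complex_of_real (fst p))) \<in> borel_measurable (lborel \<Otimes>\<^sub>M lborel)" by measurable
      from measurable_sets[OF this generic_borel]
      show "{x \<in> space (lborel \<Otimes>\<^sub>M lborel). generic (cayley (complex_of_real (fst (x :: real \<times> real))))} \<in> sets (lborel \<Otimes>\<^sub>M lborel)"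
        by (simp add: vimage_def Int_def conj_commute)
      show "AE x in lborel. AE y in lborel. generic (cayley (complex_of_real (fst (x, y))))"
        using AE_generic by eventually_elim simp
    qed
    thus ?thesis unfolding lborel_prod .
  qed
  have "AE p in geodesic_measure. generic (fst (?f p))"
    unfolding geodesic_measure_def
  proof (subst AE_density)
    have "(\<lambda>(w, a). ennreal (1 / (w - a)\<^sup>2)) \<in> borel_measurable (borel :: (real \<times> real) measure)"
      unfolding borel_prod[symmetric] by measurable
    thus "(\<lambda>(w, a). ennreal (1 / (w - a)\<^sup>2)) \<in> borel_measurable lborel" by simp
    show "AE p in lborel. 0 < (case p of (w, a) \<Rightarrow> ennreal (1 / (w - a)\<^sup>2)) \<longrightarrow> generic (fst (?f p))"
      using lb by eventually_elim (simp add: case_prod_beta)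
  qed
  hence "AE p in distr geodesic_measure borel ?f. generic (fst p)"
    by (subst AE_distr_iff[OF f']) (use G in auto)
  hence "AE p in distr geodesic_measure borel ?f. p \<in> S_B m \<theta> \<longrightarrow> has_mean_free_path m \<theta> (billiard_trajectory m \<theta> (fst p) (snd p)) 0"
  proof eventually_elim
    case (elim p)
    thus ?case using has_mean_free_pathI[OF _ bounce_time_at_top bounce_time_sublinear] by blast
  qed
  hence "AE p in mu_tilde m \<theta>. has_mean_free_path m \<theta> (billiard_trajectory m \<theta> (fst p) (snd p)) 0"
    unfolding mu_tilde_def using S_B_borel by (subst AE_restrict_space_iff) auto
  thus ?thesis by (simp add: case_prod_beta)
qed

end

section \<open>Periodic trajectories and words in the reflection matrices\<close>

lemma mat2_mult:
  fixes A B :: "complex^2^2"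
  shows "(A ** B) $ i $ j = A $ i $ 1 * B $ 1 $ j + A $ i $ 2 * B $ 2 $ j"
  by (simp add: matrix_matrix_mult_def sum_2)

lemma mat2_vec: fixes A :: "complex^2^2" shows "(A *v x) $ i = A $ i $ 1 * x $ 1 + A $ i $ 2 * x $ 2"
  by (simp add: matrix_vector_mult_def sum_2)

lemma trace2: "trace (A :: complex^2^2) = A $ 1 $ 1 + A $ 2 $ 2" by (simp add: trace_def sum_2)

lemma eigenvalue_iff:
  fixes M :: "complex^2^2"
  shows "(\<exists>v. v \<noteq> 0 \<and> M *v v = c *s v) \<longleftrightarrow> c\<^sup>2 - trace M * c + det M = 0"
proof -
  have "(M - mat c) *v v = M *v v - c *s v" for v :: "complex^2"
    by (simp add: vec_eq_iff mat2_vec forall_2 mat_def algebra_simps)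
  hence "(\<exists>v. v \<noteq> 0 \<and> M *v v = c *s v) \<longleftrightarrow> (\<exists>v. (M - mat c) *v v = 0 \<and> v \<noteq> 0)" by auto
  also have "\<dots> \<longleftrightarrow> \<not> invertible (M - mat c)"
    using matrix_left_invertible_ker[of "M - mat c"] invertible_left_inverse[of "M - mat c"] by blast
  also have "\<dots> \<longleftrightarrow> det (M - mat c) = 0" by (simp add: invertible_det_nz)
  also have "det (M - mat c) = c\<^sup>2 - trace M * c + det M"
    by (simp add: det_2 trace2 mat_def power2_eq_square algebra_simps)
  finally show ?thesis .
qed

lemma spectral_radius_roots:
  "\<exists>r s. trace M = r + s \<and> det M = r * s \<and> (\<forall>c. (\<exists>v. v \<noteq> 0 \<and> M *v v = c *s v) \<longleftrightarrow> c = r \<or> c = s)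
    \<and> spectral_radius M = max (norm r) (norm s)"
proof -
  define q where "q = csqrt ((trace M)\<^sup>2 - 4 * det M)"
  define r s where "r = (trace M + q) / 2" and "s = (trace M - q) / 2"
  have q: "q\<^sup>2 = (trace M)\<^sup>2 - 4 * det M" by (simp add: q_def)
  have t: "trace M = r + s" by (simp add: r_def s_def field_simps)
  have d: "det M = r * s"
  proof -
    have "r * s = ((trace M)\<^sup>2 - q\<^sup>2) / 4" by (simp add: r_def s_def field_simps power2_eq_square)
    thus ?thesis by (simp add: q)
  qed
  have "c\<^sup>2 - trace M * c + det M = (c - r) * (c - s)" for c by (simp add: t d power2_eq_square algebra_simps)
  hence ev: "(\<exists>v. v \<noteq> 0 \<and> M *v v = c *s v) \<longleftrightarrow> c = r \<or> c = s" for c unfolding eigenvalue_iff by simp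
  have "{norm c | c. \<exists>v. v \<noteq> 0 \<and> M *v v = c *s v} = {norm r, norm s}" unfolding ev by auto
  hence "spectral_radius M = max (norm r) (norm s)" by (simp add: spectral_radius_def)
  thus ?thesis using t d ev by blast
qed

lemma spectral_radius_cong: "trace M = trace N \<Longrightarrow> det M = det N \<Longrightarrow> spectral_radius M = spectral_radius N"
  unfolding spectral_radius_def eigenvalue_iff by simp

lemma norm_trace_le: "norm (trace M) \<le> 2 * spectral_radius M"
proof -
  obtain r s where "trace M = r + s" "spectral_radius M = max (norm r) (norm s)" using spectral_radius_roots[of M] by blast
  thus ?thesis using norm_triangle_ineq[of r s] by simp
qed

definition pvec :: "complex \<Rightarrow> complex^2" where "pvec z = vector [z, 1]"

lemma pvec_nth: "pvec z $ 1 = z" "pvec z $ 2 = 1" by (simp_all add: pvec_def)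
lemma pvec_nonzero: "pvec z \<noteq> 0" by (metis pvec_nth(2) zero_index zero_neq_one)

lemma reflection_matrix_nth:
  "reflection_matrix x y $ 1 $ 1 = - (x + y) / (x - y)" "reflection_matrix x y $ 1 $ 2 = 2 * x * y / (x - y)"
  "reflection_matrix x y $ 2 $ 1 = - 2 / (x - y)" "reflection_matrix x y $ 2 $ 2 = (x + y) / (x - y)"
  by (simp_all add: reflection_matrix_def mat2_mult mat_def divide_inverse algebra_simps)

lemma det_reflection_matrix: "x \<noteq> y \<Longrightarrow> det (reflection_matrix x y) = - 1"
proof -
  assume "x \<noteq> y"
  hence d: "x - y \<noteq> 0" by simp
  have "det (reflection_matrix x y) = (- (x + y) * (x + y) + 4 * x * y) / ((x - y) * (x - y))"
    unfolding det_2 reflection_matrix_nth using d by (simp add: divide_simps)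
  also have "- (x + y) * (x + y) + 4 * x * y = - ((x - y) * (x - y))" by (simp add: algebra_simps)
  finally show ?thesis using d by simp
qed

lemma reflection_matrix_square: "x \<noteq> y \<Longrightarrow> reflection_matrix x y ** reflection_matrix x y = mat 1"
proof -
  assume "x \<noteq> y"
  hence d: "x - y \<noteq> 0" by simp
  have e: "(x + y) * (x + y) - 4 * x * y = (x - y) * (x - y)" by (simp add: algebra_simps)
  have "(reflection_matrix x y ** reflection_matrix x y) $ 1 $ 1 = ((x + y) * (x + y) - 4 * x * y) / ((x - y) * (x - y))"
    "(reflection_matrix x y ** reflection_matrix x y) $ 2 $ 2 = ((x + y) * (x + y) - 4 * x * y) / ((x - y) * (x - y))"
    unfolding mat2_mult reflection_matrix_nth using d by (simp_all add: divide_simps) (simp_all add: algebra_simps)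
  moreover have "(reflection_matrix x y ** reflection_matrix x y) $ 1 $ 2 = 0" "(reflection_matrix x y ** reflection_matrix x y) $ 2 $ 1 = 0"
    unfolding mat2_mult reflection_matrix_nth using d by (simp_all add: divide_simps) (simp_all add: algebra_simps)
  ultimately show ?thesis unfolding vec_eq_iff forall_2 e using d by (simp add: mat_def)
qed

lemma reflection_matrix_pvec:
  assumes "norm x = 1" "norm y = 1" "x \<noteq> y" "norm z = 1"
  shows "\<exists>c. reflection_matrix x y *v pvec z = c *s pvec (circle_reflection x y z) \<and> norm c = kappa x y z"
proof (intro exI[of _ "(x + y - 2 * z) / (x - y)"] conjI)
  have d: "2 * z - (x + y) \<noteq> 0" "x - y \<noteq> 0" using refl_den_nonzero[OF assms] assms by auto
  have "(x + y - 2 * z) * circle_reflection x y z = - ((x + y) * z - 2 * x * y)"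
  proof -
    have "x + y - 2 * z = - (2 * z - (x + y))" by simp
    thus ?thesis unfolding circle_reflection_def using d by (simp only: mult_minus_left) simp
  qed
  thus "reflection_matrix x y *v pvec z = ((x + y - 2 * z) / (x - y)) *s pvec (circle_reflection x y z)"
    using d by (simp add: vec_eq_iff forall_2 mat2_vec reflection_matrix_nth pvec_nth divide_simps) (simp add: algebra_simps)
  show "norm ((x + y - 2 * z) / (x - y)) = kappa x y z" by (simp add: kappa_def norm_divide norm_minus_commute)
qed

text \<open>The Hermitian form of signature (1,1) whose isotropic lines are the points of the unit
  circle in homogeneous coordinates.\<close>

definition herm :: "complex^2 \<Rightarrow> real" where "herm v = (norm (v $ 1))\<^sup>2 - (norm (v $ 2))\<^sup>2"

lemma herm_reflection_matrix:
  assumes "norm x = 1" "norm y = 1" "x \<noteq> y"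
  shows "herm (reflection_matrix x y *v v) = - herm v"
proof -
  define a b where "a = v $ 1" and "b = v $ 2"
  have d: "norm (x - y) \<noteq> 0" using assms by simp
  have 1: "(reflection_matrix x y *v v) $ 1 = (2 * x * y * b - (x + y) * a) / (x - y)" "(reflection_matrix x y *v v) $ 2 = ((x + y) * b - 2 * a) / (x - y)"
    using assms(3) by (simp_all add: mat2_vec reflection_matrix_nth a_def b_def divide_simps) (simp_all add: algebra_simps)
  have "complex_of_real ((norm (2 * x * y * b - (x + y) * a))\<^sup>2 - (norm ((x + y) * b - 2 * a))\<^sup>2) = of_real (- ((norm (x - y))\<^sup>2 * herm v))"
    unfolding herm_def a_def[symmetric] b_def[symmetric] of_real_minus of_real_mult of_real_diff complex_norm_square
      complex_cnj_diff complex_cnj_add complex_cnj_mult complex_cnj_numeral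
    using norm1_cnj[OF assms(1)] norm1_cnj[OF assms(2)] by algebra
  hence "(norm (2 * x * y * b - (x + y) * a))\<^sup>2 - (norm ((x + y) * b - 2 * a))\<^sup>2 = - ((norm (x - y))\<^sup>2 * herm v)"
    using of_real_eq_iff by blast
  thus ?thesis unfolding herm_def[of "_ *v _"] 1 norm_divide power_divide diff_divide_distrib[symmetric] using d by simp
qed

text \<open>A common point at parameter \<open>w\<close> means
  \<open>exp (2 * w) *\<^sub>R X + Y = 0\<close> for the differences of the light vectors; two
  different parameters leave only \<open>X = Y = 0\<close>.\<close>

lemma geo_segment_unique:
  assumes "norm s = 1" "norm t = 1" "s \<noteq> t" "norm s' = 1" "norm t' = 1" "s' \<noteq> t'"
    and eq: "geo s t u = geo s' t' (u + d)" "geo s t v = geo s' t' (v + d)" and uv: "u < v"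
  shows "s = s'" "t = t'"
proof -
  define X where "X = (1 / norm (s - t)) *\<^sub>R light s - (exp d / norm (s' - t')) *\<^sub>R light s'"
  define Y where "Y = (1 / norm (s - t)) *\<^sub>R light t - (exp (- d) / norm (s' - t')) *\<^sub>R light t'"
  have XY: "exp w *\<^sub>R X + exp (- w) *\<^sub>R Y = 0" if "geo s t w = geo s' t' (w + d)" for w
    using lift_geo[OF assms(1-3), of w] lift_geo[OF assms(4-6), of "w + d"] that
    by (simp add: X_def Y_def exp_add scaleR_add_right scaleR_diff_right exp_diff exp_minus field_simps algebra_simps)
  have Y: "Y = - (exp (2 * w) *\<^sub>R X)" if "geo s t w = geo s' t' (w + d)" for w
  proof -
    have "exp w *\<^sub>R (exp w *\<^sub>R X + exp (- w) *\<^sub>R Y) = 0" using XY[OF that] by simp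
    hence "exp (2 * w) *\<^sub>R X + Y = 0" by (simp add: scaleR_add_right flip: exp_add)
    thus ?thesis by (metis add.commute eq_neg_iff_add_eq_0)
  qed
  have "exp (2 * u) *\<^sub>R X = exp (2 * v) *\<^sub>R X" using Y[OF eq(1)] Y[OF eq(2)] by (metis neg_equal_iff_equal)
  hence X0: "X = 0" using uv by auto
  hence Y0: "Y = 0" using Y[OF eq(1)] by simp
  have "snd X = 0" "fst X = 0" "snd Y = 0" "fst Y = 0" using X0 Y0 by simp_all
  hence "1 / norm (s - t) = exp d / norm (s' - t')" "(1 / norm (s - t)) *\<^sub>R s = (exp d / norm (s' - t')) *\<^sub>R s'"
    "1 / norm (s - t) = exp (- d) / norm (s' - t')" "(1 / norm (s - t)) *\<^sub>R t = (exp (- d) / norm (s' - t')) *\<^sub>R t'"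
    by (simp_all add: X_def Y_def light_def)
  moreover have "1 / norm (s - t) \<noteq> 0" using assms by simp
  ultimately show "s = s'" "t = t'" by (metis scaleR_cancel_left)+
qed

lemma linear_growth_limit:
  fixes T :: "nat \<Rightarrow> real"
  assumes k: "k \<ge> 1" and T: "\<And>n. T (n + k) = T n + c"
  shows "(\<lambda>n. T n / real n) \<longlonglongrightarrow> c / real k"
proof -
  define f where "f = (\<lambda>n. T n - c / real k * real n)"
  have per: "f (n + k) = f n" for n unfolding f_def T using k by (simp add: field_simps)
  have pf: "f n = f (n mod k)" for n
  proof -
    have "f (i + j * k) = f i" for i j
    proof (induction j)
      case (Suc j) thus ?case using per[of "i + j * k"] by (simp add: add_ac)
    qed simp
    from this[of "n mod k" "n div k"] show ?thesis by simp
  qed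
  define K where "K = Max ((\<lambda>i. norm (f i)) ` {..<k})"
  have K: "norm (f n) \<le> K" for n
  proof -
    have "norm (f (n mod k)) \<le> K" unfolding K_def using k by (intro Max_ge) auto
    thus ?thesis using pf[of n] by metis
  qed
  have "(\<lambda>n. K * (1 / real n)) \<longlonglongrightarrow> K * 0" by (intro tendsto_intros lim_1_over_n)
  hence K0: "(\<lambda>n. K * (1 / real n)) \<longlonglongrightarrow> 0" by simp
  have "norm (f n * (1 / real n)) \<le> K * (1 / real n)" for n
    unfolding norm_mult using mult_right_mono[OF K[of n], of "1 / real n"] by simp
  hence "(\<lambda>n. f n * (1 / real n)) \<longlonglongrightarrow> 0"
    by (intro Lim_null_comparison[OF _ K0] always_eventually allI)
  hence "(\<lambda>n. f n * (1 / real n) + c / real k) \<longlonglongrightarrow> 0 + c / real k" by (intro tendsto_add tendsto_const)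
  hence "(\<lambda>n. f n * (1 / real n) + c / real k) \<longlonglongrightarrow> c / real k" by simp
  moreover have "eventually (\<lambda>n. f n * (1 / real n) + c / real k = T n / real n) sequentially"
    using eventually_gt_at_top[of 0] by eventually_elim (simp add: f_def field_simps)
  ultimately show ?thesis by (rule Lim_transform_eventually)
qed

context ideal_polygon
begin

section \<open>Products of reflection matrices along words\<close>

definition rmat :: "nat \<Rightarrow> complex^2^2" where "rmat a = reflection_matrix (\<theta> a) (\<theta> (nxt a))"

definition mat_word :: "nat list \<Rightarrow> complex^2^2" where "mat_word w = foldr (\<lambda>a M. rmat a ** M) w (mat 1)"

lemma mat_word_Nil [simp]: "mat_word [] = mat 1" and mat_word_Cons [simp]: "mat_word (a # w) = rmat a ** mat_word w"
  by (simp_all add: mat_word_def)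

lemma mat_word_append: "mat_word (v @ w) = mat_word v ** mat_word w"
  by (induction v) (simp_all add: matrix_mul_assoc)

lemma det_mat_word: "set w \<subseteq> {..<m} \<Longrightarrow> norm (det (mat_word w)) = 1"
  by (induction w) (auto simp: det_mul rmat_def det_reflection_matrix vertex_neq norm_mult)

lemma rmat_square: "a < m \<Longrightarrow> rmat a ** rmat a = mat 1"
  unfolding rmat_def by (rule reflection_matrix_square[OF vertex_neq])

primrec kap_word :: "nat list \<Rightarrow> complex \<Rightarrow> real" where
  "kap_word [] z = 1"
| "kap_word (a # w) z = kap a (crefl_word w z) * kap_word w z"

lemma kap_word_pos: "set w \<subseteq> {..<m} \<Longrightarrow> norm z = 1 \<Longrightarrow> kap_word w z > 0"
  by (induction w) (auto simp: kap_pos norm_crefl_word)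

lemma mat_word_pvec:
  "set w \<subseteq> {..<m} \<Longrightarrow> norm z = 1 \<Longrightarrow> \<exists>c. mat_word w *v pvec z = c *s pvec (crefl_word w z) \<and> norm c = kap_word w z"
proof (induction w)
  case Nil thus ?case by (intro exI[of _ 1]) simp
next
  case (Cons a w)
  then obtain c where c: "mat_word w *v pvec z = c *s pvec (crefl_word w z)" "norm c = kap_word w z" by auto
  have a: "a < m" "norm (crefl_word w z) = 1" using Cons.prems norm_crefl_word by auto
  obtain d where d: "rmat a *v pvec (crefl_word w z) = d *s pvec (crefl a (crefl_word w z))" "norm d = kap a (crefl_word w z)"
    unfolding rmat_def crefl_def kap_def
    using reflection_matrix_pvec[OF norm_vertex[OF a(1)] norm_vertex_nxt vertex_neq[OF a(1)] a(2)] by blast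
  have "mat_word (a # w) *v pvec z = (c * d) *s pvec (crefl_word (a # w) z)"
    by (simp add: c d matrix_vector_mul_assoc[symmetric] vector_scalar_commute vector_smult_assoc)
  thus ?case using c d by (intro exI[of _ "c * d"]) (simp add: norm_mult mult.commute)
qed

lemma herm_mat_word: "set w \<subseteq> {..<m} \<Longrightarrow> \<bar>herm (mat_word w *v v)\<bar> = \<bar>herm v\<bar>"
proof (induction w)
  case (Cons a w)
  thus ?case unfolding mat_word_Cons matrix_vector_mul_assoc[symmetric] rmat_def
    using herm_reflection_matrix[OF norm_vertex norm_vertex_nxt vertex_neq] by auto
qed simp

context
  fixes p assumes p: "p \<in> S_B m \<theta>"
begin

abbreviation (input) rev_it :: "nat \<Rightarrow> nat list" where "rev_it n \<equiv> rev (itinerary p n)"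

lemma shift_kap_word: "shift p n = shift p 0 + ln (kap_word (rev_it n) (fst p)) - ln (kap_word (rev_it n) (snd p))"
proof (induction n)
  case (Suc n)
  have l: "letter p n < m" "set (rev_it n) \<subseteq> {..<m}" using letter_less[OF p] itinerary_letters[OF p] by auto
  have n: "norm (fst p) = 1" "norm (snd p) = 1" using norm_orbit[OF p, of 0] by auto
  have pos: "kap_word (rev_it n) (fst p) > 0" "kap_word (rev_it n) (snd p) > 0" using kap_word_pos l n by auto
  have "kap (letter p n) (fst (orbit p n)) > 0" "kap (letter p n) (snd (orbit p n)) > 0" using kap_pos l norm_orbit[OF p] by auto
  thus ?case unfolding shift.simps(2) using Suc pos
    by (simp add: itinerary.simps[OF p] orbit_crefl_word[OF p, symmetric] ln_mult)
qed (simp add: itinerary.simps[OF p])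

context
  fixes k :: nat assumes k: "k \<ge> 1" and per: "orbit p k = p"
begin

lemma orbit_periodic: "orbit p (n + k) = orbit p n"
proof (induction n)
  case (Suc n)
  have "orbit p (Suc (n + k)) = orbit p (Suc n)" unfolding orbit.simps(2) Suc ..
  thus ?case by simp
qed (simp add: per)

lemma bounce_time_periodic: "bounce_time p (n + k) = bounce_time p n + bounce_time p k" "bounce_time p k = shift p 0 - shift p k"
proof -
  have s: "shift p (n + k) = shift p k + (shift p n - shift p 0)" for n
  proof (induction n)
    case (Suc n)
    have "shift p (Suc (n + k)) = shift p k + (shift p (Suc n) - shift p 0)" unfolding shift.simps(2) Suc orbit_periodic by simp
    thus ?case by simp
  qed simp
  show e: "bounce_time p k = shift p 0 - shift p k" unfolding bounce_time_def per by simp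
  show "bounce_time p (n + k) = bounce_time p n + bounce_time p k"
    unfolding e unfolding bounce_time_def orbit_periodic s by simp
qed

text \<open>Both ends are fixed by the word, hence give eigenvectors whose eigenvalues have the
  \<open>kap_word\<close> values as moduli. The time of one period is the difference of their
  logarithms; as the determinant has modulus one, the moduli are inverse to each other, whence the
  factor 2.\<close>

lemma spectral_radius_periodic: "bounce_time p k = 2 * ln (spectral_radius (mat_word (rev_it k)))" "spectral_radius (mat_word (rev_it k)) > 1"
proof -
  let ?M = "mat_word (rev_it k)"
  have l: "set (rev_it k) \<subseteq> {..<m}" using itinerary_letters[OF p] by auto
  have n: "norm (fst p) = 1" "norm (snd p) = 1" using norm_orbit[OF p, of 0] by auto
  have fx: "crefl_word (rev_it k) (fst p) = fst p" "crefl_word (rev_it k) (snd p) = snd p"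
    using orbit_crefl_word[OF p, of k] per by simp_all
  obtain c where c: "?M *v pvec (fst p) = c *s pvec (fst p)" "norm c = kap_word (rev_it k) (fst p)"
    using mat_word_pvec[OF l n(1)] fx by auto
  obtain d where d: "?M *v pvec (snd p) = d *s pvec (snd p)" "norm d = kap_word (rev_it k) (snd p)"
    using mat_word_pvec[OF l n(2)] fx by auto
  have pos: "norm c > 0" "norm d > 0" using kap_word_pos[OF l] n c d by auto
  have b: "bounce_time p k = ln (norm d) - ln (norm c)" unfolding bounce_time_periodic(2) using shift_kap_word[of k] c d by simp
  have "bounce_time p k > 0" using bounce_time_0[OF p] bounce_time_mono[OF p] k by (metis strict_mono_less zero_less_one less_le_trans)
  hence cd: "norm c < norm d" using b pos by simp
  obtain r s where rs: "det ?M = r * s" "\<And>c. (\<exists>v. v \<noteq> 0 \<and> ?M *v v = c *s v) \<longleftrightarrow> c = r \<or> c = s"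
    "spectral_radius ?M = max (norm r) (norm s)" using spectral_radius_roots[of ?M] by auto
  have "c = r \<or> c = s" "d = r \<or> d = s" using rs(2) c(1) d(1) pvec_nonzero by blast+
  hence sr: "spectral_radius ?M = norm d" "norm c * norm d = 1" using cd rs(1,3) det_mat_word[OF l] by (auto simp: norm_mult mult.commute)
  have "norm c = 1 / norm d" using sr(2) pos by (simp add: field_simps)
  hence "ln (norm c) = - ln (norm d)" using pos by (simp add: ln_div)
  thus bb: "bounce_time p k = 2 * ln (spectral_radius ?M)" using b sr by simp
  hence "ln (spectral_radius ?M) > 0" using \<open>bounce_time p k > 0\<close> by simp
  thus "spectral_radius ?M > 1" using sr pos by (simp add: ln_gt_zero_iff)
qed

lemma periodic_orbit_mean_free_path:
  "has_mean_free_path m \<theta> (billiard_trajectory m \<theta> (fst p) (snd p)) (2 * ln (spectral_radius (mat_word (rev_it k))) / k)"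
  using linear_growth_limit[OF k, of "bounce_time p" "bounce_time p k", OF bounce_time_periodic(1)] unfolding spectral_radius_periodic(1)
  by (rule has_mean_free_pathI[OF p bounce_time_at_top[OF p]])

lemma periodic_orbit_trajectory: "periodic (billiard_trajectory m \<theta> (fst p) (snd p))"
  unfolding periodic_def
proof (intro exI[of _ "bounce_time p k"] conjI allI)
  show "bounce_time p k > 0" using spectral_radius_periodic by simp
  fix u
  note S = S_B_D[OF p_pair[OF p]]
  have "refl_word (rev_it k) (geo (fst p) (snd p) (u + bounce_time p k + shift p 0)) = geo (fst p) (snd p) (u + shift p 0)"
    unfolding refl_word_geo[OF p] per bounce_time_periodic(2) by simp
  hence "table_proj m \<theta> (geo (fst p) (snd p) (u + shift p 0)) = table_proj m \<theta> (geo (fst p) (snd p) (u + bounce_time p k + shift p 0))"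
    using table_proj_refl_word[of "rev_it k" "geo (fst p) (snd p) (u + bounce_time p k + shift p 0)"] itinerary_letters[OF p] geo_in_disk[OF S(1,2,3)] by simp
  thus "billiard_trajectory m \<theta> (fst p) (snd p) (u + bounce_time p k) = billiard_trajectory m \<theta> (fst p) (snd p) u"
    unfolding billiard_trajectory_eq[OF p_pair[OF p]] shift.simps(1) by simp
qed

lemma periodic_orbit_in: "2 * ln (spectral_radius (mat_word (rev_it k))) / k \<in> periodic_mean_free_paths m \<theta>"
  unfolding periodic_mean_free_paths_def using p_pair[OF p] periodic_orbit_trajectory periodic_orbit_mean_free_path by blast

end

text \<open>Periodicity is known only for the projected path. Translation by the period maps two
  consecutive bounces to two consecutive bounces, so the geodesic pieces between them agree, and a
  piece determines its ends.\<close>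

lemma periodic_trajectory_orbit:
  assumes "periodic (billiard_trajectory m \<theta> (fst p) (snd p))"
  shows "\<exists>k\<ge>1. orbit p k = p"
proof -
  let ?b = "billiard_trajectory m \<theta> (fst p) (snd p)" let ?T = "bounce_time p" let ?S = "\<Union>a<m. side m \<theta> a"
  obtain P where P: "P > 0" "\<And>t. ?b (t + P) = ?b t" using assms unfolding periodic_def by blast
  note top = bounce_time_at_top[OF p] and mono = bounce_time_mono[OF p]
  have onS: "?b t \<in> ?S \<longleftrightarrow> (\<exists>n\<ge>1. t = ?T n)" if "t > 0" for t
    using bounce_set[OF p top, of t] that by (auto simp: set_eq_iff)
  have pos: "?T n > 0" if "n \<ge> 1" for n using bounce_time_0[OF p] mono that by (metis strict_mono_less zero_less_one less_le_trans)
  have Ts: "\<exists>j\<ge>1. ?T n + P = ?T j" if "n \<ge> 1" for n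
  proof -
    have "?b (?T n + P) \<in> ?S" unfolding P(2) using onS[OF pos[OF that]] that by blast
    moreover have "?T n + P > 0" using pos[OF that] P(1) by simp
    ultimately show ?thesis using onS by blast
  qed
  \<comment> \<open>Bounces 1 and 2 are compared, not 0 and 1: the description of bounces covers
    positive times only, and the entry at time 0 is not among them.\<close>
  obtain j where j: "j \<ge> 1" "?T 1 + P = ?T j" using Ts[of 1] by auto
  obtain i where i: "i \<ge> 1" "?T 2 + P = ?T i" using Ts[of 2] by auto
  have "?T 1 < ?T j" using j P by linarith
  hence j1: "1 < j" using mono by (simp add: strict_mono_less)
  have T12: "?T 1 < ?T 2" using mono by (simp add: strict_mono_less)
  have "?T j < ?T i" using i j T12 by linarith
  hence ji: "Suc j \<le> i" using mono by (simp add: strict_mono_less)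
  have "i = Suc j"
  proof (rule ccontr)
    assume "i \<noteq> Suc j"
    hence lt: "?T j < ?T (Suc j)" "?T (Suc j) < ?T i" using ji mono by (simp_all add: strict_mono_less)
    define u where "u = ?T (Suc j) - P"
    have u: "?T 1 < u" "u < ?T 2" using lt i j by (auto simp: u_def)
    have "?b u \<in> ?S" using P(2)[of u] onS[of "?T (Suc j)"] pos[of "Suc j"] by (auto simp: u_def)
    then obtain n where n: "u = ?T n" using onS[of u] u(1) pos[of 1] by auto
    hence "1 < n" "n < 2" using u mono by (simp_all add: strict_mono_less)
    thus False by simp
  qed
  hence Tj: "?T (Suc j) = ?T 2 + P" using i by simp
  obtain s t where o1: "orbit p 1 = (s, t)" by (cases "orbit p 1")
  obtain s' t' where oj: "orbit p j = (s', t')" by (cases "orbit p j")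
  note S1 = S_B_D[OF orbit_S_B[OF p, of 1], unfolded o1 fst_conv snd_conv]
  note Sj = S_B_D[OF orbit_S_B[OF p, of j], unfolded oj fst_conv snd_conv]
  have eq: "geo s t (u + shift p 1) = geo s' t' (u + shift p 1 + (P + shift p j - shift p 1))" if "?T 1 \<le> u" "u \<le> ?T 2" for u
  proof -
    have "?b u = geo s t (u + shift p 1)" using trajectory_eq[OF p, of 1 u] that o1 by (simp add: numeral_2_eq_2)
    moreover have "?b (u + P) = geo s' t' (u + P + shift p j)" using trajectory_eq[OF p, of j "u + P"] that oj j Tj by simp
    ultimately show ?thesis using P(2)[of u] by (simp add: algebra_simps)
  qed
  have "s = s'" "t = t'"
    using geo_segment_unique[OF S1(1,2,3) Sj(1,2,3) eq[of "?T 1"] eq[of "?T 2"]] T12 by auto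
  hence o: "orbit p 1 = orbit p j" using o1 oj by simp
  obtain k where k: "j = Suc k" "k \<ge> 1" using j1 by (cases j) auto
  have oo: "orbit p (Suc 0) = orbit p (Suc k)" using o k by simp
  \<comment> \<open>To get from \<open>orbit p 1\<close> back to \<open>p\<close>, the last
    reflection is undone; its letter is recorded in the arc of the past end, so it is the same on
    both sides.\<close>
  define a where "a = letter p 0"
  have a: "letter p k = a" using orbit_snd_index[OF p, of 0] orbit_snd_index[OF p, of k] oo by (simp add: a_def)
  have am: "a < m" unfolding a_def by (rule letter_less[OF p])
  have "fst (orbit p 0) = fst (orbit p k)" "snd (orbit p 0) = snd (orbit p k)"
    using orbit_fst[of p 0] orbit_fst[of p k] orbit_snd[of p 0] orbit_snd[of p k] oo a a_def crefl_inj[OF am] norm_orbit[OF p] by metis+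
  hence "orbit p k = p" by (simp add: prod_eq_iff)
  thus ?thesis using k(2) by blast
qed

end

lemma periodic_mean_free_paths_subset:
  assumes "l \<in> periodic_mean_free_paths m \<theta>"
  shows "\<exists>w. w \<noteq> [] \<and> set w \<subseteq> {..<m} \<and> spectral_radius (mat_word w) > 1 \<and> l = 2 * ln (spectral_radius (mat_word w)) / length w"
proof -
  obtain s t where st: "(s, t) \<in> S_B m \<theta>" "periodic (billiard_trajectory m \<theta> s t)" "has_mean_free_path m \<theta> (billiard_trajectory m \<theta> s t) l"
    using assms unfolding periodic_mean_free_paths_def by blast
  obtain k where k: "k \<ge> 1" "orbit (s, t) k = (s, t)" using periodic_trajectory_orbit[OF st(1)] st(2) by auto
  let ?w = "rev (itinerary (s, t) k)"
  have h: "has_mean_free_path m \<theta> (billiard_trajectory m \<theta> s t) (2 * ln (spectral_radius (mat_word ?w)) / k)"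
    using periodic_orbit_mean_free_path[OF st(1) k] by simp
  have "l = 2 * ln (spectral_radius (mat_word ?w)) / k"
    by (rule tendsto_unique[OF trivial_limit_at_top_linorder st(3)[unfolded has_mean_free_path_def] h[unfolded has_mean_free_path_def]])
  moreover have "length ?w = k" by (simp add: itinerary_map[OF st(1)])
  moreover have "set ?w \<subseteq> {..<m}" using itinerary_letters[OF st(1)] by simp
  ultimately show ?thesis using spectral_radius_periodic(2)[OF st(1) k] k(1) by (intro exI[of _ ?w]) auto
qed

end

section \<open>Coding of periodic trajectories\<close>

lemma spectral_radius_le:
  assumes "\<And>c v. v \<noteq> 0 \<Longrightarrow> M *v v = c *s v \<Longrightarrow> norm c \<le> B"
  shows "spectral_radius M \<le> B"
proof -
  obtain r s where rs: "\<And>c. (\<exists>v. v \<noteq> 0 \<and> M *v v = c *s v) \<longleftrightarrow> c = r \<or> c = s" "spectral_radius M = max (norm r) (norm s)"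
    using spectral_radius_roots[of M] by auto
  thus ?thesis using assms by (metis max.bounded_iff)
qed

lemma smult_pvec_eq_iff: "c *s pvec z = d *s pvec w \<longleftrightarrow> c = d \<and> (c = 0 \<or> z = w)"
  by (auto simp: vec_eq_iff forall_2 pvec_nth)

text \<open>Consecutive sides share a vertex, so the factor \<open>y - z\<close> cancels and the
  trace is a multiple of one cross ratio of the four vertices.\<close>

lemma trace_three_reflections:
  assumes "x \<noteq> y" "y \<noteq> z" "z \<noteq> w"
  shows "trace (reflection_matrix x y ** (reflection_matrix y z ** reflection_matrix z w)) = - 4 * ((x - z) * (y - w) / ((x - y) * (z - w)))"
proof -
  have d: "x - y \<noteq> 0" "y - z \<noteq> 0" "z - w \<noteq> 0" using assms by auto
  have q: "a / (x - y) * (b / (y - z) * (c / (z - w))) = a * b * c / ((x - y) * (y - z) * (z - w))" for a b c by (simp add: mult.assoc)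
  have "trace (reflection_matrix x y ** (reflection_matrix y z ** reflection_matrix z w))
     = (- 4 * (x - z) * (y - w) * (y - z)) / ((x - y) * (y - z) * (z - w))"
    unfolding trace2 mat2_mult reflection_matrix_nth distrib_left q add_divide_distrib[symmetric]
    by (rule arg_cong[of _ _ "\<lambda>t. t / ((x - y) * (y - z) * (z - w))"]) (simp add: algebra_simps)
  also have "\<dots> = - 4 * ((x - z) * (y - w) / ((x - y) * (z - w)))" using d by (simp add: divide_simps) (simp add: algebra_simps)
  finally show ?thesis .
qed

lemma not_distinct_adj: "\<not> distinct_adj w \<Longrightarrow> \<exists>u a v. w = u @ a # a # v"
proof (induction w)
  case (Cons b w)
  show ?case
  proof (cases "distinct_adj w")
    case True
    then obtain v where "w = b # v" using Cons.prems by (cases w) (auto simp: distinct_adj_Cons)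
    thus ?thesis by (intro exI[of _ "[]"]) auto
  next
    case False
    then obtain u a v where "w = u @ a # a # v" using Cons.IH by blast
    thus ?thesis by (intro exI[of _ "b # u"]) auto
  qed
qed simp

lemma trace_commute2: "trace (A ** B) = trace (B ** (A :: complex^2^2))"
  by (simp add: trace2 mat2_mult algebra_simps)

context ideal_polygon
begin

definition code_seq :: "(nat \<Rightarrow> nat) \<Rightarrow> (nat \<Rightarrow> complex) \<Rightarrow> bool" where
  "code_seq a z \<longleftrightarrow> (\<forall>i. a i < m \<and> a (Suc i) \<noteq> a i) \<and> (\<forall>i. norm (z i) = 1 \<and> z (Suc i) = crefl (a i) (z i))"

lemma code_seqD:
  assumes "code_seq a z"
  shows "a i < m" "a (Suc i) \<noteq> a i" "norm (z i) = 1" "z (Suc i) = crefl (a i) (z i)"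
  using assms unfolding code_seq_def by blast+

lemma in_cylinder_code:
  assumes "code_seq a z" "\<And>i. sgn_arc (a i) (z i) \<ge> 0"
  shows "in_cylinder (map a [i..<i + n]) (z i)"
proof (induction n arbitrary: i)
  case (Suc n)
  have "map a [i..<i + Suc n] = a i # map a [Suc i..<Suc i + n]" by (subst upt_conv_Cons) auto
  thus ?case using assms(2)[of i] Suc.IH[of "Suc i"] code_seqD(4)[OF assms(1), of i] by simp
qed simp

lemma admissible_code:
  assumes "\<And>i. a i < m \<and> a (Suc i) \<noteq> a i" "regular e" "arc_index e \<noteq> a i"
  shows "admissible e (map a [i..<i + n])"
  using assms(2,3)
proof (induction n arbitrary: i e)
  case (Suc n)
  have "map a [i..<i + Suc n] = a i # map a [Suc i..<Suc i + n]" by (subst upt_conv_Cons) auto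
  moreover have "a i < m" "a (Suc i) \<noteq> a i" using assms(1) by auto
  ultimately show ?case using Suc.IH[of "crefl (a i) e" "Suc i"] regular_crefl[OF Suc.prems(1), of "a i"] Suc.prems(2) by auto
qed simp

text \<open>Both points lie in all cylinders of the sequence, and these shrink when seen from a base
  point outside the first arc.\<close>

lemma coding_unique:
  assumes z: "code_seq a z" "\<And>i. sgn_arc (a i) (z i) \<ge> 0" and y: "code_seq a y" "\<And>i. sgn_arc (a i) (y i) \<ge> 0"
  shows "z 0 = y 0"
proof -
  define c where "c = (if a 0 = 0 then 1 else 0 :: nat)"
  have c: "c < m" "c \<noteq> a 0" using m3 by (auto simp: c_def)
  define e where "e = mid c"
  have e: "regular e" "arc_index e = c" using mid[OF c(1)] by (auto simp: e_def)
  have am: "\<And>i. a i < m \<and> a (Suc i) \<noteq> a i" using code_seqD[OF z(1)] by blast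
  have adm: "admissible e (map a [0..<n])" for n using admissible_code[of a e 0 n, OF am e(1)] e(2) c by simp
  define L where "L = arc_ell e (arc_index e)"
  have "(\<lambda>n. wprob e (map a [0..<Suc n]) * L) \<longlonglongrightarrow> 0 * L"
    by (intro tendsto_mult tendsto_const LIMSEQ_Suc[OF wprob_tendsto_0[OF e(1) adm]])
  moreover have "ell e (z 0) (y 0) \<le> wprob e (map a [0..<Suc n]) * L" for n
    unfolding L_def using in_cylinder_code[OF z, of 0 "Suc n"] in_cylinder_code[OF y, of 0 "Suc n"] code_seqD[OF z(1)] code_seqD[OF y(1)]
    by (intro cylinder_ell_bound e adm) auto
  ultimately have "ell e (z 0) (y 0) \<le> 0" using LIMSEQ_le_const by fastforce
  hence 0: "ell e (z 0) (y 0) = 0" using ell_nonneg[of e "z 0" "y 0"] by simp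
  have "sgn_arc c e > 0" using regularD(4)[OF e(1)] e(2) by simp
  hence "sgn_arc (a 0) e < 0" using sgn_arc_disjoint[OF c(1) _ c(2)] am[of 0] regularD(1)[OF e(1)] by simp
  hence "z 0 \<noteq> e" "y 0 \<noteq> e" using z(2)[of 0] y(2)[of 0] by auto
  thus ?thesis using 0 by (auto simp: ell_def)
qed

text \<open>Points that are always outside their arc are expanded in the reverse direction: read
  backwards, the reflections bring them into their arcs, and forward uniqueness applies to the
  reversed cycle.\<close>

lemma coding_unique_backward:
  assumes z: "code_seq a z" "\<And>i. sgn_arc (a i) (z i) < 0" and y: "code_seq a y" "\<And>i. sgn_arc (a i) (y i) < 0"
    and k: "k \<ge> 2" and per: "\<And>i. a (i + k) = a i" "\<And>i. z (i + k) = z i" "\<And>i. y (i + k) = y i"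
  shows "z 0 = y 0"
proof -
  \<comment> \<open>Modulo \<open>k\<close> the index \<open>(k - 1) * i\<close> is
    \<open>- i\<close>, which reverses a periodic sequence without leaving the natural
    numbers.\<close>
  define b where "b = (\<lambda>i. a ((k - 1) * i + (k - 1)))"
  define f where "f = (\<lambda>u i. u ((k - 1) * i) :: complex)"
  have rv: "code_seq b (f x) \<and> (\<forall>i. sgn_arc (b i) (f x i) \<ge> 0)"
    if x: "code_seq a x" "\<And>i. sgn_arc (a i) (x i) < 0" "\<And>i. x (i + k) = x i" for x
  proof -
    note D = code_seqD[OF x(1)]
    have fx: "f x i = crefl (b i) (x ((k - 1) * i + (k - 1)))" for i
    proof -
      have "Suc ((k - 1) * i + (k - 1)) = (k - 1) * i + k" using k by simp
      thus ?thesis using x(3)[of "(k - 1) * i"] D(4)[of "(k - 1) * i + (k - 1)"] by (simp add: f_def b_def)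
    qed
    have fS: "f x (Suc i) = x ((k - 1) * i + (k - 1))" for i by (simp add: f_def add.commute)
    have "b (Suc i) \<noteq> b i" for i
    proof -
      have "(k - 1) * Suc i + (k - 1) = (k - 1) * i + (k - 2) + k" "Suc ((k - 1) * i + (k - 2)) = (k - 1) * i + (k - 1)"
        using le_Suc_ex[OF k] by (auto simp: algebra_simps)
      thus ?thesis unfolding b_def using per(1)[of "(k - 1) * i + (k - 2)"] D(2)[of "(k - 1) * i + (k - 2)"] by metis
    qed
    moreover have "f x (Suc i) = crefl (b i) (f x i)" for i
    proof -
      have "b i < m" using D(1) by (simp add: b_def)
      thus ?thesis unfolding fS fx[of i] using crefl_invol D(3) by simp
    qed
    moreover have "sgn_arc (b i) (f x i) \<ge> 0" for i
    proof -
      have "b i < m" "sgn_arc (b i) (x ((k - 1) * i + (k - 1))) < 0" using D(1) x(2)[of "(k - 1) * i + (k - 1)"] by (simp_all add: b_def)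
      thus ?thesis unfolding fx using sgn_arc_crefl(1) D(3) by (simp add: less_imp_le)
    qed
    ultimately show ?thesis unfolding code_seq_def using D by (simp add: f_def b_def)
  qed
  have "f z 0 = f y 0" using coding_unique rv[OF z per(2)] rv[OF y per(3)] by blast
  thus ?thesis by (simp add: f_def)
qed

text \<open>Once outside its arc, a point is reflected into an arc different from the next one, so
  it stays outside; periodicity spreads this to all indices.\<close>

lemma code_class:
  assumes z: "code_seq a z" and k: "k \<ge> 1" and per: "\<And>i. a (i + k) = a i" "\<And>i. z (i + k) = z i"
  shows "(\<forall>i. sgn_arc (a i) (z i) \<ge> 0) \<or> (\<forall>i. sgn_arc (a i) (z i) < 0)"
proof (cases "\<forall>i. sgn_arc (a i) (z i) \<ge> 0")
  case False
  then obtain i where i: "sgn_arc (a i) (z i) < 0" by (auto simp: not_le)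
  note D = code_seqD[OF z]
  have step: "sgn_arc (a (Suc j)) (z (Suc j)) < 0" if "sgn_arc (a j) (z j) < 0" for j
  proof -
    have "sgn_arc (a j) (z (Suc j)) > 0" using that sgn_arc_crefl(1)[OF D(1,3)] D(4) by simp
    thus ?thesis using sgn_arc_disjoint[OF D(1) D(1) _ D(3)] D(2)[of j] by metis
  qed
  have up: "sgn_arc (a (i + n)) (z (i + n)) < 0" for n by (induction n) (use i step in auto)
  have pk: "a (j + n * k) = a j \<and> z (j + n * k) = z j" for j n
  proof (induction n)
    case (Suc n) thus ?case using per[of "j + n * k"] by (simp add: add_ac)
  qed simp
  have "sgn_arc (a j) (z j) < 0" for j
  proof -
    have "i \<le> j + i * k" using k by (simp add: trans_le_add2)
    then obtain n where "j + i * k = i + n" using le_Suc_ex by blast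
    thus ?thesis using up[of n] pk[of j i] by metis
  qed
  thus ?thesis by blast
qed simp

text \<open>Words preserve \<open>herm\<close> up to sign, so an eigenvector whose eigenvalue is not
  of modulus one is isotropic, that is, a point of the circle.\<close>

lemma eigen_point:
  assumes w: "set w \<subseteq> {..<m}" and v: "v \<noteq> 0" "mat_word w *v v = c *s v" and c: "norm c \<noteq> 1"
  shows "\<exists>z. norm z = 1 \<and> crefl_word w z = z \<and> kap_word w z = norm c \<and> mat_word w *v pvec z = c *s pvec z"
proof -
  have "herm (c *s v) = (norm c)\<^sup>2 * herm v" by (simp add: herm_def norm_mult power_mult_distrib algebra_simps)
  hence h: "(norm c)\<^sup>2 * \<bar>herm v\<bar> = \<bar>herm v\<bar>" using herm_mat_word[OF w, of v] v(2) by (simp add: abs_mult)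
  have "(norm c)\<^sup>2 \<noteq> 1" using c by (metis abs_norm_cancel abs_square_eq_1)
  hence "herm v = 0" using h by auto
  hence n: "norm (v $ 1) = norm (v $ 2)" by (simp add: herm_def power2_eq_iff_nonneg)
  have v2: "v $ 2 \<noteq> 0" using v(1) n by (auto simp: vec_eq_iff forall_2)
  define z where "z = v $ 1 / v $ 2"
  have z: "norm z = 1" using n v2 by (simp add: z_def norm_divide)
  have vz: "v = (v $ 2) *s pvec z" using v2 by (simp add: vec_eq_iff forall_2 pvec_nth z_def)
  have "(v $ 2) *s (mat_word w *v pvec z) = (v $ 2) *s (c *s pvec z)"
    using v(2) vz by (metis vector_scalar_commute vector_smult_assoc mult.commute)
  hence M: "mat_word w *v pvec z = c *s pvec z" using v2 by (simp add: vec_eq_iff)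
  obtain d where d: "mat_word w *v pvec z = d *s pvec (crefl_word w z)" "norm d = kap_word w z" using mat_word_pvec[OF w z] by blast
  have "d \<noteq> 0" using d(2) kap_word_pos[OF w z] by auto
  moreover have "d *s pvec (crefl_word w z) = c *s pvec z" using d(1) M by metis
  ultimately have "d = c" "crefl_word w z = z" unfolding smult_pvec_eq_iff by blast+
  thus ?thesis using z d(2) M by (intro exI[of _ z] conjI) simp_all
qed

text \<open>The two eigenpoints of the hyperbolic word fall into different classes of
  \<open>code_class\<close>. The one always in its arc becomes the future end, the one always
  outside the past end. The word enters reversed because the first bounce is the rightmost
  factor.\<close>

lemma cyclic_word_periodic_orbit:
  assumes v: "set v \<subseteq> {..<m}" "distinct_adj v" "v \<noteq> []" "hd v \<noteq> last v" and sr: "spectral_radius (mat_word (rev v)) > 1"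
  shows "\<exists>p\<in>S_B m \<theta>. orbit p (length v) = p \<and> itinerary p (length v) = v"
proof -
  define k where "k = length v"
  define a where "a = (\<lambda>i. v ! (i mod k))"
  have k0: "k > 0" using v by (simp add: k_def)
  have k1: "k \<noteq> 1" using v(3,4) by (auto simp: k_def length_Suc_conv)
  have k: "k \<ge> 2" using k0 k1 by simp
  have am: "a i < m" for i using subsetD[OF v(1), of "v ! (i mod k)"] k0 by (simp add: a_def k_def)
  have ap: "a (i + k) = a i" for i by (simp add: a_def)
  have adj: "a (Suc i) \<noteq> a i" for i
  proof (cases "Suc (i mod k) = k")
    case True
    hence "Suc i mod k = 0" by (simp add: mod_Suc)
    moreover have "i mod k = k - 1" using True by simp
    ultimately show ?thesis using v(3,4) unfolding a_def k_def by (simp add: hd_conv_nth last_conv_nth)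
  next
    case False
    hence "Suc i mod k = Suc (i mod k)" by (simp add: mod_Suc)
    moreover have "Suc (i mod k) < k" using False k0 by (metis Suc_lessI mod_less_divisor)
    ultimately show ?thesis using v(2) unfolding a_def k_def distinct_adj_conv_nth by (metis less_diff_conv Suc_eq_plus1)
  qed
  have va: "map a [0..<k] = v" by (intro nth_equalityI) (auto simp: a_def k_def)
  define sq where "sq = (\<lambda>z i. crefl_word (rev (map a [0..<i])) z)"
  have sq0: "sq z 0 = z" for z by (simp add: sq_def)
  have sqS: "sq z (Suc i) = crefl (a i) (sq z i)" for z i by (simp add: sq_def)
  have code: "code_seq a (sq z)" if "norm z = 1" for z
  proof -
    have "norm (sq z i) = 1" for i by (induction i) (simp_all add: sq0 sqS that norm_crefl am)
    thus ?thesis unfolding code_seq_def using am adj sqS by blast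
  qed
  have sqp: "sq z (i + k) = sq z i" if "crefl_word (rev v) z = z" for z i
  proof (induction i)
    case 0 thus ?case using that by (simp add: sq_def va)
  next
    case (Suc i) thus ?case using sqS[of z i] sqS[of z "i + k"] ap by simp
  qed
  have wv: "set (rev v) \<subseteq> {..<m}" using v by simp
  obtain r s where rs: "det (mat_word (rev v)) = r * s" "\<And>c. (\<exists>u. u \<noteq> 0 \<and> mat_word (rev v) *v u = c *s u) \<longleftrightarrow> c = r \<or> c = s"
    "spectral_radius (mat_word (rev v)) = max (norm r) (norm s)" using spectral_radius_roots[of "mat_word (rev v)"] by auto
  have nrs: "norm r * norm s = 1" using rs(1) det_mat_word[OF wv] by (simp add: norm_mult)
  have ne1: "norm r \<noteq> 1" "norm s \<noteq> 1" using nrs sr rs(3) by auto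
  have "r \<noteq> s"
  proof
    assume "r = s"
    hence "(norm r)\<^sup>2 = 1" using nrs by (simp add: power2_eq_square)
    thus False using ne1 by (metis abs_norm_cancel abs_square_eq_1)
  qed
  obtain x where x: "norm x = 1" "crefl_word (rev v) x = x" "kap_word (rev v) x \<noteq> 1" "mat_word (rev v) *v pvec x = r *s pvec x"
    using eigen_point[OF wv _ _ ne1(1)] rs(2) ne1 by metis
  obtain y where y: "norm y = 1" "crefl_word (rev v) y = y" "kap_word (rev v) y \<noteq> 1" "mat_word (rev v) *v pvec y = s *s pvec y"
    using eigen_point[OF wv _ _ ne1(2)] rs(2) ne1 by metis
  have xy: "x \<noteq> y" using x(4) y(4) \<open>r \<noteq> s\<close> smult_pvec_eq_iff by metis
  have cl: "(\<forall>i. sgn_arc (a i) (sq z i) \<ge> 0) \<or> (\<forall>i. sgn_arc (a i) (sq z i) < 0)" if "norm z = 1" "crefl_word (rev v) z = z" for z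
    using code_class[OF code[OF that(1)] _ ap sqp[OF that(2)]] k0 by simp
  \<comment> \<open>Each class contains at most one fixed point by uniqueness of codings, so two
    distinct fixed points must be divided between the classes.\<close>
  have notA: "\<not> ((\<forall>i. sgn_arc (a i) (sq x i) \<ge> 0) \<and> (\<forall>i. sgn_arc (a i) (sq y i) \<ge> 0))"
  proof
    assume h: "(\<forall>i. sgn_arc (a i) (sq x i) \<ge> 0) \<and> (\<forall>i. sgn_arc (a i) (sq y i) \<ge> 0)"
    have "sq x 0 = sq y 0"
      by (rule coding_unique[OF code[OF x(1)] _ code[OF y(1)]]) (rule h[THEN conjunct1, rule_format], rule h[THEN conjunct2, rule_format])
    thus False using xy sq0 by simp
  qed
  have notR: "\<not> ((\<forall>i. sgn_arc (a i) (sq x i) < 0) \<and> (\<forall>i. sgn_arc (a i) (sq y i) < 0))"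
  proof
    assume h: "(\<forall>i. sgn_arc (a i) (sq x i) < 0) \<and> (\<forall>i. sgn_arc (a i) (sq y i) < 0)"
    have "sq x 0 = sq y 0"
      by (rule coding_unique_backward[OF code[OF x(1)] _ code[OF y(1)] _ k])
        (rule h[THEN conjunct1, rule_format], rule h[THEN conjunct2, rule_format], rule ap, rule sqp[OF x(2)], rule sqp[OF y(2)])
    thus False using xy sq0 by simp
  qed
  obtain \<sigma> \<tau> where st: "norm \<sigma> = 1" "crefl_word (rev v) \<sigma> = \<sigma>" "kap_word (rev v) \<sigma> \<noteq> 1" "\<And>i. sgn_arc (a i) (sq \<sigma> i) \<ge> 0"
    "norm \<tau> = 1" "crefl_word (rev v) \<tau> = \<tau>" "\<And>i. sgn_arc (a i) (sq \<tau> i) < 0"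
    using cl[OF x(1,2)] cl[OF y(1,2)] notA notR x y by metis
  note Ds = code_seqD[OF code[OF st(1)]] and Dt = code_seqD[OF code[OF st(5)]]
  have per: "sq z (i + n * k) = sq z i" if "crefl_word (rev v) z = z" for z i n
  proof (induction n)
    case (Suc n) thus ?case using sqp[OF that, of "i + n * k"] by (simp add: add_ac)
  qed simp
  have pa: "a (i + n * k) = a i" for i n by (simp add: a_def)
  \<comment> \<open>A boundary value would put the orbit at a vertex, where it stays for ever by
    periodicity; every factor of \<open>kap_word\<close> would then be one, which is the parabolic
    case excluded by the choice of \<open>\<sigma>\<close>.\<close>
  have spos: "sgn_arc (a i) (sq \<sigma> i) > 0" for i
  proof (rule ccontr)
    assume "\<not> ?thesis"
    hence z0: "sgn_arc (a i) (sq \<sigma> i) = 0" using st(4)[of i] by simp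
    have fixed: "sgn_arc (a (i + n)) (sq \<sigma> (i + n)) = 0" for n
    proof (induction n)
      case (Suc n)
      hence e: "sq \<sigma> (i + n) = \<theta> (a (i + n)) \<or> sq \<sigma> (i + n) = \<theta> (nxt (a (i + n)))" using sgn_arc_eq_0_iff[OF Ds(1,3)] by blast
      hence "sq \<sigma> (Suc (i + n)) = sq \<sigma> (i + n)" using Ds(4)[of "i + n"] crefl_vertex[OF Ds(1)] by metis
      hence "sq \<sigma> (Suc (i + n)) \<in> verts" using e Ds(1)[of "i + n"] nxt_less by auto
      thus ?case using sgn_arc_vertex[OF _ Ds(1)[of "Suc (i + n)"]] st(4)[of "Suc (i + n)"] by (auto intro: order_antisym)
    qed (simp add: z0)
    have all0: "sgn_arc (a j) (sq \<sigma> j) = 0" for j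
    proof -
      have "i \<le> j + i * k" using k0 by (simp add: trans_le_add2)
      then obtain n where "j + i * k = i + n" using le_Suc_ex by blast
      thus ?thesis using fixed[of n] per[OF st(2), of j i] pa[of j i] by metis
    qed
    have "kap (a j) (sq \<sigma> j) = 1" for j
      using all0[of j] sgn_arc_eq_0_iff[OF Ds(1,3)] kap_vertex[OF Ds(1)] by metis
    hence "kap_word (rev (map a [0..<n])) \<sigma> = 1" for n by (induction n) (auto simp: sq_def)
    thus False using st(3) va by metis
  qed
  have tpos: "sgn_arc (a i) (sq \<tau> (Suc i)) > 0" for i using st(7)[of i] sgn_arc_crefl(1)[OF Dt(1,3)] Dt(4) by simp
  have si: "arc_index (sq \<sigma> i) = a i" "sq \<sigma> i \<notin> verts" for i
    using arc_index_unique[OF Ds(1,3) spos] sgn_arc_pos_not_vertex[OF Ds(1) spos] by auto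
  have ti: "arc_index (sq \<tau> (Suc i)) = a i" "sq \<tau> (Suc i) \<notin> verts" for i
    using arc_index_unique[OF Dt(1,3) tpos] sgn_arc_pos_not_vertex[OF Dt(1) tpos] by auto
  have Bs: "(B_map m \<theta> ^^ h) \<sigma> = sq \<sigma> h" for h by (induction h) (simp_all add: sq0 B_map_eq si sqS)
  \<comment> \<open>On the past end the boundary map runs along the sequence backwards, since it
    undoes the last reflection.\<close>
  have Bt: "(B_map m \<theta> ^^ h) (sq \<tau> (i + h)) = sq \<tau> i" for h i
  proof (induction h)
    case (Suc h)
    have "B_map m \<theta> (sq \<tau> (Suc (i + h))) = sq \<tau> (i + h)" unfolding B_map_eq ti using Dt(4)[of "i + h"] crefl_invol[OF Dt(1,3)] by simp
    thus ?case using Suc unfolding funpow_Suc_right comp_def by simp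
  qed simp
  have tk: "\<tau> = sq \<tau> (Suc (k - 1))" using sqp[OF st(6), of 0] sq0 k0 by simp
  have "nonterm \<sigma>" using Bs si by (intro nontermI st) auto
  moreover have "nonterm \<tau>"
  proof (intro nontermI st)
    fix h
    have "\<tau> = sq \<tau> (h * k)" using per[OF st(6), of 0 h] sq0 by simp
    also have "h * k = h * (k - 1) + h" using k0 by (cases k) auto
    finally have "(B_map m \<theta> ^^ h) \<tau> = sq \<tau> (h * (k - 1))" using Bt[of h "h * (k - 1)"] by metis
    also have "\<dots> = sq \<tau> (Suc (h * (k - 1) + (k - 1)))" using sqp[OF st(6), of "h * (k - 1)"] k0 by simp
    finally show "(B_map m \<theta> ^^ h) \<tau> \<notin> verts" using ti(2) by simp
  qed
  moreover have "arc_index \<sigma> \<noteq> arc_index \<tau>"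
  proof -
    have "arc_index \<sigma> = a 0" using si(1)[of 0] sq0 by simp
    moreover have "arc_index \<tau> = a (k - 1)" using ti(1)[of "k - 1"] tk by simp
    moreover have "a (Suc (k - 1)) = a 0" using ap[of 0] k0 by simp
    ultimately show ?thesis using adj[of "k - 1"] by metis
  qed
  ultimately have p: "(\<sigma>, \<tau>) \<in> S_B m \<theta>" using S_B_iff by blast
  have o: "orbit (\<sigma>, \<tau>) i = (sq \<sigma> i, sq \<tau> i)" for i
    by (induction i) (simp_all add: sq0 orbit.simps(2) Let_def si sqS)
  have "orbit (\<sigma>, \<tau>) k = (\<sigma>, \<tau>)" using o sqp[OF st(2), of 0] sqp[OF st(6), of 0] sq0 by simp
  moreover have "itinerary (\<sigma>, \<tau>) k = v" unfolding itinerary_map[OF p] o using va si by simp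
  ultimately show ?thesis using p unfolding k_def by blast
qed

lemma spectral_radius_rmat: "a < m \<Longrightarrow> spectral_radius (rmat a) \<le> 1"
proof (rule spectral_radius_le)
  fix c v assume a: "a < m" and v: "v \<noteq> 0" "rmat a *v v = c *s v"
  have "v = rmat a *v (rmat a *v v)" using rmat_square[OF a] by (simp add: matrix_vector_mul_assoc)
  also have "\<dots> = (c * c) *s v" by (simp add: v vector_scalar_commute vector_smult_assoc)
  finally have "v = (c * c) *s v" .
  moreover obtain i where "v $ i \<noteq> 0" using v(1) by (auto simp: vec_eq_iff)
  ultimately have "c * c = 1" by (metis mult_cancel_right2 vector_smult_component)
  hence "norm c * norm c = 1" by (metis norm_mult norm_one)
  thus "norm c \<le> 1" by (metis abs_norm_cancel abs_square_eq_1 order_refl power2_eq_square)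
qed

text \<open>Cancelling a repeated letter leaves the matrix unchanged, and removing equal outer
  letters is a conjugation; a word of spectral radius above one cannot be exhausted in this way,
  because the identity and single reflections have radius at most one.\<close>

lemma reduce_cyclic_word:
  assumes "set w \<subseteq> {..<m}" "spectral_radius (mat_word w) > 1"
  shows "\<exists>v. set v \<subseteq> {..<m} \<and> length v \<le> length w \<and> spectral_radius (mat_word v) = spectral_radius (mat_word w)
     \<and> distinct_adj v \<and> v \<noteq> [] \<and> hd v \<noteq> last v"
  using assms
proof (induction "length w" arbitrary: w rule: less_induct)
  case less
  have IH: ?case if "length u < length w" "set u \<subseteq> {..<m}" "spectral_radius (mat_word u) = spectral_radius (mat_word w)" for u
    using less.hyps[OF that(1,2)] that less.prems by (metis less_imp_le order_trans)
  have w0: "w \<noteq> []"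
  proof
    assume "w = []"
    moreover have "spectral_radius (mat 1) \<le> 1"
    proof (rule spectral_radius_le)
      fix c and v :: "complex^2" assume v: "v \<noteq> 0" "mat 1 *v v = c *s v"
      obtain i where "v $ i \<noteq> 0" using v(1) by (auto simp: vec_eq_iff)
      moreover have "v = c *s v" using v(2) by simp
      ultimately have "c = 1" by (metis mult_cancel_right2 vector_smult_component)
      thus "norm c \<le> 1" by simp
    qed
    ultimately show False using less.prems by simp
  qed
  show ?case
  proof (cases "distinct_adj w")
    case False
    then obtain u a v where w: "w = u @ a # a # v" using not_distinct_adj by blast
    hence a: "a < m" using less.prems by auto
    have "mat_word w = mat_word u ** (rmat a ** (rmat a ** mat_word v))" by (simp add: w mat_word_append)
    also have "\<dots> = mat_word (u @ v)" using rmat_square[OF a] by (simp add: matrix_mul_assoc mat_word_append)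
    finally show ?thesis using less.prems w by (intro IH[of "u @ v"]) auto
  next
    case True
    show ?thesis
    proof (cases "hd w = last w")
      case False thus ?thesis using True w0 less.prems by blast
    next
      case hl: True
      obtain a u where w: "w = a # u" using w0 by (cases w) auto
      have a: "a < m" using less.prems w by auto
      show ?thesis
      proof (cases "u = []")
        case True thus ?thesis using less.prems spectral_radius_rmat[OF a] by (simp add: w)
      next
        case False
        then obtain x where u: "u = x @ [a]" using hl w by (metis append_butlast_last_id last_ConsR list.sel(1))
        have M: "mat_word w = rmat a ** (mat_word x ** rmat a)" by (simp add: w u mat_word_append)
        have "trace (mat_word w) = trace (mat_word x ** (rmat a ** rmat a))" unfolding M trace_commute2[of "rmat a"] by (simp add: matrix_mul_assoc)
        moreover have "det (mat_word w) = det (mat_word x) * det (rmat a ** rmat a)" unfolding M det_mul by simp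
        ultimately have "spectral_radius (mat_word w) = spectral_radius (mat_word x)"
          using rmat_square[OF a] by (intro spectral_radius_cong) auto
        thus ?thesis using less.prems w u by (intro IH[of x]) auto
      qed
    qed
  qed
qed

text \<open>Only an inequality, because cyclic reduction may shorten the word while its spectral
  radius stays, which raises the quotient.\<close>

lemma word_periodic_mean_free_path:
  assumes w: "w \<noteq> []" "set w \<subseteq> {..<m}" "spectral_radius (mat_word w) > 1"
  shows "\<exists>l\<in>periodic_mean_free_paths m \<theta>. l \<ge> 2 * ln (spectral_radius (mat_word w)) / length w"
proof -
  obtain v where v: "set v \<subseteq> {..<m}" "length v \<le> length w" "spectral_radius (mat_word v) = spectral_radius (mat_word w)"
     "distinct_adj v" "v \<noteq> []" "hd v \<noteq> last v" using reduce_cyclic_word[OF w(2,3)] by blast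
  obtain p where p: "p \<in> S_B m \<theta>" "orbit p (length (rev v)) = p" "itinerary p (length (rev v)) = rev v"
    using cyclic_word_periodic_orbit[of "rev v"] v w(3) by (auto simp: hd_rev last_rev)
  have "length (rev v) \<ge> 1" using v(5) by (cases v) auto
  from periodic_orbit_in[OF p(1) this p(2)]
  have "2 * ln (spectral_radius (mat_word w)) / length v \<in> periodic_mean_free_paths m \<theta>" unfolding p(3) using v(3) by simp
  moreover have "2 * ln (spectral_radius (mat_word w)) / length w \<le> 2 * ln (spectral_radius (mat_word w)) / length v"
    using w(1,3) v by (intro divide_left_mono) auto
  ultimately show ?thesis by blast
qed

text \<open>Supplies a hyperbolic word in every polygon. The trace is \<open>-4\<close> times a
  cross ratio, and Ptolemy's identity for sines shows that this cross ratio is at least one.\<close>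

lemma three_letter_word: "spectral_radius (mat_word [0, 1, 2]) \<ge> 2"
proof -
  define A B C where "A = (\<alpha> 1 - \<alpha> 0) / 2" and "B = (\<alpha> 2 - \<alpha> 1) / 2" and "C = (\<alpha> 3 - \<alpha> 2) / 2"
  have pos: "A > 0" "B > 0" "C > 0" using angle_less[of 0 1] angle_less[of 1 2] angle_less[of 2 3] by (auto simp: A_def B_def C_def)
  have le: "A + B + C \<le> pi" using angle_le[of 3 m] angle_period[of 0] m3 by (simp add: A_def B_def C_def field_simps)
  have v: "\<theta> 0 = cis (\<alpha> 0)" "\<theta> 1 = cis (\<alpha> 1)" "\<theta> 2 = cis (\<alpha> 2)" "\<theta> (nxt 2) = cis (\<alpha> 3)" "nxt 0 = 1" "nxt 1 = 2"
    using m3 vertex_eq vertex_nxt[of 2] by (auto simp: numeral_2_eq_2 numeral_3_eq_3)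
  have d: "\<theta> 0 \<noteq> \<theta> 1" "\<theta> 1 \<noteq> \<theta> 2" "\<theta> 2 \<noteq> \<theta> (nxt 2)"
    using vertex_neq[of 0, unfolded v(5)] vertex_neq[of 1, unfolded v(6)] vertex_neq[of 2] m3 by simp_all
  have s: "sin A > 0" "sin C > 0" "sin B > 0" "sin (A + B + C) \<ge> 0" using pos le by (auto intro!: sin_gt_zero sin_ge_zero)
  have "trace (mat_word [0, 1, 2]) = - 4 * ((\<theta> 0 - \<theta> 2) * (\<theta> 1 - \<theta> (nxt 2)) / ((\<theta> 0 - \<theta> 1) * (\<theta> 2 - \<theta> (nxt 2))))"
  proof -
    have "mat_word [0, 1, 2] = reflection_matrix (\<theta> 0) (\<theta> 1) ** (reflection_matrix (\<theta> 1) (\<theta> 2) ** reflection_matrix (\<theta> 2) (\<theta> (nxt 2)))"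
      by (simp only: mat_word_Cons mat_word_Nil matrix_mul_rid rmat_def v(5,6))
    thus ?thesis using trace_three_reflections[OF d] by metis
  qed
  also have "\<dots> = - 4 * of_real (sin ((\<alpha> 0 - \<alpha> 2) / 2) * sin ((\<alpha> 1 - \<alpha> 3) / 2) / (sin ((\<alpha> 0 - \<alpha> 1) / 2) * sin ((\<alpha> 2 - \<alpha> 3) / 2)))"
    unfolding v cis_cross_ratio ..
  also have "sin ((\<alpha> 0 - \<alpha> 2) / 2) * sin ((\<alpha> 1 - \<alpha> 3) / 2) / (sin ((\<alpha> 0 - \<alpha> 1) / 2) * sin ((\<alpha> 2 - \<alpha> 3) / 2)) =
    sin (A + B) * sin (B + C) / (sin A * sin C)"
  proof -
    have e: "(\<alpha> 0 - \<alpha> 2) / 2 = - (A + B)" "(\<alpha> 1 - \<alpha> 3) / 2 = - (B + C)" "(\<alpha> 0 - \<alpha> 1) / 2 = - A" "(\<alpha> 2 - \<alpha> 3) / 2 = - C"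
      by (simp_all add: A_def B_def C_def field_simps)
    show ?thesis unfolding e sin_minus by simp
  qed
  finally have tr: "norm (trace (mat_word [0, 1, 2])) = 4 * \<bar>sin (A + B) * sin (B + C) / (sin A * sin C)\<bar>"
    by (simp add: norm_mult norm_divide abs_mult)
  have "sin (A + B) * sin (B + C) = sin A * sin C + sin B * sin (A + B + C)"
  proof -
    have "(cos B)\<^sup>2 = 1 - (sin B)\<^sup>2" by (rule cos_squared_eq)
    thus ?thesis unfolding sin_add cos_add by algebra
  qed
  hence "sin (A + B) * sin (B + C) \<ge> sin A * sin C" using s by simp
  hence "sin (A + B) * sin (B + C) / (sin A * sin C) \<ge> 1" using s by simp
  hence "norm (trace (mat_word [0, 1, 2])) \<ge> 4" unfolding tr by linarith
  thus ?thesis using norm_trace_le[of "mat_word [0, 1, 2]"] by simp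
qed

end

section \<open>The joint spectral radius\<close>

lemma bounded_linear_mat2: "bounded_linear ((*v) (M :: complex^2^2))"
  by (rule matrix_vector_mul_bounded_linear)

definition opn :: "complex^2^2 \<Rightarrow> real" where "opn M = onorm ((*v) M)"

lemma opn_nonneg: "opn M \<ge> 0" unfolding opn_def by (rule onorm_pos_le[OF bounded_linear_mat2])
lemma opn_bound: "norm (M *v x) \<le> opn M * norm x" unfolding opn_def by (rule onorm[OF bounded_linear_mat2])
lemma opn_least: "(\<And>x. norm (M *v x) \<le> B * norm x) \<Longrightarrow> opn M \<le> B" unfolding opn_def by (rule onorm_le)
lemma opn_uminus: "opn (- M) = opn M"
proof -
  have "(*v) (- M) = (\<lambda>x. - (M *v x))" by (auto simp: vec_eq_iff forall_2 mat2_vec)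
  thus ?thesis unfolding opn_def by (simp add: onorm_neg)
qed
lemma opn_mult: "opn (M ** N) \<le> opn M * opn N"
proof (rule opn_least)
  fix x
  have "norm ((M ** N) *v x) \<le> opn M * norm (N *v x)" using opn_bound[of M "N *v x"] by (simp add: matrix_vector_mul_assoc)
  also have "\<dots> \<le> opn M * (opn N * norm x)" by (intro mult_left_mono opn_bound opn_nonneg)
  finally show "norm ((M ** N) *v x) \<le> opn M * opn N * norm x" by (simp add: mult.assoc)
qed
lemma opn_one: "opn (mat 1) \<le> 1" by (rule opn_least) simp

lemma norm_smult_vec2: "norm (c *s (v :: complex^2)) = norm c * norm v"
  by (simp add: norm_vec_def L2_set_def sum_2 norm_mult power_mult_distrib real_sqrt_mult flip: distrib_left)

lemma spectral_radius_le_opn: "spectral_radius M \<le> opn M"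
proof (rule spectral_radius_le)
  fix c v assume v: "v \<noteq> 0" "M *v v = c *s v"
  have "norm c * norm v \<le> opn M * norm v" using opn_bound[of M v] by (simp add: v norm_smult_vec2)
  thus "norm c \<le> opn M" using v(1) by simp
qed

lemma opn_le_norm: "opn M \<le> 4 * norm M"
proof (rule opn_least)
  fix x :: "complex^2"
  have e: "norm (M $ i $ j * x $ j) \<le> norm M * norm x" for i j
    unfolding norm_mult using Finite_Cartesian_Product.norm_nth_le[of "M $ i" j] Finite_Cartesian_Product.norm_nth_le[of M i] Finite_Cartesian_Product.norm_nth_le[of x j] by (intro mult_mono) auto
  have c: "norm ((M *v x) $ i) \<le> 2 * (norm M * norm x)" for i
    unfolding mat2_vec using norm_triangle_ineq[of "M $ i $ 1 * x $ 1" "M $ i $ 2 * x $ 2"] e[of i 1] e[of i 2] by linarith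
  have "norm (M *v x) \<le> norm ((M *v x) $ 1) + norm ((M *v x) $ 2)"
    using L2_set_le_sum[of UNIV "\<lambda>i. norm ((M *v x) $ i)"] by (simp add: norm_vec_def sum_2)
  thus "norm (M *v x) \<le> 4 * norm M * norm x" using c[of 1] c[of 2] by simp
qed

lemma spectral_radius_uminus: "spectral_radius (- M) = spectral_radius M"
proof -
  have "(- M) *v v = c *s v \<longleftrightarrow> M *v v = (- c) *s v" for c v
  proof -
    have "(- M) *v v = - (M *v v)" "(- c) *s v = - (c *s v)" by (simp_all add: vec_eq_iff forall_2 mat2_vec)
    thus ?thesis by (metis minus_minus)
  qed
  hence "{norm c | c. \<exists>v. v \<noteq> 0 \<and> (- M) *v v = c *s v} = {norm c | c. \<exists>v. v \<noteq> 0 \<and> M *v v = (- c) *s v}" by simp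
  also have "\<dots> = {norm c | c. \<exists>v. v \<noteq> 0 \<and> M *v v = c *s v}"
  proof (intro equalityI subsetI)
    fix x assume "x \<in> {norm c | c. \<exists>v. v \<noteq> 0 \<and> M *v v = (- c) *s v}"
    then obtain c where "x = norm (- c)" "\<exists>v. v \<noteq> 0 \<and> M *v v = (- c) *s v" by auto
    thus "x \<in> {norm c | c. \<exists>v. v \<noteq> 0 \<and> M *v v = c *s v}" by blast
  next
    fix x assume "x \<in> {norm c | c. \<exists>v. v \<noteq> 0 \<and> M *v v = c *s v}"
    then obtain c where "x = norm (- c)" "\<exists>v. v \<noteq> 0 \<and> M *v v = (- (- c)) *s v" by auto
    thus "x \<in> {norm c | c. \<exists>v. v \<noteq> 0 \<and> M *v v = (- c) *s v}" by blast
  qed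
  finally show ?thesis by (simp add: spectral_radius_def)
qed

lemma spectral_radius_eigenvector: "\<exists>c v. v \<noteq> 0 \<and> M *v v = c *s v \<and> norm c = spectral_radius M"
proof -
  obtain r s where "\<And>c. (\<exists>v. v \<noteq> 0 \<and> M *v v = c *s v) \<longleftrightarrow> c = r \<or> c = s" "spectral_radius M = max (norm r) (norm s)"
    using spectral_radius_roots[of M] by auto
  thus ?thesis by (metis max_def)
qed

lemma uminus_mat_mult: "(- (M :: complex^2^2)) ** N = - (M ** (N :: complex^2^2))" "(M :: complex^2^2) ** (- N) = - (M ** (N :: complex^2^2))"
  by (simp_all add: vec_eq_iff forall_2 mat2_mult)

lemma cayley_matrix_inv: "cayley_matrix ** matrix_inv cayley_matrix = mat 1" "matrix_inv cayley_matrix ** cayley_matrix = mat 1"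
proof -
  have "cayley_matrix $ 1 $ 1 = 1 / complex_of_real (sqrt 2)" "cayley_matrix $ 1 $ 2 = - \<i> / complex_of_real (sqrt 2)"
    "cayley_matrix $ 2 $ 1 = - \<i> / complex_of_real (sqrt 2)" "cayley_matrix $ 2 $ 2 = 1 / complex_of_real (sqrt 2)"
    by (simp_all add: cayley_matrix_def mat2_mult mat_def)
  moreover have "complex_of_real (sqrt 2) * complex_of_real (sqrt 2) = 2" by (simp flip: of_real_mult)
  ultimately have "det cayley_matrix = 1" by (simp add: det_2)
  hence "invertible cayley_matrix" by (simp add: invertible_det_nz)
  thus "cayley_matrix ** matrix_inv cayley_matrix = mat 1" "matrix_inv cayley_matrix ** cayley_matrix = mat 1"
    unfolding matrix_inv_def invertible_def by (metis (mono_tags, lifting) someI_ex)+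
qed

lemma growth_root_limit:
  assumes c: "c > 0" and r: "r \<ge> 0" shows "(\<lambda>n. root n (c * r ^ n)) \<longlonglongrightarrow> r"
proof -
  have "(\<lambda>n. root n c * r) \<longlonglongrightarrow> 1 * r" by (intro tendsto_mult LIMSEQ_root_const c tendsto_const)
  hence "(\<lambda>n. root n c * r) \<longlonglongrightarrow> r" by simp
  moreover have "eventually (\<lambda>n. root n c * r = root n (c * r ^ n)) sequentially"
    using eventually_gt_at_top[of 0] by eventually_elim (use r in \<open>simp add: real_root_mult real_root_power_cancel\<close>)
  ultimately show ?thesis by (rule Lim_transform_eventually)
qed

context ideal_polygon
begin

definition rates :: "real set" where
  "rates = {root (length w) (spectral_radius (mat_word w)) | w. w \<noteq> [] \<and> set w \<subseteq> {..<m}}"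

text \<open>For a traceless matrix each remaining condition says that the symmetric expression
  \<open>p * (a + b) + q - r * a * b\<close> vanishes at the two ends of a side. Subtracting the
  conditions for adjacent sides gives \<open>p = r * y\<close> and \<open>p = r * z\<close>. For a
  triangle \<open>w\<close> is \<open>x\<close>, so only \<open>x \<noteq> z\<close> and
  \<open>y \<noteq> w\<close> may be used.\<close>

lemma trace_forms_independent:
  fixes X :: "complex^2^2"
  assumes t: "trace X = 0" "trace (X ** rmat 0) = 0" "trace (X ** rmat 1) = 0" "trace (X ** rmat 2) = 0"
  shows "X = 0"
proof -
  define x y z w where "x = \<theta> 0" and "y = \<theta> 1" and "z = \<theta> 2" and "w = \<theta> (nxt 2)"
  have n: "nxt 0 = 1" "nxt 1 = 2" using m3 by (simp_all add: numeral_2_eq_2)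
  have m': "0 < m" "1 < m" "2 < m" using m3 by auto
  have d: "x \<noteq> y" "y \<noteq> z" "z \<noteq> w" using vertex_neq[OF m'(1), unfolded n] vertex_neq[OF m'(2), unfolded n] vertex_neq[OF m'(3)]
    unfolding x_def y_def z_def w_def by blast+
  have d2: "x \<noteq> z" using vertex_inj[OF m'(1,3)] by (auto simp: x_def z_def)
  have d3: "y \<noteq> w" using vertex_inj[OF m'(2) nxt_less[of 2]] m3 by (auto simp: y_def w_def mod_if split: if_splits)
  define p q r where "p = X $ 1 $ 1" and "q = X $ 1 $ 2" and "r = X $ 2 $ 1"
  have p: "X $ 2 $ 2 = - p" using t(1) by (simp add: trace2 p_def add_eq_0_iff)
  have tr: "p * (a + b) + q - r * a * b = 0" if "trace (X ** reflection_matrix a b) = 0" "a \<noteq> b" for a b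
  proof -
    have "a - b \<noteq> 0" using that by simp
    have "trace (X ** reflection_matrix a b) = - 2 * (p * (a + b) + q - r * a * b) / (a - b)"
      unfolding trace2 mat2_mult reflection_matrix_nth p p_def[symmetric] q_def[symmetric] r_def[symmetric]
      using \<open>a - b \<noteq> 0\<close> by (simp add: divide_simps) (simp add: algebra_simps)
    hence "- 2 * (p * (a + b) + q - r * a * b) / (a - b) = 0" using that(1) by (rule trans[OF sym])
    thus ?thesis using \<open>a - b \<noteq> 0\<close> by (metis divide_eq_0_iff mult_eq_0_iff neg_equal_0_iff_equal zero_neq_numeral)
  qed
  have e: "p * (x + y) + q - r * x * y = 0" "p * (y + z) + q - r * y * z = 0" "p * (z + w) + q - r * z * w = 0"
    using tr[of x y] tr[of y z] tr[of z w] t(2-4) d unfolding rmat_def n x_def y_def z_def w_def by blast+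
  have "(x - z) * (p - r * y) = 0" using e(1,2) by algebra
  hence p1: "p = r * y" using d2 by simp
  have "(y - w) * (p - r * z) = 0" using e(2,3) by algebra
  hence "p = r * z" using d3 by simp
  hence "r * (y - z) = 0" using p1 by algebra
  hence "r = 0" using d by simp
  hence "p = 0" "q = 0" using p1 e(1) by auto
  thus ?thesis using \<open>r = 0\<close> p by (simp add: vec_eq_iff forall_2 p_def q_def r_def)
qed

lemma norm_le_traces: "\<exists>D>0. \<forall>X. norm X \<le> D * (norm (trace X) + norm (trace (X ** rmat 0)) + norm (trace (X ** rmat 1)) + norm (trace (X ** rmat 2)))"
proof -
  define f where "f = (\<lambda>X. (trace X, trace (X ** rmat 0), trace (X ** rmat 1), trace (X ** rmat 2)))"
  have lin: "linear f" unfolding f_def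
    by (rule linearI) (simp_all add: trace2 mat2_mult algebra_simps scaleR_conv_of_real[where 'a = complex])
  have "inj f"
  proof (subst linear_injective_0[OF lin], intro allI impI)
    fix X assume "f X = 0" thus "X = 0" by (intro trace_forms_independent) (auto simp: f_def zero_prod_def)
  qed
  then obtain B where B: "B > 0" "\<And>X. B * norm X \<le> norm (f X)" using linear_inj_bounded_below_pos[OF lin] by metis
  show ?thesis
  proof (intro exI[of _ "1 / B"] conjI allI)
    fix X
    have "norm (f X) \<le> norm (trace X) + (norm (trace (X ** rmat 0)) + (norm (trace (X ** rmat 1)) + norm (trace (X ** rmat 2))))"
      unfolding f_def by (intro order_trans[OF norm_Pair_le] add_left_mono order_refl)
    hence "B * norm X \<le> norm (trace X) + norm (trace (X ** rmat 0)) + norm (trace (X ** rmat 1)) + norm (trace (X ** rmat 2))" using B(2)[of X] by linarith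
    thus "norm X \<le> 1 / B * (norm (trace X) + norm (trace (X ** rmat 0)) + norm (trace (X ** rmat 1)) + norm (trace (X ** rmat 2)))"
      using B(1) by (simp add: field_simps)
  qed (use B in simp)
qed

context
  fixes A :: "nat \<Rightarrow> complex^2^2" and S
  assumes A: "\<And>a. a < m \<Longrightarrow> A a = billiard_matrix m \<theta> a \<or> A a = - billiard_matrix m \<theta> a" and S: "S = A ` {..<m}"
begin

section \<open>Products of the billiard matrices and their growth\<close>

definition awd :: "nat list \<Rightarrow> complex^2^2" where "awd w = foldr (\<lambda>a M. A a ** M) w (mat 1)"

lemma awd_Nil [simp]: "awd [] = mat 1" and awd_Cons [simp]: "awd (a # w) = A a ** awd w" and awd_append: "awd (v @ w) = awd v ** awd w"
proof -
  show "awd [] = mat 1" "awd (a # w) = A a ** awd w" for a w by (simp_all add: awd_def)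
  thus "awd (v @ w) = awd v ** awd w" by (induction v) (simp_all add: matrix_mul_assoc)
qed

text \<open>The signs chosen for the letters combine into one global sign, which neither the norm
  nor the spectral radius can see.\<close>

lemma awd_conj:
  assumes "set w \<subseteq> {..<m}"
  shows "awd w = matrix_inv cayley_matrix ** mat_word w ** cayley_matrix \<or> awd w = - (matrix_inv cayley_matrix ** mat_word w ** cayley_matrix)"
  using assms
proof (induction w)
  case Nil thus ?case by (simp add: cayley_matrix_inv)
next
  case (Cons a w)
  let ?C = "cayley_matrix" let ?I = "matrix_inv cayley_matrix"
  have "(?I ** rmat a ** ?C) ** (?I ** mat_word w ** ?C) = ?I ** rmat a ** (?C ** ?I) ** mat_word w ** ?C" by (simp add: matrix_mul_assoc)
  also have "\<dots> = ?I ** mat_word (a # w) ** ?C" by (simp add: cayley_matrix_inv matrix_mul_assoc)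
  finally have e: "(?I ** rmat a ** ?C) ** (?I ** mat_word w ** ?C) = ?I ** mat_word (a # w) ** ?C" .
  have "A a = ?I ** rmat a ** ?C \<or> A a = - (?I ** rmat a ** ?C)" using A[of a] Cons.prems by (simp add: billiard_matrix_def rmat_def)
  thus ?case using Cons e by (auto simp: uminus_mat_mult)
qed

lemma set_products_awd: "set_products S k = {awd w | w. set w \<subseteq> {..<m} \<and> length w = k}"
proof (induction k)
  case (Suc k)
  show ?case
  proof (intro equalityI subsetI)
    fix X assume "X \<in> set_products S (Suc k)"
    then obtain M N where "M \<in> S" "N \<in> set_products S k" "X = M ** N" by auto
    then obtain a w where "a < m" "set w \<subseteq> {..<m}" "length w = k" "X = A a ** awd w" unfolding Suc by (auto simp: S)
    thus "X \<in> {awd w | w. set w \<subseteq> {..<m} \<and> length w = Suc k}" by (intro CollectI exI[of _ "a # w"]) auto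
  next
    fix X assume "X \<in> {awd w | w. set w \<subseteq> {..<m} \<and> length w = Suc k}"
    then obtain w where w: "set w \<subseteq> {..<m}" "length w = Suc k" "X = awd w" by auto
    then obtain a u where "w = a # u" by (cases w) auto
    hence "A a \<in> S" "awd u \<in> set_products S k" "X = A a ** awd u" unfolding Suc using w by (auto simp: S)
    thus "X \<in> set_products S (Suc k)" by auto
  qed
qed auto

lemma spectral_radius_awd: "set w \<subseteq> {..<m} \<Longrightarrow> spectral_radius (awd w) = spectral_radius (mat_word w)"
proof -
  assume w: "set w \<subseteq> {..<m}"
  let ?C = "cayley_matrix" let ?I = "matrix_inv cayley_matrix"
  have "trace (?I ** mat_word w ** ?C) = trace (mat_word w ** (?C ** ?I))"
    using trace_commute2[of ?I "mat_word w ** ?C"] by (simp add: matrix_mul_assoc)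
  moreover have "det (?I ** mat_word w ** ?C) = det (?C ** ?I) * det (mat_word w)" by (simp add: det_mul)
  ultimately have "spectral_radius (?I ** mat_word w ** ?C) = spectral_radius (mat_word w)"
    by (intro spectral_radius_cong) (simp_all add: cayley_matrix_inv)
  thus ?thesis using awd_conj[OF w] spectral_radius_uminus by metis
qed

lemma finite_words_length: "finite {w. set w \<subseteq> {..<m} \<and> length w = k}"
  by (rule finite_lists_length_eq) simp

lemma opn_awd_bound: "\<exists>K\<ge>1. \<forall>w. set w \<subseteq> {..<m} \<longrightarrow> opn (awd w) \<le> K ^ length w"
proof -
  define K where "K = Max (insert 1 ((\<lambda>a. opn (A a)) ` {..<m}))"
  have K: "K \<ge> 1" "\<And>a. a < m \<Longrightarrow> opn (A a) \<le> K" by (auto simp: K_def)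
  have "opn (awd w) \<le> K ^ length w" if "set w \<subseteq> {..<m}" for w
    using that
  proof (induction w)
    case (Cons a w)
    have "opn (awd (a # w)) \<le> opn (A a) * opn (awd w)" using opn_mult by simp
    also have "\<dots> \<le> K * K ^ length w" using Cons K by (intro mult_mono opn_nonneg) auto
    finally show ?case by simp
  qed (simp add: opn_one)
  thus ?thesis using K(1) by blast
qed

lemma rates_le: "\<exists>K. \<forall>r\<in>rates. r \<le> K"
proof -
  obtain K where K: "K \<ge> 1" "\<And>w. set w \<subseteq> {..<m} \<Longrightarrow> opn (awd w) \<le> K ^ length w" using opn_awd_bound by blast
  have "r \<le> K" if r: "r \<in> rates" for r
  proof -
    obtain w where w: "r = root (length w) (spectral_radius (mat_word w))" "w \<noteq> []" "set w \<subseteq> {..<m}" using r by (auto simp: rates_def)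
    have "spectral_radius (mat_word w) \<le> K ^ length w"
      using spectral_radius_le_opn[of "awd w"] spectral_radius_awd[OF w(3)] K(2)[OF w(3)] by simp
    hence "r \<le> root (length w) (K ^ length w)" unfolding w(1) using w(2) by (intro real_root_le_mono) auto
    thus ?thesis using K(1) w(2) by (simp add: real_root_power_cancel)
  qed
  thus ?thesis by blast
qed

lemma rates_bdd: "bdd_above rates" using rates_le by (auto simp: bdd_above_def)

lemma rates_big: "\<exists>r\<in>rates. r > 1"
proof -
  have "root 3 (spectral_radius (mat_word [0, 1, 2])) \<in> rates" unfolding rates_def using m3 by (intro CollectI exI[of _ "[0, 1, 2]"]) (auto simp: eval_nat_numeral)
  moreover have "root 3 (spectral_radius (mat_word [0, 1, 2])) > root 3 1" using three_letter_word by (intro real_root_less_mono) auto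
  ultimately show ?thesis by (metis real_root_one zero_less_numeral)
qed

lemma rate_le_Sup: "r \<in> rates \<Longrightarrow> r \<le> Sup rates" using rates_bdd by (intro cSup_upper)
lemma Sup_rates_gt_1: "Sup rates > 1" using rates_big rate_le_Sup by (meson less_le_trans)

lemma spectral_radius_le_Sup:
  assumes "w \<noteq> []" "set w \<subseteq> {..<m}" shows "spectral_radius (mat_word w) \<le> Sup rates ^ length w"
proof -
  have l: "length w > 0" using assms by simp
  have nn: "spectral_radius (mat_word w) \<ge> 0" using spectral_radius_eigenvector[of "mat_word w"] norm_ge_zero by metis
  have "root (length w) (spectral_radius (mat_word w)) \<le> Sup rates" using assms by (intro rate_le_Sup) (auto simp: rates_def)
  hence "root (length w) (spectral_radius (mat_word w)) ^ length w \<le> Sup rates ^ length w" using nn by (intro power_mono real_root_ge_zero) auto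
  thus ?thesis using l nn by (simp add: real_root_pow_pos2)
qed

text \<open>Norms are controlled by traces of \<open>w\<close> and of \<open>w\<close> with one more
  letter, hence by spectral radii of words. This replaces the general theorem equating joint and
  generalised spectral radius.\<close>

lemma opn_awd_upper: "\<exists>D>0. \<forall>w. w \<noteq> [] \<longrightarrow> set w \<subseteq> {..<m} \<longrightarrow> opn (awd w) \<le> D * Sup rates ^ length w"
proof -
  let ?C = "cayley_matrix" let ?I = "matrix_inv cayley_matrix" let ?R = "Sup rates"
  obtain D where D: "D > 0" "\<And>X. norm X \<le> D * (norm (trace X) + norm (trace (X ** rmat 0)) + norm (trace (X ** rmat 1)) + norm (trace (X ** rmat 2)))"
    using norm_le_traces by blast
  \<comment> \<open>The 4 comes from \<open>opn_le_norm\<close>; the 8 counts four traces, each at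
    most twice a spectral radius, and the extra \<open>?R\<close> pays for the additional
    letter.\<close>
  define E where "E = opn ?I * opn ?C * (4 * (D * (8 * ?R)))"
  have "opn (awd w) \<le> (E + 1) * ?R ^ length w" if w: "w \<noteq> []" "set w \<subseteq> {..<m}" for w
  proof -
    have R: "?R > 1" by (rule Sup_rates_gt_1)
    have ta: "norm (trace (mat_word w ** rmat a)) \<le> 2 * (?R * ?R ^ length w)" if "a < m" for a
    proof -
      have "mat_word w ** rmat a = mat_word (w @ [a])" by (simp add: mat_word_append)
      thus ?thesis using norm_trace_le[of "mat_word (w @ [a])"] spectral_radius_le_Sup[of "w @ [a]"] w that by simp
    qed
    have "1 * ?R ^ length w \<le> ?R * ?R ^ length w" using R by (intro mult_right_mono) auto
    hence t0: "norm (trace (mat_word w)) \<le> 2 * (?R * ?R ^ length w)"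
      using norm_trace_le[of "mat_word w"] spectral_radius_le_Sup[OF w] by simp
    have "norm (mat_word w) \<le> D * (norm (trace (mat_word w)) + norm (trace (mat_word w ** rmat 0)) + norm (trace (mat_word w ** rmat 1)) + norm (trace (mat_word w ** rmat 2)))" by (rule D(2))
    also have "\<dots> \<le> D * (8 * (?R * ?R ^ length w))" using t0 ta[of 0] ta[of 1] ta[of 2] m3 D(1) by (intro mult_left_mono) auto
    finally have nm: "norm (mat_word w) \<le> D * (8 * ?R) * ?R ^ length w" by simp
    have "opn (awd w) = opn (?I ** mat_word w ** ?C)" using awd_conj[OF w(2)] opn_uminus by metis
    also have "\<dots> \<le> opn (?I ** mat_word w) * opn ?C" by (rule opn_mult)
    also have "\<dots> \<le> (opn ?I * opn (mat_word w)) * opn ?C" by (intro mult_right_mono opn_mult opn_nonneg)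
    also have "\<dots> = opn ?I * opn ?C * opn (mat_word w)" by simp
    also have "\<dots> \<le> opn ?I * opn ?C * (4 * (D * (8 * ?R) * ?R ^ length w))"
      using nm opn_le_norm[of "mat_word w"] by (intro mult_left_mono mult_nonneg_nonneg opn_nonneg) linarith
    also have "\<dots> = E * ?R ^ length w" by (simp add: E_def)
    also have "\<dots> \<le> (E + 1) * ?R ^ length w" using R by (intro mult_right_mono) auto
    finally show ?thesis .
  qed
  moreover have "E + 1 > 0" unfolding E_def using opn_nonneg D(1) Sup_rates_gt_1 by (intro add_nonneg_pos mult_nonneg_nonneg) auto
  ultimately show ?thesis by blast
qed

lemma awd_replicate_0: "awd (replicate j 0) ** awd (replicate j 0) = mat 1"
proof (induction j)
  case (Suc j)
  have sq: "A 0 ** A 0 = mat 1"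
  proof -
    let ?C = "cayley_matrix" let ?I = "matrix_inv cayley_matrix"
    have "A 0 ** A 0 = billiard_matrix m \<theta> 0 ** billiard_matrix m \<theta> 0" using A[OF m_pos] by (auto simp: uminus_mat_mult)
    also have "\<dots> = ?I ** rmat 0 ** (?C ** ?I) ** rmat 0 ** ?C" unfolding billiard_matrix_def rmat_def by (simp add: matrix_mul_assoc)
    also have "\<dots> = ?I ** (rmat 0 ** rmat 0) ** ?C" by (simp add: cayley_matrix_inv matrix_mul_assoc)
    also have "\<dots> = mat 1" using rmat_square[OF m_pos] by (simp add: cayley_matrix_inv)
    finally show ?thesis .
  qed
  have 1: "awd (replicate (Suc j) 0) = awd (replicate j 0) ** A 0" unfolding replicate_Suc replicate_append_same[symmetric] awd_append by simp
  have 2: "awd (replicate (Suc j) 0) = A 0 ** awd (replicate j 0)" by simp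
  have "awd (replicate (Suc j) 0) ** awd (replicate (Suc j) 0) = (awd (replicate j 0) ** A 0) ** (A 0 ** awd (replicate j 0))"
    using 1 2 by metis
  also have "\<dots> = awd (replicate j 0) ** (A 0 ** A 0) ** awd (replicate j 0)" by (simp only: matrix_mul_assoc)
  finally have "awd (replicate (Suc j) 0) ** awd (replicate (Suc j) 0) = awd (replicate j 0) ** (A 0 ** A 0) ** awd (replicate j 0)" .
  thus ?case using sq Suc by simp
qed simp

text \<open>Powers of a word with rate \<open>r\<close> have a common eigenvector. To reach every
  length the powers are padded with the letter 0; the padding is its own inverse by
  \<open>awd_replicate_0\<close>, so it loses at most the factor \<open>K ^ k\<close>.\<close>

lemma opn_awd_lower:
  assumes r: "r \<in> rates" "r > 1"
  shows "\<exists>D>0. \<forall>n. \<exists>w. set w \<subseteq> {..<m} \<and> length w = n \<and> opn (awd w) \<ge> D * r ^ n"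
proof -
  obtain u where u: "r = root (length u) (spectral_radius (mat_word u))" "u \<noteq> []" "set u \<subseteq> {..<m}" using r by (auto simp: rates_def)
  define k where "k = length u"
  have k: "k > 0" using u by (simp add: k_def)
  obtain K where K: "K \<ge> 1" "\<And>w. set w \<subseteq> {..<m} \<Longrightarrow> opn (awd w) \<le> K ^ length w" using opn_awd_bound by blast
  obtain c v where cv: "v \<noteq> 0" "awd u *v v = c *s v" "norm c = spectral_radius (awd u)" using spectral_radius_eigenvector by blast
  have rk: "norm c = r ^ k" using cv(3) spectral_radius_awd[OF u(3)] k norm_ge_zero[of c] by (simp add: u(1) k_def real_root_pow_pos2)
  define D where "D = 1 / (r * K) ^ k"
  have D: "D > 0" using r K by (simp add: D_def)
  have "\<exists>w. set w \<subseteq> {..<m} \<and> length w = n \<and> opn (awd w) \<ge> D * r ^ n" for n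
  proof -
    define q j where "q = n div k" and "j = n mod k"
    have n: "n = q * k + j" "j < k" using k by (auto simp: q_def j_def)
    define x where "x = concat (replicate q u)"
    let ?z = "replicate j (0::nat)"
    have x: "set x \<subseteq> {..<m}" "length x = q * k" "awd x *v v = (c ^ q) *s v"
    proof -
      have "set (concat (replicate q u)) \<subseteq> {..<m} \<and> length (concat (replicate q u)) = q * k \<and> awd (concat (replicate q u)) *v v = (c ^ q) *s v" for q
      proof (induction q)
        case (Suc q)
        have "awd (concat (replicate (Suc q) u)) *v v = awd u *v (awd (concat (replicate q u)) *v v)" by (simp add: awd_append matrix_vector_mul_assoc)
        also have "\<dots> = (c ^ Suc q) *s v" using Suc cv(2) by (simp add: vector_scalar_commute vector_smult_assoc mult.commute)
        finally show ?case using Suc u(3) by (auto simp: k_def)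
      qed simp
      thus "set x \<subseteq> {..<m}" "length x = q * k" "awd x *v v = (c ^ q) *s v" by (auto simp: x_def)
    qed
    have z: "set ?z \<subseteq> {..<m}" using m_pos by auto
    have "norm ((c ^ q) *s v) = norm (awd ?z *v (awd (?z @ x) *v v))"
      using awd_replicate_0[of j] x(3) by (simp add: awd_append matrix_vector_mul_assoc[symmetric]) (simp add: matrix_vector_mul_assoc)
    also have "\<dots> \<le> opn (awd ?z) * norm (awd (?z @ x) *v v)" by (rule opn_bound)
    also have "\<dots> \<le> K ^ j * (opn (awd (?z @ x)) * norm v)" using K(2)[OF z] K(1) by (intro mult_mono opn_bound) (auto intro: opn_nonneg)
    finally have "norm c ^ q * norm v \<le> (K ^ j * opn (awd (?z @ x))) * norm v" by (simp add: norm_smult_vec2 norm_power mult.assoc)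
    hence "norm c ^ q \<le> K ^ j * opn (awd (?z @ x))" using cv(1) by simp
    also have "\<dots> \<le> K ^ k * opn (awd (?z @ x))" using K(1) n(2) by (intro mult_right_mono power_increasing opn_nonneg) auto
    finally have 1: "r ^ (k * q) \<le> K ^ k * opn (awd (?z @ x))" by (simp add: rk power_mult)
    have "r ^ n \<le> r ^ (k * q) * r ^ k" unfolding n(1) using r n(2) by (simp add: power_add mult.commute power_increasing)
    also have "\<dots> \<le> (K ^ k * opn (awd (?z @ x))) * r ^ k" using 1 r by (intro mult_right_mono) auto
    also have "\<dots> = (r * K) ^ k * opn (awd (?z @ x))" by (simp add: power_mult_distrib)
    finally have "D * r ^ n \<le> opn (awd (?z @ x))" unfolding D_def using r K(1) by (simp add: pos_divide_le_eq mult.commute)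
    thus ?thesis using z x n by (intro exI[of _ "?z @ x"]) auto
  qed
  thus ?thesis using D by blast
qed

text \<open>The upper and lower bounds differ from pure powers by constants whose roots tend to one.
  Convergence is part of the claim, since the definition takes \<open>lim\<close> of the
  sequence.\<close>

lemma joint_spectral_radius_eq: "joint_spectral_radius S = Sup rates"
proof -
  define u where "u = (\<lambda>k. Max {root k (onorm ((*v) M)) | M. M \<in> set_products S k})"
  have u: "u k = Max ((\<lambda>w. root k (opn (awd w))) ` {w. set w \<subseteq> {..<m} \<and> length w = k})" for k
    unfolding u_def set_products_awd opn_def by (rule arg_cong[of _ _ Max]) auto
  have fin: "finite ((\<lambda>w. root k (opn (awd w))) ` {w. set w \<subseteq> {..<m} \<and> length w = k})" for k using finite_words_length by simp
  have ne: "(\<lambda>w. root k (opn (awd w))) ` {w. set w \<subseteq> {..<m} \<and> length w = k} \<noteq> {}" for k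
  proof -
    have "replicate k 0 \<in> {w. set w \<subseteq> {..<m} \<and> length w = k}" using m_pos by auto
    thus ?thesis by blast
  qed
  obtain D where D: "D > 0" "\<And>w. w \<noteq> [] \<Longrightarrow> set w \<subseteq> {..<m} \<Longrightarrow> opn (awd w) \<le> D * Sup rates ^ length w" using opn_awd_upper by blast
  have up: "u k \<le> root k (D * Sup rates ^ k)" if "k > 0" for k
    unfolding u using fin ne that D(2) by (subst Max_le_iff) (auto intro!: real_root_le_mono)
  have "u \<longlonglongrightarrow> Sup rates"
  proof (rule order_tendstoI)
    fix a assume a: "a > Sup rates"
    have "eventually (\<lambda>k. root k (D * Sup rates ^ k) < a) sequentially"
      using order_tendstoD(2)[OF growth_root_limit[OF D(1)] a] Sup_rates_gt_1 by simp
    thus "eventually (\<lambda>k. u k < a) sequentially" using eventually_gt_at_top[of 0]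
      by eventually_elim (use up in \<open>meson order_le_less_trans\<close>)
  next
    fix a assume a: "a < Sup rates"
    hence "max a 1 < Sup rates" using Sup_rates_gt_1 by simp
    then obtain r where r: "r \<in> rates" "r > 1" "r > a" using less_cSupD[of rates "max a 1"] rates_big by auto
    obtain E where E: "E > 0" "\<And>n. \<exists>w. set w \<subseteq> {..<m} \<and> length w = n \<and> opn (awd w) \<ge> E * r ^ n" using opn_awd_lower[OF r(1,2)] by blast
    have lo: "root k (E * r ^ k) \<le> u k" if "k > 0" for k
    proof -
      obtain w where w: "set w \<subseteq> {..<m}" "length w = k" "opn (awd w) \<ge> E * r ^ k" using E(2) by blast
      have "root k (E * r ^ k) \<le> root k (opn (awd w))" using w(3) that by (intro real_root_le_mono) auto
      also have "\<dots> \<le> u k" unfolding u using w fin by (intro Max_ge) auto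
      finally show ?thesis .
    qed
    have "eventually (\<lambda>k. a < root k (E * r ^ k)) sequentially" using order_tendstoD(1)[OF growth_root_limit[OF E(1)] r(3)] r(2) by simp
    thus "eventually (\<lambda>k. a < u k) sequentially" using eventually_gt_at_top[of 0]
      by eventually_elim (use lo in \<open>meson less_le_trans\<close>)
  qed
  thus ?thesis unfolding joint_spectral_radius_def u_def[symmetric] by (rule limI)
qed

lemma rate_of_mean_free_path:
  assumes "l \<in> periodic_mean_free_paths m \<theta>" shows "\<exists>r\<in>rates. r > 1 \<and> l = 2 * ln r"
proof -
  obtain w where w: "w \<noteq> []" "set w \<subseteq> {..<m}" "spectral_radius (mat_word w) > 1" "l = 2 * ln (spectral_radius (mat_word w)) / length w"
    using periodic_mean_free_paths_subset[OF assms] by blast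
  let ?r = "root (length w) (spectral_radius (mat_word w))"
  have "?r \<in> rates" using w by (auto simp: rates_def)
  moreover have "?r > 1" using w by (simp add: real_root_gt_1_iff)
  moreover have "l = 2 * ln ?r" using w by (simp add: ln_root)
  ultimately show ?thesis by blast
qed

lemma mean_free_path_of_rate:
  assumes "r \<in> rates" "r > 1" shows "\<exists>l\<in>periodic_mean_free_paths m \<theta>. l \<ge> 2 * ln r"
proof -
  obtain w where w: "w \<noteq> []" "set w \<subseteq> {..<m}" "r = root (length w) (spectral_radius (mat_word w))" using assms by (auto simp: rates_def)
  have "spectral_radius (mat_word w) > 1" using assms(2) w by (simp add: real_root_gt_1_iff)
  moreover from this have "ln r = ln (spectral_radius (mat_word w)) / length w" unfolding w(3) using w(1) by (simp add: ln_root)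
  ultimately show ?thesis using word_periodic_mean_free_path[OF w(1,2)] by simp
qed

lemma finiteness_property_iff: "finiteness_property S \<longleftrightarrow> Sup rates \<in> rates"
proof -
  have "finiteness_property S \<longleftrightarrow> (\<exists>w. w \<noteq> [] \<and> set w \<subseteq> {..<m} \<and> Sup rates = root (length w) (spectral_radius (awd w)))"
    unfolding finiteness_property_def joint_spectral_radius_eq set_products_awd by (auto simp: Suc_le_eq)
  also have "\<dots> \<longleftrightarrow> Sup rates \<in> rates" unfolding rates_def using spectral_radius_awd by auto
  finally show ?thesis .
qed

text \<open>Rates at most one belong to no trajectory, but the supremum exceeds one, so restricting
  to larger rates changes nothing. A trajectory that is at least as long on average as an optimal
  rate predicts attains the supremum, which makes the one-sided
  \<open>mean_free_path_of_rate\<close> sufficient.\<close>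

lemma periodic_part:
  "periodic_mean_free_paths m \<theta> \<noteq> {} \<and> bdd_above (periodic_mean_free_paths m \<theta>)
    \<and> Sup (periodic_mean_free_paths m \<theta>) = 2 * ln (joint_spectral_radius S)
    \<and> (Sup (periodic_mean_free_paths m \<theta>) \<in> periodic_mean_free_paths m \<theta> \<longleftrightarrow> finiteness_property S)"
proof -
  let ?P = "periodic_mean_free_paths m \<theta>" let ?R = "Sup rates"
  have R: "?R > 1" by (rule Sup_rates_gt_1)
  have ne: "?P \<noteq> {}" using rates_big mean_free_path_of_rate by blast
  have up: "l \<le> 2 * ln ?R" if l: "l \<in> ?P" for l
  proof -
    obtain r where r: "r \<in> rates" "r > 1" "l = 2 * ln r" using rate_of_mean_free_path[OF l] by blast
    thus ?thesis using rate_le_Sup[OF r(1)] by simp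
  qed
  hence bdd: "bdd_above ?P" by (auto simp: bdd_above_def)
  have sup: "Sup ?P = 2 * ln ?R"
  proof (rule antisym)
    show "Sup ?P \<le> 2 * ln ?R" using ne up by (rule cSup_least)
    have le: "r \<le> exp (Sup ?P / 2)" if r: "r \<in> rates" "r > 1" for r
    proof -
      obtain l where "l \<in> ?P" "l \<ge> 2 * ln r" using mean_free_path_of_rate[OF r] by blast
      hence "2 * ln r \<le> Sup ?P" using cSup_upper[OF _ bdd] by fastforce
      hence "ln r \<le> Sup ?P / 2" by simp
      thus ?thesis using r(2) by (metis exp_le_cancel_iff exp_ln less_trans zero_less_one)
    qed
    have "?R \<le> exp (Sup ?P / 2)"
    proof (rule cSup_least)
      show "rates \<noteq> {}" using rates_big by blast
      fix r assume r: "r \<in> rates"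
      obtain r1 where "r1 \<in> rates" "r1 > 1" using rates_big by blast
      thus "r \<le> exp (Sup ?P / 2)" using le[of r] le[of r1] r by (cases "r > 1") auto
    qed
    hence "ln ?R \<le> Sup ?P / 2" using R by (metis ln_exp ln_le_cancel_iff exp_gt_zero less_trans zero_less_one)
    thus "2 * ln ?R \<le> Sup ?P" by simp
  qed
  have "Sup ?P \<in> ?P \<longleftrightarrow> ?R \<in> rates"
  proof
    assume "Sup ?P \<in> ?P"
    then obtain r where r: "r \<in> rates" "r > 1" "2 * ln ?R = 2 * ln r" using rate_of_mean_free_path[of "Sup ?P"] sup by auto
    hence "?R = r" using R by simp
    thus "?R \<in> rates" using r by simp
  next
    assume "?R \<in> rates"
    then obtain l where l: "l \<in> ?P" "l \<ge> 2 * ln ?R" using mean_free_path_of_rate R by blast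
    hence "l = Sup ?P" using up[OF l(1)] sup by simp
    thus "Sup ?P \<in> ?P" using l by simp
  qed
  thus ?thesis using ne bdd sup finiteness_property_iff joint_spectral_radius_eq by simp
qed

end

end

section \<open>From pythagorean triples to an ideal polygon\<close>

lemma norm_triple_point: "pythagorean_triple t \<Longrightarrow> norm (triple_point t) = 1"
proof -
  assume t: "pythagorean_triple t"
  define a b c where "a = real_of_int (t $ 1)" and "b = real_of_int (t $ 2)" and "c = real_of_int (t $ 3)"
  have c: "c > 0" using t by (simp add: pythagorean_triple_def c_def)
  have "real_of_int ((t $ 1)\<^sup>2 + (t $ 2)\<^sup>2) = real_of_int ((t $ 3)\<^sup>2)" using t by (simp only: pythagorean_triple_def)
  hence "a\<^sup>2 + b\<^sup>2 = c\<^sup>2" by (simp add: a_def b_def c_def)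
  hence "(a / c)\<^sup>2 + (b / c)\<^sup>2 = 1" using c by (simp add: power_divide flip: add_divide_distrib)
  thus ?thesis by (simp add: triple_point_def cmod_def a_def b_def c_def)
qed

lemma unimodular_partition_polygon:
  assumes t: "unimodular_partition m t" and \<theta>: "\<And>a. \<theta> a = triple_point (t a)"
  shows "\<exists>\<alpha>. ideal_polygon m \<theta> \<alpha>"
proof -
  have m3: "m \<ge> 3" and n: "norm (\<theta> a) = 1" if "a < m" for a using t norm_triple_point that by (auto simp: unimodular_partition_def \<theta>)
  have m: "m \<ge> 3" using t by (simp add: unimodular_partition_def)
  define b where "b = (\<lambda>a. Arg2pi (\<theta> a / \<theta> 0))"
  have mono: "a < c \<Longrightarrow> c < m \<Longrightarrow> b a < b c" for a c
    using t by (auto simp: unimodular_partition_def strict_mono_on_def b_def \<theta>)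
  \<comment> \<open>Angles measured from \<open>\<theta> 0\<close>, put back into position by its
    own argument and continued past the last vertex by one full turn per round.\<close>
  define \<alpha> where "\<alpha> = (\<lambda>j. Arg2pi (\<theta> 0) + b (j mod m) + 2 * pi * real (j div m))"
  have cisA: "cis (Arg2pi z) = z" if "norm z = 1" for z using Arg2pi_eq[of z] that by (simp add: cis_conv_exp)
  have "ideal_polygon m \<theta> \<alpha>"
  proof
    show "m \<ge> 3" by (rule m)
    show "\<alpha> j < \<alpha> (Suc j)" for j
    proof (cases "Suc (j mod m) = m")
      case True
      have "b 0 = 0" using n[of 0] m by (auto simp: b_def Arg2pi_eq_0)
      moreover have "Suc j mod m = 0" "Suc j div m = Suc (j div m)" using True by (auto simp: mod_Suc div_Suc)
      moreover have "b (j mod m) < 2 * pi" by (simp add: b_def Arg2pi_lt_2pi)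
      ultimately show ?thesis by (simp add: \<alpha>_def algebra_simps)
    next
      case False
      have "j mod m < m" using m by simp
      hence "Suc (j mod m) < m" using False by simp
      thus ?thesis using mono[of "j mod m" "Suc (j mod m)"] False by (simp add: \<alpha>_def mod_Suc div_Suc)
    qed
    show "\<alpha> (j + m) = \<alpha> j + 2 * pi" for j using m by (simp add: \<alpha>_def algebra_simps)
    fix j assume j: "j < m"
    have 0: "norm (\<theta> 0) = 1" using n[of 0] m by simp
    have "cis (\<alpha> j) = cis (Arg2pi (\<theta> 0)) * cis (b j)" using j by (simp add: \<alpha>_def cis_mult)
    also have "\<dots> = \<theta> 0 * (\<theta> j / \<theta> 0)" unfolding b_def using n[OF j] 0 by (simp add: cisA norm_divide)
    finally show "\<theta> j = cis (\<alpha> j)" using 0 by auto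
  qed
  thus ?thesis by blast
qed

theorem theorem10p4:
  fixes m :: nat and t :: "nat \<Rightarrow> int^3" and \<theta> :: "nat \<Rightarrow> complex"
    and A :: "nat \<Rightarrow> complex^2^2" and S :: "(complex^2^2) set"
  assumes "unimodular_partition m t"
    and "\<And>a. \<theta> a = triple_point (t a)"
    and "\<And>a. a < m \<Longrightarrow> A a = billiard_matrix m \<theta> a \<or> A a = - billiard_matrix m \<theta> a"
    and "S = A ` {..<m}"
  shows "(AE (\<sigma>, \<tau>) in mu_tilde m \<theta>.
            has_mean_free_path m \<theta> (billiard_trajectory m \<theta> \<sigma> \<tau>) 0)
       \<and> periodic_mean_free_paths m \<theta> \<noteq> {}
       \<and> bdd_above (periodic_mean_free_paths m \<theta>)
       \<and> Sup (periodic_mean_free_paths m \<theta>) = 2 * ln (joint_spectral_radius S)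
       \<and> (Sup (periodic_mean_free_paths m \<theta>) \<in> periodic_mean_free_paths m \<theta>
            \<longleftrightarrow> finiteness_property S)"
proof -
  obtain \<alpha> where "ideal_polygon m \<theta> \<alpha>" using unimodular_partition_polygon[OF assms(1,2)] by blast
  then interpret ideal_polygon m \<theta> \<alpha> .
  show ?thesis by (rule conjI[OF AE_mean_free_path periodic_part[OF _ assms(4)]]) (rule assms(3))
qed

end
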